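(* Let $S=\mathbb{H}/G$ be a hyperbolic 2-orbifold of finite area with a cone point $p$ of order $k\ge 3$, where $G$ is not a triangle group if $S$ is compact. Put $r_k=\sinh^{-1}(\cot\frac{\pi}{k})$, $\delta_k=\sinh^{-1}(\cot\frac{2\pi}{k})$ and $\varphi_k(x)=\dfrac{1-x\tan\frac{\pi}{k}}{x+\tan\frac{\pi}{k}}$. For almost all geodesic rays $\gamma$ on $S$ and for $0\le z\le r_k$, the distribution $dist_k^{*}(z)(\gamma)$ of the depths of approximating excursions converges to a function $dist_k^{*}(z)$, which is given by the formula $$dist_k^{*}(z)=\begin{cases}\dfrac{\frac{\pi}{k}\sinh z}{\log\left(2\cos\frac{\pi}{k}\right)} & \text{if } z\le\delta_k,\\[3ex] \dfrac{\sinh z\,\tan^{-1}\left(\varphi_k(\sinh z)\right)+\log\left(2\cosh z\,\sin\frac{\pi}{k}\cos\frac{\pi}{k}\right)}{\log\left(2\cos\frac{\pi}{k}\right)} & \text{if } z>\delta_k.\end{cases}$$ When $k=3$ and $4$, $\delta_k\le 0$ and the first case does not occur.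
   Context: Setting. $\mathbb{H}$ is the upper half-plane with the hyperbolic metric, $\widehat{\mathbb{R}}=\mathbb{R}\cup\{\infty\}$, $G$ is a Fuchsian group and $\pi:\mathbb{H}\to S=\mathbb{H}/G$ is the projection. A cone point of order $k$ is a point $p\in S$ having a preimage whose stabilizer in $G$ is generated by a transformation of order $k$. Geodesics. A geodesic on $S$ is $\gamma=\pi\circ\alpha$ with $\alpha:\mathbb{R}\to\mathbb{H}$ a unit-speed geodesic; its lifts are the parameterized geodesics $\tilde\gamma=g\circ\alpha$, $g\in G$, with endpoints $\tilde\gamma_\pm=\lim_{t\to\pm\infty}\tilde\gamma(t)\in\widehat{\mathbb{R}}$. A geodesic ray is the restriction of a geodesic to $[0,\infty)$. Each unit tangent vector in $T_1S$ determines a geodesic (and a ray) $\gamma$ with $\dot\gamma(0)$ equal to that vector. "Almost all geodesic rays" means all those determined by the vectors of a set of full $\mu$-measure in $T_1S$, where $\mu$ is the measure on $T_1S$ induced by (hyperbolic area)$\times$(Lebesgue measure on $S^1$) on $T_1\mathbb{H}=\mathbb{H}\times S^1$. Distinguished ray $\lambda$. A simple geodesic ray $\lambda$ on $S$ with $\lambda(0)=p$ is fixed. If $S$ is non-compact, $\lambda$ is a simple ray from $p$ that eventually goes out a cusp. If $S$ is compact, fix a simple closed geodesic $\beta$ not containing $p$ (for signature $(0;2,2,2,k)$, $\beta$ degenerates to a geodesic going back and forth between two order-two cone points) and a minimal length geodesic arc from $p$ to $\beta$; lift this arc to an arc from a lift $\tilde p$ of $p$ to a complete geodesic $\tilde\beta$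 covering $\beta$; $\lambda$ is the projection of the geodesic ray from $\tilde p$ to an endpoint $\tilde\beta_+$ of $\tilde\beta$. Normalization. $G$ is conjugated so that $i$ covers $p$, the stabilizer of $i$ in $G$ is generated by $T_k(\zeta)=\frac{\cos\frac{\pi}{k}\,\zeta+\sin\frac{\pi}{k}}{-\sin\frac{\pi}{k}\,\zeta+\cos\frac{\pi}{k}}$, and $\lambda$ has a lift $\tilde\lambda_0$ that is the ray from $i$ to $0$. Let $a_k=\tan\frac{\pi}{k}$. Approximating excursions. Let $I=[(-a_k,0)\times(0,\infty)]\cup[(0,a_k)\times(-\infty,0)]$ and $J=[(-a_k,0)\times(a_k,\infty)]\cup[(0,a_k)\times(-\infty,-a_k)]$. For $r>0$ let $\tilde B_r$ be the open hyperbolic disc of radius $r$ centered at $i$, and let $\tilde B_0=\{i\}$. An $r$-excursion of $\gamma$ is a lift $e=\tilde\gamma$ with $(\tilde\gamma_+,\tilde\gamma_-)\in I$ and $\tilde\gamma\cap\tilde B_r\ne\emptyset$; it is an approximating $r$-excursion if $(\tilde\gamma_+,\tilde\gamma_-)\in J$. An approximating excursion is an approximating $r$-excursion for some $r\ge0$. It is taken as part of the setting that an excursion $\tilde\gamma$ meets the ray $\tilde\lambda_0$ in a single point $\tilde\gamma(t_e)$; $t_e$ is the parameter of $e$. The depth $d(e)$ is the hyperbolic distance from $i$ to $\tilde\gamma$. The approximating excursions with $t_e\ge0$, when infinite in number, are listed as a sequence $e_1^*,e_2^*,\dots$ in order of increasing $t_e$; these are the approximating excursions of the ray. Distribution. For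 a ray $\gamma$ with infinitely many approximating excursions and $0\le z\le r_k$, $$dist_k^*(z)(\gamma)=\lim_{n\to\infty}\frac1n\#\{j\mid 1\le j\le n,\ d(e_j^* )\le z\},$$ if the limit exists.
   Formalization: For k=3 the denominator log(2cos(π/k)) is log 1 = 0, so the printed formula is undefined; convergence to a limit function is stated for all k≥3, but the formula for it only for k≥4. *)

theory Defs
  imports "HOL-Analysis.Analysis" "HOL-Algebra.Bij" "HOL-Algebra.Multiplicative_Group"
begin

section \<open>The hyperbolic plane\<close>

definition uhp :: "complex set" where
  "uhp = {z. 0 < Im z}"

definition hdist :: "complex \<Rightarrow> complex \<Rightarrow> real" where
  "hdist z w = arcosh (1 + (cmod (z - w))\<^sup>2 / (2 * Im z * Im w))"

definition unit_speed_geodesic :: "(real \<Rightarrow> complex) \<Rightarrow> bool" where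
  "unit_speed_geodesic \<alpha> \<longleftrightarrow>
     range \<alpha> \<subseteq> uhp \<and> (\<forall>s t. hdist (\<alpha> s) (\<alpha> t) = \<bar>s - t\<bar>)"

text \<open>A point of the extended real line is represented by \<^term>\<open>Some x\<close> (the real number \<open>x\<close>)
  or by \<^term>\<open>None\<close> (the point at infinity).\<close>

definition tends_to_boundary :: "(real \<Rightarrow> complex) \<Rightarrow> real option \<Rightarrow> real filter \<Rightarrow> bool" where
  "tends_to_boundary \<alpha> \<zeta> F \<longleftrightarrow>
     (case \<zeta> of Some x \<Rightarrow> (\<alpha> \<longlongrightarrow> complex_of_real x) F
              | None \<Rightarrow> filterlim \<alpha> at_infinity F)"

section \<open>Fuchsian groups\<close>

text \<open>Transformations are extensional functions on the upper half-plane, so that the matrices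
  \<open>A\<close> and \<open>- A\<close> give the same transformation and the group structure is that of
  \<^term>\<open>BijGroup uhp\<close>.\<close>

definition moebius :: "real^2^2 \<Rightarrow> complex \<Rightarrow> complex" where
  "moebius A = (\<lambda>z\<in>uhp. (complex_of_real (A$1$1) * z + complex_of_real (A$1$2)) /
                        (complex_of_real (A$2$1) * z + complex_of_real (A$2$2)))"

definition fuchsian :: "(complex \<Rightarrow> complex) set \<Rightarrow> bool" where
  "fuchsian G \<longleftrightarrow> subgroup G (BijGroup uhp) \<and> G \<subseteq> moebius ` {A. det A = 1} \<and>
     discrete {A. det A = 1 \<and> moebius A \<in> G}"

definition parabolic :: "(complex \<Rightarrow> complex) \<Rightarrow> bool" where
  "parabolic h \<longleftrightarrow> (\<exists>A. det A = 1 \<and> \<bar>trace A\<bar> = 2 \<and> h = moebius A) \<and> h \<noteq> (\<lambda>z\<in>uhp. z)"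

definition stab :: "(complex \<Rightarrow> complex) set \<Rightarrow> complex \<Rightarrow> (complex \<Rightarrow> complex) set" where
  "stab G z = {g \<in> G. g z = z}"

section \<open>The quotient orbifold\<close>

text \<open>Points of \<open>S\<close> are the \<open>G\<close>-orbits in the upper half-plane.\<close>

definition proj :: "(complex \<Rightarrow> complex) set \<Rightarrow> complex \<Rightarrow> complex set" where
  "proj G z = (\<lambda>g. g z) ` G"

definition orbifold_topology :: "(complex \<Rightarrow> complex) set \<Rightarrow> complex set topology" where
  "orbifold_topology G =
     topology (\<lambda>U. U \<subseteq> proj G ` uhp \<and> openin (top_of_set uhp) {z \<in> uhp. proj G z \<in> U})"

lemma quotient_map_orbifold_topology:
  "quotient_map (top_of_set uhp) (orbifold_topology G) (proj G)"
proof -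
  let ?P = "\<lambda>U. U \<subseteq> proj G ` uhp \<and> openin (top_of_set uhp) {z \<in> uhp. proj G z \<in> U}"
  have "istopology ?P"
    unfolding istopology_def
  proof (intro conjI allI impI)
    fix U V assume U: "?P U" and V: "?P V"
    have "{z \<in> uhp. proj G z \<in> U \<inter> V} = {z \<in> uhp. proj G z \<in> U} \<inter> {z \<in> uhp. proj G z \<in> V}"
      by auto
    then show "openin (top_of_set uhp) {z \<in> uhp. proj G z \<in> U \<inter> V}"
      using U V by (simp add: openin_Int)
    show "U \<inter> V \<subseteq> proj G ` uhp"
      using U by blast
  next
    fix K assume K: "\<forall>U\<in>K. ?P U"
    have "{z \<in> uhp. proj G z \<in> \<Union>K} = \<Union>((\<lambda>U. {z \<in> uhp. proj G z \<in> U}) ` K)"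
      by auto
    then show "openin (top_of_set uhp) {z \<in> uhp. proj G z \<in> \<Union>K}"
      using K by auto
    show "\<Union>K \<subseteq> proj G ` uhp"
      using K by blast
  qed
  then have op: "openin (orbifold_topology G) = ?P"
    by (simp add: orbifold_topology_def topology_inverse')
  have "{z \<in> uhp. proj G z \<in> proj G ` uhp} = uhp"
    by auto
  then have "?P (proj G ` uhp)"
    by (metis openin_topspace order_refl topspace_euclidean_subtopology)
  then have "topspace (orbifold_topology G) = proj G ` uhp"
    unfolding topspace_def op by blast
  then show ?thesis
    by (simp add: quotient_map_def op)
qed

definition cone_point :: "(complex \<Rightarrow> complex) set \<Rightarrow> nat \<Rightarrow> complex set \<Rightarrow> bool" where
  "cone_point G k p \<longleftrightarrow>
     (\<exists>z\<in>uhp. p = proj G z \<and>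
       (\<exists>g\<in>G. group.ord (BijGroup uhp) g = k \<and> stab G z = generate (BijGroup uhp) {g}))"

text \<open>Signature \<open>(0; n\<^sub>1, \<dots>, n\<^sub>m)\<close>: the quotient is a sphere, and its cone points have
  orders \<open>n\<^sub>1, \<dots>, n\<^sub>m\<close>.\<close>

definition sphere_signature :: "(complex \<Rightarrow> complex) set \<Rightarrow> nat list \<Rightarrow> bool" where
  "sphere_signature G ns \<longleftrightarrow>
     orbifold_topology G homeomorphic_space top_of_set (sphere (0::real^3) 1) \<and>
     (\<exists>cs. distinct cs \<and> set cs = {c. \<exists>n\<ge>2. cone_point G n c} \<and> list_all2 (cone_point G) ns cs)"

text \<open>Only the cocompact triangle groups; those with cusps are not covered by this notion.\<close>

definition compact_triangle_group :: "(complex \<Rightarrow> complex) set \<Rightarrow> bool" where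
  "compact_triangle_group G \<longleftrightarrow> (\<exists>l m n. sphere_signature G [l, m, n])"

section \<open>Area and the measure on the unit tangent bundle\<close>

text \<open>The measure induced on a quotient: the measure of \<open>A\<close> is that of a maximal measurable set
  which maps injectively into \<open>A\<close>. For a discrete group acting by measure preserving maps this is
  the measure of the part over \<open>A\<close> of a fundamental domain.\<close>

definition quotient_measure :: "'a measure \<Rightarrow> ('a \<Rightarrow> 'b) \<Rightarrow> 'b measure" where
  "quotient_measure M q =
     measure_of (q ` space M) {A. A \<subseteq> q ` space M \<and> q -` A \<inter> space M \<in> sets M}
       (\<lambda>A. SUP E\<in>{E \<in> sets M. inj_on q E \<and> q ` E \<subseteq> A}. emeasure M E)"

lemma space_quotient_measure [simp]: "space (quotient_measure M q) = q ` space M"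
  by (auto simp: quotient_measure_def intro!: space_measure_of)

lemma sigma_algebra_quotient_measure:
  fixes M :: "'a measure" and q :: "'a \<Rightarrow> 'b"
  shows "sigma_algebra (q ` space M) {A. A \<subseteq> q ` space M \<and> q -` A \<inter> space M \<in> sets M}"
  unfolding sigma_algebra_iff2
proof (intro conjI ballI allI impI)
  let ?S = "{A. A \<subseteq> q ` space M \<and> q -` A \<inter> space M \<in> sets M}"
  show "?S \<subseteq> Pow (q ` space M)" "{} \<in> ?S"
    by auto
  show "q ` space M - A \<in> ?S" if "A \<in> ?S" for A
  proof -
    have "q -` (q ` space M - A) \<inter> space M = space M - (q -` A \<inter> space M)"
      by auto
    with that show ?thesis
      by (auto intro: sets.compl_sets)
  qed
  show "\<Union>(range A) \<in> ?S" if "range A \<subseteq> ?S" for A :: "nat \<Rightarrow> 'b set"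
  proof -
    have "(\<Union>i. q -` A i \<inter> space M) \<in> sets M"
      using that by (intro sets.countable_UN) auto
    moreover have "q -` \<Union>(range A) \<inter> space M = (\<Union>i. q -` A i \<inter> space M)"
      by auto
    ultimately show ?thesis
      using that by auto
  qed
qed

lemma sets_quotient_measure:
  "sets (quotient_measure M q) = {A. A \<subseteq> q ` space M \<and> q -` A \<inter> space M \<in> sets M}"
  unfolding quotient_measure_def
  by (subst sets_measure_of)
     (auto simp: sigma_algebra.sigma_sets_eq[OF sigma_algebra_quotient_measure])

lemma emeasure_quotient_measure:
  fixes M :: "'a measure" and q :: "'a \<Rightarrow> 'b"
  assumes "A \<in> sets (quotient_measure M q)"
  shows "emeasure (quotient_measure M q) A =
           (SUP E\<in>{E \<in> sets M. inj_on q E \<and> q ` E \<subseteq> A}. emeasure M E)"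
proof -
  let ?S = "sets (quotient_measure M q)"
  let ?C = "\<lambda>A. {E \<in> sets M. inj_on q E \<and> q ` E \<subseteq> A}"
  let ?\<mu> = "\<lambda>A. SUP E\<in>?C A. emeasure M E"
  have ne: "{} \<in> ?C A" for A
    by auto
  have pos: "positive ?S ?\<mu>"
  proof -
    have "?C {} = {{}}"
      by auto
    then show ?thesis
      by (simp add: positive_def)
  qed
  have ca: "countably_additive ?S ?\<mu>"
    unfolding countably_additive_def
  proof (intro allI impI)
    fix A :: "nat \<Rightarrow> 'b set"
    assume A: "range A \<subseteq> ?S" and dis: "disjoint_family A" and "\<Union>(range A) \<in> ?S"
    have Am: "q -` A i \<inter> space M \<in> sets M" for i
      using A by (auto simp: sets_quotient_measure)
    show "(\<Sum>i. ?\<mu> (A i)) = ?\<mu> (\<Union>(range A))"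
    proof (rule antisym)
      show "?\<mu> (\<Union>(range A)) \<le> (\<Sum>i. ?\<mu> (A i))"
      proof (rule SUP_least)
        fix E assume E: "E \<in> ?C (\<Union>(range A))"
        define F where "F i = E \<inter> (q -` A i \<inter> space M)" for i
        have F: "F i \<in> ?C (A i)" for i
          using E Am[of i] by (auto simp: F_def intro: inj_on_subset)
        have un: "E = (\<Union>i. F i)"
          using E sets.sets_into_space[of E M] by (fastforce simp: F_def)
        have "disjoint_family F"
          using dis by (auto simp: disjoint_family_on_def F_def)
        then have "emeasure M E = (\<Sum>i. emeasure M (F i))"
          unfolding un using F by (subst suminf_emeasure) auto
        also have "\<dots> \<le> (\<Sum>i. ?\<mu> (A i))"
          by (intro suminf_le SUP_upper F) auto
        finally show "emeasure M E \<le> (\<Sum>i. ?\<mu> (A i))" .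
      qed
    next
      have "(\<Sum>i<n. ?\<mu> (A i)) \<le> ?\<mu> (\<Union>(range A))" for n
      proof -
        have "(\<Sum>i<n. ?\<mu> (A i)) \<le> ?\<mu> (\<Union>i<n. A i)"
        proof (induction n)
          case 0
          then show ?case by simp
        next
          case (Suc n)
          have "?\<mu> (\<Union>i<n. A i) + ?\<mu> (A n) \<le> ?\<mu> (\<Union>i<Suc n. A i)"
          proof -
            have "emeasure M E + emeasure M F \<le> ?\<mu> (\<Union>i<Suc n. A i)"
              if E: "E \<in> ?C (\<Union>i<n. A i)" and F: "F \<in> ?C (A n)" for E F
            proof -
              have disj: "(\<Union>i<n. A i) \<inter> A n = {}"
                using dis by (auto simp: disjoint_family_on_def) 
                   (metis IntI empty_iff nless_le)
              have "q ` E \<inter> q ` F = {}"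
                using E F disj by blast
              then have "inj_on q (E \<union> F)" "E \<inter> F = {}"
                using E F by (auto simp: inj_on_Un)
              moreover have "q ` (E \<union> F) \<subseteq> (\<Union>i<Suc n. A i)"
                using E F by (auto simp: lessThan_Suc)
              ultimately have "E \<union> F \<in> ?C (\<Union>i<Suc n. A i)"
                using E F by auto
              then have "emeasure M (E \<union> F) \<le> ?\<mu> (\<Union>i<Suc n. A i)"
                by (rule SUP_upper)
              with E F \<open>E \<inter> F = {}\<close> show ?thesis
                by (simp add: plus_emeasure)
            qed
            then have "emeasure M E + ?\<mu> (A n) \<le> ?\<mu> (\<Union>i<Suc n. A i)"
              if "E \<in> ?C (\<Union>i<n. A i)" for E
              using that ne by (subst ennreal_SUP_add_right) (blast, intro SUP_least)
            then show ?thesis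
              using ne by (subst ennreal_SUP_add_left[symmetric]) (blast, intro SUP_least)
          qed
          with Suc show ?case
            by (simp only: sum.lessThan_Suc) (metis (no_types, lifting) add_right_mono order_trans)
        qed
        also have "\<dots> \<le> ?\<mu> (\<Union>(range A))"
          by (rule SUP_subset_mono) auto
        finally show ?thesis .
      qed
      then show "(\<Sum>i. ?\<mu> (A i)) \<le> ?\<mu> (\<Union>(range A))"
        by (intro suminf_le_const) auto
    qed
  qed
  show ?thesis
    by (rule emeasure_measure_of[OF quotient_measure_def _ pos ca assms]) auto
qed

definition hyp_area :: "complex measure" where
  "hyp_area = density (restrict_space lborel uhp) (\<lambda>z. ennreal (1 / (Im z)\<^sup>2))"

definition circle_measure :: "complex measure" where
  "circle_measure =
     distr (restrict_space lborel {0..<2*pi}) (restrict_space borel (sphere 0 1)) cis"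

definition finite_area :: "(complex \<Rightarrow> complex) set \<Rightarrow> bool" where
  "finite_area G \<longleftrightarrow> emeasure (quotient_measure hyp_area (proj G)) (proj G ` uhp) < \<infinity>"

text \<open>A unit tangent vector is a pair of its base point and its Euclidean direction, a complex
  number of modulus one. Its orbits under the differentials of elements of \<open>G\<close> are the unit tangent
  vectors of \<open>S\<close>.\<close>

definition tproj ::
  "(complex \<Rightarrow> complex) set \<Rightarrow> complex \<times> complex \<Rightarrow> (complex \<times> complex) set" where
  "tproj G v = (\<lambda>g. (g (fst v), sgn (deriv g (fst v) * snd v))) ` G"

definition T1S_measure :: "(complex \<Rightarrow> complex) set \<Rightarrow> (complex \<times> complex) set measure" where
  "T1S_measure G = quotient_measure (hyp_area \<Otimes>\<^sub>M circle_measure) (tproj G)"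

section \<open>Geodesics on the quotient\<close>

definition tangent :: "(real \<Rightarrow> complex) \<Rightarrow> real \<Rightarrow> complex \<times> complex" where
  "tangent \<alpha> t = (\<alpha> t, sgn (vector_derivative \<alpha> (at t)))"

definition geodesic_on :: "(complex \<Rightarrow> complex) set \<Rightarrow> (real \<Rightarrow> complex set) \<Rightarrow> bool" where
  "geodesic_on G \<gamma> \<longleftrightarrow> (\<exists>\<alpha>. unit_speed_geodesic \<alpha> \<and> \<gamma> = proj G \<circ> \<alpha>)"

text \<open>\<open>\<gamma>\<close> is the geodesic determined by the unit tangent vector \<open>V\<close> of \<open>S\<close>.\<close>

definition geodesic_of_vector ::
  "(complex \<Rightarrow> complex) set \<Rightarrow> (complex \<times> complex) set \<Rightarrow> (real \<Rightarrow> complex set) \<Rightarrow> bool" where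
  "geodesic_of_vector G V \<gamma> \<longleftrightarrow>
     (\<exists>\<alpha>. unit_speed_geodesic \<alpha> \<and> \<gamma> = proj G \<circ> \<alpha> \<and> V = tproj G (tangent \<alpha> 0))"

definition lifts ::
  "(complex \<Rightarrow> complex) set \<Rightarrow> (real \<Rightarrow> complex set) \<Rightarrow> (real \<Rightarrow> complex) set" where
  "lifts G \<gamma> = {g \<circ> \<alpha> |g \<alpha>. g \<in> G \<and> unit_speed_geodesic \<alpha> \<and> \<gamma> = proj G \<circ> \<alpha>}"

section \<open>The distinguished ray\<close>

text \<open>For a parabolic \<open>h\<close>, the sets \<open>{z. hdist z (h z) < \<epsilon>}\<close> are the horodiscs based at its fixed
  point; their images in \<open>S\<close> are the neighbourhoods of the cusp.\<close>

definition goes_out_cusp :: "(complex \<Rightarrow> complex) set \<Rightarrow> (real \<Rightarrow> complex set) \<Rightarrow> bool" where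
  "goes_out_cusp G lam \<longleftrightarrow>
     (\<exists>h\<in>G. parabolic h \<and>
       (\<forall>\<epsilon>>0. eventually (\<lambda>t. lam t \<in> proj G ` {z \<in> uhp. hdist z (h z) < \<epsilon>}) at_top))"

definition simple_closed_geodesic ::
  "(complex \<Rightarrow> complex) set \<Rightarrow> (real \<Rightarrow> complex set) \<Rightarrow> bool" where
  "simple_closed_geodesic G \<beta> \<longleftrightarrow>
     geodesic_on G \<beta> \<and> (\<exists>L>0. (\<forall>t. \<beta> (t + L) = \<beta> t) \<and> inj_on \<beta> {0..<L})"

text \<open>Since a geodesic turns back at a cone point of order two, the following says that \<open>\<beta>\<close> goes
  back and forth along a simple arc between two such points.\<close>

definition back_and_forth_geodesic ::
  "(complex \<Rightarrow> complex) set \<Rightarrow> (real \<Rightarrow> complex set) \<Rightarrow> bool" where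
  "back_and_forth_geodesic G \<beta> \<longleftrightarrow>
     geodesic_on G \<beta> \<and>
     (\<exists>L>0. cone_point G 2 (\<beta> 0) \<and> cone_point G 2 (\<beta> L) \<and> inj_on \<beta> {0..L})"

text \<open>The projection of \<open>c\<close> restricted to \<open>{0..L}\<close> is a geodesic arc of minimal length from \<open>p\<close>
  to \<open>\<beta>\<close>.\<close>

definition minimal_arc ::
  "(complex \<Rightarrow> complex) set \<Rightarrow> complex set \<Rightarrow> (real \<Rightarrow> complex set) \<Rightarrow>
     (real \<Rightarrow> complex) \<Rightarrow> real \<Rightarrow> bool" where
  "minimal_arc G p \<beta> c L \<longleftrightarrow>
     unit_speed_geodesic c \<and> 0 \<le> L \<and> proj G (c 0) = p \<and> proj G (c L) \<in> range \<beta> \<and>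
     (\<forall>c' L'. unit_speed_geodesic c' \<and> 0 \<le> L' \<and> proj G (c' 0) = p \<and> proj G (c' L') \<in> range \<beta>
        \<longrightarrow> L \<le> L')"

definition distinguished_ray ::
  "(complex \<Rightarrow> complex) set \<Rightarrow> nat \<Rightarrow> complex set \<Rightarrow> (real \<Rightarrow> complex set) \<Rightarrow> bool" where
  "distinguished_ray G k p lam \<longleftrightarrow>
     (\<exists>l. unit_speed_geodesic l \<and> (\<forall>t\<ge>0. lam t = proj G (l t))) \<and>
     lam 0 = p \<and> inj_on lam {0..} \<and>
     (if compact_space (orbifold_topology G) then
        (\<exists>\<beta> c L b l \<zeta>.
           (if sphere_signature G [2, 2, 2, k] then back_and_forth_geodesic G \<beta>
            else simple_closed_geodesic G \<beta>) \<and>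
           p \<notin> range \<beta> \<and> minimal_arc G p \<beta> c L \<and>
           b \<in> lifts G \<beta> \<and> c L \<in> range b \<and> tends_to_boundary b \<zeta> at_top \<and>
           unit_speed_geodesic l \<and> l 0 = c 0 \<and> tends_to_boundary l \<zeta> at_top \<and>
           (\<forall>t\<ge>0. lam t = proj G (l t)))
      else goes_out_cusp G lam)"

section \<open>The normalization\<close>

definition T_rot :: "nat \<Rightarrow> complex \<Rightarrow> complex" where
  "T_rot k = moebius (vector [vector [cos (pi / k), sin (pi / k)],
                              vector [- sin (pi / k), cos (pi / k)]])"

definition normalized ::
  "(complex \<Rightarrow> complex) set \<Rightarrow> nat \<Rightarrow> complex set \<Rightarrow> (real \<Rightarrow> complex set) \<Rightarrow> bool" where
  "normalized G k p lam \<longleftrightarrow>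
     proj G \<i> = p \<and> stab G \<i> = generate (BijGroup uhp) {T_rot k} \<and>
     (\<exists>l. unit_speed_geodesic l \<and> l 0 = \<i> \<and> tends_to_boundary l (Some 0) at_top \<and>
          (\<forall>t\<ge>0. lam t = proj G (l t)))"

definition lambda0 :: "complex set" where
  "lambda0 = {z. Re z = 0 \<and> 0 < Im z \<and> Im z \<le> 1}"

section \<open>Approximating excursions\<close>

definition a_const :: "nat \<Rightarrow> real" where
  "a_const k = tan (pi / k)"

definition region_I :: "nat \<Rightarrow> (real \<times> real) set" where
  "region_I k = {- a_const k<..<0} \<times> {0<..} \<union> {0<..<a_const k} \<times> {..<0}"

definition region_J :: "nat \<Rightarrow> (real \<times> real) set" where
  "region_J k = {- a_const k<..<0} \<times> {a_const k<..} \<union> {0<..<a_const k} \<times> {..<- a_const k}"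

definition endpoints_in :: "(real \<Rightarrow> complex) \<Rightarrow> (real \<times> real) set \<Rightarrow> bool" where
  "endpoints_in e R \<longleftrightarrow>
     (\<exists>x y. tends_to_boundary e (Some x) at_top \<and> tends_to_boundary e (Some y) at_bot \<and> (x, y) \<in> R)"

definition disc_B :: "real \<Rightarrow> complex set" where
  "disc_B r = (if r = 0 then {\<i>} else {z \<in> uhp. hdist \<i> z < r})"

text \<open>The endpoint condition alone only makes a geodesic cross the imaginary axis, possibly above
  \<open>\<i>\<close>. That an excursion meets the ray from \<open>\<i>\<close> to \<open>0\<close> is a separate requirement.\<close>

definition excursion ::
  "(complex \<Rightarrow> complex) set \<Rightarrow> nat \<Rightarrow> real \<Rightarrow> (real \<Rightarrow> complex set) \<Rightarrow> (real \<Rightarrow> complex) \<Rightarrow> bool" where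
  "excursion G k r \<gamma> e \<longleftrightarrow>
     e \<in> lifts G \<gamma> \<and> endpoints_in e (region_I k) \<and> range e \<inter> disc_B r \<noteq> {} \<and>
     (\<exists>!t. e t \<in> lambda0)"

definition approximating_excursion ::
  "(complex \<Rightarrow> complex) set \<Rightarrow> nat \<Rightarrow> (real \<Rightarrow> complex set) \<Rightarrow> (real \<Rightarrow> complex) \<Rightarrow> bool" where
  "approximating_excursion G k \<gamma> e \<longleftrightarrow>
     (\<exists>r\<ge>0. excursion G k r \<gamma> e) \<and> endpoints_in e (region_J k)"

definition parameter :: "(real \<Rightarrow> complex) \<Rightarrow> real" where
  "parameter e = (THE t. e t \<in> lambda0)"

definition depth :: "(real \<Rightarrow> complex) \<Rightarrow> real" where
  "depth e = (INF t. hdist \<i> (e t))"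

definition excursion_sequence ::
  "(complex \<Rightarrow> complex) set \<Rightarrow> nat \<Rightarrow> (real \<Rightarrow> complex set) \<Rightarrow> (nat \<Rightarrow> real \<Rightarrow> complex) \<Rightarrow> bool" where
  "excursion_sequence G k \<gamma> es \<longleftrightarrow>
     bij_betw es UNIV {e. approximating_excursion G k \<gamma> e \<and> 0 \<le> parameter e} \<and>
     strict_mono (\<lambda>n. parameter (es n))"

text \<open>The sequence is determined by \<open>\<gamma>\<close>; it is indexed from \<open>0\<close>, so its first \<open>n\<close> terms are those
  with index below \<open>n\<close>.\<close>

definition has_depth_distribution ::
  "(complex \<Rightarrow> complex) set \<Rightarrow> nat \<Rightarrow> (real \<Rightarrow> complex set) \<Rightarrow> real \<Rightarrow> real \<Rightarrow> bool" where
  "has_depth_distribution G k \<gamma> z D \<longleftrightarrow>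
     (\<exists>es. excursion_sequence G k \<gamma> es \<and>
        (\<lambda>n. real (card {j. j < n \<and> depth (es j) \<le> z}) / real n) \<longlonglongrightarrow> D)"

section \<open>The limiting distribution\<close>

definition r_const :: "nat \<Rightarrow> real" where
  "r_const k = arsinh (cot (pi / k))"

definition delta_const :: "nat \<Rightarrow> real" where
  "delta_const k = arsinh (cot (2 * pi / k))"

definition phi :: "nat \<Rightarrow> real \<Rightarrow> real" where
  "phi k x = (1 - x * tan (pi / k)) / (x + tan (pi / k))"

definition dist_case1 :: "nat \<Rightarrow> real \<Rightarrow> real" where
  "dist_case1 k z = (pi / k * sinh z) / ln (2 * cos (pi / k))"

definition dist_case2 :: "nat \<Rightarrow> real \<Rightarrow> real" where
  "dist_case2 k z =
     (sinh z * arctan (phi k (sinh z)) + ln (2 * cosh z * sin (pi / k) * cos (pi / k))) /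
     ln (2 * cos (pi / k))"

text \<open>Both quotients are undefined for \<open>k = 3\<close>, where the denominator \<open>ln (2 * cos (pi / 3))\<close>
  is zero.\<close>

definition dist_formula :: "nat \<Rightarrow> real \<Rightarrow> real" where
  "dist_formula k z = (if z \<le> delta_const k then dist_case1 k z else dist_case2 k z)"

end

theory Submission
  imports Defs
begin

text \<open>
  The approximating excursions of a geodesic \<open>\<gamma>\<close> are the lifts of \<open>\<gamma>\<close> whose end points lie in the
  region \<open>J\<close> and which cross the ray \<open>lambda0\<close> from \<open>\<i>\<close> to \<open>0\<close>. This ray projects onto the distinguished
  ray in \<open>S\<close>, so an approximating excursion is a crossing of the distinguished ray by \<open>\<gamma>\<close> in a position
  prescribed by \<open>J\<close>. The
  depth is a function of the end points of the lift. The distribution of the depths is thus the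
  distribution of a function over the visits of a typical orbit of the geodesic flow to a transversal,
  and by ergodicity the visits are distributed according to the invariant measure of the transversal.
  What is left is a computation of areas.

  Geodesics are described by three numbers \<open>(x, u, s)\<close>: the forward end point \<open>x\<close>, the number \<open>u\<close> that
  determines the backward end point \<open>y = x - 1 / u\<close>, and a time shift \<open>s\<close>. In these coordinates the group
  preserves Lebesgue measure, the geodesic flow is the translation of \<open>s\<close>, and \<open>dx du\<close> is the invariant
  measure \<open>dx dy / (x - y)\<^sup>2\<close> on the space of geodesics (\<open>nn_integral_moebius_coords\<close>). Vectors on \<open>S\<close> are
  handled through functions and sets that are invariant under the group; an integral over the whole space
  is an integral over a fundamental domain of the sum over the group (\<open>unfolding_integral\<close>). For this
  reason the average number of crossings with end points in a region \<open>C\<close> per unit of time is the area of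
  \<open>C\<close> divided by the volume of the unit tangent bundle (\<open>crossings_integral\<close>).

  Ergodicity (\<open>ergodic\<close>) is proved by Hopf's method. An invariant set of the geodesic flow is invariant
  under the horocycle flow, because the geodesic flow contracts horocycles and translations of the line
  are continuous in measure (\<open>horo_invariant\<close>). It therefore depends only on the forward end point, by
  symmetry also only on the backward one, and so is trivial. A pointwise ergodic theorem
  (\<open>ergodic_averages\<close>) turns this into the statement that for almost every geodesic the number of
  crossings in \<open>[0, t]\<close>, divided by \<open>t\<close>, has the expected limit (\<open>counting_limit\<close>).

  For a fixed typical geodesic the lifts are parameterized by the group (\<open>lifts_geo\<close>), and different
  excursions have different parameters because the distinguished ray is simple (\<open>lambda0_embedded\<close>).
  Hence they can be listed in order, and the proportion of those of depth at most \<open>z\<close> tends to the quotient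
  of the areas of two regions (\<open>depth_distribution_generic\<close>). It is enough to treat rational \<open>z\<close>, since the
  quotient is continuous in \<open>z\<close>. The exceptional set is invariant under the group and is transferred to
  a null set of vectors on \<open>S\<close> by \<open>AE_unit_tangent\<close>. Finally \<open>sinh\<close> of the depth is
  \<open>\<bar>u * (1 + x\<^sup>2) - x\<bar>\<close> (\<open>depth_geo\<close>), and integrating the lengths of the slices \<open>x = const\<close> of the regions gives
  the formula (\<open>depth_fraction_formula\<close>).
\<close>

section \<open>Averages along a measure preserving map\<close>

text \<open>Garsia's argument: let \<open>M\<^sub>n\<close> be the maximum of the partial sums of length at most \<open>n\<close>, the empty
  one included. Where \<open>M\<^sub>n\<close> is positive it is attained at a nonempty sum, so
  \<open>M\<^sub>n \<le> f + M\<^sub>n \<circ> T\<close> there; elsewhere \<open>M\<^sub>n = 0\<close>. As \<open>M\<^sub>n\<close> and \<open>M\<^sub>n \<circ> T\<close> have the same integral, \<open>f\<close> has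
  nonnegative integral over the set where \<open>M\<^sub>n\<close> is positive, and these sets exhaust almost everything.\<close>

lemma maximal_ergodic:
  fixes f :: "'a \<Rightarrow> real"
  assumes T[measurable]: "T \<in> M \<rightarrow>\<^sub>M M" and TM: "distr M M T = M"
    and f: "integrable M f"
    and pos: "AE x in M. \<exists>n. (\<Sum>j<n. f ((T ^^ j) x)) > 0"
  shows "0 \<le> (\<integral>x. f x \<partial>M)"
proof -
  define S where "S n x = (\<Sum>j<n. f ((T ^^ j) x))" for n x
  define Mx where "Mx n x = Max ((\<lambda>k. S k x) ` {..n})" for n x
  have fm[measurable]: "f \<in> borel_measurable M" using f by auto
  have Tint: "integrable M (\<lambda>x. h (T x))" "(\<integral>x. h (T x) \<partial>M) = (\<integral>x. h x \<partial>M)"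
    if h: "integrable M h" for h :: "'a \<Rightarrow> real"
  proof -
    have h': "integrable (distr M M T) h" using h TM by simp
    show "integrable M (\<lambda>x. h (T x))" by (rule integrable_distr[OF T h'])
    have "(\<integral>x. h x \<partial>distr M M T) = (\<integral>x. h (T x) \<partial>M)"
      using h by (intro integral_distr[OF T]) auto
    then show "(\<integral>x. h (T x) \<partial>M) = (\<integral>x. h x \<partial>M)" using TM by simp
  qed
  have fT: "integrable M (\<lambda>x. f ((T ^^ j) x))" for j
  proof (induction j)
    case (Suc j)
    have "integrable M (\<lambda>x. f ((T ^^ j) (T x)))" by (rule Tint(1)[OF Suc])
    then show ?case by (simp add: funpow_swap1)
  qed (use f in simp)
  have Si: "integrable M (S n)" for n
    unfolding S_def using fT by (intro Bochner_Integration.integrable_sum) auto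
  have Mx0: "Mx 0 x = 0" for x by (simp add: Mx_def S_def)
  have MxS: "Mx (Suc n) x = max (S (Suc n) x) (Mx n x)" for n x
    unfolding Mx_def atMost_Suc image_insert by (subst Max_insert) auto
  have Mi: "integrable M (Mx n)" for n
  proof (induction n)
    case 0 show ?case unfolding Mx0 by simp
  next
    case (Suc n)
    show ?case unfolding MxS using Si Suc by (intro integrable_max) auto
  qed
  have Mxm[measurable]: "Mx n \<in> borel_measurable M" for n using Mi by auto
  have Mxge: "S k x \<le> Mx n x" if "k \<le> n" for k n x
    unfolding Mx_def using that by (intro Max_ge) auto
  have Mx_nn: "0 \<le> Mx n x" for n x
    using Mxge[of 0 n x] by (simp add: S_def)
  have SSuc: "S (Suc k) x = f x + S k (T x)" for k x
    unfolding S_def by (subst sum.lessThan_Suc_shift) (simp add: funpow_swap1)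
  define E where "E n = {x \<in> space M. Mx n x > 0}" for n
  have Em[measurable]: "E n \<in> sets M" for n unfolding E_def by measurable
  have key: "Mx n x - Mx n (T x) \<le> f x * indicator (E n) x" if x: "x \<in> space M" for n x
  proof (cases "x \<in> E n")
    case False
    then have "Mx n x = 0" using Mx_nn[of n x] x by (auto simp: E_def)
    then show ?thesis using False Mx_nn[of n "T x"] by simp
  next
    case True
    have "Mx n x \<in> (\<lambda>k. S k x) ` {..n}" unfolding Mx_def by (intro Max_in) auto
    then obtain k where k: "k \<le> n" "Mx n x = S k x" by auto
    have "k \<noteq> 0"
    proof
      assume "k = 0"
      then show False using True k by (simp add: E_def S_def)
    qed
    then obtain k' where k': "k = Suc k'" by (cases k) auto
    have "Mx n x = f x + S k' (T x)" using k k' SSuc by simp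
    also have "\<dots> \<le> f x + Mx n (T x)" using Mxge[of k' n "T x"] k k' by simp
    finally show ?thesis using True by simp
  qed
  have En: "0 \<le> (\<integral>x. f x * indicator (E n) x \<partial>M)" for n
  proof -
    have "0 = (\<integral>x. Mx n x - Mx n (T x) \<partial>M)"
      using Tint[OF Mi[of n]] Mi[of n] by simp
    also have "\<dots> \<le> (\<integral>x. f x * indicator (E n) x \<partial>M)"
      using key Tint(1)[OF Mi[of n]] Mi[of n] f
      by (intro integral_mono Bochner_Integration.integrable_diff integrable_real_mult_indicator) auto
    finally show ?thesis .
  qed
  have lim: "(\<lambda>n. \<integral>x. f x * indicator (E n) x \<partial>M) \<longlonglongrightarrow> (\<integral>x. f x \<partial>M)"
  proof (rule integral_dominated_convergence[where w = "\<lambda>x. norm (f x)"])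
    show "AE x in M. (\<lambda>n. f x * indicator (E n) x) \<longlonglongrightarrow> f x"
      using pos
    proof (rule AE_mp, intro AE_I2 impI)
      fix x assume x: "x \<in> space M" and "\<exists>n. 0 < (\<Sum>j<n. f ((T ^^ j) x))"
      then obtain n where n: "0 < S n x" by (auto simp: S_def)
      have "x \<in> E m" if "m \<ge> n" for m
        using Mxge[OF that, of x] n x by (auto simp: E_def)
      then have "\<forall>\<^sub>F m in sequentially. f x * indicator (E m) x = f x"
        by (intro eventually_sequentiallyI[of n]) auto
      then show "(\<lambda>n. f x * indicator (E n) x) \<longlonglongrightarrow> f x"
        by (rule tendsto_eventually)
    qed
  qed (use f in \<open>auto simp: indicator_def\<close>)
  show ?thesis by (rule LIMSEQ_le_const[OF lim]) (use En in auto)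
qed

text \<open>The hypotheses \<open>up\<close> and \<open>lo\<close> are the only consequences of ergodicity that Birkhoff's theorem
  needs for the single function \<open>f\<close>. Stated in this form the theorem also applies to the time one
  map of an ergodic flow, which need not be ergodic itself, as soon as the upper and lower limits of
  the averages of \<open>f\<close> are invariant under the whole flow. The proof applies the maximal inequality to
  \<open>f - b\<close> and \<open>b - f\<close>.\<close>

lemma ergodic_averages:
  fixes f :: "'a \<Rightarrow> real"
  assumes fin: "finite_measure M"
    and T[measurable]: "T \<in> M \<rightarrow>\<^sub>M M" and TM: "distr M M T = M"
    and f: "integrable M f"
    and up: "\<And>b. (AE x in M. limsup (\<lambda>n. ereal ((\<Sum>j<n. f ((T ^^ j) x)) / real n)) \<le> ereal b)
              \<or> (AE x in M. limsup (\<lambda>n. ereal ((\<Sum>j<n. f ((T ^^ j) x)) / real n)) > ereal b)"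
    and lo: "\<And>b. (AE x in M. liminf (\<lambda>n. ereal ((\<Sum>j<n. f ((T ^^ j) x)) / real n)) \<ge> ereal b)
              \<or> (AE x in M. liminf (\<lambda>n. ereal ((\<Sum>j<n. f ((T ^^ j) x)) / real n)) < ereal b)"
  shows "AE x in M. (\<lambda>n. (\<Sum>j<n. f ((T ^^ j) x)) / real n) \<longlonglongrightarrow> (\<integral>x. f x \<partial>M) / measure M (space M)"
proof -
  interpret finite_measure M by fact
  define S where "S n x = (\<Sum>j<n. f ((T ^^ j) x))" for n x
  define m where "m = (\<integral>x. f x \<partial>M)"
  define V where "V = measure M (space M)"
  show ?thesis
  proof (cases "V = 0")
    case True
    then have "emeasure M (space M) = 0" unfolding V_def by (simp add: emeasure_eq_measure)
    then have "AE x in M. False" by (intro AE_I[of _ _ "space M"]) auto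
    then show ?thesis by (rule AE_mp) auto
  next
    case False
    then have V: "V > 0" unfolding V_def by (simp add: less_le)
    have pick: "\<exists>n. S n x > b * real n" if "limsup (\<lambda>n. ereal (S n x / real n)) > ereal b" for x b
    proof (rule ccontr)
      assume "\<not> ?thesis"
      then have "S n x \<le> b * real n" for n by (auto simp: not_less)
      then have "\<forall>\<^sub>F n in sequentially. ereal (S n x / real n) \<le> ereal b"
        by (intro eventually_sequentiallyI[of 1]) (auto simp: field_simps)
      then have "limsup (\<lambda>n. ereal (S n x / real n)) \<le> ereal b" by (rule Limsup_bounded)
      then show False using that by simp
    qed
    have pick2: "\<exists>n. S n x < b * real n" if "liminf (\<lambda>n. ereal (S n x / real n)) < ereal b" for x b
    proof (rule ccontr)
      assume "\<not> ?thesis"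
      then have "S n x \<ge> b * real n" for n by (auto simp: not_less)
      then have "\<forall>\<^sub>F n in sequentially. ereal (S n x / real n) \<ge> ereal b"
        by (intro eventually_sequentiallyI[of 1]) (auto simp: field_simps)
      then have "liminf (\<lambda>n. ereal (S n x / real n)) \<ge> ereal b" by (rule Liminf_bounded)
      then show False using that by simp
    qed
    have U: "AE x in M. limsup (\<lambda>n. ereal (S n x / real n)) \<le> ereal b" if b: "b > m / V" for b
    proof (rule ccontr)
      assume "\<not> ?thesis"
      then have "AE x in M. limsup (\<lambda>n. ereal (S n x / real n)) > ereal b"
        using up[of b] by (auto simp: S_def)
      then have "AE x in M. \<exists>n. (\<Sum>j<n. (f ((T ^^ j) x) - b)) > 0"
        by (rule AE_mp) (intro AE_I2 impI, drule pick, simp add: S_def sum_subtractf mult.commute)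
      then have "0 \<le> (\<integral>x. f x - b \<partial>M)"
        using f by (intro maximal_ergodic[OF T TM]) auto
      then have "b * V \<le> m" using f by (simp add: m_def V_def mult.commute)
      then show False using b V by (simp add: field_simps)
    qed
    have L: "AE x in M. liminf (\<lambda>n. ereal (S n x / real n)) \<ge> ereal b" if b: "b < m / V" for b
    proof (rule ccontr)
      assume "\<not> ?thesis"
      then have "AE x in M. liminf (\<lambda>n. ereal (S n x / real n)) < ereal b"
        using lo[of b] by (auto simp: S_def)
      then have "AE x in M. \<exists>n. (\<Sum>j<n. (b - f ((T ^^ j) x))) > 0"
        by (rule AE_mp) (intro AE_I2 impI, drule pick2, simp add: S_def sum_subtractf mult.commute)
      then have "0 \<le> (\<integral>x. b - f x \<partial>M)"
        using f by (intro maximal_ergodic[OF T TM]) auto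
      then have "b * V \<ge> m" using f by (simp add: m_def V_def mult.commute)
      then show False using b V by (simp add: field_simps)
    qed
    have "AE x in M. \<forall>k::nat. limsup (\<lambda>n. ereal (S n x / real n)) \<le> ereal (m / V + inverse (Suc k))"
      by (subst AE_all_countable) (auto intro!: U)
    moreover have "AE x in M. \<forall>k::nat. liminf (\<lambda>n. ereal (S n x / real n)) \<ge> ereal (m / V - inverse (Suc k))"
      by (subst AE_all_countable) (auto intro!: L)
    ultimately have "AE x in M. (\<lambda>n. S n x / real n) \<longlonglongrightarrow> m / V"
    proof eventually_elim
      case (elim x)
      have i: "(\<lambda>k. inverse (real (Suc k))) \<longlonglongrightarrow> 0" by (rule LIMSEQ_inverse_real_of_nat)
      have "(\<lambda>k. ereal (m / V + inverse (Suc k))) \<longlonglongrightarrow> ereal (m / V + 0)"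
        by (intro tendsto_intros i)
      from LIMSEQ_le_const[OF this] have a: "limsup (\<lambda>n. ereal (S n x / real n)) \<le> ereal (m / V)"
        using elim(1) by simp
      have "(\<lambda>k. ereal (m / V - inverse (Suc k))) \<longlonglongrightarrow> ereal (m / V - 0)"
        by (intro tendsto_intros i)
      from LIMSEQ_le_const2[OF this] have b: "liminf (\<lambda>n. ereal (S n x / real n)) \<ge> ereal (m / V)"
        using elim(2) by simp
      have "(\<lambda>n. ereal (S n x / real n)) \<longlonglongrightarrow> ereal (m / V)"
        using a b Liminf_le_Limsup[of sequentially "\<lambda>n. ereal (S n x / real n)"]
        by (subst tendsto_iff_Liminf_eq_Limsup) auto
      then show ?case by simp
    qed
    then show ?thesis by (simp add: S_def m_def V_def)
  qed
qed

section \<open>Measure preserving actions with a fundamental domain\<close>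

text \<open>The domain \<open>D\<close> is required to meet almost every orbit exactly once, counted with the group
  elements that move a point into it. Points with nontrivial stabilizer form a null set under this
  hypothesis.\<close>

locale measured_action = group Gr for Gr :: "('g, 'x) monoid_scheme" (structure) +
  fixes M :: "'a measure" and act :: "'g \<Rightarrow> 'a \<Rightarrow> 'a" and D :: "'a set"
  assumes countable_carrier: "countable (carrier Gr)"
    and act_measurable[measurable]: "g \<in> carrier Gr \<Longrightarrow> act g \<in> M \<rightarrow>\<^sub>M M"
    and act_preserves: "g \<in> carrier Gr \<Longrightarrow> distr M M (act g) = M"
    and act_one: "x \<in> space M \<Longrightarrow> act \<one> x = x"
    and act_mult: "\<lbrakk>g \<in> carrier Gr; h \<in> carrier Gr; x \<in> space M\<rbrakk> \<Longrightarrow> act (g \<otimes> h) x = act g (act h x)"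
    and D_sets[measurable]: "D \<in> sets M"
    and D_fundamental: "AE x in M. (\<integral>\<^sup>+g. indicator D (act g x) \<partial>count_space (carrier Gr)) = 1"
    and D_finite: "emeasure M D < \<infinity>"
begin

lemma act_space: "g \<in> carrier Gr \<Longrightarrow> x \<in> space M \<Longrightarrow> act g x \<in> space M"
  using measurable_space[OF act_measurable] by blast

definition invariant_set :: "'a set \<Rightarrow> bool" where
  "invariant_set A \<longleftrightarrow> A \<subseteq> space M \<and> (\<forall>g\<in>carrier Gr. \<forall>x\<in>space M. act g x \<in> A \<longleftrightarrow> x \<in> A)"

lemma nn_integral_orbit:
  assumes h: "h \<in> carrier Gr" and x: "x \<in> space M"
  shows "(\<integral>\<^sup>+g. f (act g (act h x)) \<partial>count_space (carrier Gr)) = (\<integral>\<^sup>+g. f (act g x) \<partial>count_space (carrier Gr))"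
proof -
  have b: "bij_betw (\<lambda>g. g \<otimes> h) (carrier Gr) (carrier Gr)"
  proof (rule bij_betwI[where g = "\<lambda>g. g \<otimes> inv h"])
    show "(\<lambda>g. g \<otimes> h) \<in> carrier Gr \<rightarrow> carrier Gr" using h by auto
    show "(\<lambda>g. g \<otimes> inv h) \<in> carrier Gr \<rightarrow> carrier Gr" using h by auto
    show "\<And>g. g \<in> carrier Gr \<Longrightarrow> g \<otimes> h \<otimes> inv h = g" using h by (simp add: m_assoc)
    show "\<And>g. g \<in> carrier Gr \<Longrightarrow> g \<otimes> inv h \<otimes> h = g" using h by (simp add: m_assoc)
  qed
  have "(\<integral>\<^sup>+g. f (act g x) \<partial>count_space (carrier Gr)) = (\<integral>\<^sup>+g. f (act (g \<otimes> h) x) \<partial>count_space (carrier Gr))"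
    by (rule nn_integral_bij_count_space[OF b, symmetric])
  also have "\<dots> = (\<integral>\<^sup>+g. f (act g (act h x)) \<partial>count_space (carrier Gr))"
    using h x by (intro nn_integral_cong) (simp add: act_mult)
  finally show ?thesis by simp
qed

lemma nn_integral_inverse:
  "(\<integral>\<^sup>+g. f (inv g) \<partial>count_space (carrier Gr)) = (\<integral>\<^sup>+g. f g \<partial>count_space (carrier Gr))"
  by (rule nn_integral_bij_count_space[where g = "\<lambda>g. inv g"])
     (auto intro!: bij_betwI[where g = "\<lambda>g. inv g"])

lemma measurable_orbit_sum[measurable]:
  assumes [measurable]: "f \<in> borel_measurable M"
  shows "(\<lambda>x. \<integral>\<^sup>+g. f (act g x) \<partial>count_space (carrier Gr)) \<in> borel_measurable M"
proof -
  interpret c: sigma_finite_measure "count_space (carrier Gr)"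
    by (rule sigma_finite_measure_count_space_countable[OF countable_carrier])
  have "(\<lambda>p. f (act (snd p) (fst p))) \<in> borel_measurable (M \<Otimes>\<^sub>M count_space (carrier Gr))"
    by (rule measurable_compose_countable'[where g = snd and I = "carrier Gr" and f = "\<lambda>g p. f (act g (fst p))"])
       (use countable_carrier in auto)
  then have "case_prod (\<lambda>x g. f (act g x)) \<in> borel_measurable (M \<Otimes>\<^sub>M count_space (carrier Gr))"
    by (simp add: case_prod_beta')
  then show ?thesis by (rule c.borel_measurable_nn_integral)
qed

lemma act_inv: "g \<in> carrier Gr \<Longrightarrow> x \<in> space M \<Longrightarrow> act (inv g) (act g x) = x"
  by (metis act_mult act_one inv_closed l_inv)

lemma act_inv': "g \<in> carrier Gr \<Longrightarrow> x \<in> space M \<Longrightarrow> act g (act (inv g) x) = x"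
  by (metis act_mult act_one inv_closed r_inv)

lemma nn_integral_act:
  assumes g: "g \<in> carrier Gr" and [measurable]: "f \<in> borel_measurable M"
  shows "(\<integral>\<^sup>+x. f (act g x) \<partial>M) = (\<integral>\<^sup>+x. f x \<partial>M)"
proof -
  have "(\<integral>\<^sup>+x. f x \<partial>M) = (\<integral>\<^sup>+x. f x \<partial>distr M M (act g))"
    by (simp add: act_preserves[OF g])
  also have "\<dots> = (\<integral>\<^sup>+x. f (act g x) \<partial>M)"
    using g by (intro nn_integral_distr) auto
  finally show ?thesis by simp
qed

text \<open>Insert the number of translates in \<open>D\<close>, which is one, and move each translate back by invariance
  of \<open>M\<close>. All integrals over the quotient are computed from this identity.\<close>

lemma unfolding_integral:
  assumes [measurable]: "f \<in> borel_measurable M"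
  shows "(\<integral>\<^sup>+x. f x \<partial>M) = (\<integral>\<^sup>+x. (\<integral>\<^sup>+g. f (act g x) \<partial>count_space (carrier Gr)) * indicator D x \<partial>M)"
proof -
  let ?C = "count_space (carrier Gr)"
  have cm: "(\<lambda>x. F (act g x)) \<in> borel_measurable M" if "g \<in> carrier Gr" "F \<in> borel_measurable M" for F :: "'a \<Rightarrow> ennreal" and g
    using act_measurable[OF that(1)] that(2) by (rule measurable_compose)
  have im: "(\<lambda>x. indicator D (act g x) :: ennreal) \<in> borel_measurable M" if "g \<in> carrier Gr" for g
    by (rule cm[OF that]) measurable
  have "(\<integral>\<^sup>+x. f x \<partial>M) = (\<integral>\<^sup>+x. (\<integral>\<^sup>+g. f x * indicator D (act g x) \<partial>?C) \<partial>M)"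
  proof (rule nn_integral_cong_AE)
    show "AE x in M. f x = (\<integral>\<^sup>+g. f x * indicator D (act g x) \<partial>?C)"
      using D_fundamental by eventually_elim (simp add: nn_integral_cmult)
  qed
  also have "\<dots> = (\<integral>\<^sup>+g. (\<integral>\<^sup>+x. f x * indicator D (act g x) \<partial>M) \<partial>?C)"
    using im by (intro nn_integral_count_space_nn_integral countable_carrier) auto
  also have "\<dots> = (\<integral>\<^sup>+g. (\<integral>\<^sup>+x. f (act (inv g) x) * indicator D x \<partial>M) \<partial>?C)"
  proof (rule nn_integral_cong)
    fix g assume "g \<in> space ?C"
    then have g: "g \<in> carrier Gr" "inv g \<in> carrier Gr" by auto
    have "(\<integral>\<^sup>+x. f x * indicator D (act g x) \<partial>M) = (\<integral>\<^sup>+x. f (act (inv g) x) * indicator D (act g (act (inv g) x)) \<partial>M)"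
      by (rule nn_integral_act[OF g(2), symmetric]) (use im[OF g(1)] in simp)
    also have "\<dots> = (\<integral>\<^sup>+x. f (act (inv g) x) * indicator D x \<partial>M)"
      using g by (intro nn_integral_cong) (simp add: act_inv')
    finally show "(\<integral>\<^sup>+x. f x * indicator D (act g x) \<partial>M) = (\<integral>\<^sup>+x. f (act (inv g) x) * indicator D x \<partial>M)" .
  qed
  also have "\<dots> = (\<integral>\<^sup>+g. (\<integral>\<^sup>+x. f (act g x) * indicator D x \<partial>M) \<partial>?C)"
    by (rule nn_integral_inverse)
  also have "\<dots> = (\<integral>\<^sup>+x. (\<integral>\<^sup>+g. f (act g x) * indicator D x \<partial>?C) \<partial>M)"
    using cm[of _ f] by (intro nn_integral_count_space_nn_integral[symmetric] countable_carrier) auto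
  also have "\<dots> = (\<integral>\<^sup>+x. (\<integral>\<^sup>+g. f (act g x) \<partial>?C) * indicator D x \<partial>M)"
    by (simp add: nn_integral_multc)
  finally show ?thesis .
qed

lemma invariant_null:
  assumes "invariant_set A" and [measurable]: "A \<in> sets M" and 0: "emeasure M (A \<inter> D) = 0"
  shows "emeasure M A = 0"
proof -
  have "emeasure M A = (\<integral>\<^sup>+x. (\<integral>\<^sup>+g. indicator A (act g x) \<partial>count_space (carrier Gr)) * indicator D x \<partial>M)"
    using unfolding_integral[of "indicator A"] by simp
  also have "\<dots> = 0"
  proof (subst nn_integral_0_iff_AE)
    have "AE x in M. x \<notin> A \<inter> D" using 0 by (intro AE_not_in null_setsI) auto
    then show "AE x in M. (\<integral>\<^sup>+g. indicator A (act g x) \<partial>count_space (carrier Gr)) * indicator D x = 0"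
    proof (rule AE_mp, intro AE_I2 impI)
      fix x assume x: "x \<in> space M" "x \<notin> A \<inter> D"
      show "(\<integral>\<^sup>+g. indicator A (act g x) \<partial>count_space (carrier Gr)) * indicator D x = 0"
      proof (cases "x \<in> D")
        case True
        then have "x \<notin> A" using x by auto
        then have "(\<integral>\<^sup>+g. indicator A (act g x) \<partial>count_space (carrier Gr)) = (\<integral>\<^sup>+g. 0 \<partial>count_space (carrier Gr))"
          using assms(1) x(1) by (intro nn_integral_cong) (auto simp: invariant_set_def indicator_def)
        then show ?thesis by simp
      qed simp
    qed
  qed measurable
  finally show ?thesis .
qed

text \<open>A measure preserving map commuting with the group carries \<open>D\<close> to another fundamental domain, and an
  invariant function has the same integral over every fundamental domain.\<close>

lemma commuting_map_integral:
  assumes T[measurable]: "T \<in> M \<rightarrow>\<^sub>M M" and T'[measurable]: "T' \<in> M \<rightarrow>\<^sub>M M"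
    and TM: "distr M M T = M" and T'M: "distr M M T' = M"
    and TT': "\<And>x. x \<in> space M \<Longrightarrow> T' (T x) = x"
    and comm: "\<And>g x. g \<in> carrier Gr \<Longrightarrow> x \<in> space M \<Longrightarrow> T' (act g x) = act g (T' x)"
    and F[measurable]: "F \<in> borel_measurable M"
    and inv: "\<And>g x. g \<in> carrier Gr \<Longrightarrow> x \<in> space M \<Longrightarrow> F (act g x) = F x"
  shows "(\<integral>\<^sup>+x. F (T x) * indicator D x \<partial>M) = (\<integral>\<^sup>+x. F x * indicator D x \<partial>M)"
proof -
  let ?C = "count_space (carrier Gr)"
  have iT: "(\<lambda>x. indicator D (T' x) :: ennreal) \<in> borel_measurable M"
    using T' by (rule measurable_compose) measurable
  have "(\<integral>\<^sup>+x. F (T x) * indicator D x \<partial>M) = (\<integral>\<^sup>+x. F (T x) * indicator D (T' (T x)) \<partial>M)"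
    by (intro nn_integral_cong) (simp add: TT')
  also have "\<dots> = (\<integral>\<^sup>+x. F x * indicator D (T' x) \<partial>distr M M T)"
    using iT by (subst nn_integral_distr) auto
  also have "\<dots> = (\<integral>\<^sup>+x. F x * indicator D (T' x) \<partial>M)" by (simp add: TM)
  also have "\<dots> = (\<integral>\<^sup>+x. (\<integral>\<^sup>+g. F (act g x) * indicator D (T' (act g x)) \<partial>?C) * indicator D x \<partial>M)"
    using iT by (intro unfolding_integral) auto
  also have "\<dots> = (\<integral>\<^sup>+x. F x * (\<integral>\<^sup>+g. indicator D (act g (T' x)) \<partial>?C) * indicator D x \<partial>M)"
    by (intro nn_integral_cong arg_cong2[where f = "(*)"] refl, subst nn_integral_cmult[symmetric], simp, intro nn_integral_cong)
       (simp add: inv comm)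
  also have "\<dots> = (\<integral>\<^sup>+x. F x * indicator D x \<partial>M)"
  proof (rule nn_integral_cong_AE)
    have "AE x in distr M M T'. (\<integral>\<^sup>+g. indicator D (act g x) \<partial>?C) = 1"
      by (subst T'M) (rule D_fundamental)
    then have "AE x in M. (\<integral>\<^sup>+g. indicator D (act g (T' x)) \<partial>?C) = 1"
      by (rule AE_distrD[OF T'])
    then show "AE x in M. F x * (\<integral>\<^sup>+g. indicator D (act g (T' x)) \<partial>?C) * indicator D x = F x * indicator D x"
      by eventually_elim simp
  qed
  finally show ?thesis .
qed

text \<open>The quotient by the group, encoded without forming orbits: the points stay those of \<open>M\<close>, the
  measurable sets are the invariant ones, and their measure is that of the part inside \<open>D\<close>.\<close>

definition quot :: "'a measure" where
  "quot = distr (density M (indicator D)) (sigma (space M) {A \<in> sets M. invariant_set A}) (\<lambda>x. x)"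

lemma sigma_algebra_invariant: "sigma_algebra (space M) {A \<in> sets M. invariant_set A}"
  unfolding sigma_algebra_iff2
proof (intro conjI ballI allI impI)
  show "{A \<in> sets M. invariant_set A} \<subseteq> Pow (space M)" using sets.sets_into_space by auto
  show "{} \<in> {A \<in> sets M. invariant_set A}" by (simp add: invariant_set_def)
  show "space M - s \<in> {A \<in> sets M. invariant_set A}" if "s \<in> {A \<in> sets M. invariant_set A}" for s
    using that act_space by (auto simp: invariant_set_def)
  show "\<Union>(range A) \<in> {A \<in> sets M. invariant_set A}" if "range A \<subseteq> {A \<in> sets M. invariant_set A}" for A :: "nat \<Rightarrow> 'a set"
  proof -
    have A: "A i \<in> sets M" "invariant_set (A i)" for i using that by auto
    have "\<Union>(range A) \<in> sets M" using A(1) by (intro sets.countable_UN) auto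
    moreover have "invariant_set (\<Union>(range A))" using A(2) by (auto simp: invariant_set_def)
    ultimately show ?thesis by simp
  qed
qed

lemma space_quot[simp]: "space quot = space M"
  unfolding quot_def space_distr using sigma_algebra_invariant sets.space_closed[of M]
  by (subst space_measure_of) auto

lemma sets_quot: "sets quot = {A \<in> sets M. invariant_set A}"
  unfolding quot_def sets_distr using sigma_algebra.sets_measure_of_eq[OF sigma_algebra_invariant] by simp

lemma measurable_quotI:
  assumes f: "f \<in> measurable M N" and inv: "\<And>g x. g \<in> carrier Gr \<Longrightarrow> x \<in> space M \<Longrightarrow> f (act g x) = f x"
  shows "f \<in> measurable quot N"
proof (rule measurableI)
  show "f x \<in> space N" if "x \<in> space quot" for x using that measurable_space[OF f] by simp
  show "f -` A \<inter> space quot \<in> sets quot" if "A \<in> sets N" for A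
    unfolding sets_quot space_quot
    using measurable_sets[OF f that] inv act_space by (auto simp: invariant_set_def)
qed

lemma id_measurable_quot: "(\<lambda>x. x) \<in> density M (indicator D) \<rightarrow>\<^sub>M sigma (space M) {A \<in> sets M. invariant_set A}"
  by (rule measurable_measure_of) (use sets.space_closed[of M] in auto)

lemma nn_integral_quot:
  assumes F: "F \<in> borel_measurable quot"
  shows "(\<integral>\<^sup>+x. F x \<partial>quot) = (\<integral>\<^sup>+x. F x * indicator D x \<partial>M)"
proof -
  have sm: "sets (sigma (space M) {A \<in> sets M. invariant_set A}) = sets quot"
    unfolding quot_def by simp
  have F1: "F \<in> borel_measurable (sigma (space M) {A \<in> sets M. invariant_set A})"
    using F unfolding measurable_cong_sets[OF sm refl] .
  have F2: "F \<in> borel_measurable M"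
    using measurable_compose[OF id_measurable_quot F1] by simp
  have "(\<integral>\<^sup>+x. F x \<partial>quot) = (\<integral>\<^sup>+x. F x \<partial>density M (indicator D))"
    unfolding quot_def by (rule nn_integral_distr[OF id_measurable_quot]) (use F1 in simp)
  also have "\<dots> = (\<integral>\<^sup>+x. F x * indicator D x \<partial>M)"
    using F2 by (subst nn_integral_density) (auto simp: mult.commute)
  finally show ?thesis .
qed

lemma emeasure_quot: "A \<in> sets quot \<Longrightarrow> emeasure quot A = emeasure M (A \<inter> D)"
proof -
  assume A: "A \<in> sets quot"
  then have AM: "A \<in> sets M" by (simp add: sets_quot)
  have "emeasure quot A = (\<integral>\<^sup>+x. indicator A x \<partial>quot)" using A by simp
  also have "\<dots> = (\<integral>\<^sup>+x. indicator A x * indicator D x \<partial>M)" using A by (intro nn_integral_quot) auto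
  also have "\<dots> = emeasure M (A \<inter> D)" using AM by (simp add: indicator_inter_arith[symmetric])
  finally show ?thesis .
qed

lemma finite_quot: "finite_measure quot"
proof (rule finite_measureI)
  show "emeasure quot (space quot) \<noteq> \<infinity>"
    using emeasure_quot[OF sets.top] D_finite sets.sets_into_space[OF D_sets] by (simp add: Int_absorb1)
qed

lemma AE_quot_iff:
  assumes "{x \<in> space M. \<not> P x} \<in> sets quot"
  shows "(AE x in quot. P x) \<longleftrightarrow> (AE x in M. P x)"
proof -
  let ?A = "{x \<in> space M. \<not> P x}"
  have "(AE x in quot. P x) \<longleftrightarrow> emeasure quot ?A = 0"
    using assms by (subst AE_iff_measurable[of ?A]) auto
  also have "\<dots> \<longleftrightarrow> emeasure M ?A = 0"
    using emeasure_quot[OF assms] invariant_null[of ?A] assms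
    by (metis (no_types, lifting) D_sets emeasure_eq_0 inf.cobounded1 mem_Collect_eq sets_quot)
  also have "\<dots> \<longleftrightarrow> (AE x in M. P x)"
    using assms by (subst AE_iff_measurable[of ?A]) (auto simp: sets_quot)
  finally show ?thesis .
qed

lemma commuting_map_quot:
  assumes T[measurable]: "T \<in> M \<rightarrow>\<^sub>M M" and T': "T' \<in> M \<rightarrow>\<^sub>M M"
    and TM: "distr M M T = M" and T'M: "distr M M T' = M"
    and TT': "\<And>x. x \<in> space M \<Longrightarrow> T' (T x) = x"
    and comm': "\<And>g x. g \<in> carrier Gr \<Longrightarrow> x \<in> space M \<Longrightarrow> T' (act g x) = act g (T' x)"
    and comm: "\<And>g x. g \<in> carrier Gr \<Longrightarrow> x \<in> space M \<Longrightarrow> T (act g x) = act g (T x)"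
  shows "T \<in> quot \<rightarrow>\<^sub>M quot" "distr quot quot T = quot"
proof -
  have T_space: "x \<in> space M \<Longrightarrow> T x \<in> space M" for x using measurable_space[OF T] .
  show Tq: "T \<in> quot \<rightarrow>\<^sub>M quot"
  proof (rule measurableI)
    show "T x \<in> space quot" if "x \<in> space quot" for x using that T_space by simp
    show "T -` A \<inter> space quot \<in> sets quot" if "A \<in> sets quot" for A
      using that measurable_sets[OF T, of A] act_space T_space
      by (auto simp: sets_quot invariant_set_def comm)
  qed
  show "distr quot quot T = quot"
  proof (rule measure_eqI)
    fix A assume "A \<in> sets (distr quot quot T)"
    then have A: "A \<in> sets quot" by simp
    then have AM[measurable]: "A \<in> sets M" and Ai: "invariant_set A" by (auto simp: sets_quot)
    have pre: "T -` A \<inter> space quot \<in> sets quot" by (rule measurable_sets[OF Tq A])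
    then have preM: "T -` A \<inter> space M \<in> sets M" by (simp add: sets_quot)
    have "emeasure (distr quot quot T) A = emeasure M ((T -` A \<inter> space M) \<inter> D)"
      using A Tq pre by (simp add: emeasure_distr emeasure_quot)
    also have "\<dots> = (\<integral>\<^sup>+x. indicator A (T x) * indicator D x \<partial>M)"
    proof -
      have "emeasure M ((T -` A \<inter> space M) \<inter> D) = (\<integral>\<^sup>+x. indicator ((T -` A \<inter> space M) \<inter> D) x \<partial>M)"
        using preM by simp
      also have "\<dots> = (\<integral>\<^sup>+x. indicator A (T x) * indicator D x \<partial>M)"
        by (intro nn_integral_cong) (auto simp: indicator_def)
      finally show ?thesis .
    qed
    also have "\<dots> = (\<integral>\<^sup>+x. indicator A x * indicator D x \<partial>M)"
      by (rule commuting_map_integral[OF T T' TM T'M TT' comm']) (use Ai in \<open>auto simp: invariant_set_def indicator_def\<close>)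
    also have "\<dots> = emeasure quot A"
      using A by (simp add: emeasure_quot indicator_inter_arith[symmetric])
    finally show "emeasure (distr quot quot T) A = emeasure quot A" .
  qed simp
qed

end

section \<open>Translations and substitutions on the line\<close>

lemma measure_set_translate:
  fixes B :: "real set"
  assumes "B \<in> sets borel"
  shows "{u. u + \<delta> \<in> B} \<in> sets borel" "emeasure lborel {u. u + \<delta> \<in> B} = emeasure lborel B"
proof -
  note [measurable] = assms
  show "{u. u + \<delta> \<in> B} \<in> sets borel" by measurable
  have "emeasure lborel B = (\<integral>\<^sup>+u. indicator B u \<partial>lborel)" by simp
  also have "\<dots> = (\<integral>\<^sup>+u. indicator B (\<delta> + 1 * u) \<partial>lborel)"
    by (subst nn_integral_real_affine[where c = 1 and t = \<delta>]) auto
  also have "\<dots> = (\<integral>\<^sup>+u. indicator {u. u + \<delta> \<in> B} u \<partial>lborel)"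
    by (intro nn_integral_cong) (auto simp: indicator_def add.commute)
  also have "\<dots> = emeasure lborel {u. u + \<delta> \<in> B}" by simp
  finally show "emeasure lborel {u. u + \<delta> \<in> B} = emeasure lborel B" by simp
qed

text \<open>Squeeze \<open>E\<close> between a compact set and an open set of nearly the same measure. A translation by less
  than the distance from the compact set to the complement of the open set moves points of \<open>E\<close> out of \<open>E\<close>,
  or into it, only within the small remainder.\<close>

lemma translate_bounded_set:
  fixes E :: "real set" and e :: real
  assumes E: "E \<in> sets borel" and fin: "emeasure lborel E < \<infinity>" and e: "0 < e"
  shows "\<exists>d>0. \<forall>\<delta>. \<bar>\<delta>\<bar> < d \<longrightarrow> emeasure lborel {u. (u + \<delta> \<in> E) \<noteq> (u \<in> E)} \<le> ennreal e"
proof -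
  note [measurable] = E
  have EL: "E \<in> sets lebesgue" by simp
  obtain U where U: "open U" "E \<subseteq> U" "emeasure lebesgue (U - E) < ennreal (e / 8)"
    using sets_lebesgue_outer_open[OF EL, of "e / 8"] e by (metis zero_less_divide_iff zero_less_numeral)
  obtain K where K: "compact K" "K \<subseteq> E" "emeasure lebesgue (E - K) < ennreal (e / 8)"
  proof -
    obtain T where T: "closed T" "T \<subseteq> E" "E - T \<in> lmeasurable" "emeasure lebesgue (E - T) < ennreal (e / 16)"
      using sets_lebesgue_inner_closed[OF EL, of "e / 16"] e by (metis zero_less_divide_iff zero_less_numeral)
    have Tb[measurable]: "T \<in> sets borel" using T(1) by auto
    define Tn where "Tn n = T - {- real n .. real n}" for n
    have "(\<lambda>n. emeasure lborel (Tn n)) \<longlonglongrightarrow> emeasure lborel (\<Inter>n. Tn n)"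
    proof (rule Lim_emeasure_decseq)
      show "range Tn \<subseteq> sets lborel" by (auto simp: Tn_def)
      show "decseq Tn" by (auto simp: Tn_def decseq_def)
      show "emeasure lborel (Tn i) \<noteq> \<infinity>" for i
      proof -
        have "emeasure lborel (Tn i) \<le> emeasure lborel E" using T(2) by (intro emeasure_mono) (auto simp: Tn_def)
        then show ?thesis using fin by auto
      qed
    qed
    moreover have "(\<Inter>n. Tn n) = {}"
    proof (intro equals0I)
      fix x assume x: "x \<in> (\<Inter>n. Tn n)"
      obtain n where "\<bar>x\<bar> \<le> real n" using real_arch_simple by blast
      then show False using x by (auto simp: Tn_def abs_le_iff)
    qed
    ultimately have "(\<lambda>n. emeasure lborel (Tn n)) \<longlonglongrightarrow> 0" by simp
    then have "\<forall>\<^sub>F n in sequentially. emeasure lborel (Tn n) < ennreal (e / 16)"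
      using e by (intro order_tendstoD) auto
    then obtain n where n: "emeasure lborel (Tn n) < ennreal (e / 16)"
      by (auto simp: eventually_sequentially)
    define K where "K = T \<inter> {- real n .. real n}"
    show thesis
    proof
      show "compact K" unfolding K_def using T(1) by (simp add: closed_Int_compact)
      show "K \<subseteq> E" using T(2) by (auto simp: K_def)
      have "emeasure lebesgue (E - K) = emeasure lborel (E - K)" by (simp add: K_def)
      also have "\<dots> \<le> emeasure lborel ((E - T) \<union> Tn n)"
        by (rule emeasure_mono) (auto simp: K_def Tn_def)
      also have "\<dots> \<le> emeasure lborel (E - T) + emeasure lborel (Tn n)"
        by (rule emeasure_subadditive) (auto simp: Tn_def)
      also have "\<dots> < ennreal (e / 16) + ennreal (e / 16)"
        using T(4) n by (intro add_strict_mono) auto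
      also have "\<dots> = ennreal (e / 8)" using e by (simp add: ennreal_plus[symmetric] del: ennreal_plus)
      finally show "emeasure lebesgue (E - K) < ennreal (e / 8)" .
    qed
  qed
  have Ub[measurable]: "U \<in> sets borel" and Kb[measurable]: "K \<in> sets borel"
    using U(1) K(1) by (auto simp: compact_imp_closed)
  have UE: "emeasure lborel (U - E) \<le> ennreal (e / 8)" using U(3) by simp
  have EK: "emeasure lborel (E - K) \<le> ennreal (e / 8)" using K(3) by simp
  obtain d where d: "d > 0" "\<And>x y. x \<in> K \<Longrightarrow> y \<in> - U \<Longrightarrow> d \<le> dist x y"
  proof -
    have "closed (- U)" "K \<inter> - U = {}" using U(1,2) K(2) by auto
    from separate_compact_closed[OF K(1) this] show thesis using that by blast
  qed
  have "emeasure lborel {u. (u + \<delta> \<in> E) \<noteq> (u \<in> E)} \<le> ennreal e" if \<delta>: "\<bar>\<delta>\<bar> < d" for \<delta>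
  proof -
    let ?A = "{u. u + \<delta> \<in> E - K}" and ?B = "{u. u + \<delta> \<in> U - E}"
    have ms: "?A \<in> sets borel" "?B \<in> sets borel" by measurable
    have sub: "{u. (u + \<delta> \<in> E) \<noteq> (u \<in> E)} \<subseteq> (?A \<union> (U - E)) \<union> ((E - K) \<union> ?B)"
    proof
      fix u assume u: "u \<in> {u. (u + \<delta> \<in> E) \<noteq> (u \<in> E)}"
      have 1: "u \<in> U" if "u + \<delta> \<in> K" using d(2)[OF that, of u] \<delta> by (force simp: dist_real_def)
      have 2: "u + \<delta> \<in> U" if "u \<in> K" using d(2)[OF that, of "u + \<delta>"] \<delta> by (force simp: dist_real_def)
      show "u \<in> (?A \<union> (U - E)) \<union> ((E - K) \<union> ?B)"
        using u 1 2 by auto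
    qed
    have "emeasure lborel {u. (u + \<delta> \<in> E) \<noteq> (u \<in> E)} \<le> emeasure lborel ((?A \<union> (U - E)) \<union> ((E - K) \<union> ?B))"
      by (rule emeasure_mono[OF sub]) (use ms in auto)
    also have "\<dots> \<le> (emeasure lborel ?A + emeasure lborel (U - E)) + (emeasure lborel (E - K) + emeasure lborel ?B)"
      using ms by (intro order_trans[OF emeasure_subadditive] add_mono emeasure_subadditive) auto
    also have "\<dots> = (emeasure lborel (E - K) + emeasure lborel (U - E)) + (emeasure lborel (E - K) + emeasure lborel (U - E))"
      by (subst (1 2) measure_set_translate(2)) auto
    also have "\<dots> \<le> (ennreal (e/8) + ennreal (e/8)) + (ennreal (e/8) + ennreal (e/8))"
      by (intro add_mono UE EK)
    also have "\<dots> \<le> ennreal e" using e by (simp add: ennreal_plus[symmetric] del: ennreal_plus)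
    finally show ?thesis .
  qed
  then show ?thesis using d(1) by auto
qed

text \<open>Continuity of translation in measure. \<open>B\<close> may have infinite measure, so only the discrepancy
  inside a fixed set of finite measure can be controlled; this is the form in which small horocycle
  translations act on the fibres of a fundamental domain.\<close>

lemma translate_continuity:
  fixes B D :: "real set"
  assumes B[measurable]: "B \<in> sets borel" and D[measurable]: "D \<in> sets borel"
    and fin: "emeasure lborel D < \<infinity>" and \<delta>: "\<delta> \<longlonglongrightarrow> 0"
  shows "(\<lambda>n. emeasure lborel {u \<in> D. (u + \<delta> n \<in> B) \<noteq> (u \<in> B)}) \<longlonglongrightarrow> 0"
proof (rule order_tendstoI)
  fix e :: ennreal assume e0: "0 < e"
  obtain e' where e': "0 < e'" "ennreal e' \<le> e"
  proof (cases e)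
    case (real r) with e0 show thesis by (intro that[of r]) auto
  next
    case top then show thesis by (intro that[of 1]) auto
  qed
  define Dn where "Dn n = D - {- real n .. real n}" for n
  have "(\<lambda>n. emeasure lborel (Dn n)) \<longlonglongrightarrow> emeasure lborel (\<Inter>n. Dn n)"
  proof (rule Lim_emeasure_decseq)
    show "range Dn \<subseteq> sets lborel" by (auto simp: Dn_def)
    show "decseq Dn" by (auto simp: Dn_def decseq_def)
    show "emeasure lborel (Dn i) \<noteq> \<infinity>" for i
    proof -
      have "emeasure lborel (Dn i) \<le> emeasure lborel D" by (rule emeasure_mono) (auto simp: Dn_def)
      then show ?thesis using fin by auto
    qed
  qed
  moreover have "(\<Inter>n. Dn n) = {}"
  proof (intro equals0I)
    fix x assume x: "x \<in> (\<Inter>n. Dn n)"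
    obtain n where "\<bar>x\<bar> \<le> real n" using real_arch_simple by blast
    then show False using x by (auto simp: Dn_def abs_le_iff)
  qed
  ultimately have "(\<lambda>n. emeasure lborel (Dn n)) \<longlonglongrightarrow> 0" by simp
  then have "\<forall>\<^sub>F n in sequentially. emeasure lborel (Dn n) < ennreal (e' / 4)"
    using e' by (intro order_tendstoD) auto
  then obtain N where N: "emeasure lborel (Dn N) < ennreal (e' / 4)"
    by (auto simp: eventually_sequentially)
  define E where "E = B \<inter> {- real N - 1 .. real N + 1}"
  have E: "E \<in> sets borel" by (simp add: E_def)
  have "emeasure lborel E \<le> emeasure lborel {- real N - 1 .. real N + 1}"
    by (rule emeasure_mono) (auto simp: E_def)
  also have "\<dots> < \<infinity>" by simp
  finally have Ef: "emeasure lborel E < \<infinity>" .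
  obtain d where d: "d > 0" "\<And>t. \<bar>t\<bar> < d \<Longrightarrow> emeasure lborel {u. (u + t \<in> E) \<noteq> (u \<in> E)} \<le> ennreal (e' / 4)"
    using translate_bounded_set[OF E Ef, of "e' / 4"] e' by auto
  have "\<forall>\<^sub>F n in sequentially. \<bar>\<delta> n\<bar> < min d 1"
    using \<delta> d(1) tendsto_rabs_zero_iff[of \<delta>] by (intro order_tendstoD(2)) auto
  then show "\<forall>\<^sub>F n in sequentially. emeasure lborel {u \<in> D. (u + \<delta> n \<in> B) \<noteq> (u \<in> B)} < e"
  proof eventually_elim
    case (elim n)
    have "{u \<in> D. (u + \<delta> n \<in> B) \<noteq> (u \<in> B)} \<subseteq> Dn N \<union> {u. (u + \<delta> n \<in> E) \<noteq> (u \<in> E)}"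
      using elim by (auto simp: Dn_def E_def)
    moreover have m: "{u. (u + \<delta> n \<in> E) \<noteq> (u \<in> E)} \<in> sets borel" unfolding E_def by measurable
    ultimately have "emeasure lborel {u \<in> D. (u + \<delta> n \<in> B) \<noteq> (u \<in> B)} \<le> emeasure lborel (Dn N \<union> {u. (u + \<delta> n \<in> E) \<noteq> (u \<in> E)})"
      by (intro emeasure_mono) (auto simp: Dn_def)
    also have "\<dots> \<le> emeasure lborel (Dn N) + emeasure lborel {u. (u + \<delta> n \<in> E) \<noteq> (u \<in> E)}"
      using m by (intro emeasure_subadditive) (auto simp: Dn_def)
    also have "\<dots> \<le> ennreal (e' / 4) + ennreal (e' / 4)"
      using N d(2)[of "\<delta> n"] elim by (intro add_mono) auto
    also have "\<dots> = ennreal (e' / 2)" using e' by (simp add: ennreal_plus[symmetric] del: ennreal_plus)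
    also have "\<dots> < ennreal e'" using e' by (intro ennreal_lessI) auto
    also have "\<dots> \<le> e" by fact
    finally show ?case .
  qed
qed auto

text \<open>Monotone convergence extends the substitution rule from compact intervals to increasing unions of
  them, as is needed for substitutions with a pole such as \<open>x \<mapsto> - 1 / x\<close>.\<close>

lemma nn_integral_substitution_exhaustion:
  fixes f :: "real \<Rightarrow> ennreal" and g g' :: "real \<Rightarrow> real" and a b :: "nat \<Rightarrow> real"
  assumes f[measurable]: "f \<in> borel_measurable borel"
    and g[measurable]: "g \<in> borel_measurable borel" and g'[measurable]: "g' \<in> borel_measurable borel"
    and deriv: "\<And>n x. x \<in> {a n..b n} \<Longrightarrow> (g has_real_derivative g' x) (at x)"
    and cont: "\<And>n. continuous_on {a n..b n} g'"
    and nonneg: "\<And>n x. x \<in> {a n..b n} \<Longrightarrow> g' x \<ge> 0"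
    and less: "\<And>n. a n < b n"
    and inc: "incseq (\<lambda>n. {a n..b n})" "incseq (\<lambda>n. {g (a n)..g (b n)})"
  shows "(\<integral>\<^sup>+x. f x * indicator (\<Union>n. {g (a n)..g (b n)}) x \<partial>lborel) =
         (\<integral>\<^sup>+x. f (g x) * ennreal (g' x) * indicator (\<Union>n. {a n..b n}) x \<partial>lborel)"
proof -
  have S: "(\<integral>\<^sup>+x. h x * indicator (\<Union>n. A n) x \<partial>lborel) = (SUP n. \<integral>\<^sup>+x. h x * indicator (A n) x \<partial>lborel)"
    if A: "incseq A" "\<And>n. A n \<in> sets borel" and h[measurable]: "h \<in> borel_measurable borel"
    for h :: "real \<Rightarrow> ennreal" and A :: "nat \<Rightarrow> real set"
  proof -
    note [measurable] = A(2)
    have "(\<integral>\<^sup>+x. h x * indicator (\<Union>n. A n) x \<partial>lborel) = emeasure (density lborel h) (\<Union>n. A n)"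
      using A(2) by (subst emeasure_density) auto
    also have "\<dots> = (SUP n. emeasure (density lborel h) (A n))"
      using A by (intro SUP_emeasure_incseq[symmetric]) auto
    also have "\<dots> = (SUP n. \<integral>\<^sup>+x. h x * indicator (A n) x \<partial>lborel)"
      by (subst emeasure_density) auto
    finally show ?thesis .
  qed
  have "(\<integral>\<^sup>+x. f x * indicator (\<Union>n. {g (a n)..g (b n)}) x \<partial>lborel)
      = (SUP n. \<integral>\<^sup>+x. f x * indicator {g (a n)..g (b n)} x \<partial>lborel)"
    by (rule S[OF inc(2)]) auto
  also have "\<dots> = (SUP n. \<integral>\<^sup>+x. f (g x) * ennreal (g' x) * indicator {a n..b n} x \<partial>lborel)"
    using deriv cont nonneg less by (intro SUP_cong refl nn_integral_substitution_aux) auto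
  also have "\<dots> = (\<integral>\<^sup>+x. f (g x) * ennreal (g' x) * indicator (\<Union>n. {a n..b n}) x \<partial>lborel)"
    by (rule S[OF inc(1), symmetric]) auto
  finally show ?thesis .
qed

lemma nn_integral_inversion:
  fixes f :: "real \<Rightarrow> ennreal"
  assumes f[measurable]: "f \<in> borel_measurable borel"
  shows "(\<integral>\<^sup>+x. f (- 1 / x) * ennreal (1 / x\<^sup>2) \<partial>lborel) = (\<integral>\<^sup>+x. f x \<partial>lborel)"
proof -
  have pos: "(\<Union>n. {inverse (real n + 2)..real n + 2}) = {0<..}"
  proof (intro Set.set_eqI iffI)
    fix x :: real assume "x \<in> {0<..}"
    then have x: "x > 0" by simp
    obtain n1 where n1: "x \<le> real n1" using real_arch_simple by blast
    obtain n2 where n2: "inverse x \<le> real n2" using real_arch_simple by blast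
    have "inverse (real (max n1 n2) + 2) \<le> inverse (inverse x)"
      using n2 x by (intro le_imp_inverse_le) auto
    moreover have "x \<le> real (max n1 n2) + 2" using n1 by simp
    ultimately have "x \<in> {inverse (real (max n1 n2) + 2)..real (max n1 n2) + 2}" by simp
    then show "x \<in> (\<Union>n. {inverse (real n + 2)..real n + 2})" by blast
  next
    fix x :: real assume "x \<in> (\<Union>n. {inverse (real n + 2)..real n + 2})"
    then obtain n where "inverse (real n + 2) \<le> x" by auto
    moreover have "0 < inverse (real n + 2)" by simp
    ultimately have "0 < x" by linarith
    then show "x \<in> {0<..}" by simp
  qed
  have neg: "(\<Union>n. {- (real n + 2)..- inverse (real n + 2)}) = {..<0}"
  proof -
    have "(\<Union>n. {- (real n + 2)..- inverse (real n + 2)}) = uminus ` (\<Union>n. {inverse (real n + 2)..real n + 2})"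
      by (simp add: image_UN)
    also have "\<dots> = {..<0}" by (simp add: pos)
    finally show ?thesis .
  qed
  have lt: "inverse (real n + 2) < real n + 2" for n
    by (rule less_trans[of _ 1]) (auto intro: inverse_less_1_iff[THEN iffD2])
  have le: "inverse (real m + 2) \<le> inverse (real n + 2)" if "n \<le> m" for n m
    using that by (intro le_imp_inverse_le) auto
  have i1: "incseq (\<lambda>n. {inverse (real n + 2)..real n + 2})"
    using le by (simp add: incseq_def)
  have i2: "incseq (\<lambda>n. {- (real n + 2)..- inverse (real n + 2)})"
    using le by (simp add: incseq_def)
  have d: "((\<lambda>x. - 1 / x) has_real_derivative 1 / x\<^sup>2) (at x)" if "x \<noteq> 0" for x :: real
    using that by (auto intro!: derivative_eq_intros simp: power2_eq_square)
  have nz: "x \<noteq> 0" if "x \<in> {inverse (real n + 2)..real n + 2}" for x n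
    using that inverse_positive_iff_positive[of "real n + 2"] by auto
  have nz': "x \<noteq> 0" if "x \<in> {- (real n + 2)..- inverse (real n + 2)}" for x n
    using that inverse_positive_iff_positive[of "real n + 2"] by auto
  have c: "continuous_on S (\<lambda>x. 1 / x\<^sup>2)" if "\<And>x. x \<in> S \<Longrightarrow> x \<noteq> 0" for S :: "real set"
    using that by (auto intro!: continuous_intros)
  have 1: "(\<integral>\<^sup>+x. f x * indicator {..<0} x \<partial>lborel) = (\<integral>\<^sup>+x. f (- 1 / x) * ennreal (1 / x\<^sup>2) * indicator {0<..} x \<partial>lborel)"
  proof -
    have *: "{- 1 / inverse (real n + 2)..- 1 / (real n + 2)} = {- (real n + 2)..- inverse (real n + 2)}" for n
      by (simp add: field_simps)
    have "(\<integral>\<^sup>+x. f x * indicator (\<Union>n. {- 1 / inverse (real n + 2)..- 1 / (real n + 2)}) x \<partial>lborel)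
        = (\<integral>\<^sup>+x. f (- 1 / x) * ennreal (1 / x\<^sup>2) * indicator (\<Union>n. {inverse (real n + 2)..real n + 2}) x \<partial>lborel)"
    proof (rule nn_integral_substitution_exhaustion)
      show "((\<lambda>x. - 1 / x) has_real_derivative 1 / x\<^sup>2) (at x)" if "x \<in> {inverse (real n + 2)..real n + 2}" for n x
        by (rule d) (rule nz[OF that])
      show "continuous_on {inverse (real n + 2)..real n + 2} (\<lambda>x. 1 / x\<^sup>2)" for n
        by (rule c) (rule nz)
      show "inverse (real n + 2) < real n + 2" for n using lt[of n] by simp
      show "incseq (\<lambda>n. {inverse (real n + 2)..real n + 2})" by fact
      show "incseq (\<lambda>n. {- 1 / inverse (real n + 2)..- 1 / (real n + 2)})" unfolding * by fact
    qed auto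
    then show ?thesis unfolding * pos neg .
  qed
  have 2: "(\<integral>\<^sup>+x. f x * indicator {0<..} x \<partial>lborel) = (\<integral>\<^sup>+x. f (- 1 / x) * ennreal (1 / x\<^sup>2) * indicator {..<0} x \<partial>lborel)"
  proof -
    have *: "{- 1 / - (real n + 2)..- 1 / - inverse (real n + 2)} = {inverse (real n + 2)..real n + 2}" for n
      by (simp add: field_simps)
    have "(\<integral>\<^sup>+x. f x * indicator (\<Union>n. {- 1 / - (real n + 2)..- 1 / - inverse (real n + 2)}) x \<partial>lborel)
        = (\<integral>\<^sup>+x. f (- 1 / x) * ennreal (1 / x\<^sup>2) * indicator (\<Union>n. {- (real n + 2)..- inverse (real n + 2)}) x \<partial>lborel)"
    proof (rule nn_integral_substitution_exhaustion)
      show "((\<lambda>x. - 1 / x) has_real_derivative 1 / x\<^sup>2) (at x)" if "x \<in> {- (real n + 2)..- inverse (real n + 2)}" for n x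
        by (rule d) (rule nz'[OF that])
      show "continuous_on {- (real n + 2)..- inverse (real n + 2)} (\<lambda>x. 1 / x\<^sup>2)" for n
        by (rule c) (rule nz')
      show "- (real n + 2) < - inverse (real n + 2)" for n using lt[of n] by simp
      show "incseq (\<lambda>n. {- (real n + 2)..- inverse (real n + 2)})" by fact
      show "incseq (\<lambda>n. {- 1 / - (real n + 2)..- 1 / - inverse (real n + 2)})" unfolding * by fact
    qed auto
    then show ?thesis unfolding * pos neg .
  qed
  have split: "(\<integral>\<^sup>+x. h x \<partial>lborel) = (\<integral>\<^sup>+x. h x * indicator {..<0} x \<partial>lborel) + (\<integral>\<^sup>+x. h x * indicator {0<..} x \<partial>lborel)"
    if [measurable]: "h \<in> borel_measurable borel" for h :: "real \<Rightarrow> ennreal"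
  proof -
    have "(\<integral>\<^sup>+x. h x \<partial>lborel) = (\<integral>\<^sup>+x. h x * indicator {..<0} x + h x * indicator {0<..} x \<partial>lborel)"
      by (rule nn_integral_cong_AE, rule AE_mp[OF AE_lborel_singleton[of 0]])
         (auto simp: indicator_def not_less le_less)
    also have "\<dots> = (\<integral>\<^sup>+x. h x * indicator {..<0} x \<partial>lborel) + (\<integral>\<^sup>+x. h x * indicator {0<..} x \<partial>lborel)"
      by (rule nn_integral_add) auto
    finally show ?thesis .
  qed
  show ?thesis
    by (subst (1 2) split) (auto simp: 1 2 add.commute)
qed

lemma nn_integral_exp:
  fixes h :: "real \<Rightarrow> ennreal"
  assumes h[measurable]: "h \<in> borel_measurable borel"
  shows "(\<integral>\<^sup>+r. ennreal (exp (- r)) * h (exp r) \<partial>lborel) = (\<integral>\<^sup>+q. h q * ennreal (1 / q\<^sup>2) * indicator {0<..} q \<partial>lborel)"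
proof -
  have u: "(\<Union>n. {- (real n + 1)..real n + 1}) = UNIV"
  proof (intro Set.set_eqI iffI UNIV_I)
    fix x :: real
    obtain n where "\<bar>x\<bar> \<le> real n" using real_arch_simple by blast
    then show "x \<in> (\<Union>n. {- (real n + 1)..real n + 1})" by (intro UN_I[of n]) auto
  qed
  have p: "(\<Union>n. {exp (- (real n + 1))..exp (real n + 1)}) = {0<..}"
  proof (intro Set.set_eqI iffI)
    fix x :: real assume "x \<in> {0<..}"
    then have x: "x = exp (ln x)" by simp
    obtain n where "\<bar>ln x\<bar> \<le> real n" using real_arch_simple by blast
    then have "exp (- (real n + 1)) \<le> exp (ln x)" "exp (ln x) \<le> exp (real n + 1)" by auto
    then show "x \<in> (\<Union>n. {exp (- (real n + 1))..exp (real n + 1)})" using x by auto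
  next
    fix x :: real assume "x \<in> (\<Union>n. {exp (- (real n + 1))..exp (real n + 1)})"
    then obtain n where "exp (- (real n + 1)) \<le> x" by auto
    then show "x \<in> {0<..}" using less_le_trans[OF exp_gt_zero] by auto
  qed
  have "(\<integral>\<^sup>+q. h q * ennreal (1 / q\<^sup>2) * indicator {0<..} q \<partial>lborel)
      = (\<integral>\<^sup>+r. h (exp r) * ennreal (1 / (exp r)\<^sup>2) * ennreal (exp r) * indicator UNIV r \<partial>lborel)"
    using nn_integral_substitution_exhaustion[where g = exp and g' = exp and f = "\<lambda>q. h q * ennreal (1 / q\<^sup>2)"
          and a = "\<lambda>n. - (real n + 1)" and b = "\<lambda>n. real n + 1"]
    unfolding u p by (auto intro!: continuous_on_exp[OF continuous_on_id] simp: incseq_def intro: order_trans)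
  also have "\<dots> = (\<integral>\<^sup>+r. ennreal (exp (- r)) * h (exp r) \<partial>lborel)"
  proof (rule nn_integral_cong)
    fix r :: real
    have "ennreal (1 / (exp r)\<^sup>2) * ennreal (exp r) = ennreal (exp (- r))"
      by (simp add: ennreal_mult[symmetric] power2_eq_square exp_minus field_simps)
    then show "h (exp r) * ennreal (1 / (exp r)\<^sup>2) * ennreal (exp r) * indicator UNIV r = ennreal (exp (- r)) * h (exp r)"
      by (simp add: mult.assoc) (simp add: mult.commute)
  qed
  finally show ?thesis by simp
qed

section \<open>Coordinates on the space of unit tangent vectors\<close>

text \<open>The parameterized geodesic that ends at the real number \<open>x\<close>: it is the preimage of the vertical
  geodesic \<open>t \<mapsto> u + \<i> * exp (s + t)\<close> under \<open>z \<mapsto> - 1 / (z - x)\<close>. Its other end point is \<open>x - 1 / u\<close>, or infinity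
  if \<open>u = 0\<close>. In these coordinates the invariant measure on the unit tangent bundle is Lebesgue measure.\<close>

definition geo :: "real \<times> real \<times> real \<Rightarrow> real \<Rightarrow> complex" where
  "geo \<omega> t = (case \<omega> of (x, u, s) \<Rightarrow> complex_of_real x - 1 / Complex u (exp (s + t)))"

text \<open>The action of \<open>A\<close> on the coordinates of \<open>geo\<close>; its Jacobian is one, because the derivative of the
  first coordinate in \<open>x\<close> is the inverse of that of the second in \<open>u\<close>.\<close>

definition moebius_coords :: "real^2^2 \<Rightarrow> real \<times> real \<times> real \<Rightarrow> real \<times> real \<times> real" where
  "moebius_coords A \<omega> = (case \<omega> of (x, u, s) \<Rightarrow>
     ((A$1$1 * x + A$1$2) / (A$2$1 * x + A$2$2),
      (A$2$1 * x + A$2$2)\<^sup>2 * u - A$2$1 * (A$2$1 * x + A$2$2),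
      s + 2 * ln \<bar>A$2$1 * x + A$2$2\<bar>))"

text \<open>The coordinates of the unit tangent vector at \<open>z\<close> whose direction \<open>d\<close> has stereographic coordinate
  \<open>m = Re d / (1 - Im d)\<close>. Projecting from \<open>\<i>\<close> leaves out exactly the vectors that point to infinity.\<close>

definition vec_coords :: "complex \<Rightarrow> real \<Rightarrow> real \<times> real \<times> real" where
  "vec_coords z m = (Re z + m * Im z, m / (Im z * (1 + m\<^sup>2)), - ln (Im z * (1 + m\<^sup>2)))"

text \<open>The map \<open>x \<mapsto> (a * x + b) / (c * x + d)\<close> is affine if \<open>c = 0\<close> and otherwise a composition of affine
  maps with the inversion \<open>x \<mapsto> - 1 / x\<close>.\<close>

lemma nn_integral_moebius:
  fixes a b c d :: real and K :: "real \<Rightarrow> ennreal"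
  assumes det: "a * d - b * c = 1" and K[measurable]: "K \<in> borel_measurable borel"
  shows "(\<integral>\<^sup>+x. K ((a * x + b) / (c * x + d)) * ennreal (1 / (c * x + d)\<^sup>2) \<partial>lborel) = (\<integral>\<^sup>+x. K x \<partial>lborel)"
proof (cases "c = 0")
  case True
  then have ad: "a * d = 1" using det by simp
  then have d: "d \<noteq> 0" "a \<noteq> 0" by auto
  have "\<bar>a / d\<bar> = 1 / d\<^sup>2"
  proof -
    have "a = 1 / d" using ad d by (simp add: field_simps)
    then show ?thesis by (simp add: power2_eq_square)
  qed
  then have "(\<integral>\<^sup>+x. K x \<partial>lborel) = ennreal (1 / d\<^sup>2) * (\<integral>\<^sup>+x. K (b / d + (a / d) * x) \<partial>lborel)"
    using nn_integral_real_affine[of K "a / d" "b / d"] d by simp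
  also have "\<dots> = (\<integral>\<^sup>+x. K ((a * x + b) / (c * x + d)) * ennreal (1 / (c * x + d)\<^sup>2) \<partial>lborel)"
    using True d by (subst nn_integral_cmult[symmetric]) (auto intro!: nn_integral_cong simp: mult.commute add_divide_distrib add.commute)
  finally show ?thesis by simp
next
  case False
  define G where "G y = K (a / c + - 1 / y) * ennreal (1 / y\<^sup>2)" for y
  have Gm[measurable]: "G \<in> borel_measurable borel" unfolding G_def by measurable
  have "(\<integral>\<^sup>+x. K x \<partial>lborel) = (\<integral>\<^sup>+x. K (a / c + x) \<partial>lborel)"
    using nn_integral_real_affine[of K 1 "a / c"] by simp
  also have "\<dots> = (\<integral>\<^sup>+y. G y \<partial>lborel)"
    unfolding G_def by (rule nn_integral_inversion[of "\<lambda>x. K (a / c + x)", symmetric]) measurable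
  also have "\<dots> = ennreal (c\<^sup>2) * (\<integral>\<^sup>+x. G (c * d + c\<^sup>2 * x) \<partial>lborel)"
    using nn_integral_real_affine[of G "c\<^sup>2" "c * d"] False by simp
  also have "\<dots> = (\<integral>\<^sup>+x. ennreal (c\<^sup>2) * G (c * d + c\<^sup>2 * x) \<partial>lborel)"
    by (rule nn_integral_cmult[symmetric]) measurable
  also have "\<dots> = (\<integral>\<^sup>+x. K ((a * x + b) / (c * x + d)) * ennreal (1 / (c * x + d)\<^sup>2) \<partial>lborel)"
  proof (rule nn_integral_cong)
    fix x :: real
    show "ennreal (c\<^sup>2) * G (c * d + c\<^sup>2 * x) = K ((a * x + b) / (c * x + d)) * ennreal (1 / (c * x + d)\<^sup>2)"
    proof (cases "c * x + d = 0")
      case True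
      then have "c * (c * x + d) = 0" by simp
      then have "c * d + c\<^sup>2 * x = 0" by (simp add: power2_eq_square algebra_simps)
      then show ?thesis using True by (simp add: G_def)
    next
      case j: False
      have y: "c * d + c\<^sup>2 * x = c * (c * x + d)" by (simp add: power2_eq_square algebra_simps)
      have "a / c + - 1 / (c * (c * x + d)) = (a * x + b) / (c * x + d)"
        using False j det by (simp add: divide_simps) (simp add: algebra_simps)
      moreover have "c\<^sup>2 * (1 / (c * (c * x + d))\<^sup>2) = 1 / (c * x + d)\<^sup>2"
        using False j by (simp add: power_mult_distrib)
      from arg_cong[OF this, of ennreal] have "ennreal (c\<^sup>2) * ennreal (1 / (c * (c * x + d))\<^sup>2) = ennreal (1 / (c * x + d)\<^sup>2)"
        by (simp add: ennreal_mult[symmetric])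
      ultimately show ?thesis
        unfolding G_def y by (metis mult.left_commute)
    qed
  qed
  finally show ?thesis by simp
qed

lemma nn_integral_triple:
  fixes f :: "real \<times> real \<times> real \<Rightarrow> ennreal"
  assumes f[measurable]: "f \<in> borel_measurable borel"
  shows "(\<integral>\<^sup>+\<omega>. f \<omega> \<partial>lborel) = (\<integral>\<^sup>+x. \<integral>\<^sup>+u. \<integral>\<^sup>+s. f (x, u, s) \<partial>lborel \<partial>lborel \<partial>lborel)"
proof -
  have f1: "f \<in> borel_measurable (lborel \<Otimes>\<^sub>M (lborel :: (real \<times> real) measure))" using f by (simp add: lborel_prod)
  have f2: "(\<lambda>p. f (x, p)) \<in> borel_measurable (lborel \<Otimes>\<^sub>M lborel)" for x
    using f by (simp add: lborel_prod)
  have "(\<integral>\<^sup>+\<omega>. f \<omega> \<partial>lborel) = (\<integral>\<^sup>+x. \<integral>\<^sup>+p. f (x, p) \<partial>lborel \<partial>lborel)"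
    unfolding lborel_prod[symmetric, where 'a = real and 'b = "real \<times> real"]
    by (rule lborel.nn_integral_fst[OF f1, symmetric])
  also have "\<dots> = (\<integral>\<^sup>+x. \<integral>\<^sup>+u. \<integral>\<^sup>+s. f (x, u, s) \<partial>lborel \<partial>lborel \<partial>lborel)"
    unfolding lborel_prod[symmetric, where 'a = real and 'b = real]
    by (intro nn_integral_cong lborel.nn_integral_fst[OF f2, symmetric])
  finally show ?thesis .
qed

lemma moebius_coords_measurable[measurable]: "moebius_coords A \<in> borel_measurable borel"
proof -
  have "(\<lambda>\<omega>. ((A$1$1 * fst \<omega> + A$1$2) / (A$2$1 * fst \<omega> + A$2$2),
      (A$2$1 * fst \<omega> + A$2$2)\<^sup>2 * fst (snd \<omega>) - A$2$1 * (A$2$1 * fst \<omega> + A$2$2),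
      snd (snd \<omega>) + 2 * ln \<bar>A$2$1 * fst \<omega> + A$2$2\<bar>)) \<in> borel_measurable (borel \<Otimes>\<^sub>M (borel \<Otimes>\<^sub>M borel))"
    by measurable
  then show ?thesis
    unfolding moebius_coords_def[abs_def] case_prod_beta' borel_prod .
qed

lemma linear_form_null:
  fixes c d :: real
  assumes "c \<noteq> 0 \<or> d \<noteq> 0"
  shows "AE x in lborel. c * x + d \<noteq> 0"
proof (cases "c = 0")
  case False
  then have "c * x + d \<noteq> 0" if "x \<noteq> - d / c" for x using that by (auto simp: field_simps)
  then show ?thesis using AE_lborel_singleton[of "- d / c"] by (auto elim: AE_mp)
qed (use assms in simp)

lemma nn_integral_moebius_coords:
  fixes f :: "real \<times> real \<times> real \<Rightarrow> ennreal"
  assumes det: "det A = (1::real)" and f[measurable]: "f \<in> borel_measurable borel"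
  shows "(\<integral>\<^sup>+\<omega>. f (moebius_coords A \<omega>) \<partial>lborel) = (\<integral>\<^sup>+\<omega>. f \<omega> \<partial>lborel)"
proof -
  define a b c d where "a = A$1$1" and "b = A$1$2" and "c = A$2$1" and "d = A$2$2"
  have D: "a * d - b * c = 1" using det by (simp add: det_2 a_def b_def c_def d_def)
  define K where "K x = (\<integral>\<^sup>+u. \<integral>\<^sup>+s. f (x, u, s) \<partial>lborel \<partial>lborel)" for x
  have f'[measurable]: "f \<in> borel_measurable (borel \<Otimes>\<^sub>M (borel \<Otimes>\<^sub>M borel))"
    using f by (simp add: borel_prod)
  have [measurable]: "K \<in> borel_measurable borel" unfolding K_def by measurable
  have "(\<integral>\<^sup>+\<omega>. f (moebius_coords A \<omega>) \<partial>lborel) = (\<integral>\<^sup>+x. \<integral>\<^sup>+u. \<integral>\<^sup>+s. f (moebius_coords A (x, u, s)) \<partial>lborel \<partial>lborel \<partial>lborel)"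
    by (rule nn_integral_triple) measurable
  also have "\<dots> = (\<integral>\<^sup>+x. K ((a * x + b) / (c * x + d)) * ennreal (1 / (c * x + d)\<^sup>2) \<partial>lborel)"
  proof (rule nn_integral_cong_AE)
    have "c \<noteq> 0 \<or> d \<noteq> 0" using D by auto
    from linear_form_null[OF this]
    show "AE x in lborel. (\<integral>\<^sup>+u. \<integral>\<^sup>+s. f (moebius_coords A (x, u, s)) \<partial>lborel \<partial>lborel)
        = K ((a * x + b) / (c * x + d)) * ennreal (1 / (c * x + d)\<^sup>2)"
    proof eventually_elim
      case (elim x)
      define j where "j = c * x + d"
      have j: "j \<noteq> 0" using elim by (simp add: j_def)
      define y where "y = (a * x + b) / j"
      define H where "H u = (\<integral>\<^sup>+s. f (y, u, s) \<partial>lborel)" for u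
      have [measurable]: "H \<in> borel_measurable borel" unfolding H_def by measurable
      have "(\<integral>\<^sup>+s. f (moebius_coords A (x, u, s)) \<partial>lborel) = H (- c * j + j\<^sup>2 * u)" for u
      proof -
        have "H (- c * j + j\<^sup>2 * u) = (\<integral>\<^sup>+s. f (y, - c * j + j\<^sup>2 * u, 2 * ln \<bar>j\<bar> + 1 * s) \<partial>lborel)"
          unfolding H_def by (subst nn_integral_real_affine[where c = 1 and t = "2 * ln \<bar>j\<bar>"]) auto
        also have "\<dots> = (\<integral>\<^sup>+s. f (moebius_coords A (x, u, s)) \<partial>lborel)"
          by (simp add: moebius_coords_def a_def b_def c_def d_def j_def y_def add.commute)
        finally show ?thesis by simp
      qed
      then have "(\<integral>\<^sup>+u. \<integral>\<^sup>+s. f (moebius_coords A (x, u, s)) \<partial>lborel \<partial>lborel) = (\<integral>\<^sup>+u. H (- c * j + j\<^sup>2 * u) \<partial>lborel)"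
        by simp
      also have "\<dots> = (\<integral>\<^sup>+u. H u \<partial>lborel) * ennreal (1 / j\<^sup>2)"
      proof -
        have "(\<integral>\<^sup>+u. H u \<partial>lborel) = ennreal (j\<^sup>2) * (\<integral>\<^sup>+u. H (- c * j + j\<^sup>2 * u) \<partial>lborel)"
          using nn_integral_real_affine[of H "j\<^sup>2" "- c * j"] j by simp
        then have "(\<integral>\<^sup>+u. H u \<partial>lborel) * ennreal (1 / j\<^sup>2) = (ennreal (j\<^sup>2) * ennreal (1 / j\<^sup>2)) * (\<integral>\<^sup>+u. H (- c * j + j\<^sup>2 * u) \<partial>lborel)"
          by (simp add: ac_simps)
        also have "ennreal (j\<^sup>2) * ennreal (1 / j\<^sup>2) = 1"
          using j by (simp add: ennreal_mult[symmetric])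
        finally show ?thesis by simp
      qed
      finally show ?case by (simp add: K_def H_def y_def j_def)
    qed
  qed
  also have "\<dots> = (\<integral>\<^sup>+x. K x \<partial>lborel)" by (rule nn_integral_moebius[OF D]) measurable
  also have "\<dots> = (\<integral>\<^sup>+\<omega>. f \<omega> \<partial>lborel)" unfolding K_def by (rule nn_integral_triple[symmetric]) measurable
  finally show ?thesis .
qed

lemma lborel_complex: "distr (lborel \<Otimes>\<^sub>M lborel) borel (\<lambda>p. Complex (fst p) (snd p)) = (lborel :: complex measure)"
proof (rule lborel_eqI[symmetric])
  have m[measurable]: "(\<lambda>p. Complex (fst p) (snd p)) \<in> borel_measurable (lborel \<Otimes>\<^sub>M lborel)"
    unfolding Complex_eq by measurable
  fix l u :: complex assume lu: "\<And>b. b \<in> Basis \<Longrightarrow> l \<bullet> b \<le> u \<bullet> b"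
  have r: "Re l \<le> Re u" using lu[of 1] by (simp add: Basis_complex_def)
  have i: "Im l \<le> Im u" using lu[of \<i>] by (simp add: Basis_complex_def)
  have "(\<lambda>p. Complex (fst p) (snd p)) -` box l u \<inter> space (lborel \<Otimes>\<^sub>M lborel) = {Re l <..< Re u} \<times> {Im l <..< Im u}"
    by (auto simp: box_def Basis_complex_def space_pair_measure)
  then have "emeasure (distr (lborel \<Otimes>\<^sub>M lborel) borel (\<lambda>p. Complex (fst p) (snd p))) (box l u)
     = emeasure (lborel \<Otimes>\<^sub>M lborel) ({Re l <..< Re u} \<times> {Im l <..< Im u})"
    by (subst emeasure_distr[OF m]) auto
  also have "\<dots> = ennreal ((Re u - Re l) * (Im u - Im l))"
    using r i by (subst lborel.emeasure_pair_measure_Times) (auto simp: ennreal_mult)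
  also have "\<dots> = ennreal (\<Prod>b\<in>Basis. (u - l) \<bullet> b)"
    by (simp add: Basis_complex_def)
  finally show "emeasure (distr (lborel \<Otimes>\<^sub>M lborel) borel (\<lambda>p. Complex (fst p) (snd p))) (box l u) = ennreal (\<Prod>b\<in>Basis. (u - l) \<bullet> b)" .
qed simp

lemma uhp_borel[measurable]: "uhp \<in> sets borel"
  unfolding uhp_def by measurable

lemma nn_integral_hyp_area:
  fixes F :: "complex \<Rightarrow> ennreal"
  assumes F[measurable]: "F \<in> borel_measurable borel"
  shows "(\<integral>\<^sup>+z. F z \<partial>hyp_area) = (\<integral>\<^sup>+q. (\<integral>\<^sup>+p. F (Complex p q) \<partial>lborel) * ennreal (1 / q\<^sup>2) * indicator {0<..} q \<partial>lborel)"
proof -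
  have m[measurable]: "(\<lambda>p. Complex (fst p) (snd p)) \<in> borel_measurable (lborel \<Otimes>\<^sub>M lborel)"
    unfolding Complex_eq by measurable
  have Fm[measurable]: "F \<in> borel_measurable (restrict_space lborel uhp)"
    by (rule measurable_restrict_space1) simp
  have "(\<integral>\<^sup>+z. F z \<partial>hyp_area) = (\<integral>\<^sup>+z. ennreal (1 / (Im z)\<^sup>2) * F z \<partial>restrict_space lborel uhp)"
    unfolding hyp_area_def by (rule nn_integral_density[OF measurable_restrict_space1]) measurable
  also have "\<dots> = (\<integral>\<^sup>+z. ennreal (1 / (Im z)\<^sup>2) * F z * indicator uhp z \<partial>lborel)"
    by (rule nn_integral_restrict_space) simp
  also have "\<dots> = (\<integral>\<^sup>+p. ennreal (1 / (snd p)\<^sup>2) * F (Complex (fst p) (snd p)) * indicator uhp (Complex (fst p) (snd p)) \<partial>(lborel \<Otimes>\<^sub>M lborel))"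
    by (subst lborel_complex[symmetric], subst nn_integral_distr[OF m]) auto
  also have "\<dots> = (\<integral>\<^sup>+q. \<integral>\<^sup>+p. ennreal (1 / q\<^sup>2) * F (Complex p q) * indicator uhp (Complex p q) \<partial>lborel \<partial>lborel)"
    by (subst lborel_pair.nn_integral_snd[symmetric]) auto
  also have "\<dots> = (\<integral>\<^sup>+q. \<integral>\<^sup>+p. (ennreal (1 / q\<^sup>2) * indicator {0<..} q) * F (Complex p q) \<partial>lborel \<partial>lborel)"
    by (intro nn_integral_cong) (auto simp: uhp_def indicator_def)
  also have "\<dots> = (\<integral>\<^sup>+q. (\<integral>\<^sup>+p. F (Complex p q) \<partial>lborel) * ennreal (1 / q\<^sup>2) * indicator {0<..} q \<partial>lborel)"
  proof (rule nn_integral_cong)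
    fix q :: real
    have [measurable]: "(\<lambda>p. F (Complex p q)) \<in> borel_measurable borel"
    proof -
      have "(\<lambda>p. Complex p q) \<in> borel_measurable borel" unfolding Complex_eq by measurable
      then show ?thesis by (rule measurable_compose) simp
    qed
    show "(\<integral>\<^sup>+p. (ennreal (1 / q\<^sup>2) * indicator {0<..} q) * F (Complex p q) \<partial>lborel) = (\<integral>\<^sup>+p. F (Complex p q) \<partial>lborel) * ennreal (1 / q\<^sup>2) * indicator {0<..} q"
      by (subst nn_integral_cmult) (auto simp: ac_simps)
  qed
  finally show ?thesis .
qed

lemma sigma_finite_hyp_area: "sigma_finite_measure hyp_area"
proof -
  interpret r: sigma_finite_measure "restrict_space lborel uhp"
    by (rule sigma_finite_measure_restrict_space[OF sigma_finite_lborel]) simp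
  show ?thesis unfolding hyp_area_def
    by (subst r.sigma_finite_iff_density_finite) (auto intro!: measurable_restrict_space1)
qed

text \<open>Lebesgue measure in the coordinates \<open>(x, u, s)\<close> is hyperbolic area times \<open>dm / (1 + m\<^sup>2)\<close>, which is
  half of the arc length of the direction. It therefore has the same null sets as the product of
  hyperbolic area and arc length.\<close>

lemma nn_integral_vec_coords:
  fixes f :: "real \<times> real \<times> real \<Rightarrow> ennreal"
  assumes f[measurable]: "f \<in> borel_measurable borel"
  shows "(\<integral>\<^sup>+\<omega>. f \<omega> \<partial>lborel) = (\<integral>\<^sup>+z. (\<integral>\<^sup>+m. ennreal (1 / (1 + m\<^sup>2)) * f (vec_coords z m) \<partial>lborel) \<partial>hyp_area)"
proof -
  have f'[measurable]: "f \<in> borel_measurable (borel \<Otimes>\<^sub>M (borel \<Otimes>\<^sub>M borel))"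
    using f by (simp add: borel_prod)
  have pm: "0 < 1 + m\<^sup>2" for m :: real by (simp add: add_pos_nonneg)
  have "(\<integral>\<^sup>+\<omega>. f \<omega> \<partial>lborel) = (\<integral>\<^sup>+x. \<integral>\<^sup>+u. \<integral>\<^sup>+s. f (x, u, s) \<partial>lborel \<partial>lborel \<partial>lborel)"
    by (rule nn_integral_triple) measurable
  also have "\<dots> = (\<integral>\<^sup>+x. \<integral>\<^sup>+s. \<integral>\<^sup>+u. f (x, u, s) \<partial>lborel \<partial>lborel \<partial>lborel)"
    by (rule nn_integral_cong, rule lborel_pair.Fubini') measurable
  also have "\<dots> = (\<integral>\<^sup>+s. \<integral>\<^sup>+x. \<integral>\<^sup>+u. f (x, u, s) \<partial>lborel \<partial>lborel \<partial>lborel)"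
    by (intro lborel_pair.Fubini') measurable
  also have "\<dots> = (\<integral>\<^sup>+s. \<integral>\<^sup>+x. \<integral>\<^sup>+m. ennreal (exp s) * f (x, m * exp s, s) \<partial>lborel \<partial>lborel \<partial>lborel)"
  proof (rule nn_integral_cong, rule nn_integral_cong)
    fix s x :: real
    show "(\<integral>\<^sup>+u. f (x, u, s) \<partial>lborel) = (\<integral>\<^sup>+m. ennreal (exp s) * f (x, m * exp s, s) \<partial>lborel)"
      by (subst nn_integral_real_affine[where c = "exp s" and t = 0])
         (auto simp: nn_integral_cmult mult.commute)
  qed
  also have "\<dots> = (\<integral>\<^sup>+s. \<integral>\<^sup>+m. \<integral>\<^sup>+x. ennreal (exp s) * f (x, m * exp s, s) \<partial>lborel \<partial>lborel \<partial>lborel)"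
    by (rule nn_integral_cong, rule lborel_pair.Fubini') measurable
  also have "\<dots> = (\<integral>\<^sup>+m. \<integral>\<^sup>+s. \<integral>\<^sup>+x. ennreal (exp s) * f (x, m * exp s, s) \<partial>lborel \<partial>lborel \<partial>lborel)"
    by (intro lborel_pair.Fubini') measurable
  also have "\<dots> = (\<integral>\<^sup>+m. \<integral>\<^sup>+q. (\<integral>\<^sup>+p. ennreal (1 / (1 + m\<^sup>2)) * f (vec_coords (Complex p q) m) \<partial>lborel) * ennreal (1 / q\<^sup>2) * indicator {0<..} q \<partial>lborel \<partial>lborel)"
  proof (rule nn_integral_cong)
    fix m :: real
    define k where "k = 1 + m\<^sup>2"
    have k: "k > 0" using pm by (simp add: k_def)
    define H where "H q = (\<integral>\<^sup>+p. ennreal (1 / k) * f (p + m * q, m / (q * k), - ln (q * k)) \<partial>lborel)" for q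
    have [measurable]: "H \<in> borel_measurable borel" unfolding H_def by measurable
    define R where "R s = (\<integral>\<^sup>+x. ennreal (exp s) * f (x, m * exp s, s) \<partial>lborel)" for s
    have [measurable]: "R \<in> borel_measurable borel" unfolding R_def by measurable
    have "(\<integral>\<^sup>+s. R s \<partial>lborel) = (\<integral>\<^sup>+r. R (- ln k + (- 1) * r) \<partial>lborel)"
      by (subst nn_integral_real_affine[where c = "-1" and t = "- ln k"]) auto
    also have "\<dots> = (\<integral>\<^sup>+r. ennreal (exp (- r)) * H (exp r) \<partial>lborel)"
    proof (rule nn_integral_cong)
      fix r :: real
      let ?s = "- ln k + (- 1) * r"
      have e: "exp ?s = exp (- r) * (1 / k)" using k by (simp add: exp_diff exp_minus field_simps)
      have l: "- ln (exp r * k) = ?s" using k by (simp add: ln_mult)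
      have e2: "m / (exp r * k) = m * exp ?s" unfolding e by (simp add: exp_minus field_simps)
      have E: "ennreal (exp ?s) = ennreal (exp (- r)) * ennreal (1 / k)"
        using k unfolding e by (intro ennreal_mult) auto
      have "R ?s = (\<integral>\<^sup>+p. ennreal (exp ?s) * f (m * exp r + 1 * p, m * exp ?s, ?s) \<partial>lborel)"
        unfolding R_def by (subst nn_integral_real_affine[where c = 1 and t = "m * exp r"]) auto
      also have "\<dots> = (\<integral>\<^sup>+p. ennreal (exp (- r)) * (ennreal (1 / k) * f (p + m * exp r, m / (exp r * k), - ln (exp r * k))) \<partial>lborel)"
        unfolding l e2 by (simp only: E mult.assoc mult_1_left add.commute)
      also have "\<dots> = ennreal (exp (- r)) * H (exp r)"
        unfolding H_def by (rule nn_integral_cmult) measurable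
      finally show "R ?s = ennreal (exp (- r)) * H (exp r)" .
    qed
    also have "\<dots> = (\<integral>\<^sup>+q. H q * ennreal (1 / q\<^sup>2) * indicator {0<..} q \<partial>lborel)"
      by (rule nn_integral_exp) measurable
    finally show "(\<integral>\<^sup>+s. \<integral>\<^sup>+x. ennreal (exp s) * f (x, m * exp s, s) \<partial>lborel \<partial>lborel)
       = (\<integral>\<^sup>+q. (\<integral>\<^sup>+p. ennreal (1 / (1 + m\<^sup>2)) * f (vec_coords (Complex p q) m) \<partial>lborel) * ennreal (1 / q\<^sup>2) * indicator {0<..} q \<partial>lborel)"
      by (simp add: R_def H_def k_def vec_coords_def)
  qed
  also have "\<dots> = (\<integral>\<^sup>+m. \<integral>\<^sup>+z. ennreal (1 / (1 + m\<^sup>2)) * f (vec_coords z m) \<partial>hyp_area \<partial>lborel)"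
  proof (rule nn_integral_cong)
    fix m :: real
    show "(\<integral>\<^sup>+q. (\<integral>\<^sup>+p. ennreal (1 / (1 + m\<^sup>2)) * f (vec_coords (Complex p q) m) \<partial>lborel) * ennreal (1 / q\<^sup>2) * indicator {0<..} q \<partial>lborel)
      = (\<integral>\<^sup>+z. ennreal (1 / (1 + m\<^sup>2)) * f (vec_coords z m) \<partial>hyp_area)"
      unfolding vec_coords_def by (rule nn_integral_hyp_area[symmetric]) measurable
  qed
  also have "\<dots> = (\<integral>\<^sup>+z. (\<integral>\<^sup>+m. ennreal (1 / (1 + m\<^sup>2)) * f (vec_coords z m) \<partial>lborel) \<partial>hyp_area)"
  proof -
    from sigma_finite_hyp_area
    interpret h: pair_sigma_finite hyp_area "lborel :: real measure"
      unfolding pair_sigma_finite_def by (simp add: sigma_finite_lborel)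
    have id: "(\<lambda>z. z) \<in> hyp_area \<rightarrow>\<^sub>M borel" unfolding hyp_area_def
      by (simp add: measurable_restrict_space1)
    have "(\<lambda>p. ennreal (1 / (1 + (snd p)\<^sup>2)) * f (vec_coords (fst p) (snd p))) \<in> borel_measurable (borel \<Otimes>\<^sub>M lborel)"
      unfolding vec_coords_def by measurable
    moreover have "(\<lambda>p. (fst p, snd p)) \<in> hyp_area \<Otimes>\<^sub>M lborel \<rightarrow>\<^sub>M borel \<Otimes>\<^sub>M lborel"
      by (intro measurable_Pair measurable_compose[OF measurable_fst id] measurable_snd)
    ultimately have "(\<lambda>p. ennreal (1 / (1 + (snd p)\<^sup>2)) * f (vec_coords (fst p) (snd p))) \<in> borel_measurable (hyp_area \<Otimes>\<^sub>M lborel)"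
      by (rule measurable_compose[rotated, THEN measurable_cong[THEN iffD1, rotated]]) auto
    then show ?thesis
      by (intro h.Fubini') (simp add: case_prod_beta')
  qed
  finally show ?thesis .
qed

section \<open>Classification of unit speed geodesics\<close>

lemma cosh_hdist:
  assumes "z \<in> uhp" "w \<in> uhp"
  shows "cosh (hdist z w) = 1 + (cmod (z - w))\<^sup>2 / (2 * Im z * Im w)"
  using assms unfolding hdist_def by (intro cosh_arcosh_real) (auto simp: uhp_def)

lemma hdist_nonneg: "z \<in> uhp \<Longrightarrow> w \<in> uhp \<Longrightarrow> 0 \<le> hdist z w"
  unfolding hdist_def by (rule arcosh_nonneg_real) (auto simp: uhp_def)

lemma unit_speed_in_uhp: "unit_speed_geodesic \<alpha> \<Longrightarrow> \<alpha> t \<in> uhp"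
  by (auto simp: unit_speed_geodesic_def)

lemma unit_speed_cosh:
  assumes "unit_speed_geodesic \<alpha>"
  shows "(Re (\<alpha> s) - Re (\<alpha> t))\<^sup>2 + (Im (\<alpha> s))\<^sup>2 + (Im (\<alpha> t))\<^sup>2 = 2 * Im (\<alpha> s) * Im (\<alpha> t) * cosh (s - t)"
proof -
  have u: "Im (\<alpha> s) > 0" "Im (\<alpha> t) > 0" using unit_speed_in_uhp[OF assms] by (auto simp: uhp_def)
  have "cosh (s - t) = cosh (hdist (\<alpha> s) (\<alpha> t))"
    using assms by (simp add: unit_speed_geodesic_def cosh_real_abs)
  also have "\<dots> = 1 + (cmod (\<alpha> s - \<alpha> t))\<^sup>2 / (2 * Im (\<alpha> s) * Im (\<alpha> t))"
    by (intro cosh_hdist unit_speed_in_uhp assms)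
  finally have "2 * Im (\<alpha> s) * Im (\<alpha> t) * cosh (s - t) = 2 * Im (\<alpha> s) * Im (\<alpha> t) + (cmod (\<alpha> s - \<alpha> t))\<^sup>2"
    using u by (simp add: field_simps)
  moreover have "(cmod (\<alpha> s - \<alpha> t))\<^sup>2 = (Re (\<alpha> s) - Re (\<alpha> t))\<^sup>2 + ((Im (\<alpha> s))\<^sup>2 + (Im (\<alpha> t))\<^sup>2 - 2 * Im (\<alpha> s) * Im (\<alpha> t))"
    by (simp only: cmod_power2 minus_complex.sel power2_diff[of "Im (\<alpha> s)"])
  ultimately show ?thesis by linarith
qed

text \<open>Two points determine a unit speed geodesic: the distances of \<open>\<beta> t\<close> to two points of the vertical
  geodesic give two equations whose only solution is the point of the vertical geodesic.\<close>

lemma vertical_geodesic: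
  assumes us: "unit_speed_geodesic \<beta>" and ne: "t0 \<noteq> t1"
    and b0: "\<beta> t0 = Complex u (exp (s + t0))" and b1: "\<beta> t1 = Complex u (exp (s + t1))"
  shows "\<beta> t = Complex u (exp (s + t))"
proof -
  define r where "r = Im (\<beta> t)"
  define P where "P = (Re (\<beta> t) - u)\<^sup>2 + r\<^sup>2"
  have r: "r > 0" using unit_speed_in_uhp[OF us] by (auto simp: uhp_def r_def)
  have k: "P + (exp (s + t'))\<^sup>2 = r * exp s * (exp t + exp (2 * t' - t))" if "\<beta> t' = Complex u (exp (s + t'))" for t'
  proof -
    have "2 * exp (s + t') * cosh (t - t') = exp s * (exp t + exp (2 * t' - t))"
    proof -
      have "exp (2 * t') = exp t' * exp t'" by (simp flip: exp_add)
      then show ?thesis by (simp add: cosh_def exp_add exp_diff exp_minus field_simps)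
    qed
    then show ?thesis
      using unit_speed_cosh[OF us, of t t'] that by (simp add: P_def r_def mult.assoc)
  qed
  have e: "(exp (s + t'))\<^sup>2 = (exp s * exp (2 * t')) * exp s" for t'
  proof -
    have "exp (2 * t') = exp t' * exp t'" by (simp flip: exp_add)
    then show ?thesis by (simp add: exp_add power2_eq_square)
  qed
  have "(exp s * (exp (2 * t1) - exp (2 * t0))) * exp s = (exp s * (exp (2 * t1) - exp (2 * t0))) * (r * exp (- t))"
  proof -
    have x: "exp (2 * t' - t) = exp (2 * t') * exp (- t)" for t' by (simp flip: exp_add)
    have alg: "E * (B - A) * E = E * (B - A) * (r * W)"
      if "P + E * A * E = r * E * (X + A * W)" "P + E * B * E = r * E * (X + B * W)" for E A B X W :: real
    proof -
      have "E * (B - A) * E - E * (B - A) * (r * W)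
          = (P + E * B * E - r * E * (X + B * W)) - (P + E * A * E - r * E * (X + A * W))"
        by (simp add: algebra_simps)
      then show ?thesis using that by simp
    qed
    show ?thesis using alg k[OF b0] k[OF b1] unfolding e x by blast
  qed
  moreover have "exp s * (exp (2 * t1) - exp (2 * t0)) \<noteq> 0" using ne by simp
  ultimately have "exp s = r * exp (- t)" by (metis mult_left_cancel)
  then have req: "r = exp (s + t)" by (simp add: exp_add exp_minus field_simps)
  have "P = r * r"
  proof -
    have "exp (2 * t0 - t) * exp t = exp t0 * exp t0" by (simp flip: exp_add)
    moreover have "r * exp s * (exp t + exp (2 * t0 - t)) = r * r + exp s * exp s * (exp (2 * t0 - t) * exp t)"
      unfolding req exp_add by (simp add: algebra_simps)
    ultimately show ?thesis using k[OF b0] by (simp add: exp_add power2_eq_square)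
  qed
  then have "Re (\<beta> t) = u" by (simp add: P_def power2_eq_square)
  then show ?thesis using req by (simp add: complex_eq_iff r_def)
qed

lemma inversion_dist:
  assumes z: "z \<in> uhp" and w: "w \<in> uhp"
  shows "- 1 / (z - complex_of_real x) \<in> uhp"
    "hdist (- 1 / (z - complex_of_real x)) (- 1 / (w - complex_of_real x)) = hdist z w"
proof -
  have im: "Im (- 1 / (v - complex_of_real x)) = Im v / (cmod (v - complex_of_real x))\<^sup>2" for v
    unfolding cmod_power2 by (simp add: Im_divide)
  have nz: "v - complex_of_real x \<noteq> 0" if "v \<in> uhp" for v using that by (auto simp: uhp_def complex_eq_iff)
  show "- 1 / (z - complex_of_real x) \<in> uhp"
    using z nz[OF z] unfolding uhp_def mem_Collect_eq im by simp
  have d: "- 1 / (z - complex_of_real x) - (- 1 / (w - complex_of_real x)) = (z - w) / ((z - complex_of_real x) * (w - complex_of_real x))"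
    using nz[OF z] nz[OF w] by (simp add: field_simps)
  show "hdist (- 1 / (z - complex_of_real x)) (- 1 / (w - complex_of_real x)) = hdist z w"
  proof -
    have alg: "(N / (A * B))\<^sup>2 / (2 * (p / A\<^sup>2) * (q / B\<^sup>2)) = N\<^sup>2 / (2 * p * q)" if "A \<noteq> 0" "B \<noteq> 0" for N A B p q :: real
      using that by (simp add: power_divide power_mult_distrib)
    show ?thesis
      unfolding hdist_def d im norm_divide norm_mult
      by (subst alg) (use nz[OF z] nz[OF w] in simp_all)
  qed
qed

lemma unit_speed_inversion:
  assumes "unit_speed_geodesic \<alpha>"
  shows "unit_speed_geodesic (\<lambda>t. - 1 / (\<alpha> t - complex_of_real x))"
  unfolding unit_speed_geodesic_def
proof (intro conjI allI)
  show "range (\<lambda>t. - 1 / (\<alpha> t - complex_of_real x)) \<subseteq> uhp"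
    using inversion_dist(1)[OF unit_speed_in_uhp[OF assms] unit_speed_in_uhp[OF assms]] by blast
  fix s t
  show "hdist (- 1 / (\<alpha> s - complex_of_real x)) (- 1 / (\<alpha> t - complex_of_real x)) = \<bar>s - t\<bar>"
    unfolding inversion_dist(2)[OF unit_speed_in_uhp[OF assms] unit_speed_in_uhp[OF assms]]
    using assms by (simp add: unit_speed_geodesic_def)
qed

lemma unit_speed_reverse:
  assumes "unit_speed_geodesic \<alpha>"
  shows "unit_speed_geodesic (\<lambda>t. \<alpha> (- t))"
  using assms by (auto simp: unit_speed_geodesic_def)

lemma Complex_nz: "Complex u (exp v) \<noteq> 0" by (simp add: complex_eq_iff)

lemma geo_inversion: "- 1 / (geo (x, u, s) t - complex_of_real x) = Complex u (exp (s + t))"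
  using Complex_nz by (simp add: geo_def)

text \<open>The isometry \<open>z \<mapsto> - 1 / (z - x)\<close> makes \<open>geo \<omega>\<close> vertical.\<close>

lemma geo_determined:
  assumes us: "unit_speed_geodesic \<beta>" and ne: "t0 \<noteq> t1"
    and "\<beta> t0 = geo \<omega> t0" "\<beta> t1 = geo \<omega> t1"
  shows "\<beta> = geo \<omega>"
proof
  fix t
  obtain x u s where w: "\<omega> = (x, u, s)" by (cases \<omega>) auto
  have "- 1 / (\<beta> t - complex_of_real x) = Complex u (exp (s + t))"
    by (rule vertical_geodesic[OF unit_speed_inversion[OF us] ne])
       (simp_all only: assms(3,4) w geo_inversion)
  moreover have "\<beta> t - complex_of_real x \<noteq> 0"
    using unit_speed_in_uhp[OF us, of t] by (auto simp: uhp_def complex_eq_iff)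
  ultimately have "\<beta> t - complex_of_real x = - 1 / Complex u (exp (s + t))"
    using Complex_nz[of u "s + t"] by (simp add: field_simps)
  then show "\<beta> t = geo \<omega> t" by (simp add: w geo_def algebra_simps)
qed

lemma geo_reverse:
  assumes "u \<noteq> 0"
  shows "geo (x - 1 / u, - u, 2 * ln \<bar>u\<bar> - s) t = geo (x, u, s) (- t)"
proof -
  define v where "v = exp (s - t)"
  have v: "v > 0" by (simp add: v_def)
  have e: "exp (2 * ln \<bar>u\<bar> - s + t) = u\<^sup>2 / v"
    using assms by (simp add: v_def exp_diff exp_add exp_double exp_minus field_simps power2_eq_square)
  have n1: "Complex u v \<noteq> 0" "Complex (- u) (u\<^sup>2 / v) \<noteq> 0" using v assms by (auto simp: complex_eq_iff)
  have "1 / Complex u v - (of_real (1 / u) + 1 / Complex (- u) (u\<^sup>2 / v)) = 0"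
  proof -
    have "Complex (- u) (u\<^sup>2 / v) = \<i> * of_real (u / v) * Complex u v"
      using v by (simp add: complex_eq_iff power2_eq_square)
    then have "1 / Complex u v - (of_real (1 / u) + 1 / Complex (- u) (u\<^sup>2 / v))
      = 1 / Complex u v - (1 / of_real u + 1 / (\<i> * of_real (u / v) * Complex u v))" by simp
    also have "\<dots> = (of_real u * \<i> - (\<i> * Complex u v + of_real v)) / (of_real u * \<i> * Complex u v)"
      using assms v n1 by (simp add: field_simps)
    also have "of_real u * \<i> - (\<i> * Complex u v + of_real v) = 0" by (simp add: complex_eq_iff)
    finally show ?thesis by simp
  qed
  then show ?thesis unfolding geo_def prod.case e by (simp add: v_def[symmetric] algebra_simps)
qed

text \<open>If two points of \<open>\<alpha>\<close> have the same real part, they lie on a vertical geodesic traversed upwards or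
  downwards. Otherwise \<open>\<alpha>\<close> lies on a half circle, and the inversion at an end point of this half
  circle brings it into vertical position. A geodesic is then \<open>geo \<omega>\<close> unless it runs upwards to
  infinity.\<close>

lemma geodesic_classification:
  assumes us: "unit_speed_geodesic \<alpha>"
  shows "(\<exists>\<omega>. \<alpha> = geo \<omega>) \<or> (\<exists>y s. \<alpha> = (\<lambda>t. Complex y (exp (s + t))))"
proof -
  have vert: "(\<exists>u s. \<beta> = (\<lambda>t. Complex u (exp (s + t)))) \<or> (\<exists>u s. \<beta> = (\<lambda>t. Complex u (exp (s - t))))"
    if us: "unit_speed_geodesic \<beta>" and re: "Re (\<beta> 0) = Re (\<beta> 1)" for \<beta>
  proof -
    define u q0 q1 where "u = Re (\<beta> 0)" and "q0 = Im (\<beta> 0)" and "q1 = Im (\<beta> 1)"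
    have q: "q0 > 0" "q1 > 0" using unit_speed_in_uhp[OF us] by (auto simp: uhp_def q0_def q1_def)
    have "q1\<^sup>2 + q0\<^sup>2 = 2 * q1 * q0 * cosh 1"
      using unit_speed_cosh[OF us, of 1 0] re by (simp add: q0_def q1_def)
    then have "(q1 - q0 * exp 1) * (q1 - q0 * exp (- 1)) = 0"
      by (simp add: cosh_def exp_minus field_simps power2_eq_square)
    then consider "q1 = q0 * exp 1" | "q1 = q0 * exp (- 1)" by auto
    then show ?thesis
    proof cases
      case 1
      have "\<beta> t = Complex u (exp (ln q0 + t))" for t
        by (rule vertical_geodesic[OF us, of 0 1])
           (use 1 q re in \<open>auto simp: u_def q0_def q1_def complex_eq_iff exp_add\<close>)
      then show ?thesis by auto
    next
      case 2
      have "\<beta> (- t) = Complex u (exp (ln q0 + t))" for t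
        by (rule vertical_geodesic[OF unit_speed_reverse[OF us], of 0 "- 1"])
           (use 2 q re in \<open>auto simp: u_def q0_def q1_def complex_eq_iff exp_add exp_diff exp_minus field_simps\<close>)
      from this[of "- _"] have "\<beta> t = Complex u (exp (ln q0 - t))" for t by simp
      then have "\<beta> = (\<lambda>t. Complex u (exp (ln q0 - t)))" by blast
      then show ?thesis by blast
    qed
  qed
  show ?thesis
  proof (cases "Re (\<alpha> 0) = Re (\<alpha> 1)")
    case True
    from vert[OF us True] show ?thesis
    proof (elim disjE exE)
      fix u s assume "\<alpha> = (\<lambda>t. Complex u (exp (s - t)))"
      moreover have "geo (u, 0, - s) t = Complex u (exp (s - t))" for t
      proof -
        have "1 / Complex 0 v = Complex 0 (- (1 / v))" for v
          by (simp add: complex_eq_iff Re_divide Im_divide power2_eq_square)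
        moreover have "1 / exp (- s + t) = exp (s - t)"
          by (simp add: exp_minus[symmetric] inverse_eq_divide[symmetric])
        ultimately show ?thesis by (simp add: geo_def complex_eq_iff)
      qed
      ultimately have "\<alpha> = geo (u, 0, - s)" by auto
      then show ?thesis by blast
    qed auto
  next
    case False
    define z0 z1 where "z0 = \<alpha> 0" and "z1 = \<alpha> 1"
    have im: "Im z0 > 0" "Im z1 > 0" using unit_speed_in_uhp[OF us] by (auto simp: uhp_def z0_def z1_def)
    define c where "c = ((cmod z1)\<^sup>2 - (cmod z0)\<^sup>2) / (2 * (Re z1 - Re z0))"
    define R where "R = cmod (z0 - of_real c)"
    define x where "x = c + R"
    have ne: "Re z1 - Re z0 \<noteq> 0" using False by (simp add: z0_def z1_def)
    have R0: "R > 0" using im by (auto simp: R_def complex_eq_iff)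
    have sq0: "(Re z0 - c)\<^sup>2 + (Im z0)\<^sup>2 = R\<^sup>2" by (simp add: R_def cmod_power2)
    have cc: "2 * c * (Re z1 - Re z0) = (Re z1)\<^sup>2 + (Im z1)\<^sup>2 - ((Re z0)\<^sup>2 + (Im z0)\<^sup>2)"
    proof -
      have "2 * (N / (2 * d)) * d = N" if "d \<noteq> 0" for N d :: real using that by simp
      from this[OF ne] show ?thesis unfolding c_def cmod_power2 .
    qed
    have sq1: "(Re z1 - c)\<^sup>2 + (Im z1)\<^sup>2 = R\<^sup>2"
    proof -
      have "(Re z1 - c)\<^sup>2 + (Im z1)\<^sup>2 - R\<^sup>2 = ((Re z0 - c)\<^sup>2 + (Im z0)\<^sup>2 - R\<^sup>2)
          + ((Re z1)\<^sup>2 + (Im z1)\<^sup>2 - ((Re z0)\<^sup>2 + (Im z0)\<^sup>2) - 2 * c * (Re z1 - Re z0))"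
        by (simp add: power2_diff algebra_simps)
      then show ?thesis unfolding sq0 cc by simp
    qed
    have re: "Re (- 1 / (z - complex_of_real x)) = 1 / (2 * R)"
      if "(Re z - c)\<^sup>2 + (Im z)\<^sup>2 = R\<^sup>2" "Im z > 0" for z
    proof -
      have e: "(Re z - x)\<^sup>2 + (Im z)\<^sup>2 = 2 * R * (x - Re z)"
      proof -
        have "(Re z - x)\<^sup>2 + (Im z)\<^sup>2 - 2 * R * (x - Re z) = (Re z - c)\<^sup>2 + (Im z)\<^sup>2 - R\<^sup>2"
          unfolding x_def by (simp add: power2_eq_square algebra_simps)
        then show ?thesis unfolding that(1) by simp
      qed
      have p: "(Re z - x)\<^sup>2 + (Im z)\<^sup>2 > 0" using that(2) by (simp add: add_nonneg_pos)
      then have "x - Re z \<noteq> 0" using e by auto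
      have "Re (- 1 / (z - complex_of_real x)) = (x - Re z) / ((Re z - x)\<^sup>2 + (Im z)\<^sup>2)"
        by (simp add: Re_divide) (simp only: minus_divide_left minus_diff_eq)
      also have "\<dots> = 1 / (2 * R)" unfolding e using \<open>x - Re z \<noteq> 0\<close> R0 by simp
      finally show ?thesis .
    qed
    let ?\<beta> = "\<lambda>t. - 1 / (\<alpha> t - complex_of_real x)"
    have recover: "\<alpha> t = of_real x - 1 / ?\<beta> t" for t
      using unit_speed_in_uhp[OF us, of t] by (auto simp: uhp_def)
    have "Re (?\<beta> 0) = Re (?\<beta> 1)"
      using re[OF sq0 im(1)] re[OF sq1 im(2)] by (simp only: z0_def z1_def)
    from vert[OF unit_speed_inversion[OF us] this] show ?thesis
    proof (elim disjE exE)
      fix u s assume "?\<beta> = (\<lambda>t. Complex u (exp (s + t)))"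
      then have "\<alpha> t = geo (x, u, s) t" for t using recover[of t] by (simp add: geo_def fun_eq_iff)
      then show ?thesis by blast
    next
      fix u s assume b: "?\<beta> = (\<lambda>t. Complex u (exp (s - t)))"
      then have a: "\<alpha> t = geo (x, u, s) (- t)" for t using recover[of t] by (simp add: geo_def fun_eq_iff)
      have "u = 1 / (2 * R)" using re[OF sq0 im(1)] b by (simp add: fun_eq_iff z0_def complex_eq_iff)
      then have "u \<noteq> 0" using R0 by simp
      then have "\<alpha> = geo (x - 1 / u, - u, 2 * ln \<bar>u\<bar> - s)" using a geo_reverse[of u x s] by auto
      then show ?thesis by blast
    qed
  qed
qed

section \<open>End points, crossings of the distinguished ray, and depth\<close>

lemma Re_geo: "Re (geo (x, u, s) t) = x - u / (u\<^sup>2 + (exp (s + t))\<^sup>2)"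
  and Im_geo: "Im (geo (x, u, s) t) = exp (s + t) / (u\<^sup>2 + (exp (s + t))\<^sup>2)"
  by (simp_all add: geo_def Re_divide Im_divide)

lemma denom_pos: "0 < (u::real)\<^sup>2 + (exp v)\<^sup>2"
  by (simp add: add_nonneg_pos)

lemma geo_in_uhp: "geo \<omega> t \<in> uhp"
  using denom_pos by (cases \<omega>) (simp add: uhp_def Im_geo)

lemma geo_tendsto_top: "((geo (x, u, s)) \<longlongrightarrow> complex_of_real x) at_top"
proof -
  have "((\<lambda>t. norm (geo (x, u, s) t - complex_of_real x)) \<longlongrightarrow> 0) at_top"
  proof (rule tendsto_sandwich[OF _ _ tendsto_const])
    show "\<forall>\<^sub>F t in at_top. 0 \<le> norm (geo (x, u, s) t - complex_of_real x)" by simp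
    show "\<forall>\<^sub>F t in at_top. norm (geo (x, u, s) t - complex_of_real x) \<le> exp (- (s + t))"
    proof (rule always_eventually, rule allI)
      fix t
      have "exp (s + t) \<le> cmod (Complex u (exp (s + t)))"
        using abs_Im_le_cmod[of "Complex u (exp (s + t))"] by simp
      then have "1 / cmod (Complex u (exp (s + t))) \<le> 1 / exp (s + t)"
        by (intro divide_left_mono mult_pos_pos) (auto intro: less_le_trans[OF exp_gt_zero])
      moreover have "norm (geo (x, u, s) t - complex_of_real x) = 1 / cmod (Complex u (exp (s + t)))"
        by (simp add: geo_def norm_divide)
      moreover have "1 / exp (s + t) = exp (- (s + t))" by (simp only: exp_minus inverse_eq_divide)
      ultimately show "norm (geo (x, u, s) t - complex_of_real x) \<le> exp (- (s + t))" by (simp only:)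
    qed
    have "((\<lambda>t::real. exp (- s) * exp (- t)) \<longlongrightarrow> exp (- s) * 0) at_top"
      by (intro tendsto_mult tendsto_const filterlim_compose[OF exp_at_bot filterlim_uminus_at_bot_at_top])
    then show "((\<lambda>t::real. exp (- (s + t))) \<longlongrightarrow> 0) at_top" by (simp add: exp_add[symmetric])
  qed
  then show ?thesis by (simp add: tendsto_norm_zero_iff LIM_zero_iff)
qed

lemma geo_tendsto_bot:
  assumes "u \<noteq> 0"
  shows "((geo (x, u, s)) \<longlongrightarrow> complex_of_real (x - 1 / u)) at_bot"
proof -
  have e: "((\<lambda>t. exp s * exp t) \<longlongrightarrow> exp s * 0) at_bot"
    by (intro tendsto_mult tendsto_const exp_at_bot)
  have "((\<lambda>t. Complex u (exp (s + t))) \<longlongrightarrow> Complex u 0) at_bot"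
    using e by (intro tendsto_Complex tendsto_const) (simp add: exp_add)
  then have "((\<lambda>t. complex_of_real x - 1 / Complex u (exp (s + t))) \<longlongrightarrow> complex_of_real x - 1 / Complex u 0) at_bot"
    using assms by (intro tendsto_diff tendsto_divide tendsto_const) (auto simp: complex_eq_iff)
  moreover have "complex_of_real x - 1 / Complex u 0 = complex_of_real (x - 1 / u)"
    using assms by (simp add: complex_eq_iff Re_divide Im_divide power2_eq_square)
  ultimately show ?thesis by (simp add: geo_def[abs_def])
qed

lemma geo_bot_infinite:
  "\<not> ((geo (x, 0, s)) \<longlongrightarrow> complex_of_real y) at_bot"
proof
  assume "((geo (x, 0, s)) \<longlongrightarrow> complex_of_real y) at_bot"
  then have "((\<lambda>t. Im (geo (x, 0, s) t)) \<longlongrightarrow> Im (complex_of_real y)) at_bot" by (rule tendsto_Im)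
  moreover have "Im (geo (x, 0, s) t) = exp (- (s + t))" for t
    by (simp add: Im_geo power2_eq_square exp_minus del: minus_add_distrib) (simp add: inverse_eq_divide)
  ultimately have "((\<lambda>t. exp (- (s + t))) \<longlongrightarrow> 0) at_bot" by simp
  then have "\<forall>\<^sub>F t in at_bot. exp (- (s + t)) < 1" by (rule order_tendstoD) simp
  then obtain N where N: "\<And>t. t \<le> N \<Longrightarrow> exp (- (s + t)) < 1" by (auto simp: eventually_at_bot_linorder)
  have "exp (- (s + min N (- s))) < 1" by (rule N) simp
  then show False by simp
qed

lemma geo_tends_top_iff: "tends_to_boundary (geo (x, u, s)) (Some x') at_top \<longleftrightarrow> x' = x"
  unfolding tends_to_boundary_def option.case
proof
  assume "((geo (x, u, s)) \<longlongrightarrow> complex_of_real x') at_top"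
  from tendsto_unique[OF _ this geo_tendsto_top] show "x' = x" by simp
qed (simp add: geo_tendsto_top)

lemma geo_tends_bot_iff: "tends_to_boundary (geo (x, u, s)) (Some y) at_bot \<longleftrightarrow> u \<noteq> 0 \<and> y = x - 1 / u"
proof (cases "u = 0")
  case True
  then show ?thesis unfolding tends_to_boundary_def option.case using geo_bot_infinite by simp
next
  case False
  show ?thesis unfolding tends_to_boundary_def option.case
  proof
    assume "((geo (x, u, s)) \<longlongrightarrow> complex_of_real y) at_bot"
    from tendsto_unique[OF _ this geo_tendsto_bot[OF False]] have "complex_of_real y = complex_of_real (x - 1 / u)" by simp
    then show "u \<noteq> 0 \<and> y = x - 1 / u" using False unfolding of_real_eq_iff by blast
  next
    assume "u \<noteq> 0 \<and> y = x - 1 / u"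
    then show "((geo (x, u, s)) \<longlongrightarrow> complex_of_real y) at_bot" using geo_tendsto_bot[OF False, of x s] by blast
  qed
qed

lemma endpoints_in_geo_iff:
  "endpoints_in (geo (x, u, s)) R \<longleftrightarrow> u \<noteq> 0 \<and> (x, x - 1 / u) \<in> R"
  unfolding endpoints_in_def geo_tends_top_iff geo_tends_bot_iff by auto

lemma vertical_not_tends: "\<not> tends_to_boundary (\<lambda>t. Complex y (exp (s + t))) (Some x) at_top"
proof
  assume "tends_to_boundary (\<lambda>t. Complex y (exp (s + t))) (Some x) at_top"
  then have "((\<lambda>t. Im (Complex y (exp (s + t)))) \<longlongrightarrow> Im (complex_of_real x)) at_top"
    unfolding tends_to_boundary_def option.case by (rule tendsto_Im)
  then have "((\<lambda>t. exp (s + t)) \<longlongrightarrow> 0) at_top" by simp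
  then have "\<forall>\<^sub>F t in at_top. exp (s + t) < 1" by (rule order_tendstoD) simp
  then obtain N where N: "\<And>t. t \<ge> N \<Longrightarrow> exp (s + t) < 1" by (auto simp: eventually_at_top_linorder)
  have "exp (s + max N (- s)) < 1" by (rule N) simp
  then show False by simp
qed

lemma geo_inj: "geo \<omega> = geo \<omega>' \<Longrightarrow> \<omega> = \<omega>'"
proof -
  assume eq: "geo \<omega> = geo \<omega>'"
  obtain x u s where w1: "\<omega> = (x, u, s)" by (cases \<omega>) auto
  obtain x' u' s' where w2: "\<omega>' = (x', u', s')" by (cases \<omega>') auto
  note w = w1 w2
  have "tends_to_boundary (geo (x, u, s)) (Some x) at_top" by (simp add: geo_tends_top_iff)
  then have "tends_to_boundary (geo (x', u', s')) (Some x) at_top" using eq by (simp only: w)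
  then have x: "x = x'" by (simp only: geo_tends_top_iff)
  have e: "geo (x, u, s) 0 = geo (x', u', s') 0" using eq by (simp only: w)
  have "Complex u (exp (s + 0)) = - 1 / (geo (x, u, s) 0 - of_real x)" by (rule geo_inversion[symmetric])
  also have "\<dots> = - 1 / (geo (x', u', s') 0 - of_real x')" unfolding e unfolding x ..
  also have "\<dots> = Complex u' (exp (s' + 0))" by (rule geo_inversion)
  finally have "Complex u (exp (s + 0)) = Complex u' (exp (s' + 0))" .
  then show ?thesis using x w by simp
qed

lemma geo_ne_vertical: "geo \<omega> \<noteq> (\<lambda>t. Complex y (exp (s + t)))"
proof
  assume eq: "geo \<omega> = (\<lambda>t. Complex y (exp (s + t)))"
  obtain x u r where w: "\<omega> = (x, u, r)" by (cases \<omega>) auto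
  have "tends_to_boundary (geo \<omega>) (Some x) at_top" unfolding w by (simp add: geo_tends_top_iff)
  then show False unfolding eq using vertical_not_tends by blast
qed

text \<open>The parameter at which a geodesic with end points of opposite sign crosses the imaginary axis.\<close>

definition crossing_time :: "real \<times> real \<times> real \<Rightarrow> real" where
  "crossing_time \<omega> = (case \<omega> of (x, u, s) \<Rightarrow> ln (\<bar>u\<bar> * sqrt (- (x - 1 / u) / x)) - s)"

text \<open>With \<open>y = x - 1 / u\<close> the other end point, the half circle over \<open>x\<close> and \<open>y\<close> meets the imaginary axis at
  height \<open>sqrt (- (x * y))\<close>, and \<open>lambda0\<close> is the part of height at most one.\<close>

lemma geo_lambda0_iff:
  assumes u: "u \<noteq> 0" and xy: "x * (x - 1 / u) < 0"
  shows "geo (x, u, s) t \<in> lambda0 \<longleftrightarrow> t = crossing_time (x, u, s) \<and> - (x * (x - 1 / u)) \<le> 1"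
proof -
  define y where "y = x - 1 / u"
  define v where "v = exp (s + t)"
  have v: "v > 0" by (simp add: v_def)
  have x: "x \<noteq> 0" and yx: "- y / x > 0" using xy by (auto simp: y_def[symmetric] mult_less_0_iff divide_less_0_iff)
  have n: "u\<^sup>2 + v\<^sup>2 > 0" using v by (simp add: add_nonneg_pos)
  have sol: "(\<bar>u\<bar> * sqrt (- y / x))\<^sup>2 = u / x - u\<^sup>2"
  proof -
    have "(\<bar>u\<bar> * sqrt (- y / x))\<^sup>2 = u\<^sup>2 * (- y / x)" using yx by (simp add: power_mult_distrib)
    also have "\<dots> = u / x - u\<^sup>2" using x u by (simp add: y_def field_simps power2_eq_square)
    finally show ?thesis .
  qed
  have eqv: "x - u / (u\<^sup>2 + v\<^sup>2) = 0 \<longleftrightarrow> v\<^sup>2 = u / x - u\<^sup>2"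
  proof -
    have "x - u / N = 0 \<longleftrightarrow> N = u / x" if "N > 0" for N
      using that x by (auto simp: field_simps)
    from this[OF n] show ?thesis by linarith
  qed
  have "Re (geo (x, u, s) t) = 0 \<longleftrightarrow> v\<^sup>2 = u / x - u\<^sup>2"
    unfolding Re_geo v_def[symmetric] by (rule eqv)
  also have "\<dots> \<longleftrightarrow> v = \<bar>u\<bar> * sqrt (- y / x)"
    using v yx unfolding sol[symmetric] by (intro power2_eq_iff_nonneg) auto
  also have "\<dots> \<longleftrightarrow> s + t = ln (\<bar>u\<bar> * sqrt (- y / x))"
  proof -
    have "\<bar>u\<bar> * sqrt (- y / x) > 0" using u yx by simp
    moreover have "exp r = R \<longleftrightarrow> r = ln R" if "R > 0" for r R :: real
      using that by (auto simp: ln_exp)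
    ultimately show ?thesis unfolding v_def by blast
  qed
  also have "\<dots> \<longleftrightarrow> t = crossing_time (x, u, s)"
    by (auto simp: crossing_time_def y_def)
  finally have re: "Re (geo (x, u, s) t) = 0 \<longleftrightarrow> t = crossing_time (x, u, s)" .
  have im0: "Im (geo (x, u, s) t) > 0" using geo_in_uhp[of "(x, u, s)" t] by (simp add: uhp_def)
  have im: "Im (geo (x, u, s) t) \<le> 1 \<longleftrightarrow> - (x * y) \<le> 1" if "Re (geo (x, u, s) t) = 0"
  proof -
    have "x = u / (u\<^sup>2 + v\<^sup>2)" using that by (simp add: Re_geo v_def)
    then have "(Im (geo (x, u, s) t))\<^sup>2 = v\<^sup>2 * (x / u)\<^sup>2"
      using u by (simp add: Im_geo v_def[symmetric] power_divide)
    also have "v\<^sup>2 = u / x - u\<^sup>2"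
      using that unfolding Re_geo v_def[symmetric] eqv .
    also have "(u / x - u\<^sup>2) * (x / u)\<^sup>2 = - (x * y)"
      using u x by (simp add: y_def field_simps power2_eq_square)
    finally have "- (x * y) = (Im (geo (x, u, s) t))\<^sup>2" by simp
    then show ?thesis using im0 by (simp add: power_le_one_iff abs_square_le_1)
  qed
  show ?thesis unfolding lambda0_def mem_Collect_eq y_def[symmetric] using re im im0 by blast
qed

text \<open>The hyperbolic cosine of the distance from \<open>\<i>\<close> to \<open>geo (x, u, s) t\<close> is \<open>(P / v + Q * v) / 2\<close> with
  \<open>v = exp (s + t)\<close>, \<open>Q = 1 + x\<^sup>2\<close> and \<open>P * Q = 1 + w\<^sup>2\<close>, where \<open>w\<close> is the quantity in the absolute value.
  Its minimum is \<open>sqrt (P * Q)\<close>.\<close>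

lemma depth_geo: "depth (geo (x, u, s)) = arsinh \<bar>u * (1 + x\<^sup>2) - x\<bar>"
proof -
  define P Q w where "P = (x * u - 1)\<^sup>2 + u\<^sup>2" and "Q = 1 + x\<^sup>2" and "w = u * (1 + x\<^sup>2) - x"
  have Q: "Q > 0" by (simp add: Q_def add_pos_nonneg)
  have PQ: "P * Q = 1 + w\<^sup>2" by (simp add: P_def Q_def w_def power2_eq_square algebra_simps)
  then have "P * Q > 0" by (simp add: add_pos_nonneg)
  then have P: "P > 0" using Q by (simp add: zero_less_mult_iff)
  have i: "\<i> \<in> uhp" by (simp add: uhp_def)
  have ch: "cosh (hdist \<i> (geo (x, u, s) t)) = (P / exp (s + t) + Q * exp (s + t)) / 2" for t
  proof -
    define v where "v = exp (s + t)"
    have v: "v > 0" by (simp add: v_def)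
    have n: "u\<^sup>2 + v\<^sup>2 > 0" using v by (simp add: add_nonneg_pos)
    have I: "Im (geo (x, u, s) t) = v / (u\<^sup>2 + v\<^sup>2)" and R: "Re (geo (x, u, s) t) = x - u / (u\<^sup>2 + v\<^sup>2)"
      by (simp_all add: Im_geo Re_geo v_def)
    have "cosh (hdist \<i> (geo (x, u, s) t)) = 1 + ((x - u / (u\<^sup>2 + v\<^sup>2))\<^sup>2 + (1 - v / (u\<^sup>2 + v\<^sup>2))\<^sup>2) / (2 * (v / (u\<^sup>2 + v\<^sup>2)))"
    proof -
      have c: "(cmod (\<i> - geo (x, u, s) t))\<^sup>2 = (x - u / (u\<^sup>2 + v\<^sup>2))\<^sup>2 + (1 - v / (u\<^sup>2 + v\<^sup>2))\<^sup>2"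
        unfolding cmod_power2 by (simp add: I R power2_commute)
      show ?thesis unfolding cosh_hdist[OF i geo_in_uhp] c I by simp
    qed
    also have "\<dots> = ((x - u / (u\<^sup>2 + v\<^sup>2))\<^sup>2 + 1 + (v / (u\<^sup>2 + v\<^sup>2))\<^sup>2) / (2 * (v / (u\<^sup>2 + v\<^sup>2)))"
    proof -
      have "1 + (a\<^sup>2 + (1 - b)\<^sup>2) / (2 * b) = (a\<^sup>2 + 1 + b\<^sup>2) / (2 * b)" if "b > 0" for a b :: real
        using that by (simp add: field_simps power2_diff)
      from this[of "v / (u\<^sup>2 + v\<^sup>2)" "x - u / (u\<^sup>2 + v\<^sup>2)"] show ?thesis using v n by (simp only: divide_pos_pos)
    qed
    also have "(x - u / (u\<^sup>2 + v\<^sup>2))\<^sup>2 + 1 + (v / (u\<^sup>2 + v\<^sup>2))\<^sup>2 = (P + Q * v\<^sup>2) / (u\<^sup>2 + v\<^sup>2)"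
    proof -
      define N where "N = u\<^sup>2 + v\<^sup>2"
      have "(x - u / N)\<^sup>2 + 1 + (v / N)\<^sup>2 = x\<^sup>2 + 1 - 2 * x * u / N + (u\<^sup>2 + v\<^sup>2) / N\<^sup>2"
        by (simp add: power2_diff power_divide add_divide_distrib)
      also have "\<dots> = ((x\<^sup>2 + 1) * N - 2 * x * u + 1) / N"
        using n unfolding N_def[symmetric] by (simp add: field_simps power2_eq_square)
      also have "(x\<^sup>2 + 1) * N - 2 * x * u + 1 = P + Q * v\<^sup>2"
        by (simp add: N_def P_def Q_def power2_eq_square algebra_simps)
      finally show ?thesis by (simp add: N_def)
    qed
    also have "(P + Q * v\<^sup>2) / (u\<^sup>2 + v\<^sup>2) / (2 * (v / (u\<^sup>2 + v\<^sup>2))) = (P / v + Q * v) / 2"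
    proof -
      have "X / N / (2 * (v / N)) = X / (2 * v)" if "N > 0" for X N :: real using that v by simp
      then have "(P + Q * v\<^sup>2) / (u\<^sup>2 + v\<^sup>2) / (2 * (v / (u\<^sup>2 + v\<^sup>2))) = (P + Q * v\<^sup>2) / (2 * v)"
        using n by blast
      also have "\<dots> = (P / v + Q * v) / 2" using v by (simp add: field_simps power2_eq_square)
      finally show ?thesis .
    qed
    finally show ?thesis by (simp add: v_def)
  qed
  have cw: "cosh (arsinh \<bar>w\<bar>) = sqrt (P * Q)" by (simp add: cosh_arsinh_real PQ add.commute)
  have arw: "0 \<le> arsinh \<bar>w\<bar>" using arsinh_real_neg_iff[of "\<bar>w\<bar>"] by (simp add: not_less[symmetric] del: arsinh_real_neg_iff)
  have amgm: "sqrt (P * Q) \<le> (P / v + Q * v) / 2" if "v > 0" for v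
  proof -
    have "sqrt (P * Q) = sqrt ((P / v) * (Q * v))" using that by simp
    also have "\<dots> \<le> (P / v + Q * v) / 2"
      using that P Q by (intro arith_geo_mean_sqrt) auto
    finally show ?thesis .
  qed
  show ?thesis unfolding depth_def w_def[symmetric]
  proof (rule cInf_eq_minimum)
    define t where "t = ln (sqrt (P / Q)) - s"
    have e: "exp (s + t) = sqrt (P / Q)" using P Q by (simp add: t_def)
    have "(P / sqrt (P / Q) + Q * sqrt (P / Q)) / 2 = sqrt (P * Q)"
    proof -
      have "P / sqrt (P / Q) = sqrt (P * Q)"
        using P Q by (simp add: real_sqrt_divide real_sqrt_mult field_simps)
      moreover have "Q * sqrt (P / Q) = sqrt (P * Q)"
        using P Q by (simp add: real_sqrt_divide real_sqrt_mult field_simps)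
      ultimately show ?thesis by simp
    qed
    then have "cosh (hdist \<i> (geo (x, u, s) t)) = cosh (arsinh \<bar>w\<bar>)" by (simp add: ch cw e)
    then have "hdist \<i> (geo (x, u, s) t) = arsinh \<bar>w\<bar>"
      using hdist_nonneg[OF i geo_in_uhp[of "(x, u, s)" t]] arw by simp
    then show "arsinh \<bar>w\<bar> \<in> range (\<lambda>t. hdist \<i> (geo (x, u, s) t))" by (metis rangeI)
  next
    fix d assume "d \<in> range (\<lambda>t. hdist \<i> (geo (x, u, s) t))"
    then obtain t where d: "d = hdist \<i> (geo (x, u, s) t)" by auto
    have "cosh (arsinh \<bar>w\<bar>) \<le> cosh d" unfolding d ch cw by (rule amgm) simp
    then show "arsinh \<bar>w\<bar> \<le> d"
      using hdist_nonneg[OF i geo_in_uhp[of "(x, u, s)" t]] d arw cosh_real_nonneg_le_iff[of "arsinh \<bar>w\<bar>" d] by simp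
  qed
qed

lemma moebius_geo:
  assumes det: "det A = (1::real)" and j: "A$2$1 * x + A$2$2 \<noteq> 0"
  shows "moebius A (geo (x, u, s) t) = geo (moebius_coords A (x, u, s)) t"
proof -
  define a b c d where "a = A$1$1" and "b = A$1$2" and "c = A$2$1" and "d = A$2$2"
  have D: "a * d - b * c = 1" using det by (simp add: det_2 a_def b_def c_def d_def)
  define jr where "jr = c * x + d"
  have jr: "jr \<noteq> 0" using j by (simp add: jr_def c_def d_def)
  define w where "w = Complex u (exp (s + t))"
  have w0: "w \<noteq> 0" by (simp add: w_def complex_eq_iff)
  define k where "k = of_real jr * w - of_real c"
  have k0: "k \<noteq> 0"
  proof
    assume "k = 0"
    then have "Im k = 0" by simp
    then show False using jr by (simp add: k_def w_def)
  qed
  have w2: "Complex (jr\<^sup>2 * u - c * jr) (exp (s + 2 * ln \<bar>jr\<bar> + t)) = of_real jr * k"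
  proof -
    have "exp (s + 2 * ln \<bar>jr\<bar> + t) = exp (s + t) * (exp (ln \<bar>jr\<bar>) * exp (ln \<bar>jr\<bar>))"
      by (simp add: exp_add[symmetric])
    also have "\<dots> = exp (s + t) * (jr * jr)" using jr by simp
    finally show ?thesis by (simp add: k_def w_def complex_eq_iff power2_eq_square algebra_simps)
  qed
  have num: "of_real a * (of_real x - 1 / w) + of_real b = (of_real (a * x + b) * w - of_real a) / w"
    using w0 by (simp add: field_simps)
  have den: "of_real c * (of_real x - 1 / w) + of_real d = k / w"
    using w0 by (simp add: k_def jr_def field_simps)
  have g: "geo (x, u, s) t = of_real x - 1 / w" by (simp add: geo_def w_def)
  have "moebius A (geo (x, u, s) t) = (of_real (a * x + b) * w - of_real a) / k"
    using geo_in_uhp[of "(x, u, s)" t] w0 k0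
    unfolding moebius_def g a_def[symmetric] b_def[symmetric] c_def[symmetric] d_def[symmetric]
    by (simp add: num den)
  also have "\<dots> = of_real ((a * x + b) / jr) - 1 / (of_real jr * k)"
  proof -
    define Y where "Y = complex_of_real (a * x + b)"
    have "a * jr = c * (a * x + b) + 1" using D by (simp add: jr_def algebra_simps)
    then have "complex_of_real (a * jr) = of_real (c * (a * x + b) + 1)" by simp
    then have aj: "complex_of_real a * of_real jr = of_real c * Y + 1" by (simp add: Y_def)
    have "(Y * w - of_real a) * of_real jr = Y * w * of_real jr - (of_real c * Y + 1)"
      unfolding left_diff_distrib aj ..
    also have "\<dots> = Y * k - 1" by (simp add: k_def algebra_simps)
    finally have e: "(Y * w - of_real a) * of_real jr = Y * k - 1" .
    have "(Y * w - of_real a) / k = ((Y * w - of_real a) * of_real jr) / (of_real jr * k)"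
      using jr k0 by simp
    then have "(Y * w - of_real a) / k = (Y * k - 1) / (of_real jr * k)"
      unfolding e .
    then have "(of_real (a * x + b) * w - of_real a) / k = (of_real (a * x + b) * k - 1) / (of_real jr * k)"
      unfolding Y_def .
    also have "\<dots> = of_real ((a * x + b) / jr) - 1 / (of_real jr * k)"
      using jr k0 by (simp add: diff_divide_distrib)
    finally show ?thesis .
  qed
  also have "\<dots> = geo (moebius_coords A (x, u, s)) t"
    unfolding moebius_coords_def prod.case a_def[symmetric] b_def[symmetric] c_def[symmetric] d_def[symmetric] jr_def[symmetric]
    unfolding geo_def prod.case w2 ..
  finally show ?thesis .
qed

text \<open>The exceptional case of \<open>moebius_geo\<close>: the end point \<open>x\<close> is sent to infinity.\<close>

lemma moebius_geo_vertical:
  assumes det: "det A = (1::real)" and j: "A$2$1 * x + A$2$2 = 0"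
  shows "\<exists>y r. \<forall>t. moebius A (geo (x, u, s) t) = Complex y (exp (r + t))"
proof -
  define a b c d where "a = A$1$1" and "b = A$1$2" and "c = A$2$1" and "d = A$2$2"
  have D: "a * d - b * c = 1" using det by (simp add: det_2 a_def b_def c_def d_def)
  have d: "d = - (c * x)" using j by (simp add: c_def d_def)
  have c: "c \<noteq> 0" using D d by auto
  have ab: "(a * x + b) * c = - 1" using D d by (simp add: algebra_simps)
  have "moebius A (geo (x, u, s) t) = Complex (u / c\<^sup>2 + a / c) (exp (s - 2 * ln \<bar>c\<bar> + t))" for t
  proof -
    define w where "w = Complex u (exp (s + t))"
    have w0: "w \<noteq> 0" by (simp add: w_def complex_eq_iff)
    have g: "geo (x, u, s) t = of_real x - 1 / w" by (simp add: geo_def w_def)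
    have num: "of_real a * (of_real x - 1 / w) + of_real b = (of_real (a * x + b) * w - of_real a) / w"
      using w0 by (simp add: field_simps)
    have den: "of_real c * (of_real x - 1 / w) + of_real d = - of_real c / w"
      using w0 by (simp add: d field_simps)
    have "moebius A (geo (x, u, s) t) = (of_real (a * x + b) * w - of_real a) / (- of_real c)"
      using geo_in_uhp[of "(x, u, s)" t] w0 c
      unfolding moebius_def g a_def[symmetric] b_def[symmetric] c_def[symmetric] d_def[symmetric]
      by (simp add: num den)
    also have "\<dots> = ((of_real (a * x + b) * of_real c) * w - of_real a * of_real c) / (- (of_real c)\<^sup>2)"
    proof -
      have "(X * w - A') / (- C) = (X * C * w - A' * C) / (- C\<^sup>2)" if "C \<noteq> 0" for X A' C :: complex
      proof -
        have "(X * C * w - A' * C) / (- C\<^sup>2) = ((X * w - A') * C) / ((- C) * C)"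
          by (rule arg_cong2[where f = "(/)"]) (simp_all add: power2_eq_square algebra_simps)
        also have "\<dots> = (X * w - A') / (- C)"
          by (rule nonzero_mult_divide_mult_cancel_right[OF that])
        finally show ?thesis by (rule sym)
      qed
      then show ?thesis using c by (simp only: of_real_eq_0_iff not_False_eq_True)
    qed
    also have "of_real (a * x + b) * of_real c = (- 1 :: complex)"
    proof -
      have "complex_of_real ((a * x + b) * c) = of_real (- 1)" by (simp only: ab)
      then show ?thesis by (simp only: of_real_mult of_real_minus of_real_1)
    qed
    also have "(- 1 * w - of_real a * of_real c) / (- (of_real c)\<^sup>2) = w / (of_real (c\<^sup>2)) + of_real (a / c)"
    proof -
      have "(- 1 * w - A' * C) / (- C\<^sup>2) = w / C\<^sup>2 + A' / C" if "C \<noteq> 0" for A' C :: complex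
      proof -
        have "- 1 * w - A' * C = - (w + A' * C)" by simp
        then have "(- 1 * w - A' * C) / (- C\<^sup>2) = (w + A' * C) / C\<^sup>2" by (simp only: minus_divide_divide)
        also have "\<dots> = w / C\<^sup>2 + (A' * C) / (C * C)" unfolding add_divide_distrib power2_eq_square ..
        also have "(A' * C) / (C * C) = A' / C" by (rule nonzero_mult_divide_mult_cancel_right[OF that])
        finally show ?thesis .
      qed
      from this[of "of_real c" "of_real a"] show ?thesis using c by simp
    qed
    also have "\<dots> = Complex (u / c\<^sup>2 + a / c) (exp (s - 2 * ln \<bar>c\<bar> + t))"
    proof -
      have "exp (s - 2 * ln \<bar>c\<bar> + t) = exp (s + t) / (exp (ln \<bar>c\<bar>) * exp (ln \<bar>c\<bar>))"
      proof -
        have "s - 2 * ln \<bar>c\<bar> + t = (s + t) - (ln \<bar>c\<bar> + ln \<bar>c\<bar>)" by simp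
        then show ?thesis by (simp only: exp_diff exp_add)
      qed
      also have "\<dots> = exp (s + t) / c\<^sup>2" using c by (simp add: power2_eq_square)
      finally show ?thesis by (simp add: w_def complex_eq_iff del: of_real_power)
    qed
    finally show ?thesis .
  qed
  then show ?thesis by blast
qed

section \<open>Tangent vectors of geodesics\<close>

lemma geo_has_derivative:
  "(geo (x, u, s) has_vector_derivative \<i> * of_real (exp (s + t)) / (Complex u (exp (s + t)))\<^sup>2) (at t)"
proof -
  have d: "((\<lambda>t. Complex u (exp (s + t))) has_vector_derivative \<i> * of_real (exp (s + t))) (at t)"
    unfolding Complex_eq by (auto intro!: derivative_eq_intros simp: has_vector_derivative_def[symmetric] has_real_derivative_iff_has_vector_derivative[symmetric] scaleR_conv_of_real)
  have "((\<lambda>w. of_real x - 1 / w) has_field_derivative 1 / (Complex u (exp (s + t)))\<^sup>2) (at (Complex u (exp (s + t))))"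
    using Complex_nz[of u "s + t"] by (auto intro!: derivative_eq_intros simp: power2_eq_square)
  from field_vector_diff_chain_at[OF d this]
  have "((\<lambda>w. of_real x - 1 / w) \<circ> (\<lambda>t. Complex u (exp (s + t))) has_vector_derivative \<i> * of_real (exp (s + t)) * (1 / (Complex u (exp (s + t)))\<^sup>2)) (at t)" .
  moreover have "(\<lambda>w. of_real x - 1 / w) \<circ> (\<lambda>t. Complex u (exp (s + t))) = geo (x, u, s)"
    by (auto simp: geo_def)
  ultimately show ?thesis by simp
qed

lemma sgn_positive: "r > 0 \<Longrightarrow> sgn (complex_of_real r) = 1"
  by (simp add: sgn_div_norm scaleR_conv_of_real)

lemma sgn_geo_derivative:
  assumes v: "v > 0"
  shows "sgn (\<i> * of_real v / (Complex u v)\<^sup>2) = Complex (2 * u * v / (u\<^sup>2 + v\<^sup>2)) ((u\<^sup>2 - v\<^sup>2) / (u\<^sup>2 + v\<^sup>2))"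
proof -
  define N where "N = u\<^sup>2 + v\<^sup>2"
  have N: "N > 0" using v by (simp add: N_def add_nonneg_pos)
  have n: "Complex u v * Complex u (- v) = of_real N" by (simp add: complex_eq_iff N_def power2_eq_square)
  have nz: "Complex u v \<noteq> 0" using v by (simp add: complex_eq_iff)
  have "\<i> * of_real v / (Complex u v)\<^sup>2 = \<i> * of_real v * (Complex u (- v))\<^sup>2 / (of_real N)\<^sup>2"
    unfolding n[symmetric] using nz v by (simp add: power_mult_distrib complex_eq_iff[of "Complex u (- v)" 0])
  also have "\<dots> = of_real (v / N) * Complex (2 * u * v / N) ((u\<^sup>2 - v\<^sup>2) / N)"
  proof -
    have a: "\<i> * (Complex u (- v))\<^sup>2 = of_real N * Complex (2 * u * v / N) ((u\<^sup>2 - v\<^sup>2) / N)"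
      using N by (simp add: complex_eq_iff power2_eq_square)
    have "\<i> * of_real v * (Complex u (- v))\<^sup>2 / (of_real N)\<^sup>2 = of_real v * (\<i> * (Complex u (- v))\<^sup>2) / (of_real N)\<^sup>2"
      by simp
    also have "\<dots> = of_real (v / N) * Complex (2 * u * v / N) ((u\<^sup>2 - v\<^sup>2) / N)"
      unfolding a using N by (simp add: power2_eq_square)
    finally show ?thesis .
  qed
  finally have e: "\<i> * of_real v / (Complex u v)\<^sup>2 = of_real (v / N) * Complex (2 * u * v / N) ((u\<^sup>2 - v\<^sup>2) / N)" .
  have "cmod (Complex (2 * u * v / N) ((u\<^sup>2 - v\<^sup>2) / N)) = 1"
  proof -
    have "(2 * u * v / N)\<^sup>2 + ((u\<^sup>2 - v\<^sup>2) / N)\<^sup>2 = ((2 * u * v)\<^sup>2 + (u\<^sup>2 - v\<^sup>2)\<^sup>2) / N\<^sup>2"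
      by (simp add: power_divide add_divide_distrib)
    also have "(2 * u * v)\<^sup>2 + (u\<^sup>2 - v\<^sup>2)\<^sup>2 = N\<^sup>2"
      by (simp add: N_def power2_eq_square algebra_simps)
    finally show ?thesis using N by (simp add: cmod_def)
  qed
  then show ?thesis
    unfolding e N_def[symmetric] sgn_mult using sgn_positive[of "v / N"] v N by (simp add: sgn_div_norm[of "Complex _ _"] del: of_real_divide)
qed

lemma tangent_geo:
  fixes x u s :: real
  defines "v \<equiv> exp s"
  shows "tangent (geo (x, u, s)) 0 = (geo (x, u, s) 0, Complex (2 * u * v / (u\<^sup>2 + v\<^sup>2)) ((u\<^sup>2 - v\<^sup>2) / (u\<^sup>2 + v\<^sup>2)))"
proof -
  have "vector_derivative (geo (x, u, s)) (at 0) = \<i> * of_real v / (Complex u v)\<^sup>2"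
    using geo_has_derivative[of x u s 0] by (simp add: v_def vector_derivative_at)
  then show ?thesis unfolding tangent_def using sgn_geo_derivative[of v u] by (simp add: v_def)
qed

lemma tangent_vertical: "tangent (\<lambda>t. Complex y (exp (s + t))) 0 = (Complex y (exp s), \<i>)"
proof -
  have "((\<lambda>t. Complex y (exp (s + t))) has_vector_derivative \<i> * of_real (exp (s + 0))) (at 0)"
    unfolding Complex_eq by (auto intro!: derivative_eq_intros simp: has_vector_derivative_def[symmetric] has_real_derivative_iff_has_vector_derivative[symmetric] scaleR_conv_of_real)
  then have "vector_derivative (\<lambda>t. Complex y (exp (s + t))) (at 0) = \<i> * of_real (exp s)"
    by (simp add: vector_derivative_at)
  moreover have "sgn (\<i> * of_real (exp s)) = \<i>"
    using sgn_positive[of "exp s"] by (simp add: sgn_mult sgn_div_norm[of \<i>])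
  ultimately show ?thesis by (simp add: tangent_def)
qed

lemma vec_coords_tangent:
  fixes x u s :: real
  assumes "tangent (geo (x, u, s)) 0 = (z, d)"
  shows "Im d < 1" "vec_coords z (Re d / (1 - Im d)) = (x, u, s)"
proof -
  define v where "v = exp s"
  define N where "N = u\<^sup>2 + v\<^sup>2"
  have v: "v > 0" by (simp add: v_def)
  have N: "N > 0" using v by (simp add: N_def add_nonneg_pos)
  have z: "Re z = x - u / N" "Im z = v / N" and d: "Re d = 2 * u * v / N" "Im d = (u\<^sup>2 - v\<^sup>2) / N"
    using assms unfolding tangent_geo by (auto simp: Re_geo Im_geo v_def N_def)
  have e: "1 - Im d = 2 * v\<^sup>2 / N" using N by (simp add: d field_simps) (simp add: N_def)
  then show "Im d < 1" using v N by (smt (verit) divide_pos_pos zero_less_power mult_pos_pos)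
  have m: "Re d / (1 - Im d) = u / v" unfolding e using v N by (simp add: d power2_eq_square)
  have "Im z * (1 + (u / v)\<^sup>2) = 1 / v"
  proof -
    have "1 + (u / v)\<^sup>2 = N / v\<^sup>2" using v by (simp add: N_def power_divide add_divide_distrib)
    then show ?thesis using v N by (simp add: z power2_eq_square)
  qed
  then show "vec_coords z (Re d / (1 - Im d)) = (x, u, s)"
    unfolding m vec_coords_def using v N by (simp add: z ln_div) (simp add: v_def)
qed

lemma tangent_vec_coords:
  assumes z: "z \<in> uhp" and d: "cmod d = 1" and ne: "d \<noteq> \<i>"
  shows "tangent (geo (vec_coords z (Re d / (1 - Im d)))) 0 = (z, d)"
proof -
  define q m where "q = Im z" and "m = Re d / (1 - Im d)"
  have q: "q > 0" using z by (simp add: q_def uhp_def)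
  have dd: "(Re d)\<^sup>2 + (Im d)\<^sup>2 = 1" using d by (simp add: cmod_power2[symmetric])
  have i1: "Im d \<noteq> 1"
  proof
    assume "Im d = 1"
    then have "Re d = 0" using dd by simp
    then show False using ne \<open>Im d = 1\<close> by (simp add: complex_eq_iff)
  qed
  have M: "1 + m\<^sup>2 > 0" by (simp add: add_pos_nonneg)
  have m2: "1 + m\<^sup>2 = 2 / (1 - Im d)"
  proof -
    have "1 + m\<^sup>2 = ((1 - Im d)\<^sup>2 + (Re d)\<^sup>2) / (1 - Im d)\<^sup>2"
      using i1 by (simp add: m_def power_divide add_divide_distrib)
    also have "(1 - Im d)\<^sup>2 + (Re d)\<^sup>2 = 2 * (1 - Im d)" using dd by (simp add: power2_diff)
    finally have "1 + m\<^sup>2 = 2 * (1 - Im d) / (1 - Im d)\<^sup>2" .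
    moreover have "2 * k / k\<^sup>2 = 2 / k" if "k \<noteq> 0" for k :: real using that by (simp add: power2_eq_square)
    ultimately show ?thesis using i1 by (simp only: right_minus_eq not_False_eq_True)
  qed
  define v where "v = 1 / (q * (1 + m\<^sup>2))"
  have v: "v > 0" using q M by (simp add: v_def)
  have es: "exp (- ln (q * (1 + m\<^sup>2))) = v" using q M by (simp add: exp_minus v_def inverse_eq_divide)
  have um: "m / (q * (1 + m\<^sup>2)) = m * v" by (simp add: v_def)
  have N: "(m * v)\<^sup>2 + v\<^sup>2 = v / q"
  proof -
    have "(m * v)\<^sup>2 + v\<^sup>2 = v * (v * (1 + m\<^sup>2))" by (simp add: power2_eq_square algebra_simps)
    also have "v * (1 + m\<^sup>2) = 1 / q" using M q by (simp add: v_def)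
    finally show ?thesis by simp
  qed
  have b1: "2 * (m * v) * v / (v / q) = Re d"
  proof -
    have "v * q = 1 / (1 + m\<^sup>2)" using q by (simp add: v_def)
    moreover have "2 * (m * v) * v / (v / q) = 2 * m * (v * q)" using v q by (simp add: field_simps)
    ultimately have "2 * (m * v) * v / (v / q) = 2 * m / (1 + m\<^sup>2)" by simp
    also have "\<dots> = Re d" unfolding m2 using i1 by (simp add: m_def)
    finally show ?thesis .
  qed
  have b2: "((m * v)\<^sup>2 - v\<^sup>2) / (v / q) = Im d"
  proof -
    have "((m * v)\<^sup>2 - v\<^sup>2) / (v / q) = (((m * v)\<^sup>2 + v\<^sup>2) - 2 * v\<^sup>2) / (v / q)" by simp
    also have "\<dots> = 1 - 2 * v * q" unfolding N using v q by (simp add: field_simps power2_eq_square)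
    also have "\<dots> = 1 - 2 / (1 + m\<^sup>2)" using q M by (simp add: v_def)
    also have "\<dots> = Im d" unfolding m2 using i1 by (simp add: field_simps)
    finally show ?thesis .
  qed
  have "geo (Re z + m * q, m * v, - ln (q * (1 + m\<^sup>2))) 0 = z"
  proof -
    have "Re (geo (Re z + m * q, m * v, - ln (q * (1 + m\<^sup>2))) 0) = Re z"
      unfolding Re_geo add_0_right es N using v q by simp
    moreover have "Im (geo (Re z + m * q, m * v, - ln (q * (1 + m\<^sup>2))) 0) = q"
      unfolding Im_geo add_0_right es N using v q by simp
    ultimately show ?thesis by (simp add: complex_eq_iff q_def)
  qed
  then show ?thesis
    unfolding vec_coords_def m_def[symmetric] q_def[symmetric] um tangent_geo es N b1 b2 by simp
qed

lemma moebius_has_derivative: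
  assumes det: "det A = (1::real)" and z: "z \<in> uhp"
  shows "moebius A field_differentiable at z"
proof -
  define a b c d where "a = A$1$1" and "b = A$1$2" and "c = A$2$1" and "d = A$2$2"
  have D: "a * d - b * c = 1" using det by (simp add: det_2 a_def b_def c_def d_def)
  have nz: "of_real c * z + of_real d \<noteq> 0"
  proof
    assume 0: "of_real c * z + of_real d = 0"
    then have "Im (of_real c * z + of_real d) = 0" "Re (of_real c * z + of_real d) = 0" by (simp_all only: zero_complex.sel)
    then have "c = 0" "d = 0" using z by (auto simp: uhp_def)
    then show False using D by simp
  qed
  have "(\<lambda>z. (of_real a * z + of_real b) / (of_real c * z + of_real d)) field_differentiable at z"
    using nz by (intro derivative_intros) auto
  then obtain D' where "((\<lambda>z. (of_real a * z + of_real b) / (of_real c * z + of_real d)) has_field_derivative D') (at z)"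
    by (auto simp: field_differentiable_def)
  moreover have "\<forall>\<^sub>F w in nhds z. (of_real a * w + of_real b) / (of_real c * w + of_real d) = moebius A w"
  proof -
    have "open uhp" by (simp add: uhp_def open_halfspace_Im_gt)
    from eventually_nhds_in_open[OF this z] show ?thesis
      by (rule eventually_mono) (simp add: moebius_def a_def b_def c_def d_def)
  qed
  ultimately have "(moebius A has_field_derivative D') (at z)"
    by (rule DERIV_cong_ev[OF refl _ refl, THEN iffD1, rotated])
  then show ?thesis unfolding field_differentiable_def by (rule exI)
qed

lemma tangent_moebius:
  assumes det: "det A = (1::real)" and \<alpha>: "\<alpha> differentiable at 0" "\<alpha> 0 \<in> uhp"
  shows "tangent (moebius A \<circ> \<alpha>) 0 = (moebius A (fst (tangent \<alpha> 0)), sgn (deriv (moebius A) (fst (tangent \<alpha> 0)) * snd (tangent \<alpha> 0)))"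
proof -
  have "vector_derivative (moebius A \<circ> \<alpha>) (at 0) = vector_derivative \<alpha> (at 0) * deriv (moebius A) (\<alpha> 0)"
    by (rule vector_derivative_chain_at_general[OF \<alpha>(1) moebius_has_derivative[OF det \<alpha>(2)]])
  then show ?thesis by (simp add: tangent_def sgn_mult mult.commute)
qed

lemma geo_differentiable: "geo \<omega> differentiable at t"
  by (cases \<omega>) (simp add: differentiableI_vector[OF geo_has_derivative])

section \<open>Fuchsian groups\<close>

lemma discrete_countable:
  fixes S :: "'a :: second_countable_topology set"
  assumes "discrete S"
  shows "countable S"
proof -
  obtain B :: "'a set set" where B: "countable B" "topological_basis B"
    using ex_countable_basis by blast
  have "S \<subseteq> (\<lambda>b. THE x. b \<inter> S = {x}) ` B"
  proof
    fix x assume x: "x \<in> S"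
    then obtain T where T: "open T" "T \<inter> S = {x}"
      using assms by (auto simp: discrete_def isolated_in_def)
    then have "x \<in> T" by auto
    then obtain b where b: "b \<in> B" "x \<in> b" "b \<subseteq> T"
      using B(2) T(1) by (meson topological_basisE)
    then have "b \<inter> S = {x}" using T x by auto
    then have "x = (THE y. b \<inter> S = {y})" by simp
    then show "x \<in> (\<lambda>b. THE x. b \<inter> S = {x}) ` B" using b by blast
  qed
  then show ?thesis using B(1) by (meson countable_image countable_subset)
qed

lemma moebius_denom_nz:
  fixes A :: "real^2^2"
  assumes det: "det A = (1::real)" and z: "z \<in> uhp"
  shows "of_real (A$2$1) * z + of_real (A$2$2) \<noteq> 0"
proof
  assume 0: "of_real (A$2$1) * z + of_real (A$2$2) = 0"
  then have "Im (of_real (A$2$1) * z + of_real (A$2$2)) = 0" "Re (of_real (A$2$1) * z + of_real (A$2$2)) = 0"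
    by (simp_all only: zero_complex.sel)
  then have "A$2$1 = 0" "A$2$2 = 0" using z by (auto simp: uhp_def)
  then show False using det by (simp add: det_2)
qed

lemma Im_moebius:
  fixes A :: "real^2^2"
  assumes det: "det A = (1::real)" and z: "z \<in> uhp"
  shows "Im (moebius A z) = Im z / (cmod (of_real (A$2$1) * z + of_real (A$2$2)))\<^sup>2"
proof -
  have D: "A$1$1 * A$2$2 - A$1$2 * A$2$1 = 1" using det by (simp add: det_2)
  have "(A$2$1 * Re z + A$2$2) * (A$1$1 * Im z) - (A$1$1 * Re z + A$1$2) * (A$2$1 * Im z)
      = (A$1$1 * A$2$2 - A$1$2 * A$2$1) * Im z" by (simp add: algebra_simps)
  then show ?thesis
    using z by (simp add: moebius_def Im_divide cmod_power2 D ac_simps)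
qed

lemma moebius_in_uhp:
  fixes A :: "real^2^2"
  shows "det A = (1::real) \<Longrightarrow> z \<in> uhp \<Longrightarrow> moebius A z \<in> uhp"
  using Im_moebius[of A z] moebius_denom_nz[of A z] by (simp add: uhp_def)

lemma moebius_mult:
  fixes A B :: "real^2^2"
  assumes A: "det A = (1::real)" and B: "det B = (1::real)" and z: "z \<in> uhp"
  shows "moebius (A ** B) z = moebius A (moebius B z)"
proof -
  define n d where "n = of_real (B$1$1) * z + of_real (B$1$2)" and "d = of_real (B$2$1) * z + of_real (B$2$2)"
  have d: "d \<noteq> 0" using moebius_denom_nz[OF B z] by (simp add: d_def)
  have Bz: "moebius B z = n / d" using z by (simp add: moebius_def n_def d_def)
  have "moebius A (moebius B z) = (of_real (A$1$1) * (n / d) + of_real (A$1$2)) / (of_real (A$2$1) * (n / d) + of_real (A$2$2))"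
    using moebius_in_uhp[OF B z] unfolding Bz by (simp add: moebius_def)
  also have "\<dots> = ((of_real (A$1$1) * n + of_real (A$1$2) * d) / d) / ((of_real (A$2$1) * n + of_real (A$2$2) * d) / d)"
    using d by (simp add: add_divide_distrib)
  also have "\<dots> = (of_real (A$1$1) * n + of_real (A$1$2) * d) / (of_real (A$2$1) * n + of_real (A$2$2) * d)"
    using d by simp
  also have "\<dots> = moebius (A ** B) z"
    using z by (simp add: moebius_def matrix_matrix_mult_def sum_2 n_def d_def algebra_simps)
  finally show ?thesis by simp
qed

lemma moebius_one: "moebius (mat 1) = (\<lambda>z\<in>uhp. z)"
  by (auto simp: moebius_def mat_def fun_eq_iff restrict_def)

text \<open>The adjugate matrix, which is the inverse for matrices of determinant one.\<close>

definition adj2 :: "real^2^2 \<Rightarrow> real^2^2" where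
  "adj2 A = vector [vector [A$2$2, - A$1$2], vector [- A$2$1, A$1$1]]"

lemma adj2_comp: "adj2 A $1$1 = A$2$2" "adj2 A $1$2 = - A$1$2" "adj2 A $2$1 = - A$2$1" "adj2 A $2$2 = A$1$1"
  by (simp_all add: adj2_def)

lemma det_adj2: "det (adj2 A) = det A"
  by (simp add: det_2 adj2_comp)

lemma matrix2_eqI:
  fixes A B :: "real^2^2"
  assumes "A$1$1 = B$1$1" "A$1$2 = B$1$2" "A$2$1 = B$2$1" "A$2$2 = B$2$2"
  shows "A = B"
  using assms by (simp add: vec_eq_iff forall_2)

lemma mult_comp2:
  fixes A B :: "real^2^2"
  shows "(A ** B)$1$1 = A$1$1 * B$1$1 + A$1$2 * B$2$1" "(A ** B)$1$2 = A$1$1 * B$1$2 + A$1$2 * B$2$2"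
    "(A ** B)$2$1 = A$2$1 * B$1$1 + A$2$2 * B$2$1" "(A ** B)$2$2 = A$2$1 * B$1$2 + A$2$2 * B$2$2"
  by (simp_all add: matrix_matrix_mult_def sum_2)

lemma adj2_inverse:
  assumes "det A = 1" shows "adj2 A ** A = mat 1" "A ** adj2 A = mat 1"
  using assms by (auto intro!: matrix2_eqI simp: mult_comp2 adj2_comp mat_def det_2 algebra_simps)

lemma tendsto_matrix2:
  fixes X :: "nat \<Rightarrow> real^2^2"
  assumes "(\<lambda>n. X n$1$1) \<longlonglongrightarrow> L$1$1" "(\<lambda>n. X n$1$2) \<longlonglongrightarrow> L$1$2"
    "(\<lambda>n. X n$2$1) \<longlonglongrightarrow> L$2$1" "(\<lambda>n. X n$2$2) \<longlonglongrightarrow> L$2$2"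
  shows "X \<longlonglongrightarrow> L"
proof (rule vec_tendstoI, rule vec_tendstoI)
  fix i j :: 2
  show "(\<lambda>n. X n$i$j) \<longlonglongrightarrow> L$i$j"
    using assms exhaust_2[of i] exhaust_2[of j] by auto
qed

lemma tendsto_comp2:
  fixes X :: "nat \<Rightarrow> real^2^2"
  assumes "X \<longlonglongrightarrow> L"
  shows "(\<lambda>n. X n$i$j) \<longlonglongrightarrow> L$i$j"
  by (intro tendsto_vec_nth assms)

locale fuchsian_group =
  fixes G :: "(complex \<Rightarrow> complex) set"
  assumes fuchsian: "fuchsian G"
begin

definition Gr :: "(complex \<Rightarrow> complex) monoid" where "Gr = (BijGroup uhp)\<lparr>carrier := G\<rparr>"

definition Gam :: "(real^2^2) set" where "Gam = {A. det A = 1 \<and> moebius A \<in> G}"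

lemma subgrp: "subgroup G (BijGroup uhp)" and disc: "discrete Gam"
  using fuchsian by (auto simp: fuchsian_def Gam_def)

lemma representative: "g \<in> G \<Longrightarrow> \<exists>A. det A = (1::real) \<and> g = moebius A"
  using fuchsian by (auto simp: fuchsian_def)

lemma group_Gr: "group Gr"
  unfolding Gr_def using subgroup.subgroup_is_group[OF subgrp group_BijGroup] .

lemma carrier_Gr[simp]: "carrier Gr = G" by (simp add: Gr_def)

lemma G_Bij: "g \<in> G \<Longrightarrow> g \<in> Bij uhp"
  using subgroup.subset[OF subgrp] by (auto simp: BijGroup_def)

lemma G_uhp: "g \<in> G \<Longrightarrow> z \<in> uhp \<Longrightarrow> g z \<in> uhp"
  using Bij_imp_funcset[OF G_Bij] by auto

lemma mult_Gr: "g \<in> G \<Longrightarrow> h \<in> G \<Longrightarrow> mult Gr g h = compose uhp g h"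
  by (simp add: Gr_def BijGroup_def G_Bij)

lemma one_Gr: "one Gr = (\<lambda>z\<in>uhp. z)"
  by (simp add: Gr_def BijGroup_def)

lemma one_G: "(\<lambda>z\<in>uhp. z) \<in> G"
  using group.is_monoid[OF group_Gr] monoid.one_closed[of Gr] by (simp add: one_Gr)

lemma compose_G: "g \<in> G \<Longrightarrow> h \<in> G \<Longrightarrow> compose uhp g h \<in> G"
  using monoid.m_closed[OF group.is_monoid[OF group_Gr], of g h] by (simp add: mult_Gr)

lemma inverse_G:
  assumes "g \<in> G"
  shows "m_inv Gr g \<in> G" "\<And>z. z \<in> uhp \<Longrightarrow> m_inv Gr g (g z) = z" "\<And>z. z \<in> uhp \<Longrightarrow> g (m_inv Gr g z) = z"
proof -
  interpret group Gr by (rule group_Gr)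
  show i: "m_inv Gr g \<in> G" using inv_closed[of g] assms by simp
  have "compose uhp (m_inv Gr g) g = (\<lambda>z\<in>uhp. z)" using l_inv[of g] assms i by (simp add: mult_Gr one_Gr)
  then show "m_inv Gr g (g z) = z" if "z \<in> uhp" for z using that by (metis compose_eq restrict_apply')
  have "compose uhp g (m_inv Gr g) = (\<lambda>z\<in>uhp. z)" using r_inv[of g] assms i by (simp add: mult_Gr one_Gr)
  then show "g (m_inv Gr g z) = z" if "z \<in> uhp" for z using that by (metis compose_eq restrict_apply')
qed

lemma G_eqI: "g \<in> G \<Longrightarrow> h \<in> G \<Longrightarrow> (\<And>z. z \<in> uhp \<Longrightarrow> g z = h z) \<Longrightarrow> g = h"
  by (rule extensionalityI[of _ uhp]) (auto dest!: G_Bij Bij_imp_extensional)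

lemma countable_G: "countable G"
proof -
  have "G \<subseteq> moebius ` Gam" using representative by (auto simp: Gam_def)
  then show ?thesis using discrete_countable[OF disc] by (meson countable_image countable_subset)
qed

lemma Gam_one: "mat 1 \<in> Gam" by (simp add: Gam_def moebius_one one_G)

lemma Gam_mult: "A \<in> Gam \<Longrightarrow> B \<in> Gam \<Longrightarrow> A ** B \<in> Gam"
proof -
  assume a: "A \<in> Gam" "B \<in> Gam"
  have "moebius (A ** B) = compose uhp (moebius A) (moebius B)"
    using a by (auto simp: fun_eq_iff Gam_def compose_def restrict_def moebius_mult) (auto simp: moebius_def)
  then show ?thesis using a compose_G by (simp add: Gam_def det_mul)
qed

lemma Gam_adj: "A \<in> Gam \<Longrightarrow> adj2 A \<in> Gam"
proof -
  assume a: "A \<in> Gam"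
  then have g: "moebius A \<in> G" and d: "det A = 1" "det (adj2 A) = 1" by (auto simp: Gam_def det_adj2)
  have "moebius (adj2 A) = m_inv Gr (moebius A)"
  proof (rule extensionalityI[of _ uhp])
    show "moebius (adj2 A) \<in> extensional uhp" by (simp add: moebius_def)
    show "m_inv Gr (moebius A) \<in> extensional uhp" using inverse_G(1)[OF g] G_Bij Bij_imp_extensional by blast
    fix z assume z: "z \<in> uhp"
    have "moebius (adj2 A) z = m_inv Gr (moebius A) (moebius A (moebius (adj2 A) z))"
      using inverse_G(2)[OF g moebius_in_uhp[OF d(2) z]] by simp
    also have "moebius A (moebius (adj2 A) z) = z"
      unfolding moebius_mult[OF d z, symmetric] adj2_inverse[OF d(1)] moebius_one using z by simp
    finally show "moebius (adj2 A) z = m_inv Gr (moebius A) z" .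
  qed
  then show ?thesis using inverse_G(1)[OF g] d by (simp add: Gam_def)
qed

text \<open>An infinite bounded set of matrices has a limit point, so that there are matrices \<open>X n\<close> in the
  group with \<open>inverse (X n) * X (n + 1)\<close> tending to the identity. By discreteness the sequence is
  eventually constant, hence equal to its limit, which it avoids.\<close>

lemma finite_bounded_Gam:
  "finite {A \<in> Gam. \<bar>A$1$1\<bar> \<le> K \<and> \<bar>A$1$2\<bar> \<le> K \<and> \<bar>A$2$1\<bar> \<le> K \<and> \<bar>A$2$2\<bar> \<le> K}" (is "finite ?S")
proof (rule ccontr)
  assume inf: "infinite ?S"
  have "bounded ?S"
  proof (rule boundedI)
    fix A assume A: "A \<in> ?S"
    have rows: "norm (A$i) \<le> \<bar>A$i$1\<bar> + \<bar>A$i$2\<bar>" for i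
      using norm_le_l1_cart[of "A$i"] unfolding sum_2 .
    have "L2_set (\<lambda>i. norm (A$i)) UNIV \<le> (\<Sum>i\<in>UNIV. norm (A$i))" by (rule L2_set_le_sum) simp
    then have "norm A \<le> norm (A$1) + norm (A$2)" unfolding sum_2 norm_vec_def[of A] .
    also have "\<dots> \<le> (\<bar>A$1$1\<bar> + \<bar>A$1$2\<bar>) + (\<bar>A$2$1\<bar> + \<bar>A$2$2\<bar>)" by (rule add_mono[OF rows rows])
    also have "\<dots> \<le> (K + K) + (K + K)" using A unfolding mem_Collect_eq by (elim conjE) (rule add_mono[OF add_mono add_mono])
    also have "\<dots> = 4 * K" by simp
    finally show "norm A \<le> 4 * K" .
  qed
  then have c: "compact (closure ?S)" by (simp only: compact_closure)
  have "infinite ?S \<and> ?S \<subseteq> closure ?S" using inf closure_subset by (rule conjI)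
  from mp[OF spec[OF iffD1[OF compact_eq_Bolzano_Weierstrass c], of ?S] this]
  obtain L where "L islimpt ?S" ..
  then obtain X where X: "\<forall>n. X n \<in> ?S - {L}" "X \<longlonglongrightarrow> L"
    unfolding islimpt_sequential by (elim exE conjE)
  have XG: "X n \<in> Gam" "X n \<noteq> L" for n using spec[OF X(1), of n] by simp_all
  have comp: "(\<lambda>n. X n$i$j) \<longlonglongrightarrow> L$i$j" for i j by (rule tendsto_comp2[OF X(2)])
  have comp': "(\<lambda>n. X (Suc n)$i$j) \<longlonglongrightarrow> L$i$j" for i j by (rule LIMSEQ_Suc[OF comp])
  have "(\<lambda>n. det (X n)) \<longlonglongrightarrow> det L" unfolding det_2 by (intro tendsto_intros comp)
  moreover have "det (X n) = 1" for n using XG(1)[of n] by (simp add: Gam_def)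
  ultimately have dL: "det L = 1" by (simp add: LIMSEQ_const_iff)
  have "(\<lambda>n. adj2 (X n) ** X (Suc n)) \<longlonglongrightarrow> adj2 L ** L"
    by (rule tendsto_matrix2; unfold mult_comp2 adj2_comp; intro tendsto_add tendsto_mult tendsto_minus comp comp')
  then have lim: "(\<lambda>n. adj2 (X n) ** X (Suc n)) \<longlonglongrightarrow> mat 1" by (simp add: adj2_inverse[OF dL])
  obtain T where T: "open T" "T \<inter> Gam = {mat 1}"
    using disc Gam_one by (auto simp: discrete_def isolated_in_def)
  then have "mat 1 \<in> T" by blast
  then have "\<forall>\<^sub>F n in sequentially. adj2 (X n) ** X (Suc n) \<in> T"
    by (rule topological_tendstoD[OF lim T(1)])
  then obtain N where N: "\<forall>n\<ge>N. adj2 (X n) ** X (Suc n) \<in> T"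
    unfolding eventually_sequentially ..
  have step: "X (Suc n) = X n" if "n \<ge> N" for n
  proof -
    have "adj2 (X n) ** X (Suc n) \<in> T \<inter> Gam" using N that Gam_mult[OF Gam_adj[OF XG(1)] XG(1)] by simp
    then have "adj2 (X n) ** X (Suc n) = mat 1" unfolding T(2) by simp
    then have "X n ** (adj2 (X n) ** X (Suc n)) = X n" by simp
    then show ?thesis using XG(1)[of n] by (simp add: matrix_mul_assoc adj2_inverse Gam_def)
  qed
  have "X n = X N" if "n \<ge> N" for n using that by (induction n rule: dec_induct) (auto simp: step)
  then have "\<forall>\<^sub>F n in sequentially. X n = X N" by (rule eventually_sequentiallyI)
  then have "X \<longlonglongrightarrow> X N" by (rule tendsto_eventually)
  then have "X N = L" using X(2) by (rule LIMSEQ_unique)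
  then show False using XG(2)[of N] by simp
qed

text \<open>If \<open>g\<close> moves a point of a small disc into this disc, the formula for the imaginary part bounds the
  denominator of \<open>g\<close>, and with it all entries of a matrix of \<open>g\<close>.\<close>

lemma locally_finite:
  assumes z: "z \<in> uhp"
  shows "\<exists>e>0. ball z e \<subseteq> uhp \<and> finite {g \<in> G. \<exists>w\<in>ball z e. g w \<in> ball z e}"
proof -
  define q where "q = Im z"
  have q: "q > 0" using z by (simp add: q_def uhp_def)
  define B where "B = ball z (q / 2)"
  have im: "q / 2 < Im w" "Im w < 3 * q / 2" "cmod w \<le> cmod z + q" if "w \<in> B" for w
  proof -
    have d: "cmod (z - w) < q / 2" using that by (simp add: B_def dist_norm)
    then have "\<bar>Im (z - w)\<bar> < q / 2" using abs_Im_le_cmod[of "z - w"] by linarith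
    then show "q / 2 < Im w" "Im w < 3 * q / 2" by (auto simp: q_def abs_if split: if_splits)
    show "cmod w \<le> cmod z + q" using d norm_triangle_ineq4[of z "z - w"] q by simp
  qed
  define R where "R = cmod z + q"
  have R: "R \<ge> 0" using q by (simp add: R_def)
  define K where "K = 2 * (1 + R) * (1 + 2 / q) * (2 + R)"
  have sub: "{g \<in> G. \<exists>w\<in>B. g w \<in> B} \<subseteq> moebius ` {A \<in> Gam. \<bar>A$1$1\<bar> \<le> K \<and> \<bar>A$1$2\<bar> \<le> K \<and> \<bar>A$2$1\<bar> \<le> K \<and> \<bar>A$2$2\<bar> \<le> K}"
  proof
    fix g assume "g \<in> {g \<in> G. \<exists>w\<in>B. g w \<in> B}"
    then obtain w where g: "g \<in> G" and w: "w \<in> B" "g w \<in> B" by auto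
    obtain A where A: "det A = 1" "g = moebius A" using representative[OF g] by auto
    have wu: "w \<in> uhp" using im(1)[OF w(1)] q by (simp add: uhp_def)
    define n d where "n = of_real (A$1$1) * w + of_real (A$1$2)" and "d = of_real (A$2$1) * w + of_real (A$2$2)"
    have d0: "d \<noteq> 0" using moebius_denom_nz[OF A(1) wu] by (simp add: d_def)
    have gw: "g w = n / d" using wu by (simp add: A moebius_def n_def d_def)
    have "Im (g w) = Im w / (cmod d)\<^sup>2" unfolding A(2) Im_moebius[OF A(1) wu] d_def ..
    then have "(cmod d)\<^sup>2 = Im w / Im (g w)" using im(1)[OF w(2)] q d0 by (simp add: field_simps)
    also have "\<dots> \<le> (3 * q / 2) / (q / 2)" using im[OF w(1)] im[OF w(2)] q by (intro frac_le) auto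
    also have "\<dots> \<le> 2\<^sup>2" using q by simp
    finally have d2: "cmod d \<le> 2" by (rule power2_le_imp_le) simp
    have n2: "cmod n \<le> 2 * R"
    proof -
      have "cmod n = cmod (g w) * cmod d" using d0 by (simp add: gw norm_divide)
      also have "\<dots> \<le> R * 2" using im(3)[OF w(2)] d2 R by (intro mult_mono) (auto simp: R_def)
      finally show ?thesis by simp
    qed
    have low: "\<bar>a\<bar> \<le> M * (2 / q)" "\<bar>b\<bar> \<le> M + M * (2 / q) * R" if "cmod (of_real a * w + of_real b) \<le> M" for a b M
    proof -
      have "\<bar>a\<bar> * (q / 2) \<le> \<bar>a\<bar> * Im w" using im(1)[OF w(1)] by (intro mult_left_mono) auto
      also have "\<dots> = \<bar>Im (of_real a * w + of_real b)\<bar>" using im(1)[OF w(1)] q by (simp add: abs_mult)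
      also have "\<dots> \<le> M" using abs_Im_le_cmod that order_trans by blast
      finally show a: "\<bar>a\<bar> \<le> M * (2 / q)" using q by (simp add: field_simps)
      have "\<bar>b\<bar> = cmod ((of_real a * w + of_real b) - of_real a * w)" by simp
      also have "\<dots> \<le> cmod (of_real a * w + of_real b) + cmod (of_real a * w)" by (rule norm_triangle_ineq4)
      also have "\<dots> \<le> M + (M * (2 / q)) * R"
        using that a im(3)[OF w(1)] unfolding norm_mult norm_of_real
        by (intro add_mono mult_mono) (auto simp: R_def)
      finally show "\<bar>b\<bar> \<le> M + M * (2 / q) * R" .
    qed
    have K1: "M * (2 / q) \<le> K" "M + M * (2 / q) * R \<le> K" if M: "0 \<le> M" "M \<le> 2 * (1 + R)" for M
    proof -
      have t: "0 \<le> 2 / q" using q by simp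
      have e: "M + M * (2 / q) * R \<le> M * (1 + 2 / q) * (2 + R)" "M * (2 / q) \<le> M * (1 + 2 / q) * (2 + R)"
      proof -
        have "M * (1 + r) * (2 + R) - (M + M * r * R) = M * (1 + R + 2 * r)" for r
          by (simp add: algebra_simps)
        moreover have "0 \<le> M * (1 + R + 2 * (2 / q))"
          using M(1) t R by (intro mult_nonneg_nonneg) auto
        ultimately show "M + M * (2 / q) * R \<le> M * (1 + 2 / q) * (2 + R)"
          by (metis diff_ge_0_iff_ge)
        have "M * (1 + r) * (2 + R) - M * r = M * (2 + R + r + r * R)" for r
          by (simp add: algebra_simps)
        moreover have "0 \<le> M * (2 + R + (2 / q) + (2 / q) * R)"
          using M(1) t R by (intro mult_nonneg_nonneg add_nonneg_nonneg) auto
        ultimately show "M * (2 / q) \<le> M * (1 + 2 / q) * (2 + R)"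
          by (metis diff_ge_0_iff_ge)
      qed
      have "M * (1 + 2 / q) * (2 + R) \<le> K" unfolding K_def
        using M t R by (intro mult_right_mono) auto
      then show "M * (2 / q) \<le> K" "M + M * (2 / q) * R \<le> K" using e by auto
    qed
    have "A \<in> Gam" using A g by (simp add: Gam_def)
    moreover have "\<bar>A$1$1\<bar> \<le> K" "\<bar>A$1$2\<bar> \<le> K"
      using low[of "A$1$1" "A$1$2" "2 * R"] K1[of "2 * R"] n2 R by (auto simp: n_def)
    moreover have "\<bar>A$2$1\<bar> \<le> K" "\<bar>A$2$2\<bar> \<le> K"
      using low[of "A$2$1" "A$2$2" 2] K1[of 2] d2 R by (auto simp: d_def)
    ultimately show "g \<in> moebius ` {A \<in> Gam. \<bar>A$1$1\<bar> \<le> K \<and> \<bar>A$1$2\<bar> \<le> K \<and> \<bar>A$2$1\<bar> \<le> K \<and> \<bar>A$2$2\<bar> \<le> K}"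
      using A(2) by blast
  qed
  have "finite {g \<in> G. \<exists>w\<in>B. g w \<in> B}"
    by (rule finite_subset[OF sub]) (intro finite_imageI finite_bounded_Gam)
  moreover have "B \<subseteq> uhp" using im(1) q by (fastforce simp: uhp_def)
  ultimately show ?thesis using q unfolding B_def by (intro exI[of _ "q / 2"]) auto
qed

definition free_points :: "complex set" where
  "free_points = {z \<in> uhp. \<forall>g\<in>G. g z = z \<longrightarrow> g = (\<lambda>z\<in>uhp. z)}"

lemma continuous_on_G: "g \<in> G \<Longrightarrow> continuous_on uhp g"
proof -
  assume "g \<in> G"
  then obtain A where A: "det A = (1::real)" "g = moebius A" using representative by blast
  have "continuous_on uhp (\<lambda>z. (of_real (A$1$1) * z + of_real (A$1$2)) / (of_real (A$2$1) * z + of_real (A$2$2)))"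
    using moebius_denom_nz[OF A(1)] by (intro continuous_intros) auto
  then show ?thesis unfolding A(2) by (rule continuous_on_eq) (simp add: moebius_def)
qed

lemma free_neighbourhood:
  assumes z: "z \<in> free_points"
  shows "\<exists>U. open U \<and> z \<in> U \<and> U \<subseteq> uhp \<and> (\<forall>g\<in>G. \<forall>w\<in>U. g w \<in> U \<longrightarrow> g = (\<lambda>z\<in>uhp. z))"
proof -
  have zu: "z \<in> uhp" using z by (simp add: free_points_def)
  obtain e where e: "e > 0" "ball z e \<subseteq> uhp" "finite {g \<in> G. \<exists>w\<in>ball z e. g w \<in> ball z e}"
    using locally_finite[OF zu] by auto
  define F where "F = {g \<in> G. \<exists>w\<in>ball z e. g w \<in> ball z e} - {\<lambda>z\<in>uhp. z}"
  have F: "finite F" using e(3) by (simp add: F_def)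
  have ex: "\<exists>V. open V \<and> z \<in> V \<and> V \<subseteq> ball z e \<and> (\<forall>w\<in>V. g w \<notin> V)" if g: "g \<in> F" for g
  proof -
    have gG: "g \<in> G" and ne: "g z \<noteq> z" using g z by (auto simp: F_def free_points_def)
    obtain P Q where PQ: "open P" "open Q" "g z \<in> P" "z \<in> Q" "P \<inter> Q = {}"
      using hausdorff[OF ne] by blast
    have "continuous_on (ball z e) g" using continuous_on_G[OF gG] e(2) continuous_on_subset by blast
    then have "open (ball z e \<inter> g -` P)" using PQ(1) by (simp add: continuous_on_open_vimage[of "ball z e"] Int_commute)
    then show ?thesis
      using PQ e(1) by (intro exI[of _ "ball z e \<inter> g -` P \<inter> Q"]) auto
  qed
  then obtain V where V: "\<And>g. g \<in> F \<Longrightarrow> open (V g) \<and> z \<in> V g \<and> V g \<subseteq> ball z e \<and> (\<forall>w\<in>V g. g w \<notin> V g)"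
    by metis
  show ?thesis
  proof (intro exI[of _ "ball z e \<inter> (\<Inter>g\<in>F. V g)"] conjI ballI impI)
    show "open (ball z e \<inter> (\<Inter>g\<in>F. V g))" using F V by (intro open_Int open_INT) auto
    show "z \<in> ball z e \<inter> (\<Inter>g\<in>F. V g)" using e(1) V by auto
    show "ball z e \<inter> (\<Inter>g\<in>F. V g) \<subseteq> uhp" using e(2) by auto
    fix g w assume a: "g \<in> G" "w \<in> ball z e \<inter> (\<Inter>g\<in>F. V g)" "g w \<in> ball z e \<inter> (\<Inter>g\<in>F. V g)"
    show "g = (\<lambda>z\<in>uhp. z)"
    proof (rule ccontr)
      assume "g \<noteq> (\<lambda>z\<in>uhp. z)"
      then have "g \<in> F" using a by (auto simp: F_def)
      then show False using V[of g] a by auto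
    qed
  qed
qed

text \<open>A fixed point in the upper half-plane solves a real quadratic equation, whose other solution is its
  complex conjugate.\<close>

lemma fixed_point_unique:
  assumes g: "g \<in> G" and z: "z \<in> uhp" "g z = z" and w: "w \<in> uhp" "g w = w" and ne: "g \<noteq> (\<lambda>z\<in>uhp. z)"
  shows "z = w"
proof -
  obtain A where A: "det A = (1::real)" "g = moebius A" using representative[OF g] by blast
  define a b c d where "a = A$1$1" and "b = A$1$2" and "c = A$2$1" and "d = A$2$2"
  have fp: "c * ((Re v)\<^sup>2 - (Im v)\<^sup>2) + (d - a) * Re v - b = 0" "2 * c * Re v + (d - a) = 0"
    if v: "v \<in> uhp" "g v = v" for v
  proof -
    have nz: "of_real c * v + of_real d \<noteq> 0" using moebius_denom_nz[OF A(1) v(1)] by (simp add: c_def d_def)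
    have "(of_real a * v + of_real b) / (of_real c * v + of_real d) = v"
      using v by (simp add: A(2) moebius_def a_def b_def c_def d_def)
    then have e: "of_real a * v + of_real b = v * (of_real c * v + of_real d)"
      using nz by (simp add: divide_eq_eq)
    have 1: "a * Re v + b = Re v * (c * Re v + d) - Im v * (c * Im v)"
      using arg_cong[OF e, of Re] by simp
    then show "c * ((Re v)\<^sup>2 - (Im v)\<^sup>2) + (d - a) * Re v - b = 0"
      by (simp add: power2_eq_square algebra_simps)
    have 2: "a * Im v = Re v * (c * Im v) + Im v * (c * Re v + d)"
      using arg_cong[OF e, of Im] by simp
    have "Im v * (2 * c * Re v + (d - a)) = 0" using 2 by (simp add: algebra_simps)
    then show "2 * c * Re v + (d - a) = 0" using v(1) by (simp add: uhp_def)
  qed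
  have c: "c \<noteq> 0"
  proof
    assume c0: "c = 0"
    then have da: "d = a" using fp(2)[OF z] by simp
    then have b0: "b = 0" using fp(1)[OF z] c0 by simp
    have "a * a = 1" using A(1) c0 b0 da by (simp add: det_2 a_def b_def c_def d_def)
    then have a0: "a \<noteq> 0" by auto
    have "g = (\<lambda>z\<in>uhp. z)"
    proof (rule G_eqI[OF g one_G])
      fix v assume "v \<in> uhp"
      then show "g v = (\<lambda>z\<in>uhp. z) v"
        using a0 c0 da b0 unfolding A(2) by (simp add: moebius_def a_def[symmetric] b_def[symmetric] c_def[symmetric] d_def[symmetric])
    qed
    then show False using ne by simp
  qed
  have "2 * c * Re z = 2 * c * Re w" using fp(2)[OF z] fp(2)[OF w] by linarith
  then have re: "Re z = Re w" using c by simp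
  have "c * ((Re z)\<^sup>2 - (Im z)\<^sup>2) = c * ((Re w)\<^sup>2 - (Im w)\<^sup>2)"
    using fp(1)[OF z] fp(1)[OF w] unfolding re by linarith
  then have "(Im z)\<^sup>2 = (Im w)\<^sup>2" using c re by simp
  then have "Im z = Im w" using z(1) w(1) by (simp add: uhp_def power2_eq_iff_nonneg)
  then show ?thesis using re by (simp add: complex_eq_iff)
qed

lemma countable_nonfree: "countable (uhp - free_points)"
proof -
  define f where "f g = (SOME z. z \<in> uhp \<and> g z = z)" for g :: "complex \<Rightarrow> complex"
  have "uhp - free_points \<subseteq> f ` G"
  proof
    fix z assume "z \<in> uhp - free_points"
    then obtain g where g: "z \<in> uhp" "g \<in> G" "g z = z" "g \<noteq> (\<lambda>z\<in>uhp. z)" by (auto simp: free_points_def)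
    have "f g \<in> uhp \<and> g (f g) = f g" unfolding f_def using g by (intro someI[of "\<lambda>z. z \<in> uhp \<and> g z = z" z]) auto
    then have "z = f g" using fixed_point_unique[of g z "f g"] g by blast
    then show "z \<in> f ` G" using g(2) by blast
  qed
  then show ?thesis using countable_G by (meson countable_image countable_subset)
qed

lemma free_points_invariant:
  assumes g: "g \<in> G" and z: "z \<in> uhp"
  shows "g z \<in> free_points \<longleftrightarrow> z \<in> free_points"
proof -
  have imp: "g z \<in> free_points" if g: "g \<in> G" and z: "z \<in> free_points" for g z
  proof -
    have zu: "z \<in> uhp" using z by (simp add: free_points_def)
    have "h = (\<lambda>z\<in>uhp. z)" if h: "h \<in> G" "h (g z) = g z" for h
    proof -
      define k where "k = compose uhp (m_inv Gr g) (compose uhp h g)"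
      have k: "k \<in> G" unfolding k_def using g h inverse_G(1) compose_G by blast
      have kz: "k v = m_inv Gr g (h (g v))" if "v \<in> uhp" for v
        using that by (simp add: k_def compose_def)
      have "k z = z" using kz[OF zu] h(2) inverse_G(2)[OF g zu] by simp
      then have kid: "k = (\<lambda>z\<in>uhp. z)" using z k by (auto simp: free_points_def)
      show ?thesis
      proof (rule G_eqI[OF h(1) one_G])
        fix v assume v: "v \<in> uhp"
        define v' where "v' = m_inv Gr g v"
        have v': "v' \<in> uhp" "g v' = v" using inverse_G[OF g] G_uhp v by (auto simp: v'_def)
        have "m_inv Gr g (h v) = v'" using kz[OF v'(1)] kid v' by simp
        then have "g (m_inv Gr g (h v)) = g v'" by simp
        then show "h v = (\<lambda>z\<in>uhp. z) v" using inverse_G(3)[OF g G_uhp[OF h(1) v]] v v' by simp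
      qed
    qed
    then show ?thesis using G_uhp[OF g zu] by (auto simp: free_points_def)
  qed
  show ?thesis
    using imp[OF g] imp[OF inverse_G(1)[OF g], of "g z"] inverse_G(2)[OF g z] by auto
qed

lemma measurable_preimage_G:
  assumes "g \<in> G" "U \<in> sets borel"
  shows "{z \<in> uhp. g z \<in> U} \<in> sets borel"
proof -
  have "g \<in> borel_measurable (restrict_space borel uhp)"
    using continuous_on_G[OF assms(1)] by (rule borel_measurable_continuous_on_restrict)
  then have "g -` U \<inter> space (restrict_space borel uhp) \<in> sets (restrict_space borel uhp)"
    using assms(2) by (rule measurable_sets)
  moreover have "uhp \<in> sets borel" unfolding uhp_def by measurable
  moreover have "g -` U \<inter> space (restrict_space borel uhp) = {z \<in> uhp. g z \<in> U}"
    by (auto simp: space_restrict_space)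
  ultimately show ?thesis by (simp add: sets_restrict_space_iff)
qed

text \<open>The free points have neighbourhoods that are disjoint from all their translates, and countably many
  of them, \<open>U 0, U 1, \<dots>\<close>, suffice. From every orbit take the point in the first \<open>U n\<close> that it meets.\<close>

lemma fundamental_set:
  obtains F where "F \<in> sets borel" "F \<subseteq> free_points" "\<And>z. z \<in> free_points \<Longrightarrow> \<exists>!g. g \<in> G \<and> g z \<in> F"
proof -
  have ub: "uhp \<in> sets borel" unfolding uhp_def by measurable
  have fb: "free_points \<in> sets borel"
  proof -
    have "uhp - free_points \<in> sets borel" by (rule sets.countable[OF _ countable_nonfree]) auto
    then have "uhp - (uhp - free_points) \<in> sets borel" using ub by blast
    moreover have "uhp - (uhp - free_points) = free_points" by (auto simp: free_points_def)
    ultimately show ?thesis by simp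
  qed
  have fu: "free_points \<subseteq> uhp" by (simp add: free_points_def)
  define \<U> where "\<U> = {U. open U \<and> U \<subseteq> uhp \<and> (\<forall>g\<in>G. \<forall>w\<in>U. g w \<in> U \<longrightarrow> g = (\<lambda>z\<in>uhp. z))}"
  obtain \<V> where V: "\<V> \<subseteq> \<U>" "countable \<V>" "\<Union>\<V> = \<Union>\<U>"
  proof (rule Lindelof[of \<U>])
    show "open S" if "S \<in> \<U>" for S using that by (simp add: \<U>_def)
  qed (use that in blast)
  have cov: "free_points \<subseteq> \<Union>\<V>" 
  proof
    fix z assume "z \<in> free_points"
    from free_neighbourhood[OF this] obtain U where U: "open U \<and> z \<in> U \<and> U \<subseteq> uhp \<and> (\<forall>g\<in>G. \<forall>w\<in>U. g w \<in> U \<longrightarrow> g = (\<lambda>z\<in>uhp. z))" ..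
    then have "U \<in> \<U>" unfolding \<U>_def mem_Collect_eq by (elim conjE) (intro conjI; assumption)
    then show "z \<in> \<Union>\<V>" unfolding V(3) using conjunct1[OF conjunct2[OF U]] by (rule UnionI)
  qed
  have "{} \<in> \<U>" by (simp add: \<U>_def)
  define U where "U = from_nat_into (insert {} \<V>)"
  have rU: "range U = insert {} \<V>" unfolding U_def using V(2) by (intro range_from_nat_into) simp_all
  have UU: "U n \<in> \<U>" for n
  proof -
    have "U n \<in> insert {} \<V>" unfolding rU[symmetric] by (rule rangeI)
    then show ?thesis using V(1) \<open>{} \<in> \<U>\<close> by (elim insertE) (simp_all add: subsetD)
  qed
  define F where "F = (\<Union>n. {z \<in> free_points. z \<in> U n \<and> (\<forall>m<n. \<forall>g\<in>G. g z \<notin> U m)})"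
  show thesis
  proof
    have Um: "{z \<in> free_points. z \<in> U n \<and> (\<forall>m<n. \<forall>g\<in>G. g z \<notin> U m)} \<in> sets borel" for n
    proof -
      have Ub: "U n \<in> sets borel" for n using UU[of n] by (simp add: \<U>_def)
      have "{z \<in> free_points. z \<in> U n \<and> (\<forall>m<n. \<forall>g\<in>G. g z \<notin> U m)}
          = free_points \<inter> U n - (\<Union>m<n. \<Union>g\<in>G. {z \<in> uhp. g z \<in> U m})"
        using fu by fast
      moreover have "(\<Union>m<n. \<Union>g\<in>G. {z \<in> uhp. g z \<in> U m}) \<in> sets borel"
        by (intro sets.finite_UN sets.countable_UN''[OF countable_G] measurable_preimage_G Ub finite_lessThan)
      moreover have "free_points \<inter> U n \<in> sets borel" using fb Ub by (rule sets.Int)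
      ultimately show ?thesis by (simp only: sets.Diff)
    qed
    show "F \<in> sets borel" unfolding F_def by (intro sets.countable_UN image_subsetI Um)
    show "F \<subseteq> free_points" by (auto simp: F_def)
    fix z assume z: "z \<in> free_points"
    then have zu: "z \<in> uhp" by (simp add: free_points_def)
    have "\<exists>n. \<exists>g\<in>G. g z \<in> U n"
    proof -
      obtain n where "z \<in> U n" using cov z rU by (metis UN_E Union_iff insertCI rangeE subsetD)
      then show ?thesis using one_G zu by (intro exI[of _ n] bexI[of _ "\<lambda>z\<in>uhp. z"]) auto
    qed
    then obtain n where n: "\<exists>g\<in>G. g z \<in> U n" and least: "\<And>m. m < n \<Longrightarrow> \<not> (\<exists>g\<in>G. g z \<in> U m)"
      using exists_least_iff[of "\<lambda>n. \<exists>g\<in>G. g z \<in> U n"] by blast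
    have orb: "(\<exists>h\<in>G. h (g z) \<in> U m) \<longleftrightarrow> (\<exists>h\<in>G. h z \<in> U m)" if g: "g \<in> G" for g m
    proof
      assume "\<exists>h\<in>G. h (g z) \<in> U m"
      then obtain h where "h \<in> G" "h (g z) \<in> U m" by blast
      then show "\<exists>h\<in>G. h z \<in> U m" using compose_G[of h g] g zu by (intro bexI[of _ "compose uhp h g"]) (auto simp: compose_def)
    next
      assume "\<exists>h\<in>G. h z \<in> U m"
      then obtain h where h: "h \<in> G" "h z \<in> U m" by blast
      have "compose uhp h (m_inv Gr g) (g z) = h z"
        using G_uhp[OF g zu] inverse_G(2)[OF g zu] by (simp add: compose_def)
      then show "\<exists>h\<in>G. h (g z) \<in> U m" using h compose_G[OF h(1) inverse_G(1)[OF g]]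
        by (intro bexI[of _ "compose uhp h (m_inv Gr g)"]) auto
    qed
    have inF: "g z \<in> F \<longleftrightarrow> g z \<in> U n" if g: "g \<in> G" for g
    proof
      assume "g z \<in> F"
      then obtain n' where n': "g z \<in> U n'" "\<forall>m<n'. \<forall>h\<in>G. h (g z) \<notin> U m" by (auto simp: F_def)
      have "\<not> n' < n" using least[of n'] n'(1) g by blast
      moreover have "\<not> n < n'" using n'(2) orb[OF g, of n] n by blast
      ultimately show "g z \<in> U n" using n'(1) by simp
    next
      assume u: "g z \<in> U n"
      have "\<forall>m<n. \<forall>h\<in>G. h (g z) \<notin> U m" using orb[OF g] least by blast
      moreover have "g z \<in> free_points" using free_points_invariant[OF g zu] z by simp
      ultimately show "g z \<in> F" using u by (auto simp: F_def)
    qed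
    obtain g where g: "g \<in> G" "g z \<in> U n" using n by blast
    show "\<exists>!g. g \<in> G \<and> g z \<in> F"
    proof (rule ex1I[of _ g])
      show "g \<in> G \<and> g z \<in> F" using g inF by blast
      fix h assume h: "h \<in> G \<and> h z \<in> F"
      then have hz: "h z \<in> U n" using inF by blast
      define k where "k = compose uhp h (m_inv Gr g)"
      have kG: "k \<in> G" unfolding k_def using h g inverse_G(1) compose_G by blast
      have kv: "k (g v) = h v" if "v \<in> uhp" for v
        using that G_uhp[OF g(1) that] inverse_G(2)[OF g(1) that] by (simp add: k_def compose_def)
      have "k = (\<lambda>z\<in>uhp. z)" 
      proof -
        have only: "\<forall>g\<in>G. \<forall>w\<in>U n. g w \<in> U n \<longrightarrow> g = (\<lambda>z\<in>uhp. z)"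
          using UU[of n] unfolding \<U>_def mem_Collect_eq by (elim conjE)
        have "k (g z) \<in> U n" using kv[OF zu] hz by (simp only:)
        then show ?thesis by (rule mp[OF bspec[OF bspec[OF only kG] g(2)]])
      qed
      then have "g v = h v" if "v \<in> uhp" for v using kv[OF that] G_uhp[OF g(1) that] by simp
      then show "h = g" using G_eqI h g by metis
    qed
  qed
qed

end

section \<open>The geodesic and the horocycle flow\<close>

lemma AE_triple_iff:
  fixes P :: "real \<times> real \<times> real \<Rightarrow> bool"
  assumes P: "{\<omega>. P \<omega>} \<in> sets borel"
  shows "(AE \<omega> in lborel. P \<omega>) \<longleftrightarrow> (AE x in lborel. AE u in lborel. AE s in lborel. P (x, u, s))"
proof -
  have 1: "{p \<in> space (lborel \<Otimes>\<^sub>M lborel). P (fst p, snd p)} \<in> sets (lborel \<Otimes>\<^sub>M (lborel :: (real \<times> real) measure))"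
    using P unfolding lborel_prod by simp
  have 2: "{p \<in> space (lborel \<Otimes>\<^sub>M lborel). P (x, fst p, snd p)} \<in> sets (lborel \<Otimes>\<^sub>M lborel)" for x
  proof -
    have "(\<lambda>p::real \<times> real. (x, p)) \<in> borel \<rightarrow>\<^sub>M borel"
      by (intro borel_measurable_continuous_onI continuous_intros)
    from measurable_sets[OF this P] show ?thesis unfolding lborel_prod by (simp add: vimage_def)
  qed
  have "(AE \<omega> in lborel. P \<omega>) \<longleftrightarrow> (AE \<omega> in lborel \<Otimes>\<^sub>M lborel. P (fst \<omega>, snd \<omega>))"
    unfolding lborel_prod by simp
  also have "\<dots> \<longleftrightarrow> (AE x in lborel. AE p in lborel. P (x, p))"
    by (rule lborel_pair.AE_pair_iff[symmetric, OF 1])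
  also have "\<dots> \<longleftrightarrow> (AE x in lborel. AE p in lborel \<Otimes>\<^sub>M lborel. P (x, fst p, snd p))"
    unfolding lborel_prod by simp
  also have "\<dots> \<longleftrightarrow> (AE x in lborel. AE u in lborel. AE s in lborel. P (x, u, s))"
    by (intro AE_cong lborel_pair.AE_pair_iff[symmetric] 2)
  finally show ?thesis .
qed

definition flow :: "real \<Rightarrow> real \<times> real \<times> real \<Rightarrow> real \<times> real \<times> real" where
  "flow t \<omega> = (case \<omega> of (x, u, s) \<Rightarrow> (x, u, s + t))"

text \<open>Vectors pointing to the same \<open>x\<close> whose base points lie on a common horocycle at \<open>x\<close> have the same
  \<open>x\<close> and \<open>s\<close>. The factor \<open>exp s\<close> makes the parameter \<open>r\<close> the length along the horocycle, so that the
  flow commutes with the isometries.\<close>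

definition horo :: "real \<Rightarrow> real \<times> real \<times> real \<Rightarrow> real \<times> real \<times> real" where
  "horo r \<omega> = (case \<omega> of (x, u, s) \<Rightarrow> (x, u + r * exp s, s))"

lemma flow_measurable[measurable]: "flow t \<in> borel_measurable borel"
proof -
  have "(\<lambda>\<omega>::real \<times> real \<times> real. (fst \<omega>, fst (snd \<omega>), snd (snd \<omega>) + t)) \<in> borel_measurable (borel \<Otimes>\<^sub>M (borel \<Otimes>\<^sub>M borel))"
    by measurable
  then show ?thesis unfolding flow_def[abs_def] case_prod_beta' borel_prod .
qed

lemma horo_measurable[measurable]: "horo r \<in> borel_measurable borel"
proof -
  have "(\<lambda>\<omega>::real \<times> real \<times> real. (fst \<omega>, fst (snd \<omega>) + r * exp (snd (snd \<omega>)), snd (snd \<omega>))) \<in> borel_measurable (borel \<Otimes>\<^sub>M (borel \<Otimes>\<^sub>M borel))"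
    by measurable
  then show ?thesis unfolding horo_def[abs_def] case_prod_beta' borel_prod .
qed

lemma nn_integral_flow:
  fixes f :: "real \<times> real \<times> real \<Rightarrow> ennreal"
  assumes f[measurable]: "f \<in> borel_measurable borel"
  shows "(\<integral>\<^sup>+\<omega>. f (flow t \<omega>) \<partial>lborel) = (\<integral>\<^sup>+\<omega>. f \<omega> \<partial>lborel)"
proof -
  have f'[measurable]: "f \<in> borel_measurable (borel \<Otimes>\<^sub>M (borel \<Otimes>\<^sub>M borel))"
    using f by (simp add: borel_prod)
  have "(\<integral>\<^sup>+\<omega>. f (flow t \<omega>) \<partial>lborel) = (\<integral>\<^sup>+x. \<integral>\<^sup>+u. \<integral>\<^sup>+s. f (flow t (x, u, s)) \<partial>lborel \<partial>lborel \<partial>lborel)"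
    by (rule nn_integral_triple) measurable
  also have "\<dots> = (\<integral>\<^sup>+x. \<integral>\<^sup>+u. \<integral>\<^sup>+s. f (x, u, s) \<partial>lborel \<partial>lborel \<partial>lborel)"
  proof (rule nn_integral_cong, rule nn_integral_cong)
    fix x u :: real
    show "(\<integral>\<^sup>+s. f (flow t (x, u, s)) \<partial>lborel) = (\<integral>\<^sup>+s. f (x, u, s) \<partial>lborel)"
      using nn_integral_real_affine[of "\<lambda>s. f (x, u, s)" 1 t] by (simp add: flow_def add.commute)
  qed
  also have "\<dots> = (\<integral>\<^sup>+\<omega>. f \<omega> \<partial>lborel)" by (rule nn_integral_triple[symmetric]) measurable
  finally show ?thesis .
qed

lemma base_vec_coords:
  assumes z: "z \<in> uhp"
  shows "geo (vec_coords z m) 0 = z"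
proof -
  define q where "q = Im z"
  have q: "q > 0" using z by (simp add: q_def uhp_def)
  have M: "1 + m\<^sup>2 > 0" by (simp add: add_pos_nonneg)
  define v where "v = 1 / (q * (1 + m\<^sup>2))"
  have v: "v > 0" using q M by (simp add: v_def)
  have es: "exp (- ln (q * (1 + m\<^sup>2))) = v" using q M by (simp add: exp_minus v_def inverse_eq_divide)
  have um: "m / (q * (1 + m\<^sup>2)) = m * v" by (simp add: v_def)
  have N: "(m * v)\<^sup>2 + v\<^sup>2 = v / q"
  proof -
    have "(m * v)\<^sup>2 + v\<^sup>2 = v * (v * (1 + m\<^sup>2))" by (simp add: power2_eq_square algebra_simps)
    also have "v * (1 + m\<^sup>2) = 1 / q" using M q by (simp add: v_def)
    finally show ?thesis by simp
  qed
  have "Re (geo (Re z + m * q, m * v, - ln (q * (1 + m\<^sup>2))) 0) = Re z"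
    unfolding Re_geo add_0_right es N using v q by simp
  moreover have "Im (geo (Re z + m * q, m * v, - ln (q * (1 + m\<^sup>2))) 0) = q"
    unfolding Im_geo add_0_right es N using v q by simp
  ultimately show ?thesis
    unfolding vec_coords_def q_def[symmetric] um by (simp add: complex_eq_iff q_def)
qed

lemma nn_integral_cauchy_finite: "(\<integral>\<^sup>+m. ennreal (1 / (1 + m\<^sup>2)) \<partial>lborel) < \<infinity>"
proof -
  let ?f = "\<lambda>m::real. ennreal (1 / (1 + m\<^sup>2))"
  have p: "1 + m\<^sup>2 > (0::real)" for m by (simp add: add_pos_nonneg)
  have h: "(\<integral>\<^sup>+m. ?f m * indicator {0..} m \<partial>lborel) = ennreal (pi / 2 - arctan 0)"
  proof (rule nn_integral_FTC_atLeast)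
    show "(arctan has_real_derivative 1 / (1 + x\<^sup>2)) (at x)" for x :: real
      using DERIV_arctan[of x] by (simp add: inverse_eq_divide)
    show "(arctan \<longlongrightarrow> pi / 2) at_top" by (rule tendsto_arctan_at_top)
  qed (use p in \<open>auto intro: less_imp_le\<close>)
  have n: "(\<integral>\<^sup>+m. ?f m * indicator {..0} m \<partial>lborel) = (\<integral>\<^sup>+m. ?f m * indicator {0..} m \<partial>lborel)"
    using nn_integral_real_affine[of "\<lambda>m. ?f m * indicator {..0} m" "-1" 0] by (simp add: indicator_def)
  have "(\<integral>\<^sup>+m. ?f m \<partial>lborel) \<le> (\<integral>\<^sup>+m. ?f m * indicator {..0} m + ?f m * indicator {0..} m \<partial>lborel)"
    by (intro nn_integral_mono) (auto simp: indicator_def)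
  also have "\<dots> = (\<integral>\<^sup>+m. ?f m * indicator {..0} m \<partial>lborel) + (\<integral>\<^sup>+m. ?f m * indicator {0..} m \<partial>lborel)"
    by (rule nn_integral_add) auto
  also have "\<dots> < \<infinity>" unfolding n h by simp
  finally show ?thesis .
qed

lemma geo_through_point:
  assumes "geo (x, u, s) t = z"
  shows "u = Re (- 1 / (z - complex_of_real x))"
  using geo_inversion[of x u s t] assms by simp

lemma AE_avoids_point: "AE \<omega>::real \<times> real \<times> real in lborel. fst (snd \<omega>) \<noteq> Re (- 1 / (z - complex_of_real (fst \<omega>)))"
proof (rule iffD2[OF AE_triple_iff])
  have "(\<lambda>\<omega>. fst (snd \<omega>) - Re (- 1 / (z - complex_of_real (fst \<omega>)))) \<in> borel_measurable (borel \<Otimes>\<^sub>M (borel \<Otimes>\<^sub>M (borel :: real measure)))"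
    by measurable
  then have m: "(\<lambda>\<omega>::real \<times> real \<times> real. fst (snd \<omega>) - Re (- 1 / (z - complex_of_real (fst \<omega>)))) \<in> borel_measurable borel"
    by (simp only: borel_prod)
  have "(\<lambda>\<omega>::real \<times> real \<times> real. fst (snd \<omega>) - Re (- 1 / (z - complex_of_real (fst \<omega>)))) -` (- {0}) \<inter> space borel \<in> sets borel"
    by (rule measurable_sets[OF m]) auto
  moreover have "(\<lambda>\<omega>::real \<times> real \<times> real. fst (snd \<omega>) - Re (- 1 / (z - complex_of_real (fst \<omega>)))) -` (- {0}) \<inter> space borel
      = {\<omega>. fst (snd \<omega>) \<noteq> Re (- 1 / (z - complex_of_real (fst \<omega>)))}" by auto
  ultimately show "{\<omega>::real \<times> real \<times> real. fst (snd \<omega>) \<noteq> Re (- 1 / (z - complex_of_real (fst \<omega>)))} \<in> sets borel"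
    by (simp only:)
  show "AE x in lborel. AE u in lborel. AE s in lborel. fst (snd (x, u, s)) \<noteq> Re (- 1 / (z - complex_of_real (fst (x, u, s))))"
    unfolding fst_conv snd_conv
    by (rule AE_I2, rule AE_mp[OF AE_lborel_singleton], rule AE_I2, rule impI, rule AE_I2)
qed

context fuchsian_group
begin

text \<open>The geodesics none of whose translates goes up to infinity. On them the group acts through the
  coordinates; the others form a null set.\<close>

definition X0 :: "(real \<times> real \<times> real) set" where
  "X0 = {\<omega>. \<forall>A\<in>Gam. A$2$1 * fst \<omega> + A$2$2 \<noteq> 0}"

definition M :: "(real \<times> real \<times> real) measure" where "M = restrict_space lborel X0"

definition rep :: "(complex \<Rightarrow> complex) \<Rightarrow> real^2^2" where
  "rep g = (SOME A. det A = 1 \<and> g = moebius A)"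

definition act :: "(complex \<Rightarrow> complex) \<Rightarrow> real \<times> real \<times> real \<Rightarrow> real \<times> real \<times> real" where
  "act g = moebius_coords (rep g)"

lemma rep: assumes "g \<in> G" shows "det (rep g) = 1" "moebius (rep g) = g" "rep g \<in> Gam"
proof -
  have "det (rep g) = 1 \<and> g = moebius (rep g)"
    unfolding rep_def by (rule someI_ex[OF representative[OF assms]])
  then show "det (rep g) = 1" "moebius (rep g) = g" "rep g \<in> Gam" using assms by (auto simp: Gam_def)
qed

lemma geo_act: "g \<in> G \<Longrightarrow> \<omega> \<in> X0 \<Longrightarrow> geo (act g \<omega>) t = g (geo \<omega> t)"
  using rep[of g] moebius_geo[of "rep g" "fst \<omega>" "fst (snd \<omega>)" "snd (snd \<omega>)" t] by (simp add: X0_def act_def)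

lemma X0_iff: "\<omega> \<in> X0 \<longleftrightarrow> (\<forall>g\<in>G. \<exists>\<omega>'. \<forall>t. g (geo \<omega> t) = geo \<omega>' t)"
proof
  assume "\<omega> \<in> X0"
  then show "\<forall>g\<in>G. \<exists>\<omega>'. \<forall>t. g (geo \<omega> t) = geo \<omega>' t" using geo_act by metis
next
  assume R: "\<forall>g\<in>G. \<exists>\<omega>'. \<forall>t. g (geo \<omega> t) = geo \<omega>' t"
  obtain x u s where w: "\<omega> = (x, u, s)" by (cases \<omega>) auto
  show "\<omega> \<in> X0" unfolding X0_def mem_Collect_eq
  proof (intro ballI notI)
    fix A assume A: "A \<in> Gam" and j: "A$2$1 * fst \<omega> + A$2$2 = 0"
    then have d: "det A = 1" "moebius A \<in> G" by (auto simp: Gam_def)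
    obtain \<omega>' where e: "\<forall>t. moebius A (geo \<omega> t) = geo \<omega>' t" using R d(2) by blast
    obtain y r where f: "\<forall>t. moebius A (geo (x, u, s) t) = Complex y (exp (r + t))"
      using moebius_geo_vertical[OF d(1), of x u s] j w by auto
    have "geo \<omega>' = (\<lambda>t. Complex y (exp (r + t)))" using e f w by auto
    then show False using geo_ne_vertical by blast
  qed
qed

lemma act_X0: assumes g: "g \<in> G" and w: "\<omega> \<in> X0" shows "act g \<omega> \<in> X0"
  unfolding X0_iff
proof
  fix h assume h: "h \<in> G"
  have "h (geo (act g \<omega>) t) = geo (act (compose uhp h g) \<omega>) t" for t
    unfolding geo_act[OF g w] geo_act[OF compose_G[OF h g] w] using geo_in_uhp by (simp add: compose_def)
  then show "\<exists>\<omega>'. \<forall>t. h (geo (act g \<omega>) t) = geo \<omega>' t" by blast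
qed

lemma act_compose: "g \<in> G \<Longrightarrow> h \<in> G \<Longrightarrow> \<omega> \<in> X0 \<Longrightarrow> act (compose uhp g h) \<omega> = act g (act h \<omega>)"
  by (rule geo_inj, rule ext) (simp add: geo_act act_X0 compose_G compose_eq geo_in_uhp)

lemma act_id: "\<omega> \<in> X0 \<Longrightarrow> act (\<lambda>z\<in>uhp. z) \<omega> = \<omega>"
  by (rule geo_inj, rule ext) (simp add: geo_act one_G geo_in_uhp)

lemma countable_Gam: "countable Gam" by (rule discrete_countable[OF disc])

lemma X0_borel[measurable]: "X0 \<in> sets borel"
proof -
  have "{\<omega>. A$2$1 * fst \<omega> + A$2$2 = 0} \<in> sets (borel :: (real \<times> real \<times> real) measure)" for A :: "real^2^2"
    by (intro borel_closed closed_Collect_eq continuous_intros)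
  then have "(\<Union>A\<in>Gam. {\<omega>. A$2$1 * fst \<omega> + A$2$2 = 0}) \<in> sets (borel :: (real \<times> real \<times> real) measure)"
    by (intro sets.countable_UN''[OF countable_Gam])
  then have "- (\<Union>A\<in>Gam. {\<omega>. A$2$1 * fst \<omega> + A$2$2 = 0}) \<in> sets (borel :: (real \<times> real \<times> real) measure)" by (rule borel_comp)
  moreover have "X0 = - (\<Union>A\<in>Gam. {\<omega>. A$2$1 * fst \<omega> + A$2$2 = 0})" by (auto simp: X0_def)
  ultimately show ?thesis by simp
qed

lemma AE_X0: "AE \<omega> in lborel. \<omega> \<in> X0"
proof (subst AE_triple_iff)
  show "{\<omega>. \<omega> \<in> X0} \<in> sets borel" by simp
  have "AE x in lborel. \<forall>A\<in>Gam. A$2$1 * x + A$2$2 \<noteq> 0"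
  proof (subst AE_ball_countable[OF countable_Gam], rule ballI)
    fix A assume "A \<in> Gam"
    then have "A$2$1 \<noteq> 0 \<or> A$2$2 \<noteq> 0" by (auto simp: Gam_def det_2)
    then show "AE x in lborel. A$2$1 * x + A$2$2 \<noteq> 0" by (rule linear_form_null)
  qed
  then show "AE x in lborel. AE u in lborel. AE s in lborel. (x, u, s) \<in> X0"
    by (rule AE_mp) (auto simp: X0_def)
qed

lemma space_M[simp]: "space M = X0" by (simp add: M_def space_restrict_space)

lemma sets_M: "A \<in> sets M \<longleftrightarrow> A \<in> sets borel \<and> A \<subseteq> X0"
  unfolding M_def by (subst sets_restrict_space_iff) auto

lemma emeasure_M: "A \<subseteq> X0 \<Longrightarrow> emeasure M A = emeasure lborel A"
  unfolding M_def by (rule emeasure_restrict_space) auto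

lemma borel_measurable_M: "f \<in> borel_measurable borel \<Longrightarrow> f \<in> measurable M borel"
  unfolding M_def by (rule measurable_restrict_space1) simp

lemma nn_integral_M:
  assumes f: "f \<in> borel_measurable borel"
  shows "(\<integral>\<^sup>+\<omega>. f \<omega> \<partial>M) = (\<integral>\<^sup>+\<omega>. f \<omega> \<partial>lborel)"
proof -
  have "(\<integral>\<^sup>+\<omega>. f \<omega> \<partial>M) = (\<integral>\<^sup>+\<omega>. f \<omega> * indicator X0 \<omega> \<partial>lborel)"
    unfolding M_def by (rule nn_integral_restrict_space) simp
  also have "\<dots> = (\<integral>\<^sup>+\<omega>. f \<omega> \<partial>lborel)"
    by (rule nn_integral_cong_AE, rule AE_mp[OF AE_X0]) simp
  finally show ?thesis .
qed

lemma AE_M_iff: "(AE \<omega> in M. P \<omega>) \<longleftrightarrow> (AE \<omega> in lborel. P \<omega>)"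
proof -
  have "(AE \<omega> in M. P \<omega>) \<longleftrightarrow> (AE \<omega> in lborel. \<omega> \<in> X0 \<longrightarrow> P \<omega>)"
    unfolding M_def by (subst AE_restrict_space_iff) auto
  also have "\<dots> \<longleftrightarrow> (AE \<omega> in lborel. P \<omega>)"
  proof
    assume "AE \<omega> in lborel. \<omega> \<in> X0 \<longrightarrow> P \<omega>"
    with AE_X0 show "AE \<omega> in lborel. P \<omega>" by eventually_elim simp
  next
    assume "AE \<omega> in lborel. P \<omega>"
    then show "AE \<omega> in lborel. \<omega> \<in> X0 \<longrightarrow> P \<omega>" by eventually_elim simp
  qed
  finally show ?thesis .
qed

lemma preserving_map:
  assumes T[measurable]: "T \<in> borel_measurable borel" and X: "\<And>\<omega>. \<omega> \<in> X0 \<Longrightarrow> T \<omega> \<in> X0"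
    and int: "\<And>f. f \<in> borel_measurable borel \<Longrightarrow> (\<integral>\<^sup>+\<omega>. f (T \<omega>) \<partial>lborel) = (\<integral>\<^sup>+\<omega>. f \<omega> \<partial>lborel)"
  shows "T \<in> M \<rightarrow>\<^sub>M M" "distr M M T = M"
proof -
  show TM: "T \<in> M \<rightarrow>\<^sub>M M"
    unfolding M_def using X by (intro measurable_restrict_space2 measurable_restrict_space1) (auto simp: space_restrict_space)
  show "distr M M T = M"
  proof (rule measure_eqI)
    fix A assume "A \<in> sets (distr M M T)"
    then have A: "A \<in> sets M" by simp
    then have Ab[measurable]: "A \<in> sets borel" by (simp add: sets_M)
    have "emeasure (distr M M T) A = emeasure M (T -` A \<inter> space M)" by (rule emeasure_distr[OF TM A])
    also have "\<dots> = (\<integral>\<^sup>+\<omega>. indicator (T -` A \<inter> space M) \<omega> \<partial>M)"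
      using measurable_sets[OF TM A] by simp
    also have "\<dots> = (\<integral>\<^sup>+\<omega>. indicator A (T \<omega>) \<partial>M)"
      by (rule nn_integral_cong) (simp add: indicator_def)
    also have "\<dots> = (\<integral>\<^sup>+\<omega>. indicator A (T \<omega>) \<partial>lborel)" by (rule nn_integral_M) measurable
    also have "\<dots> = (\<integral>\<^sup>+\<omega>. indicator A \<omega> \<partial>lborel)" by (rule int) measurable
    also have "\<dots> = emeasure M A" using A by (simp add: emeasure_M sets_M)
    finally show "emeasure (distr M M T) A = emeasure M A" .
  qed simp
qed

lemma act_preserving: "g \<in> G \<Longrightarrow> act g \<in> M \<rightarrow>\<^sub>M M" "g \<in> G \<Longrightarrow> distr M M (act g) = M"
  using preserving_map[of "act g"] act_X0 rep(1) nn_integral_moebius_coords by (simp_all add: act_def)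

lemma flow_X0[simp]: "flow t \<omega> \<in> X0 \<longleftrightarrow> \<omega> \<in> X0" by (cases \<omega>) (simp add: X0_def flow_def)

lemma horo_X0[simp]: "horo r \<omega> \<in> X0 \<longleftrightarrow> \<omega> \<in> X0" by (cases \<omega>) (simp add: X0_def horo_def)

lemma flow_preserving: "flow t \<in> M \<rightarrow>\<^sub>M M" "distr M M (flow t) = M"
  using preserving_map[of "flow t"] nn_integral_flow by simp_all

lemma flow_act: "flow t (act g \<omega>) = act g (flow t \<omega>)"
  by (cases \<omega>) (simp add: act_def moebius_coords_def flow_def)

lemma horo_act: "g \<in> G \<Longrightarrow> \<omega> \<in> X0 \<Longrightarrow> horo r (act g \<omega>) = act g (horo r \<omega>)"
proof -
  assume g: "g \<in> G" and w: "\<omega> \<in> X0"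
  obtain x u s where e: "\<omega> = (x, u, s)" by (cases \<omega>) auto
  define j where "j = rep g $2$1 * x + rep g $2$2"
  have j: "j \<noteq> 0" using rep(3)[OF g] w by (auto simp: X0_def e j_def)
  have "exp (s + 2 * ln \<bar>j\<bar>) = exp s * (exp (ln \<bar>j\<bar>) * exp (ln \<bar>j\<bar>))" by (simp add: exp_add[symmetric])
  also have "\<dots> = exp s * j\<^sup>2" using j by (simp add: power2_eq_square)
  finally show ?thesis
    unfolding e act_def moebius_coords_def horo_def prod.case j_def[symmetric] by (simp add: algebra_simps)
qed

text \<open>Only countably many points have a nontrivial stabilizer, and through a given point there is one
  value of \<open>u\<close> for every \<open>x\<close>.\<close>

lemma AE_free: "AE \<omega> in lborel. \<forall>t. geo \<omega> t \<in> free_points"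
proof -
  have "AE \<omega>::real \<times> real \<times> real in lborel. \<forall>z\<in>uhp - free_points. fst (snd \<omega>) \<noteq> Re (- 1 / (z - complex_of_real (fst \<omega>)))"
    by (subst AE_ball_countable[OF countable_nonfree]) (intro ballI AE_avoids_point)
  then show ?thesis
  proof eventually_elim
    case (elim \<omega>)
    obtain x u s where e: "\<omega> = (x, u, s)" by (cases \<omega>) auto
    show ?case
    proof
      fix t show "geo \<omega> t \<in> free_points"
        using elim geo_through_point[of x u s t "geo \<omega> t"] geo_in_uhp[of \<omega> t] by (auto simp: e)
    qed
  qed
qed

definition fundamental_points :: "complex set" where
  "fundamental_points = (SOME F. F \<in> sets borel \<and> F \<subseteq> free_points \<and> (\<forall>z\<in>free_points. \<exists>!g. g \<in> G \<and> g z \<in> F))"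

lemma fundamental_points: "fundamental_points \<in> sets borel" "fundamental_points \<subseteq> free_points" "z \<in> free_points \<Longrightarrow> \<exists>!g. g \<in> G \<and> g z \<in> fundamental_points"
proof -
  have "\<exists>F. F \<in> sets borel \<and> F \<subseteq> free_points \<and> (\<forall>z\<in>free_points. \<exists>!g. g \<in> G \<and> g z \<in> F)"
    using fundamental_set by metis
  from someI_ex[OF this] show "fundamental_points \<in> sets borel" "fundamental_points \<subseteq> free_points" "z \<in> free_points \<Longrightarrow> \<exists>!g. g \<in> G \<and> g z \<in> fundamental_points"
    unfolding fundamental_points_def[symmetric] by auto
qed

lemma inj_proj_fundamental_points: "inj_on (proj G) fundamental_points"
proof (rule inj_onI)
  fix z w assume z: "z \<in> fundamental_points" and w: "w \<in> fundamental_points" and e: "proj G z = proj G w"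
  have zf: "z \<in> free_points" using z fundamental_points(2) by blast
  then have zu: "z \<in> uhp" by (simp add: free_points_def)
  have wu: "w \<in> uhp" using w fundamental_points(2) by (auto simp: free_points_def)
  have "w \<in> proj G w" unfolding proj_def using one_G wu by (intro image_eqI[of _ _ "\<lambda>z\<in>uhp. z"]) auto
  then obtain g where g: "g \<in> G" "w = g z" unfolding e[symmetric] by (auto simp: proj_def)
  have "g = (\<lambda>z\<in>uhp. z)"
    using fundamental_points(3)[OF zf] g w z one_G zu by (metis (no_types, lifting) restrict_apply')
  then show "z = w" using g zu by simp
qed

definition D :: "(real \<times> real \<times> real) set" where "D = {\<omega> \<in> X0. geo \<omega> 0 \<in> fundamental_points}"

lemma geo_measurable[measurable]: "(\<lambda>\<omega>. geo \<omega> t) \<in> borel_measurable borel"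
proof -
  have "(\<lambda>\<omega>. complex_of_real (fst \<omega>) - 1 / (complex_of_real (fst (snd \<omega>)) + \<i> * complex_of_real (exp (snd (snd \<omega>) + t)))) \<in> borel_measurable (borel \<Otimes>\<^sub>M (borel \<Otimes>\<^sub>M borel))"
    by measurable
  then show ?thesis unfolding geo_def[abs_def] case_prod_beta' borel_prod Complex_eq .
qed

lemma D_sets: "D \<in> sets M"
proof -
  have "(\<lambda>\<omega>. geo \<omega> 0) -` fundamental_points \<inter> space borel \<in> sets borel" by (rule measurable_sets[OF geo_measurable fundamental_points(1)])
  then have "(\<lambda>\<omega>. geo \<omega> 0) -` fundamental_points \<inter> X0 \<in> sets borel" by auto
  moreover have "D = (\<lambda>\<omega>. geo \<omega> 0) -` fundamental_points \<inter> X0" by (auto simp: D_def)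
  ultimately show ?thesis by (simp add: sets_M)
qed

lemma D_fundamental: "AE \<omega> in M. (\<integral>\<^sup>+g. indicator D (act g \<omega>) \<partial>count_space (carrier Gr)) = 1"
  unfolding AE_M_iff using AE_free AE_X0
proof eventually_elim
  case (elim \<omega>)
  obtain g0 where g0: "g0 \<in> G" "g0 (geo \<omega> 0) \<in> fundamental_points" and uni: "\<And>g. g \<in> G \<Longrightarrow> g (geo \<omega> 0) \<in> fundamental_points \<Longrightarrow> g = g0"
    using fundamental_points(3)[of "geo \<omega> 0"] elim(1) by blast
  have "(\<integral>\<^sup>+g. indicator D (act g \<omega>) \<partial>count_space G) = (\<integral>\<^sup>+g. indicator {g0} g \<partial>count_space G)"
  proof (rule nn_integral_cong)
    fix g assume "g \<in> space (count_space G)"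
    then have g: "g \<in> G" by simp
    have "act g \<omega> \<in> D \<longleftrightarrow> g (geo \<omega> 0) \<in> fundamental_points" using act_X0[OF g elim(2)] geo_act[OF g elim(2)] by (simp add: D_def)
    also have "\<dots> \<longleftrightarrow> g = g0" using g0 uni[OF g] by blast
    finally show "(indicator D (act g \<omega>) :: ennreal) = indicator {g0} g" by (simp add: indicator_def)
  qed
  also have "\<dots> = 1" using g0 by simp
  finally show ?case by simp
qed

end

locale fuchsian_finite = fuchsian_group +
  assumes finite_area: "finite_area G"
begin

lemma hyp_area_fundamental_points: "emeasure hyp_area fundamental_points < \<infinity>"
proof -
  have sp: "space hyp_area = uhp" by (simp add: hyp_area_def space_restrict_space)
  have sF: "fundamental_points \<in> sets hyp_area"
    using fundamental_points by (auto simp: hyp_area_def sets_restrict_space_iff free_points_def)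
  have top: "proj G ` uhp \<in> sets (quotient_measure hyp_area (proj G))"
    using sets.top[of "quotient_measure hyp_area (proj G)"] by (simp add: sp)
  have "emeasure hyp_area fundamental_points \<le> emeasure (quotient_measure hyp_area (proj G)) (proj G ` uhp)"
    unfolding emeasure_quotient_measure[OF top]
    by (rule SUP_upper) (use sF inj_proj_fundamental_points sets.sets_into_space[OF sF] sp in auto)
  also have "\<dots> < \<infinity>" using finite_area by (simp add: finite_area_def)
  finally show ?thesis .
qed

text \<open>In the coordinates of \<open>nn_integral_vec_coords\<close> the measure is the area of the fundamental set times
  the total mass of the directions.\<close>

lemma D_finite: "emeasure M D < \<infinity>"
proof -
  note fundamental_points(1)[measurable]
  have sp: "space hyp_area = uhp" by (simp add: hyp_area_def space_restrict_space)
  have sF: "fundamental_points \<in> sets hyp_area"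
    using fundamental_points by (auto simp: hyp_area_def sets_restrict_space_iff free_points_def)
  have gm: "(\<lambda>\<omega>. indicator fundamental_points (geo \<omega> 0) :: ennreal) \<in> borel_measurable borel" by measurable
  have "emeasure M D = (\<integral>\<^sup>+\<omega>. indicator D \<omega> \<partial>M)" using D_sets by simp
  also have "\<dots> \<le> (\<integral>\<^sup>+\<omega>. indicator fundamental_points (geo \<omega> 0) \<partial>M)"
    by (rule nn_integral_mono) (simp add: indicator_def D_def)
  also have "\<dots> = (\<integral>\<^sup>+\<omega>. indicator fundamental_points (geo \<omega> 0) \<partial>lborel)" by (rule nn_integral_M[OF gm])
  also have "\<dots> = (\<integral>\<^sup>+z. (\<integral>\<^sup>+m. ennreal (1 / (1 + m\<^sup>2)) * indicator fundamental_points (geo (vec_coords z m) 0) \<partial>lborel) \<partial>hyp_area)"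
    by (rule nn_integral_vec_coords[OF gm])
  also have "\<dots> = (\<integral>\<^sup>+z. (\<integral>\<^sup>+m. ennreal (1 / (1 + m\<^sup>2)) \<partial>lborel) * indicator fundamental_points z \<partial>hyp_area)"
    by (rule nn_integral_cong) (simp add: sp base_vec_coords nn_integral_multc)
  also have "\<dots> = (\<integral>\<^sup>+m. ennreal (1 / (1 + m\<^sup>2)) \<partial>lborel) * emeasure hyp_area fundamental_points"
    by (rule nn_integral_cmult_indicator[OF sF])
  also have "\<dots> < \<infinity>"
    using nn_integral_cauchy_finite hyp_area_fundamental_points by (simp add: ennreal_mult_less_top)
  finally show ?thesis .
qed

sublocale measured_action Gr M act D
proof (unfold_locales)
  interpret g: group Gr by (rule group_Gr)
  show "\<And>x y. x \<in> carrier Gr \<Longrightarrow> y \<in> carrier Gr \<Longrightarrow> x \<otimes>\<^bsub>Gr\<^esub> y \<in> carrier Gr" by (rule g.m_closed)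
  show "\<And>x y z. x \<in> carrier Gr \<Longrightarrow> y \<in> carrier Gr \<Longrightarrow> z \<in> carrier Gr \<Longrightarrow> x \<otimes>\<^bsub>Gr\<^esub> y \<otimes>\<^bsub>Gr\<^esub> z = x \<otimes>\<^bsub>Gr\<^esub> (y \<otimes>\<^bsub>Gr\<^esub> z)" by (rule g.m_assoc)
  show "\<one>\<^bsub>Gr\<^esub> \<in> carrier Gr" by (rule g.one_closed)
  show "\<And>x. x \<in> carrier Gr \<Longrightarrow> \<one>\<^bsub>Gr\<^esub> \<otimes>\<^bsub>Gr\<^esub> x = x" by (rule g.l_one)
  show "\<And>x. x \<in> carrier Gr \<Longrightarrow> x \<otimes>\<^bsub>Gr\<^esub> \<one>\<^bsub>Gr\<^esub> = x" by (rule g.r_one)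
  show "carrier Gr \<subseteq> Units Gr" by (rule g.Units)
  show "countable (carrier Gr)" using countable_G by simp
  show "\<And>g. g \<in> carrier Gr \<Longrightarrow> act g \<in> M \<rightarrow>\<^sub>M M" using act_preserving(1) by simp
  show "\<And>g. g \<in> carrier Gr \<Longrightarrow> distr M M (act g) = M" using act_preserving(2) by simp
  show "\<And>x. x \<in> space M \<Longrightarrow> act \<one>\<^bsub>Gr\<^esub> x = x" using act_id by (simp add: one_Gr)
  show "\<And>g h x. g \<in> carrier Gr \<Longrightarrow> h \<in> carrier Gr \<Longrightarrow> x \<in> space M \<Longrightarrow> act (g \<otimes>\<^bsub>Gr\<^esub> h) x = act g (act h x)"
    using act_compose by (simp add: mult_Gr)
  show "D \<in> sets M" by (rule D_sets)
  show "AE x in M. (\<integral>\<^sup>+g. indicator D (act g x) \<partial>count_space (carrier Gr)) = 1" by (rule D_fundamental)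
  show "emeasure M D < \<infinity>" by (rule D_finite)
qed

end

section \<open>Ergodicity of the geodesic flow\<close>

lemma AE_lborel_ex:
  fixes P :: "'a::euclidean_space \<Rightarrow> bool"
  assumes "AE x in lborel. P x"
  shows "\<exists>x. P x"
proof (rule ccontr)
  assume "\<not> ?thesis"
  then have "AE x::'a in lborel. False" using assms by auto
  then have "(UNIV :: 'a set) \<in> null_sets lborel" using AE_iff_null[of lborel "\<lambda>_::'a. False"] by simp
  then have "emeasure lborel (UNIV :: 'a set) = 0" by (rule null_setsD1)
  then show False by simp
qed

lemma AE_of_nn_integral_0:
  assumes "B \<in> sets borel" "(\<integral>\<^sup>+x. indicator B x \<partial>lborel) = 0"
  shows "AE x in lborel. x \<notin> B"
  using assms by (intro AE_not_in null_setsI) auto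

lemma AE_exp_image:
  assumes N: "N \<in> sets borel" and 0: "AE s in lborel. exp s \<notin> N"
  shows "AE v in lborel. v > 0 \<longrightarrow> v \<notin> (N :: real set)"
proof -
  note [measurable] = N
  have "(\<integral>\<^sup>+s. ennreal (exp (- s)) * indicator N (exp s) \<partial>lborel) = (\<integral>\<^sup>+s. 0 \<partial>(lborel :: real measure))"
    by (rule nn_integral_cong_AE, rule AE_mp[OF 0]) simp
  then have "(\<integral>\<^sup>+q. indicator N q * ennreal (1 / q\<^sup>2) * indicator {0<..} q \<partial>lborel) = 0"
    using nn_integral_exp[of "indicator N"] by simp
  then have "AE q in lborel. indicator N q * ennreal (1 / q\<^sup>2) * indicator {0<..} q = 0"
    by (subst (asm) nn_integral_0_iff_AE) auto
  then show ?thesis by (rule AE_mp) (auto simp: indicator_def split: if_splits)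
qed

lemma AE_inversion_image:
  assumes N: "N \<in> sets borel" and 0: "AE u in lborel. x - 1 / u \<notin> N"
  shows "AE y in lborel. y \<notin> (N :: real set)"
proof -
  note [measurable] = N
  define K where "K v = (indicator N (x + v) :: ennreal)" for v
  have [measurable]: "K \<in> borel_measurable borel" unfolding K_def by measurable
  have "(\<integral>\<^sup>+v. K (- 1 / v) * ennreal (1 / v\<^sup>2) \<partial>lborel) = (\<integral>\<^sup>+v. 0 \<partial>(lborel :: real measure))"
    by (rule nn_integral_cong_AE, rule AE_mp[OF 0]) (simp add: K_def)
  then have "(\<integral>\<^sup>+v. K v \<partial>lborel) = 0" using nn_integral_inversion[of K] by simp
  moreover have "(\<integral>\<^sup>+y. indicator N y \<partial>lborel) = (\<integral>\<^sup>+v. K v \<partial>lborel)"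
    unfolding K_def using nn_integral_real_affine[of "indicator N" 1 x] by simp
  ultimately show ?thesis by (intro AE_of_nn_integral_0[OF N]) simp
qed

lemma nn_integral_triple_middle:
  fixes f :: "real \<times> real \<times> real \<Rightarrow> ennreal"
  assumes f[measurable]: "f \<in> borel_measurable borel"
  shows "(\<integral>\<^sup>+\<omega>. f \<omega> \<partial>lborel) = (\<integral>\<^sup>+p. \<integral>\<^sup>+u. f (fst p, u, snd p) \<partial>lborel \<partial>(lborel \<Otimes>\<^sub>M lborel))"
proof -
  have f'[measurable]: "f \<in> borel_measurable (borel \<Otimes>\<^sub>M (borel \<Otimes>\<^sub>M borel))"
    using f by (simp add: borel_prod)
  have "(\<integral>\<^sup>+\<omega>. f \<omega> \<partial>lborel) = (\<integral>\<^sup>+x. \<integral>\<^sup>+u. \<integral>\<^sup>+s. f (x, u, s) \<partial>lborel \<partial>lborel \<partial>lborel)"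
    by (rule nn_integral_triple) measurable
  also have "\<dots> = (\<integral>\<^sup>+x. \<integral>\<^sup>+s. \<integral>\<^sup>+u. f (x, u, s) \<partial>lborel \<partial>lborel \<partial>lborel)"
    by (rule nn_integral_cong, rule lborel_pair.Fubini') measurable
  also have "\<dots> = (\<integral>\<^sup>+x. \<integral>\<^sup>+s. (\<lambda>p. \<integral>\<^sup>+u. f (fst p, u, snd p) \<partial>lborel) (x, s) \<partial>lborel \<partial>lborel)"
    by simp
  also have "\<dots> = (\<integral>\<^sup>+p. \<integral>\<^sup>+u. f (fst p, u, snd p) \<partial>lborel \<partial>(lborel \<Otimes>\<^sub>M lborel))"
    by (rule lborel.nn_integral_fst) measurable
  finally show ?thesis .
qed

text \<open>Flowing forward contracts the distance along horocycles by \<open>exp (- t)\<close>.\<close>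

lemma horo_flow: "horo r (flow t \<omega>) = flow t (horo (r * exp t) \<omega>)"
  by (cases \<omega>) (simp add: horo_def flow_def exp_add mult.left_commute)

context fuchsian_finite
begin

definition flow_invariant :: "(real \<times> real \<times> real) set \<Rightarrow> bool" where
  "flow_invariant A \<longleftrightarrow> A \<in> sets quot \<and> (\<forall>t \<omega>. flow t \<omega> \<in> A \<longleftrightarrow> \<omega> \<in> A)"

lemma invariant_setD: "invariant_set A \<Longrightarrow> g \<in> G \<Longrightarrow> \<omega> \<in> X0 \<Longrightarrow> act g \<omega> \<in> A \<longleftrightarrow> \<omega> \<in> A"
  by (simp add: invariant_set_def)

text \<open>Hopf's contraction argument. Let \<open>\<rho> r\<close> be the measure in the quotient of the set where \<open>A\<close> and its
  translate along horocycles of length \<open>r\<close> differ. By invariance of \<open>A\<close> and of the measure under the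
  geodesic flow, \<open>\<rho> r\<close> does not change if \<open>r\<close> is multiplied by \<open>exp t\<close>. On the other hand \<open>\<rho> r\<close> tends
  to zero with \<open>r\<close>, because translations are continuous in measure and the quotient has finite
  measure. Hence \<open>\<rho>\<close> vanishes.\<close>

lemma horo_invariant:
  assumes A: "flow_invariant A"
  shows "AE \<omega> in lborel. horo r \<omega> \<in> A \<longleftrightarrow> \<omega> \<in> A"
proof -
  have AM: "A \<in> sets M" and Ai: "invariant_set A" and Af: "\<And>t \<omega>. flow t \<omega> \<in> A \<longleftrightarrow> \<omega> \<in> A"
    using A by (auto simp: flow_invariant_def sets_quot)
  have AX: "A \<subseteq> X0" and Ab[measurable]: "A \<in> sets borel" using AM by (auto simp: sets_M)
  have Db[measurable]: "D \<in> sets borel" and DX: "D \<subseteq> X0" using D_sets by (auto simp: sets_M)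
  define S where "S q = {\<omega> \<in> X0. (horo q \<omega> \<in> A) \<noteq> (\<omega> \<in> A)}" for q
  have Sb[measurable]: "S q \<in> sets borel" for q
  proof -
    have h: "horo q -` A \<inter> space borel \<in> sets borel" by (rule measurable_sets[OF horo_measurable Ab])
    have "S q = ((horo q -` A \<inter> space borel) - A) \<union> (A - (horo q -` A \<inter> space borel))"
    proof -
      have "\<omega> \<in> X0" if "horo q \<omega> \<in> A" for \<omega> using subsetD[OF AX that] by (simp only: horo_X0)
      moreover have "\<omega> \<in> X0" if "\<omega> \<in> A" for \<omega> using AX that by (rule subsetD)
      ultimately have "\<omega> \<in> S q \<longleftrightarrow> \<omega> \<in> ((horo q -` A \<inter> space borel) - A) \<union> (A - (horo q -` A \<inter> space borel))" for \<omega>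
        by (simp add: S_def) blast
      then show ?thesis by (rule Set.set_eqI)
    qed
    then show ?thesis using h by auto
  qed
  have SX: "S q \<subseteq> X0" for q by (auto simp: S_def)
  have SM: "S q \<in> sets M" for q using SX by (simp add: sets_M)
  have Sinv: "act g \<omega> \<in> S q \<longleftrightarrow> \<omega> \<in> S q" if "g \<in> G" "\<omega> \<in> X0" for g \<omega> q
  proof -
    have "horo q (act g \<omega>) \<in> A \<longleftrightarrow> horo q \<omega> \<in> A"
      unfolding horo_act[OF that] by (rule invariant_setD[OF Ai that(1)]) (simp add: that)
    moreover have "act g \<omega> \<in> A \<longleftrightarrow> \<omega> \<in> A" by (rule invariant_setD[OF Ai that])
    ultimately show ?thesis using act_X0[OF that] that(2) by (simp add: S_def)
  qed
  have Sflow: "flow t \<omega> \<in> S q \<longleftrightarrow> \<omega> \<in> S (q * exp t)" for t \<omega> q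
    by (simp add: S_def horo_flow Af)
  define \<rho> where "\<rho> q = (\<integral>\<^sup>+\<omega>. indicator (S q) \<omega> * indicator D \<omega> \<partial>M)" for q
  \<comment> \<open>Flowing for time \<open>t\<close> contracts the displacement \<open>q * exp t\<close> to \<open>q\<close>.\<close>
  have \<rho>_scale: "\<rho> (q * exp t) = \<rho> q" for q t
  proof -
    have "\<rho> (q * exp t) = (\<integral>\<^sup>+\<omega>. indicator (S q) (flow t \<omega>) * indicator D \<omega> \<partial>M)"
      unfolding \<rho>_def by (intro nn_integral_cong) (simp add: indicator_def Sflow)
    also have "\<dots> = \<rho> q" unfolding \<rho>_def
    proof (rule commuting_map_integral[where T' = "flow (- t)"])
      show "flow t \<in> M \<rightarrow>\<^sub>M M" "flow (- t) \<in> M \<rightarrow>\<^sub>M M" "distr M M (flow t) = M" "distr M M (flow (- t)) = M"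
        by (rule flow_preserving)+
      show "flow (- t) (flow t x) = x" for x by (cases x) (simp add: flow_def)
      show "flow (- t) (act g x) = act g (flow (- t) x)" for g x by (rule flow_act)
      show "(\<lambda>\<omega>. indicator (S q) \<omega> :: ennreal) \<in> borel_measurable M" using SM by simp
      show "(indicator (S q) (act g x) :: ennreal) = indicator (S q) x" if "g \<in> carrier Gr" "x \<in> space M" for g x
        using Sinv[of g x q] that by (simp add: indicator_def)
    qed
    finally show ?thesis .
  qed
  have \<rho>_eq: "\<rho> q = (\<integral>\<^sup>+p. emeasure lborel {u. (fst p, u, snd p) \<in> S q \<inter> D} \<partial>(lborel \<Otimes>\<^sub>M lborel))" for q
  proof -
    have "\<rho> q = (\<integral>\<^sup>+\<omega>. indicator (S q \<inter> D) \<omega> \<partial>lborel)"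
    proof -
      have "\<rho> q = (\<integral>\<^sup>+\<omega>. indicator (S q) \<omega> * indicator D \<omega> \<partial>lborel)"
        unfolding \<rho>_def by (rule nn_integral_M) measurable
      also have "\<dots> = (\<integral>\<^sup>+\<omega>. indicator (S q \<inter> D) \<omega> \<partial>lborel)"
        by (rule nn_integral_cong) (rule indicator_inter_arith[symmetric])
      finally show ?thesis .
    qed
    also have "\<dots> = (\<integral>\<^sup>+p. \<integral>\<^sup>+u. indicator (S q \<inter> D) (fst p, u, snd p) \<partial>lborel \<partial>(lborel \<Otimes>\<^sub>M lborel))"
      by (rule nn_integral_triple_middle) measurable
    also have "\<dots> = (\<integral>\<^sup>+p. emeasure lborel {u. (fst p, u, snd p) \<in> S q \<inter> D} \<partial>(lborel \<Otimes>\<^sub>M lborel))"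
    proof (rule nn_integral_cong)
      fix p :: "real \<times> real"
      have c: "(\<lambda>u. (fst p, u, snd p)) \<in> borel_measurable borel"
        by (intro borel_measurable_continuous_onI continuous_intros)
      have "(\<lambda>u. (fst p, u, snd p)) -` (S q \<inter> D) \<inter> space borel \<in> sets borel"
        by (rule measurable_sets[OF c]) auto
      then have m: "{u. (fst p, u, snd p) \<in> S q \<inter> D} \<in> sets borel" by (simp add: vimage_def)
      have "(\<integral>\<^sup>+u. indicator (S q \<inter> D) (fst p, u, snd p) \<partial>lborel) = (\<integral>\<^sup>+u. indicator {u. (fst p, u, snd p) \<in> S q \<inter> D} u \<partial>lborel)"
        by (intro nn_integral_cong) (simp add: indicator_def)
      also have "\<dots> = emeasure lborel {u. (fst p, u, snd p) \<in> S q \<inter> D}" using m by simp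
      finally show "(\<integral>\<^sup>+u. indicator (S q \<inter> D) (fst p, u, snd p) \<partial>lborel) = emeasure lborel {u. (fst p, u, snd p) \<in> S q \<inter> D}" .
    qed
    finally show ?thesis .
  qed
  have slice_meas: "(\<lambda>p. emeasure lborel {u. (fst p, u, snd p) \<in> E}) \<in> borel_measurable (lborel \<Otimes>\<^sub>M lborel)"
    if E[measurable]: "E \<in> sets (borel :: (real \<times> real \<times> real) measure)" for E
  proof -
    have E'[measurable]: "E \<in> sets (borel \<Otimes>\<^sub>M (borel \<Otimes>\<^sub>M borel))" unfolding borel_prod by (rule E)
    have "(\<lambda>p. \<integral>\<^sup>+u. indicator E (fst p, u, snd p) \<partial>lborel) \<in> borel_measurable (lborel \<Otimes>\<^sub>M lborel)"
      by measurable
    moreover have "(\<integral>\<^sup>+u. indicator E (fst p, u, snd p) \<partial>lborel) = emeasure lborel {u. (fst p, u, snd p) \<in> E}" for p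
    proof -
      have c: "(\<lambda>u. (fst p, u, snd p)) \<in> borel_measurable borel"
        by (intro borel_measurable_continuous_onI continuous_intros)
      have "(\<lambda>u. (fst p, u, snd p)) -` E \<inter> space borel \<in> sets borel"
        by (rule measurable_sets[OF c E])
      then have m: "{u. (fst p, u, snd p) \<in> E} \<in> sets borel" by (simp add: vimage_def)
      have "(\<integral>\<^sup>+u. indicator E (fst p, u, snd p) \<partial>lborel) = (\<integral>\<^sup>+u. indicator {u. (fst p, u, snd p) \<in> E} u \<partial>lborel)"
        by (intro nn_integral_cong) (simp add: indicator_def)
      then show ?thesis using m by simp
    qed
    ultimately show ?thesis by simp
  qed
  have slice_set: "{u. (x, u, s) \<in> E} \<in> sets borel" if E: "E \<in> sets (borel :: (real \<times> real \<times> real) measure)" for E x s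
  proof -
    have c: "(\<lambda>u. (x, u, s)) \<in> borel_measurable borel"
      by (intro borel_measurable_continuous_onI continuous_intros)
    have "(\<lambda>u. (x, u, s)) -` E \<inter> space borel \<in> sets borel" by (rule measurable_sets[OF c E])
    then show ?thesis by (simp add: vimage_def)
  qed
  have Dfin: "(\<integral>\<^sup>+p. emeasure lborel {u. (fst p, u, snd p) \<in> D} \<partial>(lborel \<Otimes>\<^sub>M lborel)) < \<infinity>"
  proof -
    have "(\<integral>\<^sup>+p. emeasure lborel {u. (fst p, u, snd p) \<in> D} \<partial>(lborel \<Otimes>\<^sub>M lborel))
        = (\<integral>\<^sup>+p. \<integral>\<^sup>+u. indicator D (fst p, u, snd p) \<partial>lborel \<partial>(lborel \<Otimes>\<^sub>M lborel))"
    proof (rule nn_integral_cong)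
      fix p :: "real \<times> real"
      have "(\<integral>\<^sup>+u. indicator D (fst p, u, snd p) \<partial>lborel) = (\<integral>\<^sup>+u. indicator {u. (fst p, u, snd p) \<in> D} u \<partial>lborel)"
        by (intro nn_integral_cong) (simp add: indicator_def)
      then show "emeasure lborel {u. (fst p, u, snd p) \<in> D} = (\<integral>\<^sup>+u. indicator D (fst p, u, snd p) \<partial>lborel)"
        using slice_set[OF Db, of "fst p" "snd p"] by simp
    qed
    also have "\<dots> = (\<integral>\<^sup>+\<omega>. indicator D \<omega> \<partial>lborel)" by (rule nn_integral_triple_middle[symmetric]) measurable
    also have "\<dots> = emeasure M D" using DX by (simp add: emeasure_M)
    also have "\<dots> < \<infinity>" by (rule D_finite)
    finally show ?thesis .
  qed
  \<comment> \<open>All terms of this sequence equal \<open>\<rho> r\<close>, while the displacements tend to zero.\<close>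
  have "(\<lambda>n. \<rho> (r * exp (- real n))) \<longlonglongrightarrow> (\<integral>\<^sup>+p. 0 \<partial>(lborel \<Otimes>\<^sub>M lborel :: (real \<times> real) measure))"
    unfolding \<rho>_eq
  proof (rule nn_integral_dominated_convergence[where w = "\<lambda>p. emeasure lborel {u. (fst p, u, snd p) \<in> D}"])
    show "(\<lambda>p. emeasure lborel {u. (fst p, u, snd p) \<in> S (r * exp (- real j)) \<inter> D}) \<in> borel_measurable (lborel \<Otimes>\<^sub>M lborel)" for j
      by (rule slice_meas) measurable
    show "(\<lambda>p. emeasure lborel {u. (fst p, u, snd p) \<in> D}) \<in> borel_measurable (lborel \<Otimes>\<^sub>M lborel)"
      by (rule slice_meas[OF Db])
    show "AE p in lborel \<Otimes>\<^sub>M lborel. emeasure lborel {u. (fst p, u, snd p) \<in> S (r * exp (- real j)) \<inter> D} \<le> emeasure lborel {u. (fst p, u, snd p) \<in> D}" for j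
      using slice_set[OF Db] by (intro AE_I2 emeasure_mono) auto
    show "(\<integral>\<^sup>+p. emeasure lborel {u. (fst p, u, snd p) \<in> D} \<partial>(lborel \<Otimes>\<^sub>M lborel)) < \<infinity>" by (rule Dfin)
    have "AE p in lborel \<Otimes>\<^sub>M lborel. emeasure lborel {u. (fst p, u, snd p) \<in> D} \<noteq> \<infinity>"
      using Dfin by (intro nn_integral_noteq_infinite slice_meas[OF Db]) auto
    then show "AE p in lborel \<Otimes>\<^sub>M lborel. (\<lambda>i. emeasure lborel {u. (fst p, u, snd p) \<in> S (r * exp (- real i)) \<inter> D}) \<longlonglongrightarrow> 0"
    proof (rule AE_mp, intro AE_I2 impI)
      fix p :: "real \<times> real"
      assume f: "emeasure lborel {u. (fst p, u, snd p) \<in> D} \<noteq> \<infinity>"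
      define x s where "x = fst p" and "s = snd p"
      define \<delta> where "\<delta> n = r * exp (- real n) * exp s" for n :: nat
      have "(\<lambda>n. exp (- real n)) \<longlonglongrightarrow> 0"
        by (intro filterlim_compose[OF exp_at_bot] filterlim_compose[OF filterlim_uminus_at_bot_at_top] filterlim_real_sequentially)
      then have \<delta>: "\<delta> \<longlonglongrightarrow> 0" unfolding \<delta>_def by (auto intro!: tendsto_mult_right_zero tendsto_mult_left_zero)
      have eq: "{u. (fst p, u, snd p) \<in> S (r * exp (- real n)) \<inter> D}
          = {u \<in> {u. (x, u, s) \<in> D}. (u + \<delta> n \<in> {u. (x, u, s) \<in> A}) \<noteq> (u \<in> {u. (x, u, s) \<in> A})}" for n
        using DX by (auto simp: S_def horo_def x_def s_def \<delta>_def)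
      show "(\<lambda>i. emeasure lborel {u. (fst p, u, snd p) \<in> S (r * exp (- real i)) \<inter> D}) \<longlonglongrightarrow> 0"
        unfolding eq
        by (rule translate_continuity[OF slice_set[OF Ab] slice_set[OF Db] _ \<delta>])
           (use f in \<open>simp add: x_def s_def less_top[symmetric]\<close>)
    qed
  qed simp
  then have "(\<lambda>n::nat. \<rho> r) \<longlonglongrightarrow> 0" unfolding \<rho>_scale by simp
  then have "\<rho> r = 0" by (simp add: LIMSEQ_const_iff)
  then have "emeasure M (S r \<inter> D) = 0"
    using SM[of r] D_sets unfolding \<rho>_def by (simp add: indicator_inter_arith[symmetric])
  moreover have "invariant_set (S r)" using SX Sinv by (auto simp: invariant_set_def)
  ultimately have "emeasure M (S r) = 0" by (rule invariant_null[OF _ SM, rotated])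
  then have "AE \<omega> in M. \<omega> \<notin> S r" using SM by (intro AE_not_in null_setsI) auto
  then have "AE \<omega> in lborel. \<omega> \<notin> S r" by (simp add: AE_M_iff)
  with AE_X0 show ?thesis by eventually_elim (auto simp: S_def)
qed

text \<open>A flow invariant set is determined by its slice \<open>s = 0\<close>, a set of unparameterized geodesics.\<close>

definition plane :: "(real \<times> real \<times> real) set \<Rightarrow> (real \<times> real) set" where
  "plane A = {(x, u). (x, u, 0) \<in> A}"

lemma plane_iff:
  assumes "flow_invariant A"
  shows "(x, u, s) \<in> A \<longleftrightarrow> (x, u) \<in> plane A"
  using assms[unfolded flow_invariant_def, THEN conjunct2, rule_format, of s "(x, u, 0)"]
  by (simp add: plane_def flow_def)

lemma plane_borel: "A \<in> sets borel \<Longrightarrow> plane A \<in> sets borel"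
proof -
  assume A: "A \<in> sets borel"
  have c: "(\<lambda>p. (fst p, snd p, 0)) \<in> borel_measurable (borel :: (real \<times> real) measure)"
    by (intro borel_measurable_continuous_onI continuous_intros)
  have "(\<lambda>p. (fst p, snd p, 0)) -` A \<inter> space (borel :: (real \<times> real) measure) \<in> sets borel" by (rule measurable_sets[OF c A])
  then show ?thesis by (simp add: vimage_def plane_def case_prod_beta')
qed

lemma section_borel:
  fixes P :: "(real \<times> real) set"
  assumes "P \<in> sets borel"
  shows "{u. (x, u) \<in> P} \<in> sets borel"
proof -
  have c: "(\<lambda>u. (x, u)) \<in> borel_measurable (borel :: real measure)"
    by (intro borel_measurable_continuous_onI continuous_intros)
  have "(\<lambda>u. (x, u)) -` P \<inter> space borel \<in> sets borel" by (rule measurable_sets[OF c assms])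
  then show ?thesis by (simp add: vimage_def)
qed

text \<open>Horocycle translations act on the coordinate \<open>u\<close> by \<open>u + r * exp s\<close>, and since \<open>A\<close> does not depend on
  \<open>s\<close>, it is almost invariant under all translations in \<open>u\<close>: up to null sets, it depends only on the
  forward end point \<open>x\<close>.\<close>

lemma slices_trivial:
  assumes A: "flow_invariant A"
  shows "AE x in lborel. (AE u in lborel. (x, u) \<in> plane A) \<or> (AE u in lborel. (x, u) \<notin> plane A)"
proof -
  have Ab: "A \<in> sets borel" using A by (auto simp: flow_invariant_def sets_quot sets_M)
  note P = plane_borel[OF Ab]
  have sec: "{u. (x, u) \<in> plane A} \<in> sets borel" for x by (rule section_borel[OF P])
  have h: "AE x in lborel. AE u in lborel. AE s in lborel. (x, u + r * exp s) \<in> plane A \<longleftrightarrow> (x, u) \<in> plane A" for r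
  proof -
    have "{\<omega>. horo r \<omega> \<in> A \<longleftrightarrow> \<omega> \<in> A} \<in> sets borel"
    proof -
      have hb: "horo r -` A \<inter> space borel \<in> sets borel" by (rule measurable_sets[OF horo_measurable Ab])
      have "{\<omega>. horo r \<omega> \<in> A \<longleftrightarrow> \<omega> \<in> A} = ((horo r -` A \<inter> space borel) \<inter> A) \<union> (- (horo r -` A \<inter> space borel) \<inter> - A)" by auto
      then show ?thesis using hb Ab by auto
    qed
    from iffD1[OF AE_triple_iff[OF this] horo_invariant[OF A]]
    show ?thesis by (simp add: horo_def plane_iff[OF A])
  qed
  from h[of 1] h[of "-1"] show ?thesis
  proof eventually_elim
    case (elim x)
    have "AE u in lborel. (AE s in lborel. (x, u + 1 * exp s) \<in> plane A \<longleftrightarrow> (x, u) \<in> plane A) \<and>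
        (AE s in lborel. (x, u + - 1 * exp s) \<in> plane A \<longleftrightarrow> (x, u) \<in> plane A)"
      using elim by eventually_elim blast
    from AE_lborel_ex[OF this] obtain u where
      u: "AE s in lborel. (x, u + 1 * exp s) \<in> plane A \<longleftrightarrow> (x, u) \<in> plane A"
        "AE s in lborel. (x, u + - 1 * exp s) \<in> plane A \<longleftrightarrow> (x, u) \<in> plane A" by blast
    define N where "N q = {v. \<not> ((x, u + q * v) \<in> plane A \<longleftrightarrow> (x, u) \<in> plane A)}" for q
    have Nb: "N q \<in> sets borel" for q
    proof -
      have "(\<lambda>v. u + q * v) -` {v. (x, v) \<in> plane A} \<inter> space borel \<in> sets borel"
        by (rule measurable_sets[OF _ sec]) measurable
      then have m: "{v. (x, u + q * v) \<in> plane A} \<in> sets borel" by (simp add: vimage_def)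
      show ?thesis
      proof (cases "(x, u) \<in> plane A")
        case True
        then have "N q = - {v. (x, u + q * v) \<in> plane A}" by (auto simp: N_def)
        then show ?thesis using m by auto
      next
        case False
        then have "N q = {v. (x, u + q * v) \<in> plane A}" by (auto simp: N_def)
        then show ?thesis using m by auto
      qed
    qed
    have p: "AE v in lborel. v > 0 \<longrightarrow> v \<notin> N 1"
      by (rule AE_exp_image[OF Nb]) (use u(1) in \<open>simp add: N_def\<close>)
    have "AE v in lborel. v > 0 \<longrightarrow> v \<notin> N (- 1)"
      by (rule AE_exp_image[OF Nb]) (use u(2) in \<open>simp add: N_def\<close>)
    then have n: "AE v in lborel. - v > 0 \<longrightarrow> - v \<notin> N (- 1)"
      using AE_borel_affine[of "-1" "\<lambda>v. v > 0 \<longrightarrow> v \<notin> N (- 1)" 0] Nb[of "-1"] by simp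
    have "AE v in lborel. (x, u + v) \<in> plane A \<longleftrightarrow> (x, u) \<in> plane A"
      using p n AE_lborel_singleton[of 0]
    proof eventually_elim
      case (elim v)
      then consider "v > 0" | "v < 0" by linarith
      then show ?case using elim by cases (auto simp: N_def)
    qed
    then have "AE v in lborel. v \<notin> N 1" by (simp add: N_def)
    then have "AE w in lborel. - u + 1 * w \<notin> N 1"
      using AE_borel_affine[of 1 "\<lambda>v. v \<notin> N 1" "- u"] Nb[of 1] by simp
    then have "AE w in lborel. (x, w) \<in> plane A \<longleftrightarrow> (x, u) \<in> plane A" by (simp add: N_def)
    then show ?case by (cases "(x, u) \<in> plane A") simp_all
  qed
qed

text \<open>The set \<open>A\<close> seen from the other end: \<open>x - 1 / u\<close> and \<open>x\<close> exchange their roles as forward and backward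
  end point. The value \<open>0\<close> of the last coordinate is arbitrary, as \<open>reverse\<close> is applied to flow invariant
  sets.\<close>

definition reverse :: "(real \<times> real \<times> real) set \<Rightarrow> (real \<times> real \<times> real) set" where
  "reverse A = {(x, u, s). (x, u, s) \<in> X0 \<and> u \<noteq> 0 \<and> (x - 1 / u, - u, 0) \<in> A}"

lemma reverse_iff:
  assumes A: "flow_invariant A" and w: "\<omega> \<in> X0"
  shows "\<omega> \<in> reverse A \<longleftrightarrow> (\<exists>\<omega>'\<in>A. \<forall>t. geo \<omega>' t = geo \<omega> (- t))"
proof -
  obtain x u s where e: "\<omega> = (x, u, s)" by (cases \<omega>) auto
  show ?thesis
  proof
    assume "\<omega> \<in> reverse A"
    then have u: "u \<noteq> 0" and a: "(x - 1 / u, - u, 2 * ln \<bar>u\<bar> - s) \<in> A"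
      by (auto simp: reverse_def e plane_iff[OF A])
    show "\<exists>\<omega>'\<in>A. \<forall>t. geo \<omega>' t = geo \<omega> (- t)"
      using a geo_reverse[OF u, of x s] by (auto simp: e)
  next
    assume "\<exists>\<omega>'\<in>A. \<forall>t. geo \<omega>' t = geo \<omega> (- t)"
    then obtain \<omega>' where w': "\<omega>' \<in> A" "\<And>t. geo \<omega>' t = geo \<omega> (- t)" by blast
    have u: "u \<noteq> 0"
    proof
      assume u: "u = 0"
      have "geo \<omega>' t = Complex x (exp (- s + t))" for t
      proof -
        have "Re (geo (x, 0, s) (- t)) = x" by (simp add: Re_geo)
        moreover have "Im (geo (x, 0, s) (- t)) = 1 / exp (s - t)" by (simp add: Im_geo power2_eq_square)
        moreover have "1 / exp (s - t) = exp (- s + t)" by (simp add: exp_minus[symmetric] inverse_eq_divide[symmetric])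
        ultimately show ?thesis unfolding w'(2) e u by (simp add: complex_eq_iff)
      qed
      then show False using geo_ne_vertical[of \<omega>' x "- s"] by auto
    qed
    have "geo \<omega>' = geo (x - 1 / u, - u, 2 * ln \<bar>u\<bar> - s)"
      using w'(2) geo_reverse[OF u, of x s] by (auto simp: e)
    then have "\<omega>' = (x - 1 / u, - u, 2 * ln \<bar>u\<bar> - s)" by (rule geo_inj)
    then show "\<omega> \<in> reverse A" using w'(1) u w by (simp add: reverse_def e plane_iff[OF A])
  qed
qed

lemma reverse_flow_invariant:
  assumes A: "flow_invariant A"
  shows "flow_invariant (reverse A)"
proof -
  have AM: "A \<in> sets M" and Ai: "invariant_set A" using A by (auto simp: flow_invariant_def sets_quot)
  have AX: "A \<subseteq> X0" and Ab[measurable]: "A \<in> sets borel" using AM by (auto simp: sets_M)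
  have rb: "reverse A \<in> sets borel"
  proof -
    have m: "(\<lambda>\<omega>::real \<times> real \<times> real. (fst \<omega> - 1 / fst (snd \<omega>), - fst (snd \<omega>), 0::real)) \<in> borel_measurable (borel \<Otimes>\<^sub>M (borel \<Otimes>\<^sub>M borel))"
      by measurable
    have m': "(\<lambda>\<omega>::real \<times> real \<times> real. (fst \<omega> - 1 / fst (snd \<omega>), - fst (snd \<omega>), 0::real)) \<in> borel_measurable borel"
      using m unfolding borel_prod .
    have 1: "(\<lambda>\<omega>::real \<times> real \<times> real. (fst \<omega> - 1 / fst (snd \<omega>), - fst (snd \<omega>), 0::real)) -` A \<inter> space borel \<in> sets borel"
      by (rule measurable_sets[OF m' Ab])
    have 2: "{\<omega>::real \<times> real \<times> real. fst (snd \<omega>) = 0} \<in> sets borel"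
      by (intro borel_closed closed_Collect_eq continuous_intros)
    have "reverse A = X0 \<inter> - {\<omega>. fst (snd \<omega>) = 0} \<inter> ((\<lambda>\<omega>. (fst \<omega> - 1 / fst (snd \<omega>), - fst (snd \<omega>), 0::real)) -` A \<inter> space borel)"
      by (auto simp: reverse_def)
    then show ?thesis using 1 2 by auto
  qed
  have rX: "reverse A \<subseteq> X0" by (auto simp: reverse_def)
  have imp: "act g \<omega> \<in> reverse A" if g: "g \<in> G" and w: "\<omega> \<in> X0" and r: "\<omega> \<in> reverse A" for g \<omega>
  proof -
    obtain \<omega>' where w': "\<omega>' \<in> A" "\<forall>t. geo \<omega>' t = geo \<omega> (- t)" using r reverse_iff[OF A w] by blast
    have w'X: "\<omega>' \<in> X0" using w'(1) AX by blast
    have "act g \<omega>' \<in> A" using invariant_setD[OF Ai g w'X] w'(1) by simp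
    moreover have "\<forall>t. geo (act g \<omega>') t = geo (act g \<omega>) (- t)"
      using w'(2) geo_act[OF g w'X] geo_act[OF g w] by simp
    ultimately show ?thesis using reverse_iff[OF A act_X0[OF g w]] by blast
  qed
  have "act g \<omega> \<in> reverse A \<longleftrightarrow> \<omega> \<in> reverse A" if g: "g \<in> G" and w: "\<omega> \<in> X0" for g \<omega>
    using imp[OF g w] imp[of "m_inv Gr g" "act g \<omega>"] act_inv[of g \<omega>] act_X0[OF g w] inverse_G(1)[OF g] g w by auto
  then have inv: "invariant_set (reverse A)" using rX by (auto simp: invariant_set_def)
  have "flow t \<omega> \<in> reverse A \<longleftrightarrow> \<omega> \<in> reverse A" for t \<omega>
    using flow_X0[of t \<omega>] by (cases \<omega>) (simp add: reverse_def flow_def)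
  then show ?thesis using rb rX inv by (simp add: flow_invariant_def sets_quot sets_M)
qed

text \<open>By \<open>slices_trivial\<close> an invariant set depends, up to null sets, only on the forward end point.
  Applied to the reversed set, the same lemma shows that it depends only on the backward end point.
  The two end points are independent coordinates, so the set is null or of full measure.\<close>

theorem ergodic:
  assumes A: "flow_invariant A"
  shows "(AE \<omega> in M. \<omega> \<in> A) \<or> (AE \<omega> in M. \<omega> \<notin> A)"
proof -
  have Ab: "A \<in> sets borel" and AX: "A \<subseteq> X0" using A by (auto simp: flow_invariant_def sets_quot sets_M)
  define P where "P = plane A"
  have Pb: "P \<in> sets borel" unfolding P_def by (rule plane_borel[OF Ab])
  have P2[measurable]: "P \<in> sets (borel \<Otimes>\<^sub>M borel)" unfolding borel_prod by (rule Pb)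
  \<comment> \<open>\<open>B\<close> is the set of forward end points such that almost all geodesics ending there belong to \<open>A\<close>.\<close>
  define B where "B = {x. emeasure lborel {u. (x, u) \<notin> P} = 0}"
  have secc: "{u. (x, u) \<notin> P} \<in> sets borel" for x
    using section_borel[of "- P" x] Pb by auto
  have B_iff: "x \<in> B \<longleftrightarrow> (AE u in lborel. (x, u) \<in> P)" for x
    unfolding B_def using secc[of x] by (subst AE_iff_measurable[of "{u. (x, u) \<notin> P}"]) auto
  have Bb[measurable]: "B \<in> sets borel"
  proof -
    have "(\<lambda>x. \<integral>\<^sup>+u. indicator (- P) (x, u) \<partial>lborel) \<in> borel_measurable borel"
      by measurable
    moreover have "(\<integral>\<^sup>+u. indicator (- P) (x, u) \<partial>lborel) = emeasure lborel {u. (x, u) \<notin> P}" for x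
    proof -
      have "(\<integral>\<^sup>+u. indicator (- P) (x, u) \<partial>lborel) = (\<integral>\<^sup>+u. indicator {u. (x, u) \<notin> P} u \<partial>lborel)"
        by (intro nn_integral_cong) (simp add: indicator_def)
      then show ?thesis using secc[of x] by simp
    qed
    ultimately have m: "(\<lambda>x. emeasure lborel {u. (x, u) \<notin> P}) \<in> borel_measurable borel" by simp
    have "(\<lambda>x. emeasure lborel {u. (x, u) \<notin> P}) -` {0} \<inter> space borel \<in> sets borel" by (rule measurable_sets[OF m]) auto
    then show ?thesis by (simp add: B_def vimage_def)
  qed
  define N where "N = {p. \<not> (p \<in> P \<longleftrightarrow> fst p \<in> B)}"
  have N2[measurable]: "N \<in> sets (borel \<Otimes>\<^sub>M borel)"
  proof -
    have b: "fst -` B \<inter> space (borel \<Otimes>\<^sub>M borel) \<in> sets (borel \<Otimes>\<^sub>M (borel :: real measure))"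
      by (rule measurable_sets[OF measurable_fst Bb])
    have "N = (P - (fst -` B \<inter> space (borel \<Otimes>\<^sub>M borel))) \<union> ((fst -` B \<inter> space (borel \<Otimes>\<^sub>M borel)) - P)"
      by (auto simp: N_def space_pair_measure)
    then show ?thesis using b P2 by auto
  qed
  have 1: "AE x in lborel. AE u in lborel. (x, u) \<notin> N"
    using slices_trivial[OF A]
  proof eventually_elim
    case (elim x)
    show ?case
    proof (cases "x \<in> B")
      case True
      then have "AE u in lborel. (x, u) \<in> P" by (simp add: B_iff)
      then show ?thesis by (rule AE_mp) (simp add: N_def True)
    next
      case False
      then have "AE u in lborel. (x, u) \<notin> P" using elim B_iff[of x] by (auto simp: P_def)
      then show ?thesis by (rule AE_mp) (simp add: N_def False)
    qed
  qed
  \<comment> \<open>Exchanging the end points preserves null sets, since for fixed \<open>u\<close> it is a translation in \<open>x\<close>.\<close>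
  have 2: "AE x in lborel. AE u in lborel. (x - 1 / u, - u) \<notin> N"
  proof -
    have i0: "(\<integral>\<^sup>+x. \<integral>\<^sup>+u. indicator N (x, u) \<partial>lborel \<partial>lborel) = 0"
    proof -
      have "(\<integral>\<^sup>+x. \<integral>\<^sup>+u. indicator N (x, u) \<partial>lborel \<partial>lborel) = (\<integral>\<^sup>+x. 0 \<partial>(lborel :: real measure))"
      proof (rule nn_integral_cong_AE, rule AE_mp[OF 1], rule AE_I2, rule impI)
        fix x assume a: "AE u in lborel. (x, u) \<notin> N"
        have "(\<integral>\<^sup>+u. indicator N (x, u) \<partial>lborel) = (\<integral>\<^sup>+u. 0 \<partial>(lborel :: real measure))"
          by (rule nn_integral_cong_AE, rule AE_mp[OF a]) simp
        then show "(\<integral>\<^sup>+u. indicator N (x, u) \<partial>lborel) = 0" by simp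
      qed
      then show ?thesis by simp
    qed
    have "(\<integral>\<^sup>+x. \<integral>\<^sup>+u. indicator N (x - 1 / u, - u) \<partial>lborel \<partial>lborel) = (\<integral>\<^sup>+u. \<integral>\<^sup>+x. indicator N (x - 1 / u, - u) \<partial>lborel \<partial>lborel)"
      by (rule lborel_pair.Fubini'[symmetric]) measurable
    also have "\<dots> = (\<integral>\<^sup>+u. \<integral>\<^sup>+x. indicator N (x, - u) \<partial>lborel \<partial>lborel)"
    proof (rule nn_integral_cong)
      fix u :: real
      have m: "(\<lambda>x. indicator N (x, - u) :: ennreal) \<in> borel_measurable borel" by measurable
      show "(\<integral>\<^sup>+x. indicator N (x - 1 / u, - u) \<partial>lborel) = (\<integral>\<^sup>+x. indicator N (x, - u) \<partial>lborel)"
        using nn_integral_real_affine[OF m, of 1 "- 1 / u"] by simp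
    qed
    also have "\<dots> = (\<integral>\<^sup>+u. \<integral>\<^sup>+x. indicator N (x, u) \<partial>lborel \<partial>lborel)"
    proof -
      have m: "(\<lambda>u. \<integral>\<^sup>+x. indicator N (x, u) \<partial>lborel) \<in> borel_measurable borel" by measurable
      show ?thesis using nn_integral_real_affine[OF m, of "-1" 0] by simp
    qed
    also have "\<dots> = (\<integral>\<^sup>+x. \<integral>\<^sup>+u. indicator N (x, u) \<partial>lborel \<partial>lborel)"
      by (rule lborel_pair.Fubini') measurable
    finally have z: "(\<integral>\<^sup>+x. \<integral>\<^sup>+u. indicator N (x - 1 / u, - u) \<partial>lborel \<partial>lborel) = 0" using i0 by simp
    have mi: "(\<lambda>x. \<integral>\<^sup>+u. indicator N (x - 1 / u, - u) \<partial>lborel) \<in> borel_measurable lborel" by measurable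
    have "AE x in lborel. (\<integral>\<^sup>+u. indicator N (x - 1 / u, - u) \<partial>lborel) = 0"
      using z by (subst (asm) nn_integral_0_iff_AE[OF mi])
    then show ?thesis
    proof eventually_elim
      case (elim x)
      have "(\<lambda>u. indicator N (x - 1 / u, - u) :: ennreal) \<in> borel_measurable lborel" by measurable
      from elim[unfolded nn_integral_0_iff_AE[OF this]] show ?case
        by (rule AE_mp) (auto simp: indicator_def split: if_splits)
    qed
  qed
  have AEX: "AE x in lborel. (x, 0, 0) \<in> X0"
  proof -
    have "{\<omega>. \<omega> \<in> X0} \<in> sets borel" by simp
    from iffD1[OF AE_triple_iff[OF this] AE_X0] show ?thesis
    proof eventually_elim
      case (elim x)
      from AE_lborel_ex[OF elim] obtain u where "AE s in lborel. (x, u, s) \<in> X0" by blast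
      from AE_lborel_ex[OF this] show ?case by (auto simp: X0_def)
    qed
  qed
  from AE_lborel_ex[OF AE_conjI[OF 2 AE_conjI[OF slices_trivial[OF reverse_flow_invariant[OF A]] AEX]]]
  obtain x where x: "AE u in lborel. (x - 1 / u, - u) \<notin> N"
      "(AE u in lborel. (x, u) \<in> plane (reverse A)) \<or> (AE u in lborel. (x, u) \<notin> plane (reverse A))" "(x, 0, 0) \<in> X0"
    by blast
  \<comment> \<open>For this fixed \<open>x\<close>, now as the backward end point, \<open>x - 1 / u\<close> runs through almost all forward end points.\<close>
  have pr: "(x, u) \<in> plane (reverse A) \<longleftrightarrow> u \<noteq> 0 \<and> (x - 1 / u, - u) \<in> P" for u
    using x(3) by (auto simp: plane_def reverse_def P_def X0_def)
  have "(AE y in lborel. y \<in> B) \<or> (AE y in lborel. y \<notin> B)"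
    using x(2)
  proof
    assume "AE u in lborel. (x, u) \<in> plane (reverse A)"
    with x(1) have "AE u in lborel. x - 1 / u \<notin> - B" by eventually_elim (auto simp: N_def pr)
    from AE_inversion_image[OF _ this] show ?thesis by simp
  next
    assume "AE u in lborel. (x, u) \<notin> plane (reverse A)"
    with x(1) AE_lborel_singleton[of 0] have "AE u in lborel. x - 1 / u \<notin> B" by eventually_elim (auto simp: N_def pr)
    from AE_inversion_image[OF _ this] show ?thesis by simp
  qed
  then show ?thesis unfolding AE_M_iff
  proof
    assume "AE y in lborel. y \<in> B"
    then have "AE x in lborel. AE u in lborel. AE s in lborel. (x, u, s) \<in> A"
    proof eventually_elim
      case (elim x)
      then have "AE u in lborel. (x, u) \<in> P" by (simp only: B_iff)
      then show ?case
      proof eventually_elim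
        case (elim u)
        then show ?case by (intro AE_I2) (simp add: plane_iff[OF A] P_def)
      qed
    qed
    then have "AE \<omega> in lborel. \<omega> \<in> A" using Ab by (subst AE_triple_iff) auto
    then show "(AE \<omega> in lborel. \<omega> \<in> A) \<or> (AE \<omega> in lborel. \<omega> \<notin> A)" ..
  next
    assume b: "AE y in lborel. y \<notin> B"
    have "AE x in lborel. AE u in lborel. (x, u) \<notin> P" using b 1
    proof eventually_elim
      case (elim x)
      from elim(2) show ?case by (rule AE_mp) (use elim(1) in \<open>simp add: N_def\<close>)
    qed
    then have "AE x in lborel. AE u in lborel. AE s in lborel. (x, u, s) \<notin> A"
    proof eventually_elim
      case (elim x)
      then show ?case
      proof eventually_elim
        case (elim u)
        then show ?case by (intro AE_I2) (simp add: plane_iff[OF A] P_def)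
      qed
    qed
    moreover have "{\<omega>. \<omega> \<notin> A} \<in> sets borel" using Ab by auto
    ultimately have "AE \<omega> in lborel. \<omega> \<notin> A" by (subst AE_triple_iff)
    then show "(AE \<omega> in lborel. \<omega> \<in> A) \<or> (AE \<omega> in lborel. \<omega> \<notin> A)" ..
  qed
qed

end

section \<open>Counting crossings along a geodesic\<close>

text \<open>Shifting the starting time of a counting function changes it by a bounded amount and a shift of
  its argument, neither of which affects the averages.\<close>

lemma limsup_average_shift:
  fixes c d :: "nat \<Rightarrow> real"
  assumes le: "\<And>n. d n \<le> K + c (n + m)"
  shows "limsup (\<lambda>n. ereal (d n / real n)) \<le> limsup (\<lambda>n. ereal (c n / real n))"
    "liminf (\<lambda>n. ereal (d n / real n)) \<le> liminf (\<lambda>n. ereal (c n / real n))"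
proof -
  have tail: "(\<lambda>n. (K + B * real (n + m)) / real n) \<longlonglongrightarrow> B" for B
  proof -
    have "(\<lambda>n. (K + B * real m) * (1 / real n) + B) \<longlonglongrightarrow> (K + B * real m) * 0 + B"
      by (intro tendsto_intros lim_1_over_n)
    moreover have "\<forall>\<^sub>F n in sequentially. (K + B * real m) * (1 / real n) + B = (K + B * real (n + m)) / real n"
      by (rule eventually_sequentiallyI[of 1]) (simp add: field_simps)
    ultimately show ?thesis by (simp add: Lim_transform_eventually)
  qed
  show "limsup (\<lambda>n. ereal (d n / real n)) \<le> limsup (\<lambda>n. ereal (c n / real n))"
  proof (rule ccontr)
    assume "\<not> ?thesis"
    then have "limsup (\<lambda>n. ereal (c n / real n)) < limsup (\<lambda>n. ereal (d n / real n))" by (simp only: not_le)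
    from ereal_dense2[OF this] obtain B where B: "limsup (\<lambda>n. ereal (c n / real n)) < ereal B" "ereal B < limsup (\<lambda>n. ereal (d n / real n))"
      by (elim exE conjE)
    have "\<forall>\<^sub>F n in sequentially. ereal (c n / real n) < ereal B" by (rule Limsup_lessD[OF B(1)])
    then obtain N where N: "\<And>n. n \<ge> N \<Longrightarrow> c n / real n < B" by (auto simp: eventually_sequentially)
    have "\<forall>\<^sub>F n in sequentially. ereal (d n / real n) \<le> ereal ((K + B * real (n + m)) / real n)"
    proof (rule eventually_sequentiallyI[of "max N 1"])
      fix n assume n: "max N 1 \<le> n"
      then have p: "real (n + m) > 0" "real n > 0" by auto
      have "c (n + m) < B * real (n + m)" using N[of "n + m"] n p by (simp add: field_simps)
      then have "d n \<le> K + B * real (n + m)" using le[of n] by linarith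
      then show "ereal (d n / real n) \<le> ereal ((K + B * real (n + m)) / real n)"
        using p by (simp add: divide_right_mono)
    qed
    then have "limsup (\<lambda>n. ereal (d n / real n)) \<le> limsup (\<lambda>n. ereal ((K + B * real (n + m)) / real n))"
      by (rule Limsup_mono)
    also have "\<dots> = ereal B" using tail[of B] by (intro lim_imp_Limsup) auto
    finally show False using B(2) by simp
  qed
  show "liminf (\<lambda>n. ereal (d n / real n)) \<le> liminf (\<lambda>n. ereal (c n / real n))"
  proof (rule ccontr)
    assume "\<not> ?thesis"
    then have "liminf (\<lambda>n. ereal (c n / real n)) < liminf (\<lambda>n. ereal (d n / real n))" by (simp only: not_le)
    from ereal_dense2[OF this] obtain B where B: "liminf (\<lambda>n. ereal (c n / real n)) < ereal B" "ereal B < liminf (\<lambda>n. ereal (d n / real n))"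
      by (elim exE conjE)
    obtain B' where B': "ereal B < ereal B'" "ereal B' < liminf (\<lambda>n. ereal (d n / real n))"
      using ereal_dense2[OF B(2)] by (elim exE conjE)
    have "\<forall>\<^sub>F n in sequentially. ereal B' < ereal (d n / real n)" by (rule less_LiminfD[OF B'(2)])
    then obtain N1 where N1: "\<And>n. n \<ge> N1 \<Longrightarrow> B' < d n / real n" by (auto simp: eventually_sequentially)
    have "\<forall>\<^sub>F n in sequentially. (K + B * real (n + m)) / real n < B'"
      using order_tendstoD(2)[OF tail[of B], of B'] B'(1) by simp
    then obtain N2 where N2: "\<And>n. n \<ge> N2 \<Longrightarrow> (K + B * real (n + m)) / real n < B'" by (auto simp: eventually_sequentially)
    have "\<forall>\<^sub>F n in sequentially. ereal B \<le> ereal (c n / real n)"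
    proof (rule eventually_sequentiallyI[of "max (max N1 N2) 1 + m"])
      fix n assume n: "max (max N1 N2) 1 + m \<le> n"
      define n' where "n' = n - m"
      have n': "n = n' + m" "n' \<ge> N1" "n' \<ge> N2" "n' \<ge> 1" using n by (auto simp: n'_def)
      have "(K + B * real n) / real n' < d n' / real n'" using N1[OF n'(2)] N2[OF n'(3)] n'(1) by simp
      then have "K + B * real n < d n'" using n'(4) by (simp add: divide_less_cancel)
      then have "B * real n < c n" using le[of n'] n'(1) by simp
      then show "ereal B \<le> ereal (c n / real n)" using n' by (simp add: field_simps)
    qed
    then have "ereal B \<le> liminf (\<lambda>n. ereal (c n / real n))" by (rule Liminf_bounded)
    then show False using B(1) by simp
  qed
qed

text \<open>Compare \<open>f t\<close> with its values at the two integers next to \<open>t\<close>.\<close>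

lemma monotone_average:
  fixes f :: "real \<Rightarrow> real"
  assumes mono: "\<And>s t. 0 \<le> s \<Longrightarrow> s \<le> t \<Longrightarrow> f s \<le> f t" and nn: "\<And>t. 0 \<le> f t"
    and lim: "(\<lambda>n. f (real n) / real n) \<longlonglongrightarrow> L"
  shows "((\<lambda>t. f t / t) \<longlongrightarrow> L) at_top"
proof (rule tendsto_sandwich)
  define fl where "fl t = nat \<lfloor>t\<rfloor>" for t :: real
  have flt: "filterlim fl sequentially at_top"
    unfolding fl_def by (rule filterlim_compose[OF filterlim_nat_sequentially filterlim_floor_sequentially])
  have r: "((\<lambda>t. real (fl t) / t) \<longlongrightarrow> 1) at_top"
  proof (rule tendsto_sandwich[where f = "\<lambda>t. 1 - 1 / t" and h = "\<lambda>_. 1"])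
    show "\<forall>\<^sub>F t in at_top. 1 - 1 / t \<le> real (fl t) / t"
    proof (rule eventually_mono[OF eventually_gt_at_top[of 0]])
      fix t :: real assume t: "0 < t"
      have "t - 1 \<le> real (fl t)" using t unfolding fl_def by linarith
      then have "(t - 1) / t \<le> real (fl t) / t" using t by (intro divide_right_mono) auto
      then show "1 - 1 / t \<le> real (fl t) / t" using t by (simp add: diff_divide_distrib)
    qed
    show "\<forall>\<^sub>F t in at_top. real (fl t) / t \<le> 1"
    proof (rule eventually_mono[OF eventually_gt_at_top[of 0]])
      fix t :: real assume t: "0 < t"
      have "real (fl t) \<le> t" using t unfolding fl_def by linarith
      then show "real (fl t) / t \<le> 1" using t by simp
    qed
    have "((\<lambda>t::real. 1 - 1 / t) \<longlongrightarrow> 1 - 0) at_top"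
      by (intro tendsto_diff tendsto_const tendsto_divide_0[OF tendsto_const] filterlim_at_top_imp_at_infinity filterlim_ident)
    then show "((\<lambda>t::real. 1 - 1 / t) \<longlongrightarrow> 1) at_top" by simp
  qed simp
  have r1: "((\<lambda>t. real (Suc (fl t)) / t) \<longlongrightarrow> 1) at_top"
  proof -
    have "((\<lambda>t::real. 1 / t) \<longlongrightarrow> 0) at_top"
      by (intro tendsto_divide_0[OF tendsto_const] filterlim_at_top_imp_at_infinity filterlim_ident)
    from tendsto_add[OF r this] show ?thesis by (simp add: add_divide_distrib add.commute)
  qed
  show "((\<lambda>t. (f (real (fl t)) / real (fl t)) * (real (fl t) / t)) \<longlongrightarrow> L) at_top"
    using tendsto_mult[OF filterlim_compose[OF lim flt] r] by simp
  have sf: "filterlim (\<lambda>t. Suc (fl t)) sequentially at_top"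
    by (rule filterlim_compose[OF filterlim_Suc flt])
  show "((\<lambda>t. (f (real (Suc (fl t))) / real (Suc (fl t))) * (real (Suc (fl t)) / t)) \<longlongrightarrow> L) at_top"
    using tendsto_mult[OF filterlim_compose[OF lim sf] r1] unfolding mult_1_right .
  show "\<forall>\<^sub>F t in at_top. (f (real (fl t)) / real (fl t)) * (real (fl t) / t) \<le> f t / t"
  proof (rule eventually_mono[OF eventually_ge_at_top[of 1]])
    fix t :: real assume t: "1 \<le> t"
    have p: "real (fl t) > 0" "real (fl t) \<le> t" using t unfolding fl_def by linarith+
    have "f (real (fl t)) \<le> f t" using p by (intro mono) auto
    then have "f (real (fl t)) / t \<le> f t / t" using t by (intro divide_right_mono) auto
    then show "(f (real (fl t)) / real (fl t)) * (real (fl t) / t) \<le> f t / t" using p by simp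
  qed
  show "\<forall>\<^sub>F t in at_top. f t / t \<le> (f (real (Suc (fl t))) / real (Suc (fl t))) * (real (Suc (fl t)) / t)"
  proof (rule eventually_mono[OF eventually_ge_at_top[of 1]])
    fix t :: real assume t: "1 \<le> t"
    have p: "t \<le> real (Suc (fl t))" using t unfolding fl_def by linarith
    have "f t \<le> f (real (Suc (fl t)))" using p t by (intro mono) auto
    then have "f t / t \<le> f (real (Suc (fl t))) / t" using t by (intro divide_right_mono) auto
    then show "f t / t \<le> (f (real (Suc (fl t))) / real (Suc (fl t))) * (real (Suc (fl t)) / t)" by simp
  qed
qed

definition hit :: "(real \<times> real) set \<Rightarrow> real \<Rightarrow> real \<Rightarrow> (real \<times> real \<times> real) set" where
  "hit C a b = {(x, u, s). (x, u) \<in> C \<and> a \<le> crossing_time (x, u, s) \<and> crossing_time (x, u, s) < b}"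

lemma hit_flow: "flow t \<omega> \<in> hit C a b \<longleftrightarrow> \<omega> \<in> hit C (a + t) (b + t)"
  by (cases \<omega>) (auto simp: flow_def hit_def crossing_time_def)

lemma crossing_time_measurable[measurable]: "crossing_time \<in> borel_measurable borel"
proof -
  have "(\<lambda>\<omega>::real \<times> real \<times> real. ln (\<bar>fst (snd \<omega>)\<bar> * sqrt (- (fst \<omega> - 1 / fst (snd \<omega>)) / fst \<omega>)) - snd (snd \<omega>)) \<in> borel_measurable (borel \<Otimes>\<^sub>M (borel \<Otimes>\<^sub>M borel))"
    by measurable
  then show ?thesis unfolding crossing_time_def[abs_def] case_prod_beta' borel_prod .
qed

lemma hit_borel:
  assumes C: "C \<in> sets borel"
  shows "hit C a b \<in> sets borel"
proof -
  have p: "(\<lambda>\<omega>::real \<times> real \<times> real. (fst \<omega>, fst (snd \<omega>))) \<in> borel_measurable borel"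
    by (intro borel_measurable_continuous_onI continuous_intros)
  have 1: "(\<lambda>\<omega>::real \<times> real \<times> real. (fst \<omega>, fst (snd \<omega>))) -` C \<inter> space borel \<in> sets borel"
    by (rule measurable_sets[OF p C])
  have 2: "crossing_time -` {a..<b} \<inter> space borel \<in> sets borel"
    by (rule measurable_sets[OF crossing_time_measurable]) simp
  have "hit C a b = ((\<lambda>\<omega>. (fst \<omega>, fst (snd \<omega>))) -` C \<inter> space borel) \<inter> (crossing_time -` {a..<b} \<inter> space borel)"
    by (auto simp: hit_def)
  then show ?thesis using 1 2 by auto
qed

text \<open>The crossing time is a fixed function of \<open>(x, u)\<close> minus \<open>s\<close>, so every slice over \<open>(x, u)\<close> in \<open>C\<close> is an
  interval of length \<open>b - a\<close>.\<close>

lemma emeasure_hit: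
  assumes C: "C \<in> sets borel"
  shows "(\<integral>\<^sup>+\<omega>. indicator (hit C a b) \<omega> \<partial>lborel) = ennreal (b - a) * emeasure lborel C"
proof -
  have hm: "(indicator (hit C a b) :: _ \<Rightarrow> ennreal) \<in> borel_measurable borel" using hit_borel[OF C] by simp
  have "(\<integral>\<^sup>+\<omega>. indicator (hit C a b) \<omega> \<partial>lborel) = (\<integral>\<^sup>+x. \<integral>\<^sup>+u. \<integral>\<^sup>+s. indicator (hit C a b) (x, u, s) \<partial>lborel \<partial>lborel \<partial>lborel)"
    by (rule nn_integral_triple[OF hm])
  also have "\<dots> = (\<integral>\<^sup>+x. \<integral>\<^sup>+u. ennreal (b - a) * indicator C (x, u) \<partial>lborel \<partial>lborel)"
  proof (rule nn_integral_cong, rule nn_integral_cong)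
    fix x u :: real
    define \<kappa> where "\<kappa> = crossing_time (x, u, 0)"
    have "(\<integral>\<^sup>+s. indicator (hit C a b) (x, u, s) \<partial>lborel) = (\<integral>\<^sup>+s. indicator C (x, u) * indicator {\<kappa> - b<..\<kappa> - a} s \<partial>lborel)"
      by (intro nn_integral_cong) (auto simp: hit_def indicator_def \<kappa>_def crossing_time_def)
    also have "\<dots> = indicator C (x, u) * emeasure lborel {\<kappa> - b<..\<kappa> - a}"
      by (simp add: nn_integral_cmult)
    also have "emeasure lborel {\<kappa> - b<..\<kappa> - a} = ennreal (b - a)"
      by (cases "a \<le> b") (simp_all add: ennreal_neg)
    finally show "(\<integral>\<^sup>+s. indicator (hit C a b) (x, u, s) \<partial>lborel) = ennreal (b - a) * indicator C (x, u)"
      by (simp add: mult.commute)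
  qed
  also have "\<dots> = (\<integral>\<^sup>+p. ennreal (b - a) * indicator C p \<partial>(lborel \<Otimes>\<^sub>M lborel))"
    by (rule lborel.nn_integral_fst) (use C in \<open>simp add: lborel_prod\<close>)
  also have "\<dots> = ennreal (b - a) * emeasure lborel C"
    unfolding lborel_prod using C by (simp add: nn_integral_cmult)
  finally show ?thesis .
qed

context fuchsian_finite
begin

text \<open>The number of lifts of the geodesic of \<open>\<omega>\<close> whose coordinates \<open>(x, u)\<close> lie in \<open>C\<close> and which cross the
  imaginary axis at a time in \<open>{a..<b}\<close>. The group elements are counted, which for geodesics
  through free points only is the same as counting lifts.\<close>

definition crossings :: "(real \<times> real) set \<Rightarrow> real \<times> real \<times> real \<Rightarrow> real \<Rightarrow> real \<Rightarrow> ennreal" where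
  "crossings C \<omega> a b = (\<integral>\<^sup>+g. indicator (hit C a b) (act g \<omega>) \<partial>count_space G)"

lemma crossings_add:
  assumes "a \<le> b" "b \<le> c"
  shows "crossings C \<omega> a c = crossings C \<omega> a b + crossings C \<omega> b c"
proof -
  have "crossings C \<omega> a c = (\<integral>\<^sup>+g. indicator (hit C a b) (act g \<omega>) + indicator (hit C b c) (act g \<omega>) \<partial>count_space G)"
    unfolding crossings_def using assms by (intro nn_integral_cong) (auto simp: indicator_def hit_def)
  also have "\<dots> = crossings C \<omega> a b + crossings C \<omega> b c"
    unfolding crossings_def by (rule nn_integral_add) auto
  finally show ?thesis .
qed

lemma crossings_mono: "a' \<le> a \<Longrightarrow> b \<le> b' \<Longrightarrow> crossings C \<omega> a b \<le> crossings C \<omega> a' b'"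
  unfolding crossings_def by (intro nn_integral_mono) (auto simp: indicator_def hit_def)

lemma crossings_flow: "crossings C (flow t \<omega>) a b = crossings C \<omega> (a + t) (b + t)"
  unfolding crossings_def flow_act[symmetric] by (simp add: hit_flow indicator_def)

lemma crossings_act: "g \<in> G \<Longrightarrow> \<omega> \<in> X0 \<Longrightarrow> crossings C (act g \<omega>) a b = crossings C \<omega> a b"
  unfolding crossings_def using nn_integral_orbit[of g \<omega> "indicator (hit C a b)"] by simp

lemma crossings_measurable_M:
  assumes C: "C \<in> sets borel"
  shows "(\<lambda>\<omega>. crossings C \<omega> a b) \<in> borel_measurable M"
proof -
  have "(indicator (hit C a b) :: _ \<Rightarrow> ennreal) \<in> borel_measurable M"
    using hit_borel[OF C] by (intro borel_measurable_M) simp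
  from measurable_orbit_sum[OF this] show ?thesis unfolding crossings_def by simp
qed

lemma crossings_measurable:
  assumes C: "C \<in> sets borel"
  shows "(\<lambda>\<omega>. crossings C \<omega> a b) \<in> borel_measurable quot"
  by (rule measurable_quotI[OF crossings_measurable_M[OF C]]) (simp add: crossings_act)

text \<open>Summing over the group and integrating over the quotient is integrating over the whole space.\<close>

lemma crossings_integral:
  assumes C: "C \<in> sets borel"
  shows "(\<integral>\<^sup>+\<omega>. crossings C \<omega> a b \<partial>quot) = ennreal (b - a) * emeasure lborel C"
proof -
  have hm: "(indicator (hit C a b) :: _ \<Rightarrow> ennreal) \<in> borel_measurable borel" using hit_borel[OF C] by simp
  have "(\<integral>\<^sup>+\<omega>. crossings C \<omega> a b \<partial>quot) = (\<integral>\<^sup>+\<omega>. crossings C \<omega> a b * indicator D \<omega> \<partial>M)"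
    by (rule nn_integral_quot[OF crossings_measurable[OF C]])
  also have "\<dots> = (\<integral>\<^sup>+\<omega>. indicator (hit C a b) \<omega> \<partial>M)"
    using unfolding_integral[OF borel_measurable_M[OF hm]] by (simp add: crossings_def)
  also have "\<dots> = (\<integral>\<^sup>+\<omega>. indicator (hit C a b) \<omega> \<partial>lborel)" by (rule nn_integral_M[OF hm])
  also have "\<dots> = ennreal (b - a) * emeasure lborel C" by (rule emeasure_hit[OF C])
  finally show ?thesis .
qed

lemma AE_quot_imp:
  assumes "AE \<omega> in quot. P \<omega>"
  shows "AE \<omega> in M. P \<omega>"
proof -
  obtain N where N: "{\<omega> \<in> space quot. \<not> P \<omega>} \<subseteq> N" "emeasure quot N = 0" "N \<in> sets quot"
    using assms by (rule AE_E)
  then have n: "invariant_set N" "N \<in> sets M" "emeasure M (N \<inter> D) = 0" by (auto simp: emeasure_quot sets_quot)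
  have "{\<omega> \<in> space M. \<not> P \<omega>} \<subseteq> N" using N(1) by simp
  from AE_I[OF this invariant_null[OF n] n(2)] show ?thesis .
qed

lemma total_positive: "measure quot (space quot) > 0"
proof (rule ccontr)
  interpret q: finite_measure quot by (rule finite_quot)
  assume "\<not> ?thesis"
  then have "measure quot (space quot) = 0" using measure_nonneg[of quot "space quot"] by linarith
  then have "emeasure quot (space quot) = 0" by (simp add: q.emeasure_eq_measure)
  then have "AE \<omega> in quot. False"
    by (intro AE_I[where N = "space quot"] sets.top) simp_all
  from AE_quot_imp[OF this] have "AE \<omega>::real \<times> real \<times> real in lborel. False" unfolding AE_M_iff .
  then show False using AE_lborel_ex[of "\<lambda>_::real \<times> real \<times> real. False"] by simp
qed

lemma funpow_flow: "(flow 1 ^^ j) \<omega> = flow (real j) \<omega>"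
  by (induction j) (cases \<omega>; simp add: flow_def add.commute)+

text \<open>The number of crossings before time \<open>n\<close> is a sum over the time one map of the number of crossings in
  a unit of time, whose integral is the area of \<open>C\<close>. The upper and lower limits of the averages are
  invariant under the flow, so ergodicity of the flow gives the hypotheses of \<open>ergodic_averages\<close>.\<close>

theorem counting_limit:
  assumes C: "C \<in> sets borel" and fin: "emeasure lborel C < \<infinity>"
  shows "AE \<omega> in lborel. (\<forall>m::nat. crossings C \<omega> (- real m) (real m) < \<infinity>) \<and>
     ((\<lambda>t. enn2real (crossings C \<omega> 0 t) / t) \<longlongrightarrow> measure lborel C / measure quot (space quot)) at_top"
proof -
  define N where "N = crossings C"
  have Nm: "(\<lambda>\<omega>. N \<omega> a b) \<in> borel_measurable quot" for a b unfolding N_def by (rule crossings_measurable[OF C])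
  define X1 where "X1 = {\<omega> \<in> X0. \<forall>m::nat. N \<omega> (- real m) (real m) < \<infinity>}"
  have X1q: "X1 \<in> sets quot"
  proof -
    have "{\<omega> \<in> space quot. \<forall>m::nat. N \<omega> (- real m) (real m) < \<infinity>} \<in> sets quot"
      using Nm by measurable
    then show ?thesis by (simp add: X1_def)
  qed
  have AEX1: "AE \<omega> in quot. \<omega> \<in> X1"
  proof -
    have "AE \<omega> in quot. N \<omega> (- real m) (real m) \<noteq> \<infinity>" for m
      using fin by (intro nn_integral_noteq_infinite Nm) (simp add: N_def crossings_integral[OF C] ennreal_mult_eq_top_iff less_top)
    then have "AE \<omega> in quot. \<forall>m::nat. N \<omega> (- real m) (real m) \<noteq> \<infinity>" by (simp add: AE_all_countable)
    then show ?thesis by (rule AE_mp) (auto simp: X1_def less_top)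
  qed
  have finN: "N \<omega> a b < \<infinity>" if w: "\<omega> \<in> X1" for \<omega> a b
  proof -
    obtain m where m: "max \<bar>a\<bar> \<bar>b\<bar> \<le> real m" using real_arch_simple by blast
    then have "N \<omega> a b \<le> N \<omega> (- real m) (real m)" unfolding N_def by (intro crossings_mono) auto
    also have "\<dots> < \<infinity>" using w by (simp add: X1_def)
    finally show ?thesis .
  qed
  have X1flow: "flow t \<omega> \<in> X1" if w: "\<omega> \<in> X1" for t \<omega>
  proof -
    have "N (flow t \<omega>) a b < \<infinity>" for a b unfolding N_def crossings_flow using finN[OF w] by (simp add: N_def)
    then show ?thesis using w by (simp add: X1_def)
  qed
  have X1flow_iff: "flow t \<omega> \<in> X1 \<longleftrightarrow> \<omega> \<in> X1" for t \<omega>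
  proof -
    have "flow (- t) (flow t \<omega>) = \<omega>" by (cases \<omega>) (simp add: flow_def)
    then show ?thesis using X1flow[of \<omega> t] X1flow[of "flow t \<omega>" "- t"] by auto
  qed
  define f where "f \<omega> = enn2real (N \<omega> 0 1)" for \<omega>
  define S where "S n \<omega> = (\<Sum>j<n. f ((flow 1 ^^ j) \<omega>))" for n \<omega>
  have fm: "f \<in> borel_measurable quot" unfolding f_def using Nm by measurable
  have Sc: "S n \<omega> = enn2real (N \<omega> 0 (real n))" if w: "\<omega> \<in> X1" for n \<omega>
  proof (induction n)
    case 0
    have "hit C 0 0 = {}" by (auto simp: hit_def)
    then have "N \<omega> 0 0 = 0" unfolding N_def crossings_def by simp
    then show ?case by (simp add: S_def)
  next
    case (Suc n)
    have "N \<omega> 0 (real (Suc n)) = N \<omega> 0 (real n) + N \<omega> (real n) (real (Suc n))"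
      unfolding N_def by (rule crossings_add) auto
    moreover have "N \<omega> (real n) (real (Suc n)) = N (flow (real n) \<omega>) 0 1"
      unfolding N_def crossings_flow by (simp add: add.commute)
    ultimately have "enn2real (N \<omega> 0 (real (Suc n))) = enn2real (N \<omega> 0 (real n)) + f (flow (real n) \<omega>)"
      using finN[OF w] finN[OF X1flow[OF w]] by (simp add: f_def enn2real_plus)
    then show ?case using Suc by (simp add: S_def funpow_flow)
  qed
  have tm: "flow t \<in> quot \<rightarrow>\<^sub>M quot" "distr quot quot (flow t) = quot" for t
  proof -
    have b: "flow (- t) (flow t \<omega>) = \<omega>" for \<omega> by (cases \<omega>) (simp add: flow_def)
    note m = flow_preserving(1)[of t] flow_preserving(1)[of "- t"] flow_preserving(2)[of t] flow_preserving(2)[of "- t"]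
    show "flow t \<in> quot \<rightarrow>\<^sub>M quot" by (rule commuting_map_quot(1)[OF m b flow_act flow_act])
    show "distr quot quot (flow t) = quot" by (rule commuting_map_quot(2)[OF m b flow_act flow_act])
  qed
  have pw: "(\<lambda>\<omega>. f ((flow 1 ^^ j) \<omega>)) \<in> borel_measurable quot" for j
    unfolding funpow_flow using tm(1) fm by (rule measurable_compose)
  have Sm: "(\<lambda>\<omega>. S n \<omega>) \<in> borel_measurable quot" for n
    unfolding S_def using pw by (rule borel_measurable_sum)
  define Ls where "Ls \<omega> = limsup (\<lambda>n. ereal (S n \<omega> / real n))" for \<omega>
  define Li where "Li \<omega> = liminf (\<lambda>n. ereal (S n \<omega> / real n))" for \<omega>
  have Lsm: "Ls \<in> borel_measurable quot" unfolding Ls_def using Sm by measurable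
  have Lim: "Li \<in> borel_measurable quot" unfolding Li_def using Sm by measurable
  \<comment> \<open>A bound in both directions follows by flowing back, which gives the equalities below.\<close>
  have half: "Ls (flow t \<omega>) \<le> Ls \<omega>" "Li (flow t \<omega>) \<le> Li \<omega>" if w: "\<omega> \<in> X1" for t \<omega>
  proof -
    obtain m where m: "\<bar>t\<bar> \<le> real m" using real_arch_simple by blast
    have "S n (flow t \<omega>) \<le> enn2real (N \<omega> (- real m) 0) + S (n + m) \<omega>" for n
    proof -
      have "N (flow t \<omega>) 0 (real n) = N \<omega> t (real n + t)" unfolding N_def crossings_flow by simp
      also have "\<dots> \<le> N \<omega> (- real m) (real (n + m))" unfolding N_def using m by (intro crossings_mono) auto
      also have "\<dots> = N \<omega> (- real m) 0 + N \<omega> 0 (real (n + m))" unfolding N_def by (rule crossings_add) auto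
      finally have "enn2real (N (flow t \<omega>) 0 (real n)) \<le> enn2real (N \<omega> (- real m) 0 + N \<omega> 0 (real (n + m)))"
        using finN[OF w] by (intro enn2real_mono) (auto simp: less_top)
      also have "\<dots> = enn2real (N \<omega> (- real m) 0) + enn2real (N \<omega> 0 (real (n + m)))"
        using finN[OF w] by (intro enn2real_plus) auto
      finally show ?thesis using Sc[OF w] Sc[OF X1flow[OF w]] by simp
    qed
    from limsup_average_shift[where d = "\<lambda>n. S n (flow t \<omega>)" and c = "\<lambda>n. S n \<omega>" and m = m, OF this] show "Ls (flow t \<omega>) \<le> Ls \<omega>" "Li (flow t \<omega>) \<le> Li \<omega>"
      by (simp_all add: Ls_def Li_def)
  qed
  have inv: "Ls (flow t \<omega>) = Ls \<omega>" "Li (flow t \<omega>) = Li \<omega>" if w: "\<omega> \<in> X1" for t \<omega>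
  proof -
    have b: "flow (- t) (flow t \<omega>) = \<omega>" by (cases \<omega>) (simp add: flow_def)
    show "Ls (flow t \<omega>) = Ls \<omega>" "Li (flow t \<omega>) = Li \<omega>"
      using half[OF w, of t] half[OF X1flow[OF w, of t], of "- t"] b by auto
  qed
  \<comment> \<open>Only the orbits in \<open>X1\<close>, where all counts are finite, satisfy the additivity of the counts as real numbers.\<close>
  have dich: "(AE \<omega> in quot. P \<omega>) \<or> (AE \<omega> in quot. \<not> P \<omega>)"
    if Pm: "{\<omega> \<in> space quot. P \<omega>} \<in> sets quot" and Pi: "\<And>t \<omega>. \<omega> \<in> X1 \<Longrightarrow> P (flow t \<omega>) \<longleftrightarrow> P \<omega>" for P
  proof -
    define A where "A = X1 \<inter> {\<omega> \<in> space quot. P \<omega>}"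
    have Aq: "A \<in> sets quot" unfolding A_def using X1q Pm by (rule sets.Int)
    have "flow_invariant A" unfolding flow_invariant_def
    proof (intro conjI allI)
      show "A \<in> sets quot" by (rule Aq)
      fix t \<omega>
      have "\<omega> \<in> X1 \<Longrightarrow> \<omega> \<in> X0" for \<omega> by (simp add: X1_def)
      then show "flow t \<omega> \<in> A \<longleftrightarrow> \<omega> \<in> A" using X1flow_iff[of t \<omega>] Pi[of \<omega> t] by (auto simp: A_def)
    qed
    from ergodic[OF this] show ?thesis
    proof
      assume a: "AE \<omega> in M. \<omega> \<in> A"
      have q: "{\<omega> \<in> space M. \<not> \<omega> \<in> A} \<in> sets quot"
        using sets.compl_sets[OF Aq] by (simp add: set_diff_eq)
      from iffD2[OF AE_quot_iff[OF q] a] have "AE \<omega> in quot. \<omega> \<in> A" .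
      then have "AE \<omega> in quot. P \<omega>" by (rule AE_mp) (simp add: A_def)
      then show ?thesis ..
    next
      assume a: "AE \<omega> in M. \<omega> \<notin> A"
      have "{\<omega> \<in> space M. \<not> \<omega> \<notin> A} = A" using sets.sets_into_space[OF Aq] by auto
      then have q: "{\<omega> \<in> space M. \<not> \<omega> \<notin> A} \<in> sets quot" using Aq by simp
      from iffD2[OF AE_quot_iff[OF q] a] have "AE \<omega> in quot. \<omega> \<notin> A" .
      with AEX1 have "AE \<omega> in quot. \<omega> \<in> space quot \<longrightarrow> \<not> P \<omega>"
        by eventually_elim (simp add: A_def)
      then have "AE \<omega> in quot. \<not> P \<omega>" by (rule AE_mp) (intro AE_I2, simp)
      then show ?thesis ..
    qed
  qed
  have fint: "integrable quot f" "(\<integral>\<omega>. f \<omega> \<partial>quot) = measure lborel C"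
  proof -
    have e: "(\<integral>\<^sup>+\<omega>. ennreal (f \<omega>) \<partial>quot) = emeasure lborel C"
    proof -
      have "(\<integral>\<^sup>+\<omega>. ennreal (f \<omega>) \<partial>quot) = (\<integral>\<^sup>+\<omega>. N \<omega> 0 1 \<partial>quot)"
        by (rule nn_integral_cong_AE, rule AE_mp[OF AEX1], rule AE_I2) (use finN in \<open>auto simp: f_def less_top\<close>)
      also have "\<dots> = emeasure lborel C" unfolding N_def crossings_integral[OF C] by simp
      finally show ?thesis .
    qed
    show "integrable quot f"
    proof (rule integrableI_nonneg[OF fm])
      show "AE \<omega> in quot. 0 \<le> f \<omega>" by (intro AE_I2) (simp add: f_def)
      show "(\<integral>\<^sup>+\<omega>. ennreal (f \<omega>) \<partial>quot) < \<infinity>" unfolding e by (rule fin)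
    qed
    have "(\<integral>\<omega>. f \<omega> \<partial>quot) = enn2real (\<integral>\<^sup>+\<omega>. ennreal (f \<omega>) \<partial>quot)"
      by (rule integral_eq_nn_integral[OF fm]) (intro AE_I2, simp add: f_def)
    then show "(\<integral>\<omega>. f \<omega> \<partial>quot) = measure lborel C" unfolding e by (simp add: measure_def)
  qed
  have "AE \<omega> in quot. (\<lambda>n. (\<Sum>j<n. f ((flow 1 ^^ j) \<omega>)) / real n) \<longlonglongrightarrow> (\<integral>\<omega>. f \<omega> \<partial>quot) / measure quot (space quot)"
  proof (rule ergodic_averages[OF finite_quot tm fint(1)])
    fix b :: real
    have "{\<omega> \<in> space quot. Ls \<omega> \<le> ereal b} \<in> sets quot" using Lsm by measurable
    from dich[OF this] show "(AE x in quot. limsup (\<lambda>n. ereal ((\<Sum>j<n. f ((flow 1 ^^ j) x)) / real n)) \<le> ereal b) \<or>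
         (AE x in quot. ereal b < limsup (\<lambda>n. ereal ((\<Sum>j<n. f ((flow 1 ^^ j) x)) / real n)))"
      using inv by (simp add: Ls_def S_def not_le)
    have "{\<omega> \<in> space quot. ereal b \<le> Li \<omega>} \<in> sets quot" using Lim by measurable
    from dich[OF this] show "(AE x in quot. ereal b \<le> liminf (\<lambda>n. ereal ((\<Sum>j<n. f ((flow 1 ^^ j) x)) / real n))) \<or>
         (AE x in quot. liminf (\<lambda>n. ereal ((\<Sum>j<n. f ((flow 1 ^^ j) x)) / real n)) < ereal b)"
      using inv by (simp add: Li_def S_def not_le)
  qed
  with AEX1 have "AE \<omega> in quot. \<omega> \<in> X1 \<and> (\<lambda>n. S n \<omega> / real n) \<longlonglongrightarrow> measure lborel C / measure quot (space quot)"
    by eventually_elim (simp add: S_def fint(2))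
  then have "AE \<omega> in lborel. \<omega> \<in> X1 \<and> (\<lambda>n. S n \<omega> / real n) \<longlonglongrightarrow> measure lborel C / measure quot (space quot)"
    by (rule AE_quot_imp[unfolded AE_M_iff])
  then show ?thesis
  proof eventually_elim
    case (elim \<omega>)
    then have w: "\<omega> \<in> X1" by blast
    have "((\<lambda>t. enn2real (N \<omega> 0 t) / t) \<longlongrightarrow> measure lborel C / measure quot (space quot)) at_top"
    proof (rule monotone_average)
      show "enn2real (N \<omega> 0 s) \<le> enn2real (N \<omega> 0 t)" if "s \<le> t" for s t
        using finN[OF w] that unfolding N_def by (intro enn2real_mono crossings_mono) (auto simp: less_top)
      show "(\<lambda>n. enn2real (N \<omega> 0 (real n)) / real n) \<longlonglongrightarrow> measure lborel C / measure quot (space quot)"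
        using elim Sc[OF w] by simp
    qed simp
    then show ?case using finN[OF w] by (simp add: N_def)
  qed
qed

end

section \<open>The area of the region of approximating excursions\<close>

text \<open>The coordinates \<open>(x, u)\<close> of the geodesics whose end points lie in the region \<open>J\<close> and which cross the imaginary axis at
  height at most one.\<close>

definition crossing_set :: "real \<Rightarrow> (real \<times> real) set" where
  "crossing_set a = {(x, u). u \<noteq> 0 \<and> (- a < x \<and> x < 0 \<and> a < x - 1 / u \<or> 0 < x \<and> x < a \<and> x - 1 / u < - a) \<and>
      - (x * (x - 1 / u)) \<le> 1}"

text \<open>The geodesics of the region whose distance to \<open>\<i>\<close> has hyperbolic sine at most \<open>\<sigma>\<close>.\<close>

definition shallow_set :: "real \<Rightarrow> real \<Rightarrow> (real \<times> real) set" where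
  "shallow_set a \<sigma> = {(x, u) \<in> crossing_set a. \<bar>u * (1 + x\<^sup>2) - x\<bar> \<le> \<sigma>}"

text \<open>The length of the slices of \<open>shallow_set a \<sigma>\<close> over \<open>q\<close> and over \<open>- q\<close>, for \<open>q\<close> between \<open>0\<close> and \<open>a\<close>: the
  condition on the crossing bounds \<open>u\<close> from below, the condition on the backward end point and the one
  on the depth bound it from above.\<close>

definition slice_length :: "real \<Rightarrow> real \<Rightarrow> real \<Rightarrow> real" where
  "slice_length a \<sigma> q = max 0 (min (1 / (a + q)) ((q + \<sigma>) / (1 + q\<^sup>2)) - q / (1 + q\<^sup>2))"

lemma shallow_set_borel: "shallow_set a \<sigma> \<in> sets borel"
proof -
  have "{p \<in> space (borel \<Otimes>\<^sub>M borel :: (real \<times> real) measure). snd p \<noteq> 0 \<and>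
      (- a < fst p \<and> fst p < 0 \<and> a < fst p - 1 / snd p \<or> 0 < fst p \<and> fst p < a \<and> fst p - 1 / snd p < - a) \<and>
      - (fst p * (fst p - 1 / snd p)) \<le> 1 \<and> \<bar>snd p * (1 + (fst p)\<^sup>2) - fst p\<bar> \<le> \<sigma>} \<in> sets (borel \<Otimes>\<^sub>M borel)"
    by measurable
  moreover have "{p \<in> space (borel \<Otimes>\<^sub>M borel :: (real \<times> real) measure). snd p \<noteq> 0 \<and>
      (- a < fst p \<and> fst p < 0 \<and> a < fst p - 1 / snd p \<or> 0 < fst p \<and> fst p < a \<and> fst p - 1 / snd p < - a) \<and>
      - (fst p * (fst p - 1 / snd p)) \<le> 1 \<and> \<bar>snd p * (1 + (fst p)\<^sup>2) - fst p\<bar> \<le> \<sigma>} = shallow_set a \<sigma>"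
    by (auto simp: shallow_set_def crossing_set_def space_pair_measure)
  ultimately have "shallow_set a \<sigma> \<in> sets (borel \<Otimes>\<^sub>M borel)" by (simp only:)
  then show ?thesis unfolding borel_prod .
qed

lemma one_plus_sq_pos: "0 < 1 + (q::real)\<^sup>2" by (simp add: add_pos_nonneg)

lemma slice_pos:
  assumes q: "0 < q" "q < a"
  shows "(q, u) \<in> shallow_set a \<sigma> \<longleftrightarrow> q / (1 + q\<^sup>2) \<le> u \<and> u < 1 / (a + q) \<and> u \<le> (q + \<sigma>) / (1 + q\<^sup>2)"
proof (cases "u > 0")
  case False
  have "0 < q / (1 + q\<^sup>2)" using q one_plus_sq_pos[of q] by simp
  moreover have "\<not> (q - 1 / u < - a)" if "u \<noteq> 0"
  proof -
    have "1 / u < 0" using False that by simp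
    then show ?thesis using q by linarith
  qed
  ultimately show ?thesis using False q by (auto simp: shallow_set_def crossing_set_def)
next
  case u: True
  have n: "0 < 1 + q\<^sup>2" by (rule one_plus_sq_pos)
  have 1: "q - 1 / u < - a \<longleftrightarrow> u < 1 / (a + q)"
  proof -
    have "q - 1 / u < - a \<longleftrightarrow> a + q < 1 / u" by linarith
    also have "\<dots> \<longleftrightarrow> (a + q) * u < 1" using u by (simp add: less_divide_eq)
    also have "\<dots> \<longleftrightarrow> u < 1 / (a + q)" using q by (simp add: less_divide_eq mult.commute)
    finally show ?thesis .
  qed
  have 2: "- (q * (q - 1 / u)) \<le> 1 \<longleftrightarrow> q / (1 + q\<^sup>2) \<le> u"
  proof -
    have "- (q * (q - 1 / u)) = q / u - q\<^sup>2" by (simp add: algebra_simps power2_eq_square)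
    then have "- (q * (q - 1 / u)) \<le> 1 \<longleftrightarrow> q / u \<le> 1 + q\<^sup>2" by linarith
    also have "\<dots> \<longleftrightarrow> q \<le> (1 + q\<^sup>2) * u" using u by (simp add: divide_le_eq)
    also have "\<dots> \<longleftrightarrow> q / (1 + q\<^sup>2) \<le> u" using n by (simp add: divide_le_eq mult.commute)
    finally show ?thesis .
  qed
  have 3: "\<bar>u * (1 + q\<^sup>2) - q\<bar> \<le> \<sigma> \<longleftrightarrow> u \<le> (q + \<sigma>) / (1 + q\<^sup>2)" if "q / (1 + q\<^sup>2) \<le> u"
  proof -
    have "0 \<le> u * (1 + q\<^sup>2) - q" using that n by (simp add: divide_le_eq)
    then have "\<bar>u * (1 + q\<^sup>2) - q\<bar> \<le> \<sigma> \<longleftrightarrow> u * (1 + q\<^sup>2) \<le> q + \<sigma>" by linarith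
    also have "\<dots> \<longleftrightarrow> u \<le> (q + \<sigma>) / (1 + q\<^sup>2)" using n by (simp add: le_divide_eq)
    finally show ?thesis .
  qed
  have "(q, u) \<in> shallow_set a \<sigma> \<longleftrightarrow> q - 1 / u < - a \<and> - (q * (q - 1 / u)) \<le> 1 \<and> \<bar>u * (1 + q\<^sup>2) - q\<bar> \<le> \<sigma>"
    using u q by (simp add: shallow_set_def crossing_set_def)
  then show ?thesis using 1 2 3 by blast
qed

lemma shallow_sym: "(- x, - u) \<in> shallow_set a \<sigma> \<longleftrightarrow> (x, u) \<in> shallow_set a \<sigma>"
proof -
  define y t where "y = x - 1 / u" and "t = u * (1 + x\<^sup>2) - x"
  have e1: "- x - 1 / - u = - y" by (simp add: y_def)
  have e2: "- u * (1 + (- x)\<^sup>2) - - x = - t" by (simp add: t_def)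
  have e3: "- x * - y = x * y" by simp
  have e4: "(- a < - x \<and> - x < 0 \<and> a < - y \<or> 0 < - x \<and> - x < a \<and> - y < - a) \<longleftrightarrow>
      (- a < x \<and> x < 0 \<and> a < y \<or> 0 < x \<and> x < a \<and> y < - a)"
    by (smt (verit))
  have e5: "- u \<noteq> 0 \<longleftrightarrow> u \<noteq> 0" by simp
  show ?thesis unfolding shallow_set_def crossing_set_def mem_Collect_eq prod.case
    unfolding e1 e2 e3 e4 e5 abs_minus_cancel y_def[symmetric] t_def[symmetric] ..
qed

lemma emeasure_slice:
  assumes q: "0 < q" "q < a"
  shows "emeasure lborel {u. (q, u) \<in> shallow_set a \<sigma>} = ennreal (slice_length a \<sigma> q)"
    "emeasure lborel {u. (- q, u) \<in> shallow_set a \<sigma>} = ennreal (slice_length a \<sigma> q)"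
proof -
  define A B B2 where "A = q / (1 + q\<^sup>2)" and "B = 1 / (a + q)" and "B2 = (q + \<sigma>) / (1 + q\<^sup>2)"
  have e: "{u. (q, u) \<in> shallow_set a \<sigma>} = {u. A \<le> u \<and> u < B \<and> u \<le> B2}"
    unfolding slice_pos[OF q] A_def B_def B2_def ..
  have s: "{u. A \<le> u \<and> u < B \<and> u \<le> B2} = (if B \<le> B2 then {A..<B} else {A..B2})" by auto
  have m: "emeasure lborel {u. A \<le> u \<and> u < B \<and> u \<le> B2} = ennreal (max 0 (min B B2 - A))"
    unfolding s by (cases "B \<le> B2"; cases "A \<le> B"; cases "A \<le> B2") (auto simp: max_def min_def ennreal_neg)
  show 1: "emeasure lborel {u. (q, u) \<in> shallow_set a \<sigma>} = ennreal (slice_length a \<sigma> q)"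
    unfolding e m by (simp add: slice_length_def A_def B_def B2_def)
  have mb: "{u. (q, u) \<in> shallow_set a \<sigma>} \<in> sets borel" unfolding e s by simp
  have "{u. (- q, u) \<in> shallow_set a \<sigma>} = uminus -` {u. (q, u) \<in> shallow_set a \<sigma>} \<inter> space lborel"
    using shallow_sym[of q "- u" for u] by (simp add: vimage_def)
  then have "emeasure lborel {u. (- q, u) \<in> shallow_set a \<sigma>} = emeasure (distr lborel borel uminus) {u. (q, u) \<in> shallow_set a \<sigma>}"
    using mb by (subst emeasure_distr) auto
  then show "emeasure lborel {u. (- q, u) \<in> shallow_set a \<sigma>} = ennreal (slice_length a \<sigma> q)"
    unfolding lborel_distr_uminus 1 .
qed

lemma slice_length_continuous:
  assumes "0 < a"
  shows "continuous_on {0..a} (slice_length a \<sigma>)"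
proof -
  have "1 + q\<^sup>2 \<noteq> 0" for q :: real using one_plus_sq_pos[of q] by linarith
  then show ?thesis unfolding slice_length_def using assms by (intro continuous_intros) auto
qed

lemma emeasure_shallow:
  assumes a: "0 < a"
  shows "emeasure lborel (shallow_set a \<sigma>) = ennreal (2 * integral {0..a} (slice_length a \<sigma>))"
proof -
  have Sb: "shallow_set a \<sigma> \<in> sets (lborel \<Otimes>\<^sub>M lborel)" using shallow_set_borel unfolding lborel_prod by simp
  define h where "h q = ennreal (slice_length a \<sigma> q) * indicator {0<..<a} q" for q
  have hm: "h \<in> borel_measurable borel" unfolding h_def slice_length_def by measurable
  have "emeasure lborel (shallow_set a \<sigma>) = (\<integral>\<^sup>+x. emeasure lborel (Pair x -` shallow_set a \<sigma>) \<partial>lborel)"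
    unfolding lborel_prod[symmetric] by (rule lborel.emeasure_pair_measure_alt[OF Sb])
  also have "\<dots> = (\<integral>\<^sup>+x. h x + h (- x) \<partial>lborel)"
  proof (rule nn_integral_cong)
    fix x :: real
    have v: "Pair x -` shallow_set a \<sigma> = {u. (x, u) \<in> shallow_set a \<sigma>}" by auto
    consider "0 < x" "x < a" | "- a < x" "x < 0" | "x = 0 \<or> x \<le> - a \<or> a \<le> x" by linarith
    then show "emeasure lborel (Pair x -` shallow_set a \<sigma>) = h x + h (- x)"
    proof cases
      case 1 then show ?thesis unfolding v emeasure_slice(1)[OF 1] by (simp add: h_def)
    next
      case 2
      then have "0 < - x" "- x < a" by auto
      from emeasure_slice(2)[OF this] 2 show ?thesis unfolding v by (simp add: h_def)
    next
      case 3
      then have "{u. (x, u) \<in> shallow_set a \<sigma>} = {}" using a by (auto simp: shallow_set_def crossing_set_def)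
      then show ?thesis unfolding v using 3 a by (auto simp: h_def)
    qed
  qed
  also have "\<dots> = (\<integral>\<^sup>+x. h x \<partial>lborel) + (\<integral>\<^sup>+x. h (- x) \<partial>lborel)"
    using hm by (intro nn_integral_add) (auto intro: measurable_compose[of uminus])
  also have "(\<integral>\<^sup>+x. h (- x) \<partial>lborel) = (\<integral>\<^sup>+x. h x \<partial>lborel)"
    using nn_integral_real_affine[OF hm, of "-1" 0] by simp
  also have "(\<integral>\<^sup>+x. h x \<partial>lborel) = ennreal (integral {0..a} (slice_length a \<sigma>))"
  proof -
    have "AE x in lborel. h x = ennreal (indicator {0..a} x * slice_length a \<sigma> x)"
      using AE_lborel_singleton[of 0] AE_lborel_singleton[of a]
      by eventually_elim (auto simp: h_def indicator_def)
    then have "(\<integral>\<^sup>+x. h x \<partial>lborel) = (\<integral>\<^sup>+x. ennreal (indicator {0..a} x * slice_length a \<sigma> x) \<partial>lborel)"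
      by (rule nn_integral_cong_AE)
    also have "\<dots> = ennreal (integral {0..a} (slice_length a \<sigma>))"
    proof (rule nn_integral_has_integral_lborel)
      show "(\<lambda>x. indicator {0..a} x * slice_length a \<sigma> x) \<in> borel_measurable borel" unfolding slice_length_def by measurable
      show "0 \<le> indicator {0..a} x * slice_length a \<sigma> x" for x by (simp add: slice_length_def)
      have "(slice_length a \<sigma> has_integral integral {0..a} (slice_length a \<sigma>)) {0..a}"
        using slice_length_continuous[OF a] by (intro integrable_integral integrable_continuous_real)
      then have "((\<lambda>x. if x \<in> {0..a} then slice_length a \<sigma> x else 0) has_integral integral {0..a} (slice_length a \<sigma>)) UNIV"
        by (simp only: has_integral_restrict_UNIV)
      moreover have "(\<lambda>x. if x \<in> {0..a} then slice_length a \<sigma> x else 0) = (\<lambda>x. indicator {0..a} x * slice_length a \<sigma> x)"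
        by (auto simp: indicator_def)
      ultimately show "((\<lambda>x. indicator {0..a} x * slice_length a \<sigma> x) has_integral integral {0..a} (slice_length a \<sigma>)) UNIV" by simp
    qed
    finally show ?thesis .
  qed
  also have "ennreal (integral {0..a} (slice_length a \<sigma>)) + ennreal (integral {0..a} (slice_length a \<sigma>)) = ennreal (2 * integral {0..a} (slice_length a \<sigma>))"
  proof -
    have "0 \<le> integral {0..a} (slice_length a \<sigma>)" using slice_length_continuous[OF a]
      by (intro integral_nonneg integrable_continuous_real) (auto simp: slice_length_def)
    then show ?thesis by (simp add: ennreal_plus[symmetric] del: ennreal_plus)
  qed
  finally show ?thesis .
qed

lemma slice_length_integral_nonneg: "0 < a \<Longrightarrow> 0 \<le> integral {0..a} (slice_length a \<sigma>)"
  using slice_length_continuous by (intro integral_nonneg integrable_continuous_real) (auto simp: slice_length_def)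

lemma measure_shallow: "0 < a \<Longrightarrow> measure lborel (shallow_set a \<sigma>) = 2 * integral {0..a} (slice_length a \<sigma>)"
  using emeasure_shallow[of a \<sigma>] slice_length_integral_nonneg[of a \<sigma>] by (simp add: measure_def)

text \<open>The bound \<open>1 / a\<close> is attained in the limit by the geodesic from \<open>- a\<close> to \<open>0\<close>; it is the hyperbolic sine
  of \<open>r_const k\<close> for \<open>a = a_const k\<close>.\<close>

lemma crossing_set_eq_shallow:
  assumes a: "0 < a"
  shows "crossing_set a = shallow_set a (1 / a)"
proof -
  have pos: "\<bar>u * (1 + q\<^sup>2) - q\<bar> \<le> 1 / a" if q: "0 < q" "q < a" and c: "(q, u) \<in> crossing_set a" for q u
  proof -
    have u: "(q, u) \<in> shallow_set a \<bar>u * (1 + q\<^sup>2) - q\<bar>" using c by (simp add: shallow_set_def)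
    from slice_pos[OF q, THEN iffD1, OF this] have s: "q / (1 + q\<^sup>2) \<le> u" "u < 1 / (a + q)" by auto
    have n: "0 < 1 + q\<^sup>2" by (rule one_plus_sq_pos)
    have 0: "0 \<le> u * (1 + q\<^sup>2) - q" using s(1) n by (simp add: divide_le_eq)
    have "u * (1 + q\<^sup>2) \<le> (1 / (a + q)) * (1 + q\<^sup>2)" using s(2) n by (intro mult_right_mono) auto
    also have "\<dots> = (1 + q\<^sup>2) / (a + q)" by simp
    also have "\<dots> \<le> q + 1 / a"
    proof -
      have "(q + 1 / a) * (a + q) = 1 + q\<^sup>2 + (q * a + q / a)"
        using a by (simp add: distrib_left distrib_right power2_eq_square mult.commute add_divide_distrib)
      moreover have "0 \<le> q * a + q / a" using q a by simp
      ultimately show ?thesis using q a by (simp add: divide_le_eq)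
    qed
    finally show ?thesis using 0 by simp
  qed
  have "\<bar>u * (1 + x\<^sup>2) - x\<bar> \<le> 1 / a" if c: "(x, u) \<in> crossing_set a" for x u
  proof -
    consider "0 < x" "x < a" | "0 < - x" "- x < a" using c by (auto simp: crossing_set_def)
    then show ?thesis
    proof cases
      case 1 then show ?thesis using pos c by blast
    next
      case 2
      have "(x, u) \<in> shallow_set a \<bar>u * (1 + x\<^sup>2) - x\<bar>" using c by (simp add: shallow_set_def)
      then have "(- x, - u) \<in> shallow_set a \<bar>u * (1 + x\<^sup>2) - x\<bar>" by (simp only: shallow_sym)
      then have "(- x, - u) \<in> crossing_set a" by (simp add: shallow_set_def)
      from pos[OF 2 this] have "\<bar>- u * (1 + (- x)\<^sup>2) - - x\<bar> \<le> 1 / a" .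
      moreover have "- u * (1 + (- x)\<^sup>2) - - x = - (u * (1 + x\<^sup>2) - x)" by simp
      ultimately show ?thesis by (simp only: abs_minus_cancel)
    qed
  qed
  then show ?thesis by (auto simp: shallow_set_def)
qed

lemma slice_length_lipschitz: "\<bar>slice_length a \<sigma> q - slice_length a \<sigma>' q\<bar> \<le> \<bar>\<sigma> - \<sigma>'\<bar>"
proof -
  have n: "1 \<le> 1 + q\<^sup>2" by simp
  have "\<bar>(q + \<sigma>) / (1 + q\<^sup>2) - (q + \<sigma>') / (1 + q\<^sup>2)\<bar> = \<bar>\<sigma> - \<sigma>'\<bar> / (1 + q\<^sup>2)"
    using n by (simp add: diff_divide_distrib[symmetric] abs_divide)
  also have "\<dots> \<le> \<bar>\<sigma> - \<sigma>'\<bar>" 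
  proof -
    have "\<bar>\<sigma> - \<sigma>'\<bar> * 1 \<le> \<bar>\<sigma> - \<sigma>'\<bar> * (1 + q\<^sup>2)" using n by (intro mult_left_mono) auto
    then show ?thesis using one_plus_sq_pos[of q] by (simp only: pos_divide_le_eq mult_1_right)
  qed
  finally show ?thesis unfolding slice_length_def by (auto simp: max_def min_def)
qed

text \<open>Makes the limiting distribution continuous in the depth, so that it suffices to count crossings
  for countably many depths.\<close>

lemma measure_shallow_lipschitz:
  assumes a: "0 < a"
  shows "\<bar>measure lborel (shallow_set a \<sigma>) - measure lborel (shallow_set a \<sigma>')\<bar> \<le> 2 * a * \<bar>\<sigma> - \<sigma>'\<bar>"
proof -
  have i: "slice_length a s integrable_on {0..a}" for s by (intro integrable_continuous_real slice_length_continuous a)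
  have "((\<lambda>q. slice_length a \<sigma> q - slice_length a \<sigma>' q) has_integral integral {0..a} (slice_length a \<sigma>) - integral {0..a} (slice_length a \<sigma>')) (cbox 0 a)"
    using has_integral_diff[OF integrable_integral[OF i] integrable_integral[OF i]] by simp
  then have "norm (integral {0..a} (slice_length a \<sigma>) - integral {0..a} (slice_length a \<sigma>')) \<le> \<bar>\<sigma> - \<sigma>'\<bar> * measure lborel (cbox 0 a)"
    by (rule has_integral_bound[rotated]) (auto intro: slice_length_lipschitz)
  then show ?thesis using a by (simp add: measure_shallow abs_if algebra_simps split: if_splits)
qed

lemma measure_crossing_pos:
  assumes a: "0 < a"
  shows "0 < measure lborel (crossing_set a)"
proof -
  have "integral {0..a} (slice_length a (1 / a)) \<noteq> 0"
  proof
    assume "integral {0..a} (slice_length a (1 / a)) = 0"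
    then have "\<forall>x\<in>{0..a}. slice_length a (1 / a) x = 0"
      using a integral_eq_0_iff[OF slice_length_continuous[OF a], of "1 / a"] by (auto simp: slice_length_def)
    then have "slice_length a (1 / a) 0 = 0" using a by simp
    then show False using a by (simp add: slice_length_def)
  qed
  then show ?thesis using slice_length_integral_nonneg[OF a, of "1 / a"] a
    by (simp add: crossing_set_eq_shallow measure_shallow less_le)
qed

text \<open>The two upper bounds on \<open>u\<close> exchange their order at \<open>q = (1 - a * \<sigma>) / (\<sigma> + a)\<close>, the value of \<open>phi\<close>.
  The bound \<open>a \<le> 1\<close> guarantees that the slices are nonempty up to \<open>q = a\<close>.\<close>

lemma slice_length_cases:
  assumes a: "0 < a" "a \<le> 1" and q: "0 \<le> q" "q \<le> a" and \<sigma>: "0 \<le> \<sigma>"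
  shows "q \<le> (1 - a * \<sigma>) / (\<sigma> + a) \<Longrightarrow> slice_length a \<sigma> q = \<sigma> / (1 + q\<^sup>2)"
    "(1 - a * \<sigma>) / (\<sigma> + a) \<le> q \<Longrightarrow> slice_length a \<sigma> q = 1 / (a + q) - q / (1 + q\<^sup>2)"
proof -
  have n: "0 < 1 + q\<^sup>2" by (rule one_plus_sq_pos)
  have aq: "0 < a + q" using a q by simp
  have "a * q \<le> 1 * 1" using a q by (intro mult_mono) auto
  then have low: "0 \<le> 1 / (a + q) - q / (1 + q\<^sup>2)"
  proof -
    have "q * (a + q) \<le> 1 + q\<^sup>2" using \<open>a * q \<le> 1 * 1\<close> by (simp add: power2_eq_square algebra_simps)
    then have "q / (1 + q\<^sup>2) \<le> 1 / (a + q)" using n aq by (simp add: divide_le_eq le_divide_eq)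
    then show ?thesis by simp
  qed
  have d: "(q + \<sigma>) / (1 + q\<^sup>2) - q / (1 + q\<^sup>2) = \<sigma> / (1 + q\<^sup>2)" by (simp add: diff_divide_distrib[symmetric])
  have s0: "0 \<le> \<sigma> / (1 + q\<^sup>2)" using \<sigma> n by simp
  have cmp: "(q + \<sigma>) / (1 + q\<^sup>2) \<le> 1 / (a + q) \<longleftrightarrow> q \<le> (1 - a * \<sigma>) / (\<sigma> + a)"
  proof -
    have "(q + \<sigma>) / (1 + q\<^sup>2) \<le> 1 / (a + q) \<longleftrightarrow> (q + \<sigma>) * (a + q) \<le> 1 + q\<^sup>2"
      using n aq by (simp add: divide_le_eq le_divide_eq)
    also have "\<dots> \<longleftrightarrow> q * (\<sigma> + a) \<le> 1 - a * \<sigma>" by (simp add: power2_eq_square algebra_simps)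
    also have "\<dots> \<longleftrightarrow> q \<le> (1 - a * \<sigma>) / (\<sigma> + a)" using a \<sigma> by (simp add: le_divide_eq)
    finally show ?thesis .
  qed
  have cmp': "1 / (a + q) \<le> (q + \<sigma>) / (1 + q\<^sup>2) \<longleftrightarrow> (1 - a * \<sigma>) / (\<sigma> + a) \<le> q"
  proof -
    have "1 / (a + q) \<le> (q + \<sigma>) / (1 + q\<^sup>2) \<longleftrightarrow> 1 + q\<^sup>2 \<le> (q + \<sigma>) * (a + q)"
      using n aq by (simp add: divide_le_eq le_divide_eq)
    also have "\<dots> \<longleftrightarrow> 1 - a * \<sigma> \<le> q * (\<sigma> + a)" by (simp add: power2_eq_square algebra_simps)
    also have "\<dots> \<longleftrightarrow> (1 - a * \<sigma>) / (\<sigma> + a) \<le> q" using a \<sigma> by (simp add: divide_le_eq)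
    finally show ?thesis .
  qed
  show "slice_length a \<sigma> q = \<sigma> / (1 + q\<^sup>2)" if "q \<le> (1 - a * \<sigma>) / (\<sigma> + a)"
  proof -
    have "min (1 / (a + q)) ((q + \<sigma>) / (1 + q\<^sup>2)) = (q + \<sigma>) / (1 + q\<^sup>2)" using cmp that by (simp only: min_absorb2)
    then show ?thesis unfolding slice_length_def using d s0 by (simp only: max_absorb2)
  qed
  show "slice_length a \<sigma> q = 1 / (a + q) - q / (1 + q\<^sup>2)" if "(1 - a * \<sigma>) / (\<sigma> + a) \<le> q"
  proof -
    have "min (1 / (a + q)) ((q + \<sigma>) / (1 + q\<^sup>2)) = 1 / (a + q)" using cmp' that by (simp only: min_absorb1)
    then show ?thesis unfolding slice_length_def using low by (simp only: max_absorb2)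
  qed
qed

lemma integral_flat: "0 \<le> b \<Longrightarrow> ((\<lambda>q. \<sigma> / (1 + q\<^sup>2)) has_integral \<sigma> * arctan b) {0..b}"
proof -
  assume b: "0 \<le> b"
  have "((\<lambda>q. \<sigma> / (1 + q\<^sup>2)) has_integral \<sigma> * arctan b - \<sigma> * arctan 0) {0..b}"
  proof (rule fundamental_theorem_of_calculus[OF b])
    fix x :: real
    have "((\<lambda>q. \<sigma> * arctan q) has_real_derivative \<sigma> / (1 + x\<^sup>2)) (at x within {0..b})"
      by (auto intro!: derivative_eq_intros simp: inverse_eq_divide)
    then show "((\<lambda>q. \<sigma> * arctan q) has_vector_derivative \<sigma> / (1 + x\<^sup>2)) (at x within {0..b})"
      by (simp add: has_real_derivative_iff_has_vector_derivative)
  qed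
  then show ?thesis by simp
qed

lemma integral_curved:
  fixes a b :: real
  assumes a: "0 < a" and b: "0 \<le> b" "b \<le> a"
  shows "((\<lambda>q. 1 / (a + q) - q / (1 + q\<^sup>2)) has_integral
     (ln (a + a) - ln (1 + a\<^sup>2) / 2) - (ln (a + b) - ln (1 + b\<^sup>2) / 2)) {b..a}"
proof (rule fundamental_theorem_of_calculus[OF b(2)])
  fix x assume x: "x \<in> {b..a}"
  have n: "0 < 1 + x\<^sup>2" by (rule one_plus_sq_pos)
  have "4 + x\<^sup>2 * 4 = 4 * (1 + x\<^sup>2)" by simp
  then have e: "4 * x / (4 + x\<^sup>2 * 4) = x / (1 + x\<^sup>2)" by (simp only: mult_divide_mult_cancel_left[of 4] zero_neq_numeral not_False_eq_True)
  have "((\<lambda>q. ln (a + q) - ln (1 + q\<^sup>2) / 2) has_real_derivative 1 / (a + x) - x / (1 + x\<^sup>2)) (at x within {b..a})"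
    using a b x n by (auto intro!: derivative_eq_intros simp: inverse_eq_divide e)
  then show "((\<lambda>q. ln (a + q) - ln (1 + q\<^sup>2) / 2) has_vector_derivative 1 / (a + x) - x / (1 + x\<^sup>2)) (at x within {b..a})"
    by (simp add: has_real_derivative_iff_has_vector_derivative)
qed

lemma integral_slice_length_flat:
  assumes a: "0 < a" "a \<le> 1" and \<sigma>: "0 \<le> \<sigma>" and le: "a \<le> (1 - a * \<sigma>) / (\<sigma> + a)"
  shows "integral {0..a} (slice_length a \<sigma>) = \<sigma> * arctan a"
proof -
  have "(slice_length a \<sigma> has_integral \<sigma> * arctan a) {0..a}"
    by (rule has_integral_eq[OF _ integral_flat]) (use a \<sigma> le in \<open>auto simp: slice_length_cases(1)\<close>)
  then show ?thesis by (rule integral_unique)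
qed

lemma integral_slice_length_curved:
  fixes a \<sigma> :: real
  defines "\<phi> \<equiv> (1 - a * \<sigma>) / (\<sigma> + a)"
  assumes a: "0 < a" "a \<le> 1" and \<sigma>: "0 \<le> \<sigma>" and \<phi>: "0 \<le> \<phi>" "\<phi> \<le> a"
  shows "integral {0..a} (slice_length a \<sigma>) = \<sigma> * arctan \<phi> + ln (2 * a * sqrt (1 + \<sigma>\<^sup>2) / (1 + a\<^sup>2))"
proof -
  have 1: "(slice_length a \<sigma> has_integral \<sigma> * arctan \<phi>) {0..\<phi>}"
    by (rule has_integral_eq[OF _ integral_flat]) (use a \<sigma> \<phi> in \<open>auto simp: slice_length_cases(1) \<phi>_def\<close>)
  have 2: "(slice_length a \<sigma> has_integral (ln (a + a) - ln (1 + a\<^sup>2) / 2) - (ln (a + \<phi>) - ln (1 + \<phi>\<^sup>2) / 2)) {\<phi>..a}"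
    by (rule has_integral_eq[OF _ integral_curved[OF a(1) \<phi>]]) (use a \<sigma> \<phi> in \<open>auto simp: slice_length_cases(2) \<phi>_def\<close>)
  have s: "0 < \<sigma> + a" using a \<sigma> by simp
  have na: "0 < 1 + a\<^sup>2" and ns: "0 < 1 + \<sigma>\<^sup>2" by (rule one_plus_sq_pos)+
  have e1: "a + \<phi> = (1 + a\<^sup>2) / (\<sigma> + a)" using s by (simp add: \<phi>_def field_simps power2_eq_square)
  have e2: "1 + \<phi>\<^sup>2 = (1 + a\<^sup>2) * (1 + \<sigma>\<^sup>2) / (\<sigma> + a)\<^sup>2"
  proof -
    have "1 + \<phi>\<^sup>2 = ((\<sigma> + a)\<^sup>2 + (1 - a * \<sigma>)\<^sup>2) / (\<sigma> + a)\<^sup>2" using s by (simp add: \<phi>_def power_divide add_divide_distrib)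
    also have "(\<sigma> + a)\<^sup>2 + (1 - a * \<sigma>)\<^sup>2 = (1 + a\<^sup>2) * (1 + \<sigma>\<^sup>2)" by (simp add: power2_eq_square algebra_simps)
    finally show ?thesis .
  qed
  have l1: "ln (a + \<phi>) = ln (1 + a\<^sup>2) - ln (\<sigma> + a)" unfolding e1 using s na by (simp add: ln_div)
  have l2: "ln (1 + \<phi>\<^sup>2) = ln (1 + a\<^sup>2) + ln (1 + \<sigma>\<^sup>2) - 2 * ln (\<sigma> + a)"
    unfolding e2 using s na ns by (simp add: ln_div ln_mult ln_realpow)
  have l3: "ln (2 * a * sqrt (1 + \<sigma>\<^sup>2) / (1 + a\<^sup>2)) = ln (2 * a) + ln (1 + \<sigma>\<^sup>2) / 2 - ln (1 + a\<^sup>2)"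
    using a na ns by (simp add: ln_div ln_mult ln_sqrt)
  have "(ln (a + a) - ln (1 + a\<^sup>2) / 2) - (ln (a + \<phi>) - ln (1 + \<phi>\<^sup>2) / 2) = ln (2 * a * sqrt (1 + \<sigma>\<^sup>2) / (1 + a\<^sup>2))"
    unfolding l1 l2 l3 by (simp add: field_simps)
  with has_integral_combine[OF \<phi> 1 2] show ?thesis by (simp only: integral_unique)
qed

text \<open>The first case of the formula occurs when the exchange of the two bounds lies beyond \<open>a\<close>, so that
  only the depth bounds the slices. The total area is the value at \<open>\<sigma> = 1 / a\<close>, where \<open>phi\<close> vanishes.
  For \<open>k = 3\<close> one has \<open>a > 1\<close>, and the area is given by a different expression.\<close>

lemma depth_fraction_formula:
  fixes k :: nat
  assumes k: "k \<ge> 4" and z: "0 \<le> z" "z \<le> r_const k"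
  shows "measure lborel (shallow_set (a_const k) (sinh z)) / measure lborel (crossing_set (a_const k)) = dist_formula k z"
proof -
  define \<theta> a \<sigma> where "\<theta> = pi / k" and "a = a_const k" and "\<sigma> = sinh z"
  have th: "0 < \<theta>" "\<theta> \<le> pi / 4" unfolding \<theta>_def using k by (auto intro!: divide_left_mono simp del: divide_le_eq_numeral1 le_divide_eq_numeral1)
  have c: "cos \<theta> > 0" using th by (intro cos_gt_zero) auto
  have s: "sin \<theta> > 0" using th by (intro sin_gt_zero) auto
  have aT: "a = tan \<theta>" by (simp add: a_def a_const_def \<theta>_def)
  have asc: "a = sin \<theta> / cos \<theta>" by (simp add: aT tan_def)
  have a0: "0 < a" using s c by (simp add: asc)
  have a1: "a \<le> 1"
  proof -
    have "tan \<theta> \<le> tan (pi / 4)" using th by (intro tan_mono_le) auto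
    then show ?thesis by (simp add: aT tan_45)
  qed
  have at: "arctan a = \<theta>" unfolding aT using th by (intro arctan_tan) auto
  have a2: "1 + a\<^sup>2 = 1 / (cos \<theta>)\<^sup>2"
  proof -
    have "(1 + a\<^sup>2) * (cos \<theta>)\<^sup>2 = (cos \<theta>)\<^sup>2 + (sin \<theta>)\<^sup>2" using c by (simp add: asc power_divide distrib_right)
    then have "(1 + a\<^sup>2) * (cos \<theta>)\<^sup>2 = 1" by simp
    then show ?thesis using c by (simp add: eq_divide_eq)
  qed
  have s0: "0 \<le> \<sigma>" using z by (simp add: \<sigma>_def)
  have s1: "\<sigma> \<le> 1 / a"
  proof -
    have "sinh z \<le> sinh (r_const k)" using z by simp
    then show ?thesis by (simp add: \<sigma>_def r_const_def cot_def asc \<theta>_def)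
  qed
  have as1: "a * \<sigma> \<le> 1" using s1 a0 by (simp add: le_divide_eq mult.commute)
  have phi: "phi k \<sigma> = (1 - a * \<sigma>) / (\<sigma> + a)" by (simp add: phi_def a_def a_const_def mult.commute)
  have phi0: "0 \<le> (1 - a * \<sigma>) / (\<sigma> + a)" using as1 a0 s0 by simp
  have full: "integral {0..a} (slice_length a (1 / a)) = ln (2 * cos \<theta>)"
  proof -
    have p: "(1 - a * (1 / a)) / (1 / a + a) = 0" using a0 by simp
    have "integral {0..a} (slice_length a (1 / a)) = (1 / a) * arctan 0 + ln (2 * a * sqrt (1 + (1 / a)\<^sup>2) / (1 + a\<^sup>2))"
      using integral_slice_length_curved[OF a0 a1, of "1 / a"] a0 unfolding p by simp
    also have "2 * a * sqrt (1 + (1 / a)\<^sup>2) / (1 + a\<^sup>2) = 2 * cos \<theta>"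
    proof -
      have "1 + (1 / a)\<^sup>2 = (1 + a\<^sup>2) / a\<^sup>2" using a0 by (simp add: power_divide add_divide_distrib)
      then have "sqrt (1 + (1 / a)\<^sup>2) = 1 / (cos \<theta> * a)"
        unfolding a2 using c a0 by (simp add: real_sqrt_divide real_sqrt_mult)
      then show ?thesis unfolding a2 using a0 c by (simp add: power2_eq_square)
    qed
    finally show ?thesis by simp
  qed
  have crit: "z \<le> delta_const k \<longleftrightarrow> a \<le> (1 - a * \<sigma>) / (\<sigma> + a)"
  proof -
    have "z \<le> delta_const k \<longleftrightarrow> sinh z \<le> sinh (delta_const k)" by simp
    also have "\<dots> \<longleftrightarrow> \<sigma> \<le> cot (2 * \<theta>)" by (simp add: \<sigma>_def delta_const_def \<theta>_def)
    also have "cot (2 * \<theta>) = (1 - a\<^sup>2) / (2 * a)"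
    proof -
      have sa: "sin \<theta> = a * cos \<theta>" using c by (simp add: asc)
      have "((cos \<theta>)\<^sup>2 - (sin \<theta>)\<^sup>2) * (2 * a) = (1 - a\<^sup>2) * (2 * sin \<theta> * cos \<theta>)"
        unfolding sa by (simp add: power2_eq_square algebra_simps)
      then have "((cos \<theta>)\<^sup>2 - (sin \<theta>)\<^sup>2) / (2 * sin \<theta> * cos \<theta>) = (1 - a\<^sup>2) / (2 * a)"
        using c s a0 by (subst frac_eq_eq) auto
      then show ?thesis by (simp only: cot_def cos_double sin_double)
    qed
    also have "\<sigma> \<le> (1 - a\<^sup>2) / (2 * a) \<longleftrightarrow> \<sigma> * (2 * a) \<le> 1 - a\<^sup>2" using a0 by (simp add: le_divide_eq)
    also have "\<dots> \<longleftrightarrow> a * (\<sigma> + a) \<le> 1 - a * \<sigma>" by (simp add: power2_eq_square algebra_simps)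
    also have "\<dots> \<longleftrightarrow> a \<le> (1 - a * \<sigma>) / (\<sigma> + a)" using a0 s0 by (simp add: le_divide_eq)
    finally show ?thesis .
  qed
  have ratio: "measure lborel (shallow_set a \<sigma>) / measure lborel (crossing_set a) = integral {0..a} (slice_length a \<sigma>) / ln (2 * cos \<theta>)"
    using a0 by (simp add: crossing_set_eq_shallow measure_shallow full)
  show ?thesis
  proof (cases "z \<le> delta_const k")
    case True
    then have "integral {0..a} (slice_length a \<sigma>) = \<sigma> * \<theta>" using integral_slice_length_flat[OF a0 a1 s0] crit at by simp
    then show ?thesis using True ratio by (simp add: dist_formula_def dist_case1_def a_def \<sigma>_def \<theta>_def mult.commute)
  next
    case False
    then have "(1 - a * \<sigma>) / (\<sigma> + a) \<le> a" using crit by simp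
    from integral_slice_length_curved[OF a0 a1 s0 phi0 this]
    have "integral {0..a} (slice_length a \<sigma>) = \<sigma> * arctan (phi k \<sigma>) + ln (2 * a * sqrt (1 + \<sigma>\<^sup>2) / (1 + a\<^sup>2))" unfolding phi .
    also have "sqrt (1 + \<sigma>\<^sup>2) = cosh z" unfolding \<sigma>_def using cosh_square_eq[of z] by (simp add: real_sqrt_unique add.commute)
    also have "2 * a * cosh z / (1 + a\<^sup>2) = 2 * cosh z * sin \<theta> * cos \<theta>"
      unfolding a2 using c by (simp add: asc power2_eq_square)
    finally show ?thesis using False ratio by (simp add: dist_formula_def dist_case2_def a_def \<sigma>_def \<theta>_def)
  qed
qed

lemma small_orders:
  fixes k :: nat
  assumes k: "k = 3 \<or> k = 4"
  shows "delta_const k \<le> 0" "z \<in> {0..r_const k} \<Longrightarrow> dist_formula k z = dist_case2 k z"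
proof -
  have c3: "cot (2 * pi / 3) < 0"
  proof -
    have e: "2 * pi / 3 = pi - pi / 3" by simp
    have "cos (2 * pi / 3) = - (1 / 2)" "sin (2 * pi / 3) > 0"
      unfolding e cos_diff sin_diff by (simp_all add: cos_60 sin_60)
    then show ?thesis by (simp add: cot_def divide_less_0_iff)
  qed
  have c4: "cot (2 * pi / 4) = 0"
  proof -
    have e: "2 * pi / 4 = pi / 2" by simp
    show ?thesis unfolding e by (simp add: cot_def)
  qed
  have d3: "delta_const 3 < 0" using c3 by (simp add: delta_const_def)
  have d4: "delta_const 4 = 0" using c4 by (simp add: delta_const_def)
  show "delta_const k \<le> 0" using k d3 d4 by auto
  show "dist_formula k z = dist_case2 k z" if z: "z \<in> {0..r_const k}"
  proof (cases "z \<le> delta_const k")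
    case True
    then have "k = 4" "z = 0" using z k d3 d4 by auto
    have "2 * sin (pi / 4) * cos (pi / 4) = sin (2 * (pi / 4))" by (rule sin_double[symmetric])
    also have "\<dots> = 1" by simp
    finally have "2 * cosh 0 * sin (pi / 4) * cos (pi / 4) = (1::real)" by simp
    then have "ln (2 * cosh 0 * sin (pi / 4) * cos (pi / 4)) = (0::real)" by (simp only: ln_one)
    then show ?thesis using \<open>k = 4\<close> \<open>z = 0\<close> d4 by (simp add: dist_formula_def dist_case1_def dist_case2_def)
  qed (simp add: dist_formula_def)
qed

section \<open>Frequencies along a discrete set of times\<close>

text \<open>The index of an element is the number of elements before it.\<close>

lemma enumerate_by_time:
  fixes \<tau> :: "'e \<Rightarrow> real"
  assumes inj: "inj_on \<tau> E" and inf: "infinite E" and fin: "\<And>t. finite {e \<in> E. \<tau> e < t}"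
  shows "\<exists>es :: nat \<Rightarrow> 'e. bij_betw es UNIV E \<and> strict_mono (\<lambda>n. \<tau> (es n)) \<and>
    (\<forall>n. {e \<in> E. \<tau> e < \<tau> (es n)} = es ` {..<n})"
proof -
  define before where "before e = {e' \<in> E. \<tau> e' < \<tau> e}" for e
  define rank where "rank e = card (before e)" for e
  have fb: "finite (before e)" for e unfolding before_def by (rule fin)
  have less: "rank e < rank e'" if "e \<in> E" "\<tau> e < \<tau> e'" for e e'
    unfolding rank_def
  proof (rule psubset_card_mono[OF fb])
    have "e \<in> before e'" "e \<notin> before e" "before e \<subseteq> before e'" using that by (auto simp: before_def)
    then show "before e \<subset> before e'" by blast
  qed
  have less_iff: "rank e < rank e' \<longleftrightarrow> \<tau> e < \<tau> e'" if "e \<in> E" "e' \<in> E" for e e'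
  proof (cases "\<tau> e < \<tau> e'")
    case True then show ?thesis using less[OF that(1) True] by simp
  next
    case False
    then consider "\<tau> e' < \<tau> e" | "\<tau> e = \<tau> e'" by linarith
    then show ?thesis
    proof cases
      case 1 from less[OF that(2) 1] 1 show ?thesis by simp
    next
      case 2 then have "e = e'" using inj_onD[OF inj 2 that] by blast
      then show ?thesis by simp
    qed
  qed
  have inj_rank: "inj_on rank E"
  proof (rule inj_onI)
    fix e e' assume e: "e \<in> E" "e' \<in> E" "rank e = rank e'"
    then have "\<not> \<tau> e < \<tau> e'" "\<not> \<tau> e' < \<tau> e" using less_iff[of e e'] less_iff[of e' e] by auto
    then have "\<tau> e = \<tau> e'" by linarith
    then show "e = e'" by (rule inj_onD[OF inj _ e(1,2)])
  qed
  have image: "rank ` before e = {..<rank e}" if e: "e \<in> E" for e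
  proof (rule card_subset_eq)
    show "rank ` before e \<subseteq> {..<rank e}" using less by (auto simp: before_def)
    have "inj_on rank (before e)" using inj_rank by (rule inj_on_subset) (auto simp: before_def)
    then have "card (rank ` before e) = rank e" unfolding rank_def[of e] by (rule card_image)
    then show "card (rank ` before e) = card {..<rank e}" by simp
  qed simp
  have onto: "rank ` E = UNIV"
  proof -
    have "n \<in> rank ` E" for n
    proof -
      have "infinite (rank ` E)" using inf inj_rank by (simp add: finite_image_iff)
      then obtain m where "n < m" "m \<in> rank ` E" using infinite_nat_iff_unbounded by blast
      then obtain e where e: "e \<in> E" "n < rank e" by auto
      then have "n \<in> rank ` before e" using image[OF e(1)] by simp
      then show ?thesis by (auto simp: before_def)
    qed
    then show ?thesis by blast
  qed
  define es where "es = inv_into E rank"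
  have esE: "es n \<in> E" and rank_es: "rank (es n) = n" for n
    using onto by (auto simp: es_def inv_into_into f_inv_into_f)
  have es_rank: "es (rank e) = e" if "e \<in> E" for e
    using inv_into_f_f[OF inj_rank that] by (simp add: es_def)
  show ?thesis
  proof (intro exI[of _ es] conjI allI)
    show "bij_betw es UNIV E"
      by (rule bij_betw_byWitness[where f' = rank]) (use esE rank_es es_rank in auto)
    show "strict_mono (\<lambda>n. \<tau> (es n))"
    proof (rule strict_monoI)
      fix m n :: nat assume "m < n"
      then show "\<tau> (es m) < \<tau> (es n)" using less_iff[OF esE esE, of m n] by (simp add: rank_es)
    qed
    show "{e \<in> E. \<tau> e < \<tau> (es n)} = es ` {..<n}" for n
    proof -
      have "before (es n) = es ` rank ` before (es n)"
        using es_rank by (force simp: before_def image_iff)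
      also have "\<dots> = es ` {..<n}" unfolding image[OF esE] rank_es ..
      finally show ?thesis by (simp add: before_def)
    qed
  qed
qed

text \<open>At the time of the element with index \<open>n\<close> exactly \<open>n\<close> elements have occurred, so frequencies among
  the first \<open>n\<close> elements are quotients of rates at this time.\<close>

lemma relative_frequency:
  fixes \<tau> :: "'e \<Rightarrow> real"
  assumes inj: "inj_on \<tau> E" and fin: "\<And>t. finite {e \<in> E. \<tau> e < t}"
    and rate: "((\<lambda>t. real (card {e \<in> E. \<tau> e < t}) / t) \<longlongrightarrow> c) at_top" and c: "0 < c"
  obtains es :: "nat \<Rightarrow> 'e" where "bij_betw es UNIV E" "strict_mono (\<lambda>n. \<tau> (es n))"
    "\<And>Q d. ((\<lambda>t. real (card {e \<in> E. \<tau> e < t \<and> Q e}) / t) \<longlongrightarrow> d) at_top \<Longrightarrow>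
       (\<lambda>n. real (card {j. j < n \<and> Q (es j)}) / real n) \<longlonglongrightarrow> d / c"
proof -
  have inf: "infinite E"
  proof
    assume E: "finite E"
    have "((\<lambda>t. real (card {e \<in> E. \<tau> e < t}) / t) \<longlongrightarrow> 0) at_top"
    proof (rule tendsto_sandwich)
      show "\<forall>\<^sub>F t in at_top. 0 \<le> real (card {e \<in> E. \<tau> e < t}) / t"
        using eventually_ge_at_top[of 0] by eventually_elim simp
      show "\<forall>\<^sub>F t in at_top. real (card {e \<in> E. \<tau> e < t}) / t \<le> real (card E) / t"
        using eventually_ge_at_top[of 0]
      proof eventually_elim
        case (elim t)
        have "card {e \<in> E. \<tau> e < t} \<le> card E" by (rule card_mono[OF E]) auto
        then show ?case using elim by (simp add: divide_right_mono)
      qed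
      show "((\<lambda>t. real (card E) / t) \<longlongrightarrow> 0) at_top"
        by (rule real_tendsto_divide_at_top[OF tendsto_const filterlim_ident])
    qed simp
    from tendsto_unique[OF _ rate this] c show False by simp
  qed
  obtain es :: "nat \<Rightarrow> 'e" where ess: "bij_betw es UNIV E \<and> strict_mono (\<lambda>n. \<tau> (es n)) \<and>
    (\<forall>n. {e \<in> E. \<tau> e < \<tau> (es n)} = es ` {..<n})"
    using enumerate_by_time[OF inj inf fin] by (rule exE)
  note es = conjunct1[OF ess] conjunct1[OF conjunct2[OF ess]]
  have before: "{e \<in> E. \<tau> e < \<tau> (es n)} = es ` {..<n}" for n by (rule spec[OF conjunct2[OF conjunct2[OF ess]]])
  have ies: "inj es" by (rule bij_betw_imp_inj_on[OF es(1)])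
  have cnt: "card {e \<in> E. \<tau> e < \<tau> (es n)} = n" for n
    unfolding before using inj_on_subset[OF ies] by (simp add: card_image)
  have cntQ: "card {e \<in> E. \<tau> e < \<tau> (es n) \<and> Q e} = card {j. j < n \<and> Q (es j)}" for n Q
  proof -
    have "{e \<in> E. \<tau> e < \<tau> (es n) \<and> Q e} = {e \<in> es ` {..<n}. Q e}" unfolding before[symmetric] by auto
    also have "\<dots> = es ` {j. j < n \<and> Q (es j)}" by auto
    finally show ?thesis using inj_on_subset[OF ies] by (simp add: card_image)
  qed
  have top: "filterlim (\<lambda>n. \<tau> (es n)) at_top sequentially"
    unfolding filterlim_at_top
  proof
    fix B
    have "\<tau> (es n) \<ge> B" if n: "n \<ge> card {e \<in> E. \<tau> e < B}" for n
    proof (rule ccontr)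
      assume lt: "\<not> B \<le> \<tau> (es n)"
      have esn: "es n \<in> E" by (rule bij_betwE[OF es(1), rule_format]) simp
      have "es ` {..<Suc n} \<subseteq> {e \<in> E. \<tau> e < B}"
      proof -
        have "es ` {..<n} \<subseteq> {e \<in> E. \<tau> e < B}" unfolding before[symmetric] using lt by auto
        then show ?thesis using esn lt by (simp add: lessThan_Suc)
      qed
      from card_mono[OF fin this] have "Suc n \<le> card {e \<in> E. \<tau> e < B}"
        using inj_on_subset[OF ies] by (simp add: card_image)
      with n show False by simp
    qed
    then show "\<forall>\<^sub>F n in sequentially. B \<le> \<tau> (es n)" unfolding eventually_sequentially by blast
  qed
  show thesis
  proof
    show "bij_betw es UNIV E" "strict_mono (\<lambda>n. \<tau> (es n))" by (rule es)+
    fix Q d assume Q: "((\<lambda>t. real (card {e \<in> E. \<tau> e < t \<and> Q e}) / t) \<longlongrightarrow> d) at_top"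
    have 1: "(\<lambda>n. real n / \<tau> (es n)) \<longlonglongrightarrow> c"
      using filterlim_compose[OF rate top] by (simp add: cnt)
    have 2: "(\<lambda>n. real (card {j. j < n \<and> Q (es j)}) / \<tau> (es n)) \<longlonglongrightarrow> d"
      using filterlim_compose[OF Q top] by (simp add: cntQ)
    have "(\<lambda>n. (real (card {j. j < n \<and> Q (es j)}) / \<tau> (es n)) / (real n / \<tau> (es n))) \<longlonglongrightarrow> d / c"
      using c by (intro tendsto_divide 1 2) simp
    moreover have "\<forall>\<^sub>F n in sequentially. \<tau> (es n) > 0"
      using top unfolding filterlim_at_top_dense by blast
    then have "\<forall>\<^sub>F n in sequentially. (real (card {j. j < n \<and> Q (es j)}) / \<tau> (es n)) / (real n / \<tau> (es n))
        = real (card {j. j < n \<and> Q (es j)}) / real n"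
      by eventually_elim simp
    ultimately show "(\<lambda>n. real (card {j. j < n \<and> Q (es j)}) / real n) \<longlonglongrightarrow> d / c"
      by (rule Lim_transform_eventually)
  qed
qed

text \<open>A positive \<open>z\<close> lies between nonnegative rational numbers arbitrarily close to it, and \<open>F\<close> is monotone.
  There is no nonnegative number below \<open>0\<close>, but \<open>0\<close> is itself rational.\<close>

lemma squeeze_by_rationals:
  fixes F :: "real \<Rightarrow> nat \<Rightarrow> real" and D :: "real \<Rightarrow> real"
  assumes mono: "\<And>z w n. z \<le> w \<Longrightarrow> F z n \<le> F w n"
    and lim: "\<And>q. q \<in> \<rat> \<Longrightarrow> 0 \<le> q \<Longrightarrow> F q \<longlonglongrightarrow> D q"
    and D: "continuous_on UNIV D" and z: "0 \<le> z"
  shows "F z \<longlonglongrightarrow> D z"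
proof (cases "z = 0")
  case True then show ?thesis using lim by simp
next
  case False
  then have z: "0 < z" using z by simp
  have cont: "isCont D z" using D by (simp add: continuous_on_eq_continuous_at)
  show ?thesis
  proof (rule LIMSEQ_I)
    fix \<epsilon> :: real assume e: "0 < \<epsilon>"
    then obtain d where d: "d > 0" and dD: "\<And>w. \<bar>w - z\<bar> < d \<Longrightarrow> \<bar>D w - D z\<bar> < \<epsilon> / 2"
      using cont[unfolded continuous_at_eps_delta, rule_format, of "\<epsilon> / 2"] by (auto simp: dist_real_def)
    obtain p where p: "p \<in> \<rat>" "max 0 (z - d) < p" "p < z"
      using Rats_dense_in_real[of "max 0 (z - d)" z] z d by auto
    obtain q where q: "q \<in> \<rat>" "z < q" "q < z + d" using Rats_dense_in_real[of z "z + d"] d by auto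
    have Dp: "\<bar>D p - D z\<bar> < \<epsilon> / 2" by (rule dD) (use p in auto)
    have Dq: "\<bar>D q - D z\<bar> < \<epsilon> / 2" by (rule dD) (use q in auto)
    have lp: "F p \<longlonglongrightarrow> D p" by (rule lim) (use p in auto)
    have lq: "F q \<longlonglongrightarrow> D q" by (rule lim) (use q z in auto)
    obtain N1 where N1: "\<And>n. n \<ge> N1 \<Longrightarrow> norm (F p n - D p) < \<epsilon> / 2" using LIMSEQ_D[OF lp, of "\<epsilon> / 2"] e by auto
    obtain N2 where N2: "\<And>n. n \<ge> N2 \<Longrightarrow> norm (F q n - D q) < \<epsilon> / 2" using LIMSEQ_D[OF lq, of "\<epsilon> / 2"] e by auto
    have "norm (F z n - D z) < \<epsilon>" if n: "n \<ge> max N1 N2" for n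
    proof -
      have "F p n \<le> F z n" "F z n \<le> F q n" using p q by (auto intro: mono)
      moreover have "\<bar>F p n - D p\<bar> < \<epsilon> / 2" using N1[of n] n by simp
      moreover have "\<bar>F q n - D q\<bar> < \<epsilon> / 2" using N2[of n] n by simp
      ultimately have "\<bar>F z n - D z\<bar> < \<epsilon>" using Dp Dq by linarith
      then show ?thesis by simp
    qed
    then show "\<exists>N. \<forall>n\<ge>N. norm (F z n - D z) < \<epsilon>" by blast
  qed
qed

section \<open>Lifts of a geodesic\<close>

context fuchsian_group
begin

lemma proj_self: "z \<in> uhp \<Longrightarrow> z \<in> proj G z"
  unfolding proj_def using one_G by (intro image_eqI[of _ _ "\<lambda>z\<in>uhp. z"]) auto

lemma proj_image_G:
  assumes g: "g \<in> G" and z: "z \<in> uhp"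
  shows "proj G (g z) = proj G z"
proof
  show "proj G (g z) \<subseteq> proj G z"
  proof
    fix w assume "w \<in> proj G (g z)"
    then obtain h where h: "h \<in> G" "w = h (g z)" by (auto simp: proj_def)
    then have "w = compose uhp h g z" using z by (simp add: compose_eq)
    then show "w \<in> proj G z" using compose_G[OF h(1) g] by (auto simp: proj_def)
  qed
  show "proj G z \<subseteq> proj G (g z)"
  proof
    fix w assume "w \<in> proj G z"
    then obtain h where h: "h \<in> G" "w = h z" by (auto simp: proj_def)
    have "compose uhp h (m_inv Gr g) (g z) = w"
      using G_uhp[OF g z] inverse_G(2)[OF g z] h by (simp add: compose_eq)
    then show "w \<in> proj G (g z)" using compose_G[OF h(1) inverse_G(1)[OF g]] by (auto simp: proj_def)
  qed
qed

lemma free_point_eq: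
  assumes "g \<in> G" "h \<in> G" "z \<in> free_points" "g z = h z"
  shows "g = h"
proof -
  have z: "z \<in> uhp" using assms(3) by (simp add: free_points_def)
  define k where "k = compose uhp (m_inv Gr h) g"
  have kG: "k \<in> G" unfolding k_def by (intro compose_G inverse_G(1) assms)
  have "k z = z" using assms z inverse_G(2)[OF assms(2) z] by (simp add: k_def compose_eq)
  then have kid: "k = (\<lambda>z\<in>uhp. z)" using assms(3) kG by (simp add: free_points_def)
  show ?thesis
  proof (rule G_eqI[OF assms(1,2)])
    fix w assume w: "w \<in> uhp"
    have "m_inv Gr h (g w) = w" using fun_cong[OF kid, of w] w by (simp add: k_def compose_eq)
    then have "h w = h (m_inv Gr h (g w))" by simp
    also have "\<dots> = g w" by (rule inverse_G(3)[OF assms(2) G_uhp[OF assms(1) w]])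
    finally show "g w = h w" ..
  qed
qed

text \<open>If \<open>\<alpha>\<close> has the same projection as \<open>geo \<omega>\<close>, every time \<open>t\<close> has a group element \<open>h\<close> with
  \<open>\<alpha> t = h (geo \<omega> t)\<close>. The group is countable, so the same element serves two times, and two points
  determine a unit speed geodesic.\<close>

lemma lifts_geo:
  assumes w: "\<omega> \<in> X0" and us: "unit_speed_geodesic (geo \<omega>)"
  shows "lifts G (proj G \<circ> geo \<omega>) = (\<lambda>g. geo (act g \<omega>)) ` G"
proof
  show "(\<lambda>g. geo (act g \<omega>)) ` G \<subseteq> lifts G (proj G \<circ> geo \<omega>)"
  proof
    fix e assume "e \<in> (\<lambda>g. geo (act g \<omega>)) ` G"
    then obtain g where g: "g \<in> G" "e = geo (act g \<omega>)" by auto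
    have "e = g \<circ> geo \<omega>" unfolding g(2) by (rule ext) (simp add: geo_act[OF g(1) w])
    then show "e \<in> lifts G (proj G \<circ> geo \<omega>)" using g(1) us by (auto simp: lifts_def)
  qed
  show "lifts G (proj G \<circ> geo \<omega>) \<subseteq> (\<lambda>g. geo (act g \<omega>)) ` G"
  proof
    fix e assume "e \<in> lifts G (proj G \<circ> geo \<omega>)"
    then obtain g \<alpha> where g: "g \<in> G" "e = g \<circ> \<alpha>" and \<alpha>: "unit_speed_geodesic \<alpha>"
      and eq: "proj G \<circ> geo \<omega> = proj G \<circ> \<alpha>" by (auto simp: lifts_def)
    have "\<exists>h. h \<in> G \<and> \<alpha> t = h (geo \<omega> t)" for t
    proof -
      have "\<alpha> t \<in> proj G (\<alpha> t)" by (rule proj_self[OF unit_speed_in_uhp[OF \<alpha>]])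
      also have "proj G (\<alpha> t) = proj G (geo \<omega> t)" using fun_cong[OF eq, of t] by simp
      finally show ?thesis by (auto simp: proj_def)
    qed
    then obtain H where H: "\<And>t. H t \<in> G" "\<And>t. \<alpha> t = H t (geo \<omega> t)" by metis
    have "\<not> inj H"
    proof
      assume i: "inj H"
      have "countable (range H)" by (rule countable_subset[OF _ countable_G]) (use H(1) in auto)
      then have "countable (UNIV :: real set)" using i by (rule countable_image_inj_on)
      then show False using uncountable_UNIV_real by simp
    qed
    then obtain t0 t1 where t: "t0 \<noteq> t1" "H t0 = H t1" by (auto simp: inj_on_def)
    define h where "h = H t0"
    have h: "h \<in> G" using H(1) by (simp add: h_def)
    have "\<alpha> t0 = geo (act h \<omega>) t0" "\<alpha> t1 = geo (act h \<omega>) t1"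
      using H(2)[of t0] H(2)[of t1] t(2) geo_act[OF h w] by (auto simp: h_def)
    from geo_determined[OF \<alpha> t(1) this] have a: "\<alpha> = geo (act h \<omega>)" .
    have "e = geo (act (compose uhp g h) \<omega>)"
    proof
      fix t
      have "e t = g (geo (act h \<omega>) t)" by (simp add: g a)
      also have "\<dots> = geo (act g (act h \<omega>)) t" by (rule geo_act[OF g(1) act_X0[OF h w], symmetric])
      finally show "e t = geo (act (compose uhp g h) \<omega>) t" by (simp only: act_compose[OF g(1) h w])
    qed
    then show "e \<in> (\<lambda>g. geo (act g \<omega>)) ` G" using compose_G[OF g(1) h] by blast
  qed
qed

text \<open>The distinguished ray is simple, so its lift \<open>lambda0\<close> is embedded in the quotient.
  This is the reason why different excursions have different parameters.\<close>

lemma lambda0_embedded: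
  assumes inj: "inj_on lam {0..}"
    and l: "unit_speed_geodesic l" "l 0 = \<i>" "tends_to_boundary l (Some 0) at_top" "\<And>t. t \<ge> 0 \<Longrightarrow> lam t = proj G (l t)"
  shows "inj_on (proj G) lambda0"
proof -
  have l_eq: "l t = Complex 0 (exp (- t))" for t
  proof -
    obtain \<omega> where w: "l = geo \<omega>"
      using geodesic_classification[OF l(1)] l(3) vertical_not_tends by metis
    obtain x u s where c: "\<omega> = (x, u, s)" by (cases \<omega>) auto
    have x: "x = 0" using l(3) unfolding w c by (simp only: geo_tends_top_iff)
    have nz: "Complex u (exp s) \<noteq> 0" by (simp add: complex_eq_iff)
    have "- 1 / Complex u (exp s) = \<i>" using l(2) by (simp add: w c geo_def x)
    then have "- 1 = \<i> * Complex u (exp s)" unfolding nonzero_divide_eq_eq[OF nz] .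
    then have "u = 0" "exp s = 1" by (auto simp: complex_eq_iff)
    then have g: "geo \<omega> t = - 1 / Complex 0 (exp t)" by (simp add: c x geo_def)
    have "Complex 0 (exp (- t)) * Complex 0 (exp t) = - 1" by (simp add: complex_eq_iff exp_minus)
    moreover have nz': "Complex 0 (exp t) \<noteq> 0" by (simp add: complex_eq_iff)
    ultimately have "- 1 / Complex 0 (exp t) = Complex 0 (exp (- t))" unfolding nonzero_divide_eq_eq[OF nz'] by simp
    then show ?thesis by (simp add: w g)
  qed
  have z_eq: "0 \<le> - ln (Im z) \<and> z = l (- ln (Im z))" if "z \<in> lambda0" for z
    using that by (auto simp: lambda0_def l_eq complex_eq_iff)
  show ?thesis
  proof (rule inj_onI)
    fix z w assume z: "z \<in> lambda0" and w: "w \<in> lambda0" and e: "proj G z = proj G w"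
    have "lam (- ln (Im z)) = lam (- ln (Im w))"
      using z_eq[OF z] z_eq[OF w] l(4)[of "- ln (Im z)"] l(4)[of "- ln (Im w)"] e by simp
    then have "- ln (Im z) = - ln (Im w)"
      using inj_onD[OF inj, of "- ln (Im z)" "- ln (Im w)"] z_eq[OF z] z_eq[OF w] by auto
    then show "z = w" using z_eq[OF z] z_eq[OF w] by metis
  qed
qed

end

section \<open>Almost all unit tangent vectors of the quotient\<close>

lemma angle_of_slope:
  assumes t: "0 \<le> \<theta>" "\<theta> < 2 * pi" and ne: "\<theta> \<noteq> pi / 2"
  defines "m \<equiv> cos \<theta> / (1 - sin \<theta>)"
  shows "\<theta> = 2 * arctan m - pi / 2 \<or> \<theta> = 2 * arctan m - pi / 2 + 2 * pi"
proof -
  define \<phi> where "\<phi> = \<theta> / 2 + pi / 4"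
  have d: "2 * \<phi> = \<theta> + pi / 2" by (simp add: \<phi>_def)
  have "tan \<phi> = sin (2 * \<phi>) / (cos (2 * \<phi>) + 1)" by (rule tan_half)
  then have m: "m = tan \<phi>" unfolding d m_def by (simp add: sin_add cos_add)
  consider "\<phi> < pi / 2" | "pi / 2 < \<phi>" using ne by (fastforce simp: \<phi>_def)
  then show ?thesis
  proof cases
    case 1
    then have "arctan m = \<phi>" unfolding m using t pi_gt_zero by (intro arctan_tan) (auto simp: \<phi>_def)
    then show ?thesis using d by simp
  next
    case 2
    have "tan \<phi> = tan (\<phi> - pi)" using tan_periodic_pi[of "\<phi> - pi"] by simp
    then have "arctan m = \<phi> - pi" unfolding m
      using 2 t pi_gt_zero by (simp only:) (intro arctan_tan, auto simp: \<phi>_def)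
    then show ?thesis using d by simp
  qed
qed

text \<open>Up to a turn, the angle is a smooth function of the stereographic coordinate, and smooth maps
  preserve null sets.\<close>

lemma AE_circle_slope:
  assumes N: "N \<in> sets borel" "emeasure lborel (N :: real set) = 0"
  shows "AE d in circle_measure. d \<noteq> \<i> \<and> Re d / (1 - Im d) \<notin> N"
proof -
  define h where "h c m = 2 * arctan m - pi / 2 + c" for c m :: real
  have neg: "negligible N" using N by (simp add: negligible_iff_null_sets null_setsI null_sets_completionI)
  have "h c differentiable_on N" for c
    unfolding differentiable_on_def
  proof
    fix m
    have "(h c has_field_derivative 2 * inverse (1 + m\<^sup>2)) (at m within N)"
      unfolding h_def by (auto intro!: derivative_eq_intros)
    then show "h c differentiable at m within N" unfolding has_field_derivative_def by (rule differentiableI)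
  qed
  then have "negligible (h c ` N)" for c
    by (intro negligible_differentiable_image_negligible neg) auto
  then have "negligible (h 0 ` N \<union> h (2 * pi) ` N \<union> {pi / 2})" by (intro negligible_Un) auto
  then have "AE \<theta> in lebesgue. \<theta> \<notin> h 0 ` N \<union> h (2 * pi) ` N \<union> {pi / 2}"
    unfolding negligible_iff_null_sets by (rule AE_not_in)
  then have "AE \<theta> in lborel. \<theta> \<notin> h 0 ` N \<union> h (2 * pi) ` N \<union> {pi / 2}" by (simp only: AE_completion_iff)
  then have "AE \<theta> in lborel. \<theta> \<in> {0..<2 * pi} \<longrightarrow> cis \<theta> \<noteq> \<i> \<and> Re (cis \<theta>) / (1 - Im (cis \<theta>)) \<notin> N"
  proof eventually_elim
    case (elim \<theta>)
    show ?case
    proof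
      assume t: "\<theta> \<in> {0..<2 * pi}"
      then have t': "0 \<le> \<theta>" "\<theta> < 2 * pi" by auto
      have ne: "\<theta> \<noteq> pi / 2" using elim by blast
      have "cos \<theta> / (1 - sin \<theta>) \<notin> N"
      proof
        assume a: "cos \<theta> / (1 - sin \<theta>) \<in> N"
        have "\<theta> = h 0 (cos \<theta> / (1 - sin \<theta>)) \<or> \<theta> = h (2 * pi) (cos \<theta> / (1 - sin \<theta>))"
          using angle_of_slope[OF t' ne] by (simp add: h_def)
        then have "\<theta> \<in> h 0 ` N \<or> \<theta> \<in> h (2 * pi) ` N" using a by blast
        then show False using elim by blast
      qed
      moreover have "cis \<theta> \<noteq> \<i>"
      proof
        assume "cis \<theta> = \<i>"
        then have sc: "sin \<theta> = 1" "cos \<theta> = 0" by (auto simp: complex_eq_iff)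
        then have "\<theta> = 2 * arctan 0 - pi / 2 \<or> \<theta> = 2 * arctan 0 - pi / 2 + 2 * pi"
          using angle_of_slope[OF t' ne] by simp
        then have "\<theta> = 3 / 2 * pi" using t' pi_gt_zero by auto
        then have "sin \<theta> = - 1" by (simp only: sin_3over2_pi)
        with sc show False by simp
      qed
      ultimately show "cis \<theta> \<noteq> \<i> \<and> Re (cis \<theta>) / (1 - Im (cis \<theta>)) \<notin> N" by simp
    qed
  qed
  then have ae: "AE \<theta> in restrict_space lborel {0..<2 * pi}. cis \<theta> \<noteq> \<i> \<and> Re (cis \<theta>) / (1 - Im (cis \<theta>)) \<notin> N"
    by (subst AE_restrict_space_iff) auto
  have cm: "cis \<in> restrict_space lborel {0..<2 * pi} \<rightarrow>\<^sub>M restrict_space borel (sphere 0 1)"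
    by (intro measurable_restrict_space2 measurable_restrict_space1)
       (auto intro!: borel_measurable_continuous_onI continuous_intros)
  have sm: "{d \<in> space (restrict_space borel (sphere 0 1)). d \<noteq> \<i> \<and> Re d / (1 - Im d) \<notin> N} \<in> sets (restrict_space borel (sphere 0 1))"
  proof -
    have "{d \<in> space borel. d \<noteq> \<i> \<and> Re d / (1 - Im d) \<notin> N} \<in> sets (borel :: complex measure)"
      using N(1) by measurable
    then have "sphere 0 1 \<inter> {d \<in> space borel. d \<noteq> \<i> \<and> Re d / (1 - Im d) \<notin> N} \<in> sets (restrict_space borel (sphere 0 1))"
      by (subst sets_restrict_space) auto
    moreover have "sphere 0 1 \<inter> {d \<in> space borel. d \<noteq> \<i> \<and> Re d / (1 - Im d) \<notin> N} =
        {d \<in> space (restrict_space borel (sphere 0 1)). d \<noteq> \<i> \<and> Re d / (1 - Im d) \<notin> N}"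
      by (auto simp: space_restrict_space)
    ultimately show ?thesis by (simp only:)
  qed
  show ?thesis unfolding circle_measure_def using ae by (simp only: AE_distr_iff[OF cm sm])
qed

lemma space_circle: "space circle_measure = sphere 0 1"
  by (simp add: circle_measure_def space_restrict_space)

lemma space_hyp_area: "space hyp_area = uhp"
  by (simp add: hyp_area_def space_restrict_space)

lemma finite_circle_measure: "finite_measure circle_measure"
proof
  have cm: "cis \<in> restrict_space lborel {0..<2 * pi} \<rightarrow>\<^sub>M restrict_space borel (sphere 0 1)"
    by (intro measurable_restrict_space2 measurable_restrict_space1)
       (auto intro!: borel_measurable_continuous_onI continuous_intros)
  have "emeasure circle_measure (space circle_measure) \<le> emeasure (restrict_space lborel {0..<2 * pi}) (space (restrict_space lborel {0..<2 * pi}))"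
    unfolding circle_measure_def space_distr emeasure_distr[OF cm sets.top] by (intro emeasure_mono sets.top) auto
  also have "\<dots> = emeasure lborel {0..<2 * pi}" by (simp add: emeasure_restrict_space space_restrict_space)
  finally have "emeasure circle_measure (space circle_measure) \<le> ennreal (2 * pi)" using pi_gt_zero by simp
  then show "emeasure circle_measure (space circle_measure) \<noteq> \<infinity>" by (auto simp: top_unique)
qed

lemma vector_coords_measurable:
  "(\<lambda>v. vec_coords (fst v) (Re (snd v) / (1 - Im (snd v)))) \<in> hyp_area \<Otimes>\<^sub>M circle_measure \<rightarrow>\<^sub>M borel"
proof -
  have i1: "(\<lambda>z. z) \<in> hyp_area \<rightarrow>\<^sub>M borel" unfolding hyp_area_def by (simp add: measurable_restrict_space1)
  have i2: "(\<lambda>z. z) \<in> circle_measure \<rightarrow>\<^sub>M borel" unfolding circle_measure_def by (simp add: measurable_restrict_space1)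
  have [measurable]: "(\<lambda>v. fst v) \<in> hyp_area \<Otimes>\<^sub>M circle_measure \<rightarrow>\<^sub>M borel" "(\<lambda>v. snd v) \<in> hyp_area \<Otimes>\<^sub>M circle_measure \<rightarrow>\<^sub>M borel"
    by (rule measurable_compose[OF measurable_fst i1], rule measurable_compose[OF measurable_snd i2])
  have "(\<lambda>v. vec_coords (fst v) (Re (snd v) / (1 - Im (snd v)))) \<in> hyp_area \<Otimes>\<^sub>M circle_measure \<rightarrow>\<^sub>M borel \<Otimes>\<^sub>M (borel \<Otimes>\<^sub>M borel)"
    unfolding vec_coords_def by measurable
  then show ?thesis unfolding borel_prod .
qed

lemma AE_vector_coords:
  fixes N :: "(real \<times> real \<times> real) set"
  assumes N: "N \<in> sets borel" "emeasure lborel N = 0"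
  shows "AE v in hyp_area \<Otimes>\<^sub>M circle_measure. snd v \<noteq> \<i> \<and> vec_coords (fst v) (Re (snd v) / (1 - Im (snd v))) \<notin> N"
proof -
  have sec[measurable]: "(\<lambda>p. vec_coords (fst p) (snd p)) \<in> borel \<Otimes>\<^sub>M borel \<rightarrow>\<^sub>M borel"
  proof -
    have "(\<lambda>p. vec_coords (fst p) (snd p)) \<in> borel \<Otimes>\<^sub>M borel \<rightarrow>\<^sub>M borel \<Otimes>\<^sub>M (borel \<Otimes>\<^sub>M borel)"
      unfolding vec_coords_def by measurable
    then show ?thesis unfolding borel_prod .
  qed
  have ind[measurable]: "(indicator N :: _ \<Rightarrow> ennreal) \<in> borel_measurable borel" using N(1) by simp
  define h :: "complex \<Rightarrow> real \<Rightarrow> ennreal" where "h z m = ennreal (1 / (1 + m\<^sup>2)) * indicator N (vec_coords z m)" for z m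
  have hm2: "(\<lambda>p. h (fst p) (snd p)) \<in> borel_measurable (borel \<Otimes>\<^sub>M borel)"
    unfolding h_def using measurable_compose[OF sec ind] by measurable
  then have hz: "h z \<in> borel_measurable lborel" for z
    using measurable_compose[OF measurable_Pair1'[of z borel borel] hm2] by simp
  have Hm: "(\<lambda>z. \<integral>\<^sup>+m. h z m \<partial>lborel) \<in> borel_measurable hyp_area"
  proof -
    have "(\<lambda>p. h (fst p) (snd p)) \<in> borel_measurable (borel \<Otimes>\<^sub>M lborel)" using hm2 by simp
    then have "(\<lambda>z. \<integral>\<^sup>+m. h z m \<partial>lborel) \<in> borel_measurable borel"
      using lborel.borel_measurable_nn_integral[of h borel] by (simp add: case_prod_beta')
    then show ?thesis unfolding hyp_area_def by (simp add: measurable_restrict_space1)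
  qed
  have "(\<integral>\<^sup>+z. (\<integral>\<^sup>+m. h z m \<partial>lborel) \<partial>hyp_area) = (\<integral>\<^sup>+\<omega>. indicator N \<omega> \<partial>lborel)"
    unfolding h_def by (rule nn_integral_vec_coords[OF ind, symmetric])
  also have "\<dots> = 0" using N by simp
  finally have "AE z in hyp_area. (\<integral>\<^sup>+m. h z m \<partial>lborel) = 0"
    using nn_integral_0_iff_AE[OF Hm] by simp
  then have "AE z in hyp_area. AE d in circle_measure. d \<noteq> \<i> \<and> vec_coords z (Re d / (1 - Im d)) \<notin> N"
  proof eventually_elim
    case (elim z)
    define Nz where "Nz = {m. vec_coords z m \<in> N}"
    have Nzb: "Nz \<in> sets borel"
    proof -
      have "(\<lambda>m. vec_coords z m) \<in> borel \<rightarrow>\<^sub>M borel"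
        using measurable_compose[OF measurable_Pair1'[of z borel borel] sec] by simp
      from measurable_sets[OF this N(1)] show ?thesis by (simp add: Nz_def vimage_def)
    qed
    have "AE m in lborel. h z m = 0" using elim nn_integral_0_iff_AE[OF hz] by simp
    then have "AE m in lborel. m \<notin> Nz"
    proof eventually_elim
      case (elim m)
      have "0 < 1 / (1 + m\<^sup>2)" using one_plus_sq_pos[of m] by simp
      then show ?case using elim by (auto simp: h_def Nz_def ennreal_eq_0_iff)
    qed
    then have "emeasure lborel Nz = 0" using Nzb by (simp add: AE_iff_null_sets[symmetric] null_setsD1)
    from AE_circle_slope[OF Nzb this] show ?case by (simp add: Nz_def)
  qed
  moreover interpret p: pair_sigma_finite hyp_area circle_measure
    unfolding pair_sigma_finite_def using sigma_finite_hyp_area finite_circle_measure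
    by (simp add: finite_measure.axioms(1) finite_measure_def)
  have "{v \<in> space (hyp_area \<Otimes>\<^sub>M circle_measure). snd v \<noteq> \<i> \<and> vec_coords (fst v) (Re (snd v) / (1 - Im (snd v))) \<notin> N} \<in> sets (hyp_area \<Otimes>\<^sub>M circle_measure)"
  proof -
    have i2: "(\<lambda>z. z) \<in> circle_measure \<rightarrow>\<^sub>M borel" unfolding circle_measure_def by (simp add: measurable_restrict_space1)
    have [measurable]: "(\<lambda>v. snd v) \<in> hyp_area \<Otimes>\<^sub>M circle_measure \<rightarrow>\<^sub>M borel"
      by (rule measurable_compose[OF measurable_snd i2])
    note [measurable] = vector_coords_measurable N(1)
    show ?thesis by measurable
  qed
  ultimately show ?thesis by (intro p.AE_pair_measure) simp_all
qed

context fuchsian_group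
begin

lemma tproj_self:
  assumes z: "z \<in> uhp" and d: "cmod d = 1"
  shows "(z, d) \<in> tproj G (z, d)"
proof -
  have "open uhp" unfolding uhp_def by (intro open_Collect_less continuous_intros)
  then have "((\<lambda>z\<in>uhp. z) has_field_derivative 1) (at z)"
    by (rule has_field_derivative_transform_within_open[OF DERIV_ident _ z]) auto
  then have "deriv (\<lambda>z\<in>uhp. z) z = 1" by (rule DERIV_imp_deriv)
  moreover have "sgn d = d" using d by (simp add: sgn_eq)
  ultimately show ?thesis unfolding tproj_def using one_G z
    by (intro image_eqI[of _ _ "\<lambda>z\<in>uhp. z"]) auto
qed

lemma unit_tangent_geo: "cmod (snd (tangent (geo \<omega>) 0)) = 1"
proof -
  obtain x u s where w: "\<omega> = (x, u, s)" by (cases \<omega>) auto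
  have p: "0 < u\<^sup>2 + (exp s)\<^sup>2" by (simp add: add_nonneg_pos)
  have "snd (tangent (geo \<omega>) 0) \<noteq> 0"
  proof
    assume a: "snd (tangent (geo \<omega>) 0) = 0"
    have "Im (snd (tangent (geo \<omega>) 0)) = (u\<^sup>2 - (exp s)\<^sup>2) / (u\<^sup>2 + (exp s)\<^sup>2)"
      and "Re (snd (tangent (geo \<omega>) 0)) = 2 * u * exp s / (u\<^sup>2 + (exp s)\<^sup>2)" unfolding w tangent_geo by simp_all
    then have "u\<^sup>2 - (exp s)\<^sup>2 = 0" "u = 0" using p unfolding a by auto
    then show False by simp
  qed
  then have "vector_derivative (geo \<omega>) (at 0) \<noteq> 0" by (auto simp: tangent_def)
  then show ?thesis by (simp add: tangent_def norm_sgn)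
qed

text \<open>The bad vectors, which point to infinity or have coordinates in \<open>N\<close>, form a null set that is
  saturated for the projection to the quotient. A measurable set that projects into the image of the
  bad vectors consists of bad vectors, so the image has measure zero in the quotient.\<close>

lemma AE_unit_tangent:
  assumes N: "N \<in> sets borel" "emeasure lborel N = 0" "- X0 \<subseteq> N"
    and inv: "\<And>g \<omega>. g \<in> G \<Longrightarrow> \<omega> \<in> X0 \<Longrightarrow> act g \<omega> \<in> N \<Longrightarrow> \<omega> \<in> N"
  shows "AE V in T1S_measure G. \<forall>\<alpha>. unit_speed_geodesic \<alpha> \<longrightarrow> V = tproj G (tangent \<alpha> 0) \<longrightarrow>
    (\<exists>\<omega>. \<alpha> = geo \<omega> \<and> \<omega> \<notin> N)"
proof -
  define Q where "Q = hyp_area \<Otimes>\<^sub>M circle_measure"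
  define bad where "bad v \<longleftrightarrow> snd v = \<i> \<or> vec_coords (fst v) (Re (snd v) / (1 - Im (snd v))) \<in> N" for v
  define B where "B = {v \<in> space Q. bad v}"
  have spQ: "space Q = uhp \<times> sphere 0 1" by (simp add: Q_def space_pair_measure space_hyp_area space_circle)
  have Bset: "B \<in> sets Q"
  proof -
    have i2: "(\<lambda>z. z) \<in> circle_measure \<rightarrow>\<^sub>M borel" unfolding circle_measure_def by (simp add: measurable_restrict_space1)
    have [measurable]: "(\<lambda>v. snd v) \<in> hyp_area \<Otimes>\<^sub>M circle_measure \<rightarrow>\<^sub>M borel"
      by (rule measurable_compose[OF measurable_snd i2])
    note [measurable] = vector_coords_measurable N(1)
    show ?thesis unfolding B_def bad_def Q_def by measurable
  qed
  have "AE v in Q. v \<notin> B"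
    using AE_vector_coords[OF N(1,2)] unfolding Q_def[symmetric] by eventually_elim (auto simp: B_def bad_def)
  then have Bnull: "B \<in> null_sets Q" using Bset by (simp add: AE_iff_null_sets)
  have good_tangent: "\<not> bad (tangent (geo \<omega>) 0)" if "\<omega> \<notin> N" for \<omega>
  proof -
    obtain x u s where w: "\<omega> = (x, u, s)" by (cases \<omega>) auto
    obtain z d where zd: "tangent (geo (x, u, s)) 0 = (z, d)" by (cases "tangent (geo (x, u, s)) 0") auto
    have "Im d < 1" "vec_coords z (Re d / (1 - Im d)) = \<omega>" using vec_coords_tangent[OF zd] w by auto
    then show ?thesis using that by (auto simp: bad_def w zd)
  qed
  have bad_tangent: "tangent (geo \<omega>) 0 \<in> B" if "\<omega> \<in> N" for \<omega>
  proof -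
    obtain x u s where w: "\<omega> = (x, u, s)" by (cases \<omega>) auto
    obtain z d where zd: "tangent (geo (x, u, s)) 0 = (z, d)" by (cases "tangent (geo (x, u, s)) 0") auto
    have "z = geo \<omega> 0" using zd by (simp add: tangent_def w)
    moreover have "cmod d = 1" using unit_tangent_geo[of \<omega>] by (simp add: w zd)
    moreover have "vec_coords z (Re d / (1 - Im d)) = \<omega>" using vec_coords_tangent[OF zd] w by auto
    ultimately show ?thesis using that by (simp add: B_def bad_def w zd spQ geo_in_uhp)
  qed
  have saturated: "tproj G -` (tproj G ` B) \<inter> space Q = B"
  proof
    show "B \<subseteq> tproj G -` (tproj G ` B) \<inter> space Q" by (auto simp: B_def)
    show "tproj G -` (tproj G ` B) \<inter> space Q \<subseteq> B"
    proof
      fix v assume "v \<in> tproj G -` (tproj G ` B) \<inter> space Q"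
      then obtain b where v: "v \<in> space Q" and b: "b \<in> B" "tproj G v = tproj G b" by auto
      show "v \<in> B"
      proof (rule ccontr)
        assume "v \<notin> B"
        then have gv: "\<not> bad v" using v by (simp add: B_def)
        obtain z d where zd: "v = (z, d)" by (cases v) auto
        have z: "z \<in> uhp" and d: "cmod d = 1" using v by (auto simp: spQ zd)
        define \<omega> where "\<omega> = vec_coords z (Re d / (1 - Im d))"
        have w: "\<omega> \<notin> N" "d \<noteq> \<i>" using gv by (auto simp: bad_def zd \<omega>_def)
        then have wX: "\<omega> \<in> X0" using N(3) by blast
        have tv: "tangent (geo \<omega>) 0 = v" unfolding \<omega>_def zd by (rule tangent_vec_coords[OF z d w(2)])
        have "b \<in> tproj G b" using b(1) tproj_self[of "fst b" "snd b"] by (cases b) (auto simp: B_def spQ)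
        then have "b \<in> tproj G v" using b(2) by simp
        then obtain g where g: "g \<in> G" and bg: "b = (g (fst v), sgn (deriv g (fst v) * snd v))"
          by (auto simp: tproj_def)
        have "tangent (moebius (rep g) \<circ> geo \<omega>) 0 = b"
          using tangent_moebius[OF rep(1)[OF g] geo_differentiable geo_in_uhp, of \<omega>] unfolding tv rep(2)[OF g] bg .
        moreover have "moebius (rep g) \<circ> geo \<omega> = geo (act g \<omega>)"
          unfolding rep(2)[OF g] by (rule ext) (simp add: geo_act[OF g wX])
        ultimately have "tangent (geo (act g \<omega>)) 0 = b" by simp
        moreover have "act g \<omega> \<notin> N" using inv[OF g wX] w(1) by blast
        ultimately have "\<not> bad b" using good_tangent by blast
        then show False using b(1) by (simp add: B_def)
      qed
    qed
  qed
  have T: "T1S_measure G = quotient_measure Q (tproj G)" by (simp add: T1S_measure_def Q_def)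
  have S: "tproj G ` B \<in> sets (quotient_measure Q (tproj G))"
    unfolding sets_quotient_measure using saturated Bset by (auto simp: B_def)
  have "emeasure (quotient_measure Q (tproj G)) (tproj G ` B) \<le> 0"
    unfolding emeasure_quotient_measure[OF S]
  proof (rule SUP_least)
    fix E assume "E \<in> {E \<in> sets Q. inj_on (tproj G) E \<and> tproj G ` E \<subseteq> tproj G ` B}"
    then have "E \<subseteq> tproj G -` (tproj G ` B) \<inter> space Q" using sets.sets_into_space by fastforce
    then have "E \<subseteq> B" unfolding saturated .
    then have "emeasure Q E \<le> emeasure Q B" using Bset by (rule emeasure_mono)
    then show "emeasure Q E \<le> 0" using null_setsD1[OF Bnull] by simp
  qed
  then have "tproj G ` B \<in> null_sets (T1S_measure G)" unfolding T using S by (intro null_setsI) auto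
  then have "AE V in T1S_measure G. V \<notin> tproj G ` B" by (rule AE_not_in)
  then show ?thesis
  proof eventually_elim
    case (elim V)
    show ?case
    proof (intro allI impI)
      fix \<alpha> assume us: "unit_speed_geodesic \<alpha>" and V: "V = tproj G (tangent \<alpha> 0)"
      have nB: "tangent \<alpha> 0 \<notin> B" using elim V by blast
      show "\<exists>\<omega>. \<alpha> = geo \<omega> \<and> \<omega> \<notin> N"
        using geodesic_classification[OF us]
      proof
        assume "\<exists>\<omega>. \<alpha> = geo \<omega>"
        then show ?thesis using nB bad_tangent by blast
      next
        assume "\<exists>y s. \<alpha> = (\<lambda>t. Complex y (exp (s + t)))"
        then obtain y s where a: "\<alpha> = (\<lambda>t. Complex y (exp (s + t)))" by blast
        have "tangent \<alpha> 0 \<in> B" unfolding a tangent_vertical by (simp add: B_def bad_def spQ uhp_def)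
        then show ?thesis using nB by blast
      qed
    qed
  qed
qed

end

section \<open>Depths of the approximating excursions\<close>

text \<open>The condition on \<open>r\<close> in the definition of an excursion is always satisfied by a large disc.\<close>

lemma approximating_excursion_geo:
  assumes a: "0 < a_const k" and lift: "geo (x, u, s) \<in> lifts G \<gamma>"
  shows "approximating_excursion G k \<gamma> (geo (x, u, s)) \<longleftrightarrow> (x, u) \<in> crossing_set (a_const k)"
proof -
  define y where "y = x - 1 / u"
  have J: "endpoints_in (geo (x, u, s)) (region_J k) \<longleftrightarrow>
      u \<noteq> 0 \<and> (- a_const k < x \<and> x < 0 \<and> a_const k < y \<or> 0 < x \<and> x < a_const k \<and> y < - a_const k)"
    unfolding endpoints_in_geo_iff region_J_def y_def by auto
  show ?thesis
  proof (cases "endpoints_in (geo (x, u, s)) (region_J k)")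
    case False
    then show ?thesis unfolding approximating_excursion_def
      using J by (auto simp: crossing_set_def y_def)
  next
    case True
    with J have u: "u \<noteq> 0" and xy: "- a_const k < x \<and> x < 0 \<and> a_const k < y \<or> 0 < x \<and> x < a_const k \<and> y < - a_const k"
      by auto
    have neg: "x * (x - 1 / u) < 0"
    proof -
      have "x < 0 \<and> 0 < y \<or> 0 < x \<and> y < 0" using xy a by linarith
      then show ?thesis unfolding y_def[symmetric] by (auto intro: mult_neg_pos mult_pos_neg)
    qed
    have "(x, y) \<in> region_I k" using xy a by (auto simp: region_I_def)
    then have I: "endpoints_in (geo (x, u, s)) (region_I k)" unfolding endpoints_in_geo_iff y_def using u by simp
    define r where "r = hdist \<i> (geo (x, u, s) 0) + 1"
    have i: "\<i> \<in> uhp" by (simp add: uhp_def)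
    have r: "0 < r" unfolding r_def using hdist_nonneg[OF i geo_in_uhp[of "(x, u, s)" 0]] by linarith
    have "geo (x, u, s) 0 \<in> range (geo (x, u, s)) \<inter> disc_B r"
      using r geo_in_uhp by (simp add: disc_B_def r_def)
    then have near: "\<exists>r\<ge>0. range (geo (x, u, s)) \<inter> disc_B r \<noteq> {}" using r by (intro exI[of _ r]) auto
    have uniq: "(\<exists>!t. geo (x, u, s) t \<in> lambda0) \<longleftrightarrow> - (x * (x - 1 / u)) \<le> 1"
      unfolding geo_lambda0_iff[OF u neg] by auto
    have "approximating_excursion G k \<gamma> (geo (x, u, s)) \<longleftrightarrow> - (x * (x - 1 / u)) \<le> 1"
      unfolding approximating_excursion_def excursion_def uniq using lift I True near by blast
    also have "\<dots> \<longleftrightarrow> (x, u) \<in> crossing_set (a_const k)"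
      using u xy unfolding y_def by (simp add: crossing_set_def)
    finally show ?thesis .
  qed
qed

lemma parameter_geo:
  assumes a: "0 < a" and c: "(x, u) \<in> crossing_set a"
  shows "parameter (geo (x, u, s)) = crossing_time (x, u, s)"
    "geo (x, u, s) (crossing_time (x, u, s)) \<in> lambda0"
proof -
  have u: "u \<noteq> 0" and le: "- (x * (x - 1 / u)) \<le> 1"
    and "- a < x \<and> x < 0 \<and> a < x - 1 / u \<or> 0 < x \<and> x < a \<and> x - 1 / u < - a"
    using c by (auto simp: crossing_set_def)
  then have "x < 0 \<and> 0 < x - 1 / u \<or> 0 < x \<and> x - 1 / u < 0" using a by linarith
  then have neg: "x * (x - 1 / u) < 0" by (auto intro: mult_neg_pos mult_pos_neg)
  note iff = geo_lambda0_iff[OF u neg]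
  show "geo (x, u, s) (crossing_time (x, u, s)) \<in> lambda0" using iff le by blast
  show "parameter (geo (x, u, s)) = crossing_time (x, u, s)"
    unfolding parameter_def iff using le by simp
qed

lemma depth_le_iff: "depth (geo (x, u, s)) \<le> z \<longleftrightarrow> \<bar>u * (1 + x\<^sup>2) - x\<bar> \<le> sinh z"
proof -
  have "depth (geo (x, u, s)) \<le> z \<longleftrightarrow> sinh (arsinh \<bar>u * (1 + x\<^sup>2) - x\<bar>) \<le> sinh z"
    by (simp only: depth_geo sinh_real_le_iff)
  then show ?thesis by (simp only: sinh_arsinh_real)
qed

context fuchsian_finite
begin

text \<open>The approximating excursions correspond to the group elements counted by \<open>crossings\<close>, and those of
  depth at most \<open>z\<close> to the ones counted for \<open>shallow_set a (sinh z)\<close>. Frequencies are therefore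
  quotients of the rates of \<open>counting_limit\<close>, in which the total measure of the quotient cancels.\<close>

lemma depth_distribution_generic:
  fixes \<omega> :: "real \<times> real \<times> real" and k :: nat
  defines "a \<equiv> a_const k"
  assumes a: "0 < a" and w: "\<omega> \<in> X0" and us: "unit_speed_geodesic (geo \<omega>)"
    and free: "\<And>t. geo \<omega> t \<in> free_points" and emb: "inj_on (proj G) lambda0"
    and fin: "\<And>m::nat. crossings (crossing_set a) \<omega> (- real m) (real m) < \<infinity>"
    and lim: "((\<lambda>t. enn2real (crossings (crossing_set a) \<omega> 0 t) / t) \<longlongrightarrow>
        measure lborel (crossing_set a) / measure quot (space quot)) at_top"
    and limq: "\<And>q. q \<in> \<rat> \<Longrightarrow> 0 \<le> q \<Longrightarrow> ((\<lambda>t. enn2real (crossings (shallow_set a (sinh q)) \<omega> 0 t) / t) \<longlongrightarrow>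
        measure lborel (shallow_set a (sinh q)) / measure quot (space quot)) at_top"
    and z: "0 \<le> z"
  shows "has_depth_distribution G k (proj G \<circ> geo \<omega>) z
    (measure lborel (shallow_set a (sinh z)) / measure lborel (crossing_set a))"
proof -
  define E where "E = {e. approximating_excursion G k (proj G \<circ> geo \<omega>) e \<and> 0 \<le> parameter e}"
  define slopes :: "real \<times> real \<times> real \<Rightarrow> real \<times> real" where "slopes \<omega> = (fst \<omega>, fst (snd \<omega>))" for \<omega>
  define S where "S C t = {g \<in> G. act g \<omega> \<in> hit C 0 t}" for C t
  have lifts_eq: "lifts G (proj G \<circ> geo \<omega>) = (\<lambda>g. geo (act g \<omega>)) ` G" by (rule lifts_geo[OF w us])
  have hit_iff: "\<eta> \<in> hit C 0 t \<longleftrightarrow> slopes \<eta> \<in> C \<and> 0 \<le> crossing_time \<eta> \<and> crossing_time \<eta> < t" for \<eta> C t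
    by (cases \<eta>) (auto simp: hit_def slopes_def)
  have param: "parameter (geo \<eta>) = crossing_time \<eta>" "geo \<eta> (crossing_time \<eta>) \<in> lambda0"
    if "slopes \<eta> \<in> crossing_set a" for \<eta>
    using that parameter_geo[OF a] by (cases \<eta>; simp add: slopes_def)+
  have exc_iff: "approximating_excursion G k (proj G \<circ> geo \<omega>) (geo (act g \<omega>)) \<longleftrightarrow> slopes (act g \<omega>) \<in> crossing_set a"
    if g: "g \<in> G" for g
  proof -
    obtain x u s where c: "act g \<omega> = (x, u, s)" by (cases "act g \<omega>") auto
    have "geo (x, u, s) \<in> lifts G (proj G \<circ> geo \<omega>)" unfolding lifts_eq c[symmetric] using g by blast
    from approximating_excursion_geo[OF a[unfolded a_def] this] show ?thesis by (simp add: c slopes_def a_def)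
  qed
  have inj_orbit: "g = h" if "g \<in> G" "h \<in> G" "geo (act g \<omega>) t = geo (act h \<omega>) t" for g h t
    using free_point_eq[OF that(1,2) free[of t]] that(3) geo_act[OF that(1) w] geo_act[OF that(2) w] by simp
  have E_form: "\<exists>g\<in>G. e = geo (act g \<omega>) \<and> slopes (act g \<omega>) \<in> crossing_set a \<and> 0 \<le> crossing_time (act g \<omega>)" if e: "e \<in> E" for e
  proof -
    have ae: "approximating_excursion G k (proj G \<circ> geo \<omega>) e" and pe: "0 \<le> parameter e" using e by (auto simp: E_def)
    have "e \<in> lifts G (proj G \<circ> geo \<omega>)" using ae by (auto simp: approximating_excursion_def excursion_def)
    then obtain g where g: "g \<in> G" "e = geo (act g \<omega>)" unfolding lifts_eq by auto
    have "slopes (act g \<omega>) \<in> crossing_set a" using ae exc_iff[OF g(1)] g(2) by simp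
    then show ?thesis using g pe param(1) by auto
  qed
  have image: "(\<lambda>g. geo (act g \<omega>)) ` S {p \<in> crossing_set a. R p} t = {e \<in> E. parameter e < t \<and> Q e}"
    if RQ: "\<And>\<eta>. R (slopes \<eta>) \<longleftrightarrow> Q (geo \<eta>)" for R Q t
  proof
    show "(\<lambda>g. geo (act g \<omega>)) ` S {p \<in> crossing_set a. R p} t \<subseteq> {e \<in> E. parameter e < t \<and> Q e}"
    proof
      fix e assume "e \<in> (\<lambda>g. geo (act g \<omega>)) ` S {p \<in> crossing_set a. R p} t"
      then obtain g where g: "g \<in> G" "e = geo (act g \<omega>)" and h: "act g \<omega> \<in> hit {p \<in> crossing_set a. R p} 0 t"
        by (auto simp: S_def)
      have s: "slopes (act g \<omega>) \<in> crossing_set a" "R (slopes (act g \<omega>))"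
        and ct: "0 \<le> crossing_time (act g \<omega>)" "crossing_time (act g \<omega>) < t"
        using h unfolding hit_iff by auto
      show "e \<in> {e \<in> E. parameter e < t \<and> Q e}"
        using s ct g exc_iff[OF g(1)] param(1)[OF s(1)] RQ by (simp add: E_def)
    qed
    show "{e \<in> E. parameter e < t \<and> Q e} \<subseteq> (\<lambda>g. geo (act g \<omega>)) ` S {p \<in> crossing_set a. R p} t"
    proof
      fix e assume "e \<in> {e \<in> E. parameter e < t \<and> Q e}"
      then have e: "e \<in> E" "parameter e < t" "Q e" by auto
      obtain g where g: "g \<in> G" "e = geo (act g \<omega>)" and s: "slopes (act g \<omega>) \<in> crossing_set a" and ct: "0 \<le> crossing_time (act g \<omega>)"
        using E_form[OF e(1)] by auto
      have "act g \<omega> \<in> hit {p \<in> crossing_set a. R p} 0 t"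
        unfolding hit_iff using s ct e g param(1)[OF s] RQ by simp
      then show "e \<in> (\<lambda>g. geo (act g \<omega>)) ` S {p \<in> crossing_set a. R p} t" using g by (auto simp: S_def)
    qed
  qed
  have inj_S: "inj_on (\<lambda>g. geo (act g \<omega>)) (S C t)" for C t
    using inj_orbit by (intro inj_onI) (auto simp: S_def dest: fun_cong)
  have crossings_S: "crossings C \<omega> 0 t = emeasure (count_space G) (S C t)" for C t
  proof -
    have "crossings C \<omega> 0 t = (\<integral>\<^sup>+g. indicator (S C t) g \<partial>count_space G)"
      unfolding crossings_def by (intro nn_integral_cong) (auto simp: S_def indicator_def)
    then show ?thesis by (simp add: S_def)
  qed
  have finS: "finite (S (crossing_set a) t)" for t
  proof (rule ccontr)
    assume "infinite (S (crossing_set a) t)"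
    then have "crossings (crossing_set a) \<omega> 0 t = \<infinity>"
      unfolding crossings_S by (subst emeasure_count_space_infinite) (auto simp: S_def)
    moreover obtain m :: nat where "t \<le> real m" using real_arch_simple by blast
    then have "crossings (crossing_set a) \<omega> 0 t \<le> crossings (crossing_set a) \<omega> (- real m) (real m)"
      by (intro crossings_mono) auto
    ultimately show False using fin[of m] by (simp add: top_unique)
  qed
  have count: "enn2real (crossings {p \<in> crossing_set a. R p} \<omega> 0 t) = real (card {e \<in> E. parameter e < t \<and> Q e})"
    "finite {e \<in> E. parameter e < t \<and> Q e}"
    if RQ: "\<And>\<eta>. R (slopes \<eta>) \<longleftrightarrow> Q (geo \<eta>)" for R Q t
  proof -
    have f: "finite (S {p \<in> crossing_set a. R p} t)"
      by (rule finite_subset[OF _ finS[of t]]) (auto simp: S_def hit_iff)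
    show "finite {e \<in> E. parameter e < t \<and> Q e}" using f unfolding image[of R Q t, OF RQ, symmetric] by simp
    have "emeasure (count_space G) (S {p \<in> crossing_set a. R p} t) = of_nat (card (S {p \<in> crossing_set a. R p} t))"
      using f by (intro emeasure_count_space_finite) (auto simp: S_def)
    then show "enn2real (crossings {p \<in> crossing_set a. R p} \<omega> 0 t) = real (card {e \<in> E. parameter e < t \<and> Q e})"
      unfolding crossings_S image[of R Q t, OF RQ, symmetric] by (simp add: card_image[OF inj_S] ennreal_of_nat_eq_real_of_nat)
  qed
  have all: "{p \<in> crossing_set a. True} = crossing_set a" "{e \<in> E. parameter e < t \<and> True} = {e \<in> E. parameter e < t}" for t
    by auto
  define c where "c = measure lborel (crossing_set a) / measure quot (space quot)"
  have c: "0 < c" unfolding c_def using measure_crossing_pos[OF a] total_positive by (rule divide_pos_pos)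
  have inj_param: "inj_on parameter E"
  proof (rule inj_onI)
    fix e e' assume e: "e \<in> E" and e': "e' \<in> E" and eq: "parameter e = parameter e'"
    obtain g where g: "g \<in> G" "e = geo (act g \<omega>)" "slopes (act g \<omega>) \<in> crossing_set a"
      using E_form[OF e] by auto
    obtain h where h: "h \<in> G" "e' = geo (act h \<omega>)" "slopes (act h \<omega>) \<in> crossing_set a"
      using E_form[OF e'] by auto
    define T where "T = parameter e"
    have l: "e T \<in> lambda0" "e' T \<in> lambda0"
      using param[OF g(3)] param[OF h(3)] eq g(2) h(2) by (simp_all add: T_def)
    have "proj G (e T) = proj G (e' T)"
      unfolding g(2) h(2) geo_act[OF g(1) w] geo_act[OF h(1) w]
        proj_image_G[OF g(1) geo_in_uhp] proj_image_G[OF h(1) geo_in_uhp] ..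
    then have "e T = e' T" by (rule inj_onD[OF emb _ l])
    then have "g = h" using inj_orbit[OF g(1) h(1)] g(2) h(2) by simp
    then show "e = e'" using g h by simp
  qed
  have finE: "finite {e \<in> E. parameter e < t}" for t
    using count(2)[of "\<lambda>_. True" "\<lambda>_. True" t] unfolding all by simp
  have rate: "((\<lambda>t. real (card {e \<in> E. parameter e < t}) / t) \<longlongrightarrow> c) at_top"
    using lim count(1)[of "\<lambda>_. True" "\<lambda>_. True"] unfolding all c_def by simp
  show ?thesis
  proof (rule relative_frequency[OF inj_param finE rate c])
    fix es :: "nat \<Rightarrow> real \<Rightarrow> complex"
    assume bij: "bij_betw es UNIV E" and mono: "strict_mono (\<lambda>n. parameter (es n))"
      and freq: "\<And>Q d. ((\<lambda>t. real (card {e \<in> E. parameter e < t \<and> Q e}) / t) \<longlongrightarrow> d) at_top \<Longrightarrow>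
        (\<lambda>n. real (card {j. j < n \<and> Q (es j)}) / real n) \<longlonglongrightarrow> d / c"
    define F where "F z n = real (card {j. j < n \<and> depth (es j) \<le> z}) / real n" for z n
    define Dz where "Dz z = measure lborel (shallow_set a (sinh z)) / measure lborel (crossing_set a)" for z
    have "F z \<longlonglongrightarrow> Dz z"
    proof (rule squeeze_by_rationals[OF _ _ _ z])
      fix z w n assume zw: "(z::real) \<le> w"
      have "card {j. j < n \<and> depth (es j) \<le> z} \<le> card {j. j < n \<and> depth (es j) \<le> w}"
        using zw by (intro card_mono) auto
      then show "F z n \<le> F w n" by (simp add: F_def divide_right_mono)
    next
      fix q :: real assume q: "q \<in> \<rat>" "0 \<le> q"
      have RQ: "\<bar>snd (slopes \<eta>) * (1 + (fst (slopes \<eta>))\<^sup>2) - fst (slopes \<eta>)\<bar> \<le> sinh q \<longleftrightarrow> depth (geo \<eta>) \<le> q" for \<eta>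
        by (cases \<eta>) (simp add: slopes_def depth_le_iff)
      have sh: "shallow_set a (sinh q) = {p \<in> crossing_set a. \<bar>snd p * (1 + (fst p)\<^sup>2) - fst p\<bar> \<le> sinh q}"
        by (auto simp: shallow_set_def)
      have "((\<lambda>t. real (card {e \<in> E. parameter e < t \<and> depth e \<le> q}) / t) \<longlongrightarrow>
          measure lborel (shallow_set a (sinh q)) / measure quot (space quot)) at_top"
        using limq[OF q] unfolding sh count(1)[of "\<lambda>p. \<bar>snd p * (1 + (fst p)\<^sup>2) - fst p\<bar> \<le> sinh q" "\<lambda>e. depth e \<le> q", OF RQ] .
      from freq[OF this] show "F q \<longlonglongrightarrow> Dz q"
        using total_positive by (simp add: F_def[abs_def] Dz_def c_def)
    next
      have "continuous_on UNIV (\<lambda>\<sigma>. measure lborel (shallow_set a \<sigma>))"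
      proof (rule lipschitz_on_continuous_on)
        show "(2 * a)-lipschitz_on UNIV (\<lambda>\<sigma>. measure lborel (shallow_set a \<sigma>))"
          using a measure_shallow_lipschitz[OF a] by (intro lipschitz_onI) (auto simp: dist_real_def)
      qed
      then have "continuous_on UNIV (\<lambda>z. measure lborel (shallow_set a (sinh z)))"
        by (rule continuous_on_compose2) (auto intro: continuous_intros)
      then show "continuous_on UNIV Dz" unfolding Dz_def
        using measure_crossing_pos[OF a] by (intro continuous_intros) auto
    qed
    then show ?thesis unfolding has_depth_distribution_def excursion_sequence_def E_def[symmetric]
      using bij mono by (intro exI[of _ es]) (simp add: F_def[abs_def] Dz_def)
  qed
qed

text \<open>Saturating a null set under a countable group of measure preserving maps leaves it null.\<close>

lemma invariant_exceptional_set: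
  assumes P: "AE \<omega> in lborel. P \<omega>"
  obtains N where "N \<in> sets borel" "emeasure lborel N = 0" "- X0 \<subseteq> N"
    "\<And>g \<omega>. g \<in> G \<Longrightarrow> \<omega> \<in> X0 \<Longrightarrow> act g \<omega> \<in> N \<Longrightarrow> \<omega> \<in> N" "\<And>\<omega>. \<omega> \<notin> N \<Longrightarrow> P \<omega>"
proof -
  obtain N1 where N1: "{\<omega> \<in> space lborel. \<not> P \<omega>} \<subseteq> N1" "emeasure lborel N1 = 0" "N1 \<in> sets lborel"
    using P by (rule AE_E)
  define T where "T g = act g -` (N1 \<inter> X0) \<inter> space M" for g
  have T: "T g \<in> sets M" "emeasure M (T g) = 0" if g: "g \<in> G" for g
  proof -
    have s: "N1 \<inter> X0 \<in> sets M" using N1(3) X0_borel by (simp add: sets_M)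
    show "T g \<in> sets M" unfolding T_def by (rule measurable_sets[OF act_preserving(1)[OF g] s])
    have "emeasure M (T g) = emeasure (distr M M (act g)) (N1 \<inter> X0)"
      unfolding T_def by (rule emeasure_distr[OF act_preserving(1)[OF g] s, symmetric])
    also have "\<dots> = emeasure M (N1 \<inter> X0)" unfolding act_preserving(2)[OF g] ..
    also have "\<dots> = emeasure lborel (N1 \<inter> X0)" by (simp add: emeasure_M)
    also have "\<dots> \<le> emeasure lborel N1" using N1(3) by (intro emeasure_mono) auto
    finally show "emeasure M (T g) = 0" using N1(2) by simp
  qed
  have TX: "T g \<subseteq> X0" for g by (auto simp: T_def)
  have Tn: "T g \<in> null_sets lborel" if g: "g \<in> G" for g
    using T[OF g] emeasure_M[OF TX[of g]] sets_M[of "T g"] by (intro null_setsI) simp_all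
  have "- X0 \<in> sets lborel" using X0_borel by simp
  then have Xn: "- X0 \<in> null_sets lborel" using AE_X0 by (simp add: AE_iff_null_sets)
  define N where "N = - X0 \<union> (\<Union>g\<in>G. T g)"
  have Nn: "N \<in> null_sets lborel"
    unfolding N_def by (intro null_sets.Un Xn null_sets_UN' countable_G Tn)
  show thesis
  proof (rule that[of N])
    show "N \<in> sets borel" "emeasure lborel N = 0" using Nn by (auto simp: null_sets_def)
    show "- X0 \<subseteq> N" by (simp add: N_def)
    show "\<omega> \<in> N" if g: "g \<in> G" and w: "\<omega> \<in> X0" and gN: "act g \<omega> \<in> N" for g \<omega>
    proof -
      have "act g \<omega> \<in> X0" by (rule act_X0[OF g w])
      then obtain h where h: "h \<in> G" "act g \<omega> \<in> T h" using gN by (auto simp: N_def)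
      then have "act (compose uhp h g) \<omega> \<in> N1 \<inter> X0" unfolding act_compose[OF h(1) g w] by (auto simp: T_def)
      then have "\<omega> \<in> T (compose uhp h g)" using w by (simp add: T_def)
      then show ?thesis using compose_G[OF h(1) g] by (auto simp: N_def)
    qed
    show "P \<omega>" if "\<omega> \<notin> N" for \<omega>
    proof (rule ccontr)
      assume "\<not> P \<omega>"
      then have n1: "\<omega> \<in> N1" using N1(1) by auto
      have w: "\<omega> \<in> X0" using that by (auto simp: N_def)
      have "\<omega> \<in> T (\<lambda>z\<in>uhp. z)" using n1 w by (simp add: T_def act_id[OF w])
      then show False using that one_G by (auto simp: N_def)
    qed
  qed
qed

lemma crossing_set_finite:
  assumes a: "0 < a"
  shows "crossing_set a \<in> sets borel" "emeasure lborel (crossing_set a) < \<infinity>"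
    "emeasure lborel (shallow_set a \<sigma>) < \<infinity>"
  unfolding crossing_set_eq_shallow[OF a] emeasure_shallow[OF a] by (simp_all add: shallow_set_borel)

text \<open>Almost every \<open>\<omega>\<close> avoids the points with nontrivial stabilizer and satisfies the counting limits for
  the region of approximating excursions and for all rational depths.\<close>

theorem depth_distribution_AE:
  assumes k: "0 < a_const k" and emb: "inj_on (proj G) lambda0"
  shows "AE V in T1S_measure G. \<forall>\<gamma>. geodesic_of_vector G V \<gamma> \<longrightarrow> (\<forall>z\<ge>0. has_depth_distribution G k \<gamma> z
    (measure lborel (shallow_set (a_const k) (sinh z)) / measure lborel (crossing_set (a_const k))))"
proof -
  define a where "a = a_const k"
  have a: "0 < a" using k by (simp add: a_def)
  define law where "law C \<omega> \<longleftrightarrow> (\<forall>m::nat. crossings C \<omega> (- real m) (real m) < \<infinity>) \<and>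
     ((\<lambda>t. enn2real (crossings C \<omega> 0 t) / t) \<longlongrightarrow> measure lborel C / measure quot (space quot)) at_top" for C \<omega>
  have law: "AE \<omega> in lborel. law C \<omega>" if "C \<in> sets borel" "emeasure lborel C < \<infinity>" for C
    unfolding law_def by (rule counting_limit[OF that])
  have crossing: "AE \<omega> in lborel. law (crossing_set a) \<omega>" by (rule law[OF crossing_set_finite(1,2)[OF a]])
  have shallow: "AE \<omega> in lborel. \<forall>q\<in>\<rat>. law (shallow_set a (sinh q)) \<omega>"
    by (intro AE_ball_countable[THEN iffD2] countable_rat ballI law shallow_set_borel crossing_set_finite(3)[OF a])
  have "AE \<omega> in lborel. \<omega> \<in> X0 \<and> (\<forall>t. geo \<omega> t \<in> free_points) \<and> law (crossing_set a) \<omega> \<and>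
      (\<forall>q\<in>\<rat>. law (shallow_set a (sinh q)) \<omega>)"
    using AE_X0 AE_free crossing shallow by eventually_elim blast
  then obtain N where N: "N \<in> sets borel" "emeasure lborel N = 0" "- X0 \<subseteq> N"
    "\<And>g \<omega>. g \<in> G \<Longrightarrow> \<omega> \<in> X0 \<Longrightarrow> act g \<omega> \<in> N \<Longrightarrow> \<omega> \<in> N"
    and good: "\<And>\<omega>. \<omega> \<notin> N \<Longrightarrow> \<omega> \<in> X0 \<and> (\<forall>t. geo \<omega> t \<in> free_points) \<and> law (crossing_set a) \<omega> \<and>
      (\<forall>q\<in>\<rat>. law (shallow_set a (sinh q)) \<omega>)"
    by (rule invariant_exceptional_set) blast
  have "AE V in T1S_measure G. \<forall>\<alpha>. unit_speed_geodesic \<alpha> \<longrightarrow> V = tproj G (tangent \<alpha> 0) \<longrightarrow>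
    (\<exists>\<omega>. \<alpha> = geo \<omega> \<and> \<omega> \<notin> N)"
    by (rule AE_unit_tangent[OF N(1-3)]) (use N(4) in blast)
  then show ?thesis
  proof eventually_elim
    case (elim V)
    show ?case
    proof (intro allI impI)
      fix \<gamma> and z :: real assume "geodesic_of_vector G V \<gamma>" and z: "0 \<le> z"
      then obtain \<alpha> where us: "unit_speed_geodesic \<alpha>" and \<gamma>: "\<gamma> = proj G \<circ> \<alpha>" and V: "V = tproj G (tangent \<alpha> 0)"
        by (auto simp: geodesic_of_vector_def)
      obtain \<omega> where \<omega>: "\<alpha> = geo \<omega>" "\<omega> \<notin> N" using elim us V by blast
      note g = good[OF \<omega>(2)]
      have c: "law (crossing_set a) \<omega>" and s: "\<And>q. q \<in> \<rat> \<Longrightarrow> law (shallow_set a (sinh q)) \<omega>" using g by blast+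
      show "has_depth_distribution G k \<gamma> z (measure lborel (shallow_set (a_const k) (sinh z)) / measure lborel (crossing_set (a_const k)))"
        unfolding \<gamma> \<omega>(1)
      proof (rule depth_distribution_generic)
        show "unit_speed_geodesic (geo \<omega>)" using us \<omega>(1) by simp
        show "crossings (crossing_set (a_const k)) \<omega> (- real m) (real m) < \<infinity>" for m
          using c unfolding law_def a_def by blast
        show "((\<lambda>t. enn2real (crossings (crossing_set (a_const k)) \<omega> 0 t) / t) \<longlongrightarrow>
            measure lborel (crossing_set (a_const k)) / measure quot (space quot)) at_top"
          using c unfolding law_def a_def by blast
        show "((\<lambda>t. enn2real (crossings (shallow_set (a_const k) (sinh q)) \<omega> 0 t) / t) \<longlongrightarrow>
            measure lborel (shallow_set (a_const k) (sinh q)) / measure quot (space quot)) at_top" if "q \<in> \<rat>" for q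
          using s[OF that] unfolding law_def a_def by blast
      qed (use g k emb z in blast)+
    qed
  qed
qed

end

theorem theorem2:
  fixes G :: "(complex \<Rightarrow> complex) set" and k :: nat
    and p :: "complex set" and lam :: "real \<Rightarrow> complex set"
  assumes "fuchsian G" and "finite_area G"
    and "k \<ge> 3" and "cone_point G k p"
    and "compact_space (orbifold_topology G) \<longrightarrow> \<not> compact_triangle_group G"
    and "distinguished_ray G k p lam" and "normalized G k p lam"
  shows "(\<exists>D. (AE V in T1S_measure G. \<forall>\<gamma>. geodesic_of_vector G V \<gamma> \<longrightarrow>
                 (\<forall>z\<in>{0..r_const k}. has_depth_distribution G k \<gamma> z (D z))) \<and>
              (ln (2 * cos (pi / k)) \<noteq> 0 \<longrightarrow> (\<forall>z\<in>{0..r_const k}. D z = dist_formula k z))) \<and>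
         (k = 3 \<or> k = 4 \<longrightarrow>
            delta_const k \<le> 0 \<and> (\<forall>z\<in>{0..r_const k}. dist_formula k z = dist_case2 k z))"
proof -
  interpret fuchsian_finite G
    using assms(1,2) by unfold_locales
  have a: "0 < a_const k"
  proof -
    have "pi / real k \<le> pi / 3" using assms(3) by (intro divide_left_mono) auto
    then have "pi / real k < pi / 2" using pi_gt_zero by linarith
    then show ?thesis unfolding a_const_def using assms(3) by (intro tan_gt_zero) auto
  qed
  have inj: "inj_on lam {0..}" using assms(6) by (simp add: distinguished_ray_def)
  obtain l where l: "unit_speed_geodesic l" "l 0 = \<i>" "tends_to_boundary l (Some 0) at_top" "\<forall>t\<ge>0. lam t = proj G (l t)"
    using assms(7) by (auto simp: normalized_def)
  have emb: "inj_on (proj G) lambda0" by (rule lambda0_embedded[OF inj l(1-3)]) (use l(4) in blast)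
  define D where "D z = measure lborel (shallow_set (a_const k) (sinh z)) / measure lborel (crossing_set (a_const k))" for z
  have "AE V in T1S_measure G. \<forall>\<gamma>. geodesic_of_vector G V \<gamma> \<longrightarrow> (\<forall>z\<in>{0..r_const k}. has_depth_distribution G k \<gamma> z (D z))"
    using depth_distribution_AE[OF a emb] unfolding D_def[symmetric] by eventually_elim auto
  moreover have "\<forall>z\<in>{0..r_const k}. D z = dist_formula k z" if ln: "ln (2 * cos (pi / k)) \<noteq> 0"
  proof
    fix z assume z: "z \<in> {0..r_const k}"
    \<comment> \<open>For \<open>k = 3\<close> the denominator of the formula would be \<open>ln 1\<close>.\<close>
    have "k \<noteq> 3"
    proof
      assume "k = 3"
      then have "2 * cos (pi / k) = 1" by (simp add: cos_60)
      then show False using ln by simp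
    qed
    then have "4 \<le> k" using assms(3) by simp
    then show "D z = dist_formula k z" unfolding D_def using z by (intro depth_fraction_formula) auto
  qed
  moreover have "k = 3 \<or> k = 4 \<longrightarrow> delta_const k \<le> 0 \<and> (\<forall>z\<in>{0..r_const k}. dist_formula k z = dist_case2 k z)"
    using small_orders by blast
  ultimately show ?thesis by blast
qed

end
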